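(* Let $(F,H,p)$ be a full $\mathcal H$-vertex algebra. Then its vacuum space $(\Omega_{F,H},\hat Y,\mathbf 1,H,(-,-)_{\mathrm{lat}})$ is a generalized full vertex algebra.
   Context: **Formal series.** The base field is $\mathbb C$. $z,\bar z$ are independent formal variables (also used for a complex number and its conjugate), $\underline z=(z,\bar z)$, and by convention $|z|:=z\bar z$, so $|z|^r=z^r\bar z^r$. For a vector space $W$: $W[[z^{\mathbb R},\bar z^{\mathbb R}]]$ is the space of formal sums $\sum_{s,\bar s\in\mathbb R}a_{s,\bar s}z^s\bar z^{\bar s}$, $a_{s,\bar s}\in W$; $W[[z,\bar z,|z|^{\mathbb R}]]$ is the subspace with $a_{s,\bar s}=0$ unless $s-\bar s\in\mathbb Z$; $W[[z,\bar z]]$ is the subspace of sums over $s,\bar s\in\mathbb Z_{\ge0}$; $W((z,\bar z,|z|^{\mathbb R}))\subset W[[z,\bar z,|z|^{\mathbb R}]]$ consists of the series such that (i) there is $N\in\mathbb R$ with $a_{s,\bar s}=0$ if $s\le N$ or $\bar s\le N$, and (ii) for every $R\in\mathbb R$ the set $\{(s,\bar s): a_{s,\bar s}\ne0,\ s+\bar s\le R\}$ is finite. A series in $\mathbb C((z,\bar z,|z|^{\mathbb R}))$ is absolutely convergent around $0$ if, after multiplication by some $|z|^N$ making all exponents nonnegative, $\sum|a_{s,\bar s}|R^{s+\bar s}<\infty$ for some $R>0$. **Correlation functions.** $F_{0,1,\infty}$ is the space of complex-valued real analytic functions $f$ on $\mathbb CP^1\setminus\{0,1,\infty\}$ with conformal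 singularities at $0,1,\infty$: for each $\alpha\in\{0,1,\infty\}$ and each chart $\chi$ (biholomorphism from a neighbourhood of $\alpha$ to an open subset of $\mathbb C$, $\chi(\alpha)=0$) there is a series in $\mathbb C((z,\bar z,|z|^{\mathbb R}))$, absolutely convergent around $0$, converging to $f\circ\chi^{-1}(z)$ on a punctured disc at $0$; this (unique) series is denoted $j(\chi,f)$. Let $Y_2=\{(z_1,z_2)\in\mathbb C^2: z_1\ne z_2,z_1\ne0,z_2\neq0\}$ and let $\mathrm{GCor}_2$ be the span of the functions $\mu=z_1^\alpha\bar z_1^\beta f(z_2/z_1)$ on $Y_2$, $f\in F_{0,1,\infty}$, $\alpha,\beta\in\mathbb R$, $\alpha-\beta\in\mathbb Z$. Its expansions are the formal series (with $z_0=z_1-z_2$): $\mu|_{|z_1|>|z_2|}=z_1^\alpha\bar z_1^\beta\,j(z,f)|_{z=z_2/z_1}$; $\mu|_{|z_2|>|z_1|}=z_1^\alpha\bar z_1^\beta\,j(z^{-1},f)|_{z=z_1/z_2}$; $\mu|_{|z_2|>|z_1-z_2|}=\mu(z_0+z_2,z_2)|_{|z_2|>|z_0|}=z_2^\alpha\bar z_2^\beta\sum_{i,k\ge0}\binom\alpha i\binom\beta k(z_0/z_2)^i(\bar z_0/\bar z_2)^k\,j(1-z^{-1},f)|_{z=-z_0/z_2}$, where $z\mapsto -z_0/z_2$ sends $z^s\bar z^{\bar s}$ to $(-1)^{s-\bar s}(z_0/z_2)^s(\bar z_0/\bar z_2)^{\bar s}$. **Full vertex algebra.** An $\mathbb R^2$-graded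 vector space $F=\bigoplus_{h,\bar h\in\mathbb R}F_{h,\bar h}$ with a linear map $Y(-,\underline z):F\to\mathrm{End}(F)[[z,\bar z,|z|^{\mathbb R}]]$, $Y(a,\underline z)=\sum_{r,s\in\mathbb R}a(r,s)z^{-r-1}\bar z^{-s-1}$, and $\mathbf 1\in F_{0,0}$ such that, with $F^\vee=\bigoplus F_{h,\bar h}^*$: (FV1) $Y(a,\underline z)b\in F((z,\bar z,|z|^{\mathbb R}))$; (FV2) $F_{h,\bar h}=0$ unless $h-\bar h\in\mathbb Z$; (FV3) $Y(a,\underline z)\mathbf 1\in F[[z,\bar z]]$ with constant term $a(-1,-1)\mathbf 1=a$; (FV4) $Y(\mathbf 1,\underline z)=\mathrm{id}$; (FV5) for all $a,b,c\in F$, $u\in F^\vee$ there is $\mu\in\mathrm{GCor}_2$ with $u(Y(a,\underline z_1)Y(b,\underline z_2)c)=\mu|_{|z_1|>|z_2|}$, $u(Y(Y(a,\underline z_0)b,\underline z_2)c)=\mu|_{|z_2|>|z_1-z_2|}$, $u(Y(b,\underline z_2)Y(a,\underline z_1)c)=\mu|_{|z_2|>|z_1|}$; (FV6) for $a\in F_{h,\bar h}$, $a(r,s)F_{h',\bar h'}\subset F_{h+h'-r-1,\bar h+\bar h'-s-1}$. Put $Da=a(-2,-1)\mathbf 1$, $\bar Da=a(-1,-2)\mathbf 1$. **Full $\mathcal H$-vertex algebra.** Let $H_l,H_r$ be finite-dimensional real vector spaces with nondegenerate symmetric bilinear forms $(-,-)_l,(-,-)_r$; $H=H_l\oplus H_r$,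 with projections $p,\bar p$ onto $H_l,H_r$. $M_{H,p}$ is the tensor product of the Heisenberg vertex algebra of $(H_l,(-,-)_l)$ and the conjugate (roles of $z,\bar z$ exchanged) of the Heisenberg vertex algebra of $(H_r,(-,-)_r)$. A full $\mathcal H$-vertex algebra $(F,H,p)$ is a full vertex algebra $F$ with a subalgebra $M_{H,p}\subset F$, i.e. with $H_l\subset F_{1,0}$, $H_r\subset F_{0,1}$ such that $\bar DH_l=0$, $DH_r=0$, $h_l(1,-1)h_l'=(h_l,h_l')_l\mathbf 1$, $h_r(-1,1)h_r'=(h_r,h_r')_r\mathbf 1$, and $h_l(n,-1)h_l'=0$, $h_r(-1,n)h_r'=0$ for $n=0$ or $n\ge2$; write $h_l(n)=h_l(n,-1)$, $h_r(n)=h_r(-1,n)$, and extend linearly to $h(n)$, $h\in H$. It is required that (FH1) all $h_l(0),h_r(0)$ are semisimple on $F$ with real eigenvalues; (FH2) for each $\alpha\in H$ there is $N\in\mathbb R$ with $F^\alpha_{t,\bar t}=0$ if $t\le N$ or $\bar t\le N$, where $F^\alpha_{t,\bar t}=\{v\in F_{t,\bar t}: h_l(0)v=(h_l,p\alpha)_lv,\ h_r(0)v=(h_r,\bar p\alpha)_rv\ \text{for all } h_l\in H_l,h_r\in H_r\}$. **Vacuum space.** $\Omega^\alpha_{F,H}$ is the set of $v\in F$ with $h_l(n)v=h_r(n)v=0$ for $n\ge1$ and $h_l(0)v=(h_l,p\alpha)_lv$, $h_r(0)v=(h_r,\bar p\alpha)_rv$ for all $h_l\in H_l,h_r\in H_r$;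 $\Omega_{F,H}=\bigoplus_{\alpha\in H}\Omega^\alpha_{F,H}$; $(\Omega_{F,H})^\alpha_{t,\bar t}=F_{t+\frac12(p\alpha,p\alpha)_l,\ \bar t+\frac12(\bar p\alpha,\bar p\alpha)_r}\cap\Omega^\alpha_{F,H}$. The bilinear form is $(\alpha,\beta)_{\mathrm{lat}}=(p\alpha,p\beta)_l-(\bar p\alpha,\bar p\beta)_r$. For $v\in\Omega^\alpha_{F,H}$, $\hat Y(v,\underline z)=E^-(-\alpha,\underline z)Y(v,\underline z)E^+(-\alpha,\underline z)z^{(-p\alpha)(0)}\bar z^{(-\bar p\alpha)(0)}$ (it preserves $\Omega_{F,H}$), where $E^\pm(\alpha,\underline z)=\exp\bigl(\mp\sum_{n\ge1}\frac{(p\alpha)(\pm n)}nz^{\mp n}+\frac{(\bar p\alpha)(\pm n)}n\bar z^{\mp n}\bigr)$ and $z^{(p\alpha)(0)}\bar z^{(\bar p\alpha)(0)}$ acts on $\Omega^\beta_{F,H}$ by $z^{(p\alpha,p\beta)_l}\bar z^{(\bar p\alpha,\bar p\beta)_r}$. **Generalized full vertex algebra.** Conventions for branches: $z_1^az_2^b(z_1-z_2)^c|_{|z_1|>|z_2|}=z_1^{a+c}z_2^b\sum_{i\ge0}(-1)^i\binom ci(z_2/z_1)^i$, $z_1^az_2^b(z_2-z_1)^c|_{|z_2|>|z_1|}=z_1^az_2^{b+c}\sum_{i\ge0}(-1)^i\binom ci(z_1/z_2)^i$, $(z_2+z_0)^az_2^bz_0^c|_{|z_2|>|z_0|}=z_0^cz_2^{a+b}\sum_{i\ge0}\binom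 ai(z_0/z_2)^i$. A generalized full vertex algebra $(\Omega,\hat Y,\mathbf 1,H,(-,-))$ is a finite-dimensional real vector space $H$ with a nondegenerate symmetric bilinear form $(-,-)$, an $\mathbb R^2\times H$-graded vector space $\Omega=\bigoplus_{t,\bar t\in\mathbb R,\alpha\in H}\Omega^\alpha_{t,\bar t}$, a linear map $\hat Y(-,\underline z):\Omega\to\mathrm{End}\,\Omega[[z^{\mathbb R},\bar z^{\mathbb R}]]$, $\hat Y(a,\underline z)=\sum a(r,s)z^{-r-1}\bar z^{-s-1}$, and $\mathbf 1\in\Omega^0_{0,0}$ such that (with $\Omega^\alpha=\bigoplus_{t,\bar t}\Omega^\alpha_{t,\bar t}$, $\Omega^\vee=\bigoplus(\Omega^\alpha_{t,\bar t})^*$): (GFV1) $z^{(\alpha,\beta)}\hat Y(a,\underline z)b\in\Omega((z,\bar z,|z|^{\mathbb R}))$ for $a\in\Omega^\alpha$, $b\in\Omega^\beta$; (GFV2) $\Omega^\alpha_{t,\bar t}=0$ unless $(\alpha,\alpha)/2+t-\bar t\in\mathbb Z$; (GFV3) $\hat Y(a,\underline z)\mathbf 1\in\Omega[[z,\bar z]]$ with constant term $a(-1,-1)\mathbf 1=a$; (GFV4) $\hat Y(\mathbf 1,\underline z)=\mathrm{id}$; (GFV5) for $a_i\in\Omega^{\alpha_i}$ ($i=1,2,3$), $u\in\Omega^\vee$ there is $\mu\in\mathrm{GCor}_2$ with $(z_1-z_2)^{(\alpha_1,\alpha_2)}z_1^{(\alpha_1,\alpha_3)}z_2^{(\alpha_2,\alpha_3)}|_{|z_1|>|z_2|}\,u(\hat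 Y(a_1,\underline z_1)\hat Y(a_2,\underline z_2)a_3)=\mu|_{|z_1|>|z_2|}$, $z_0^{(\alpha_1,\alpha_2)}(z_2+z_0)^{(\alpha_1,\alpha_3)}z_2^{(\alpha_2,\alpha_3)}|_{|z_2|>|z_0|}\,u(\hat Y(\hat Y(a_1,\underline z_0)a_2,\underline z_2)a_3)=\mu(z_0+z_2,z_2)|_{|z_2|>|z_0|}$, $(z_2-z_1)^{(\alpha_1,\alpha_2)}z_1^{(\alpha_1,\alpha_3)}z_2^{(\alpha_2,\alpha_3)}|_{|z_2|>|z_1|}\,u(\hat Y(a_2,\underline z_2)\hat Y(a_1,\underline z_1)a_3)=\mu|_{|z_2|>|z_1|}$; (GFV6) $\Omega^\alpha_{t,\bar t}(r,s)\Omega^\beta_{t',\bar t'}\subset\Omega^{\alpha+\beta}_{t+t'-r-1,\bar t+\bar t'-s-1}$; (GFV7) for each $\alpha$ there is $N_\alpha$ with $\Omega^\alpha_{t,\bar t}=0$ if $t\le N_\alpha$ or $\bar t\le N_\alpha$. *)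

theory Defs
  imports "HOL-Complex_Analysis.Complex_Analysis" "HOL-Library.Groups_Big_Fun"
begin

section \<open>Formal series with real exponents\<close>

text \<open>A series in $W[[z^{\mathbb R},\bar z^{\mathbb R}]]$ is its coefficient function:
  \<open>a s s'\<close> is the coefficient of $z^s \bar z^{s'}$. The constant \<^const>\<open>Sum_any\<close> sums over the
  set of nonzero terms; it is used only where that set is finite, so it never takes its
  default value on an infinite support in the situations the axioms below describe.\<close>

type_synonym 'w ser = "real \<Rightarrow> real \<Rightarrow> 'w"

text \<open>Series in two pairs of variables, such as
  $z_1,\bar z_1,z_2,\bar z_2$ or $z_0,\bar z_0,z_2,\bar z_2$; the exponents
  are listed in this order.\<close>

type_synonym ser2 = "real \<Rightarrow> real \<Rightarrow> real \<Rightarrow> real \<Rightarrow> complex"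

text \<open>$W((z,\bar z,|z|^{\mathbb R}))$\<close>

definition laurent_ser :: "'w::zero ser \<Rightarrow> bool" where
  "laurent_ser a \<longleftrightarrow>
     (\<forall>s s'. s - s' \<notin> \<int> \<longrightarrow> a s s' = 0) \<and>
     (\<exists>N. \<forall>s s'. s \<le> N \<or> s' \<le> N \<longrightarrow> a s s' = 0) \<and>
     (\<forall>R. finite {(s, s'). a s s' \<noteq> 0 \<and> s + s' \<le> R})"

text \<open>$W[[z,\bar z]]$\<close>

definition power_ser :: "'w::zero ser \<Rightarrow> bool" where
  "power_ser a \<longleftrightarrow> (\<forall>s s'. \<not> (s \<in> \<nat> \<and> s' \<in> \<nat>) \<longrightarrow> a s s' = 0)"

definition abs_conv_at_0 :: "complex ser \<Rightarrow> bool" where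
  "abs_conv_at_0 a \<longleftrightarrow>
     (\<exists>N. (\<forall>s s'. a s s' \<noteq> 0 \<longrightarrow> 0 \<le> s + N \<and> 0 \<le> s' + N) \<and>
          (\<exists>R>0. (\<lambda>(s, s'). norm (a s s') * R powr ((s + N) + (s' + N))) summable_on UNIV))"

text \<open>The value of $z^s\bar z^{s'}$ at a nonzero complex number, single-valued because it is used
  only for $s-s'\in\mathbb Z$; here $z^s\bar z^{s'} = (z\bar z)^{s'} z^{s-s'}$.\<close>

definition cpow2 :: "complex \<Rightarrow> real \<Rightarrow> real \<Rightarrow> complex" where
  "cpow2 z s s' = of_real ((norm z)\<^sup>2 powr s') * z powi \<lfloor>s - s'\<rfloor>"


section \<open>Correlation functions\<close>

text \<open>Local expansion of a complex-valued function as a power series in the two real coordinates;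
  \<open>has_sum\<close> on a countable index set in \<open>complex\<close> is absolute convergence.\<close>

definition real_analytic_on :: "(complex \<Rightarrow> complex) \<Rightarrow> complex set \<Rightarrow> bool" where
  "real_analytic_on f S \<longleftrightarrow>
     (\<forall>w\<in>S. \<exists>r>0. \<exists>c :: nat \<Rightarrow> nat \<Rightarrow> complex. \<forall>z\<in>ball w r.
        ((\<lambda>(m, n). c m n * of_real (Re (z - w) ^ m * Im (z - w) ^ n)) has_sum f z) UNIV)"

definition chart_at :: "complex \<Rightarrow> complex set \<Rightarrow> (complex \<Rightarrow> complex) \<Rightarrow> bool" where
  "chart_at p U \<phi> \<longleftrightarrow> open U \<and> p \<in> U \<and> \<phi> holomorphic_on U \<and> inj_on \<phi> U \<and> \<phi> p = 0"

text \<open>The series \<open>a\<close> is $j(\phi,f)$ for the chart $\phi$ with domain \<open>U\<close>. Such a series is unique.\<close>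

definition chart_expansion ::
  "(complex \<Rightarrow> complex) \<Rightarrow> complex set \<Rightarrow> (complex \<Rightarrow> complex) \<Rightarrow> complex ser \<Rightarrow> bool" where
  "chart_expansion f U \<phi> a \<longleftrightarrow>
     laurent_ser a \<and> abs_conv_at_0 a \<and>
     (\<exists>r>0. \<forall>z. 0 < norm z \<and> norm z < r \<longrightarrow>
        z \<in> \<phi> ` U \<and>
        ((\<lambda>(s, s'). a s s' * cpow2 z s s') has_sum f (the_inv_into U \<phi> z)) UNIV)"

text \<open>$F_{0,1,\infty}$. A function on $\mathbb{CP}^1\setminus\{0,1,\infty\}$ is a function on
  \<open>complex\<close> whose values at 0 and 1 are irrelevant. Near $\infty$ the coordinate $w=1/z$
  of $\mathbb{CP}^1$ is used: a chart $\phi$ at $\infty$ is represented by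
  $w\mapsto\phi(1/w)$, a chart at $w=0$, and $f$ by $w\mapsto f(1/w)$.\<close>

definition F01inf :: "(complex \<Rightarrow> complex) \<Rightarrow> bool" where
  "F01inf f \<longleftrightarrow>
     real_analytic_on f (- {0, 1}) \<and>
     (\<forall>U \<phi>. chart_at 0 U \<phi> \<longrightarrow> (\<exists>a. chart_expansion f U \<phi> a)) \<and>
     (\<forall>U \<phi>. chart_at 1 U \<phi> \<longrightarrow> (\<exists>a. chart_expansion f U \<phi> a)) \<and>
     (\<forall>U \<phi>. chart_at 0 U \<phi> \<longrightarrow> (\<exists>a. chart_expansion (\<lambda>w. f (inverse w)) U \<phi> a))"

text \<open>The three expansions of the generator $z_1^\alpha\bar z_1^\beta f(z_2/z_1)$, as functions of
  the series $j(z,f)$, $j(z^{-1},f)$ and $j(1-z^{-1},f)$ respectively.\<close>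

definition gen_exp_12 :: "real \<Rightarrow> real \<Rightarrow> complex ser \<Rightarrow> ser2" where
  "gen_exp_12 \<alpha> \<beta> a = (\<lambda>s1 s1' s2 s2'.
     if s1 = \<alpha> - s2 \<and> s1' = \<beta> - s2' then a s2 s2' else 0)"

definition gen_exp_21 :: "real \<Rightarrow> real \<Rightarrow> complex ser \<Rightarrow> ser2" where
  "gen_exp_21 \<alpha> \<beta> a = (\<lambda>s1 s1' s2 s2'.
     if s1 = \<alpha> - s2 \<and> s1' = \<beta> - s2' then a (- s2) (- s2') else 0)"

definition gen_exp_20 :: "real \<Rightarrow> real \<Rightarrow> complex ser \<Rightarrow> ser2" where
  "gen_exp_20 \<alpha> \<beta> a = (\<lambda>s0 s0' s2 s2'.
     if s2 = \<alpha> - s0 \<and> s2' = \<beta> - s0'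
     then Sum_any (\<lambda>(i, k). of_real (\<alpha> gchoose i) * of_real (\<beta> gchoose k) *
            ((-1) powi \<lfloor>(s0 - real i) - (s0' - real k)\<rfloor> * a (s0 - real i) (s0' - real k)))
     else 0)"

text \<open>\<open>gcor2 \<mu> E12 E20 E21\<close>: the function \<open>\<mu>\<close> (on $Y_2$) belongs to $\mathrm{GCor}_2$, and the
  series are its expansions in $|z_1|>|z_2|$, in $|z_2|>|z_1-z_2|$ (in the variables $z_0,z_2$)
  and in $|z_2|>|z_1|$. This is the linear span of the graph of the expansion maps on the
  generators, i.e. the linear extension of these maps to $\mathrm{GCor}_2$. The charts are $z$
  at 0, $z^{-1}$ at $\infty$ (the identity in the coordinate $1/z$) and $1-z^{-1}$ at 1.\<close>

inductive gcor2 :: "(complex \<Rightarrow> complex \<Rightarrow> complex) \<Rightarrow> ser2 \<Rightarrow> ser2 \<Rightarrow> ser2 \<Rightarrow> bool" where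
  gen: "F01inf f \<Longrightarrow> \<alpha> - \<beta> \<in> \<int> \<Longrightarrow>
      chart_expansion f UNIV (\<lambda>z. z) a \<Longrightarrow>
      chart_expansion f (- {0}) (\<lambda>z. 1 - inverse z) b \<Longrightarrow>
      chart_expansion (\<lambda>w. f (inverse w)) UNIV (\<lambda>w. w) c \<Longrightarrow>
      gcor2 (\<lambda>z1 z2. cpow2 z1 \<alpha> \<beta> * f (z2 / z1))
        (gen_exp_12 \<alpha> \<beta> a) (gen_exp_20 \<alpha> \<beta> b) (gen_exp_21 \<alpha> \<beta> c)"
| zero: "gcor2 (\<lambda>_ _. 0) (\<lambda>_ _ _ _. 0) (\<lambda>_ _ _ _. 0) (\<lambda>_ _ _ _. 0)"
| add: "gcor2 \<mu> A B C \<Longrightarrow> gcor2 \<mu>' A' B' C' \<Longrightarrow>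
      gcor2 (\<lambda>z1 z2. \<mu> z1 z2 + \<mu>' z1 z2)
        (\<lambda>s s' t t'. A s s' t t' + A' s s' t t')
        (\<lambda>s s' t t'. B s s' t t' + B' s s' t t')
        (\<lambda>s s' t t'. C s s' t t' + C' s s' t t')"
| scale: "gcor2 \<mu> A B C \<Longrightarrow>
      gcor2 (\<lambda>z1 z2. k * \<mu> z1 z2)
        (\<lambda>s s' t t'. k * A s s' t t')
        (\<lambda>s s' t t'. k * B s s' t t')
        (\<lambda>s s' t t'. k * C s s' t t')"


section \<open>Graded vector spaces\<close>

definition decomposition :: "('i \<Rightarrow> 'v::ab_group_add set) \<Rightarrow> 'v \<Rightarrow> ('i \<Rightarrow> 'v) \<Rightarrow> bool" where
  "decomposition V v f \<longleftrightarrow> (\<forall>i. f i \<in> V i) \<and> finite {i. f i \<noteq> 0} \<and> v = Sum_any f"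

definition component :: "('i \<Rightarrow> 'v::ab_group_add set) \<Rightarrow> 'i \<Rightarrow> 'v \<Rightarrow> 'v" where
  "component V i v = (THE f. decomposition V v f) i"

definition direct_sum ::
  "(complex \<Rightarrow> 'v::ab_group_add \<Rightarrow> 'v) \<Rightarrow> ('i \<Rightarrow> 'v set) \<Rightarrow> 'v set \<Rightarrow> bool" where
  "direct_sum smul V W \<longleftrightarrow>
     module.subspace smul W \<and>
     (\<forall>i. module.subspace smul (V i) \<and> V i \<subseteq> W) \<and>
     (\<forall>v\<in>W. \<exists>!f. decomposition V v f)"

definition linear_form_on ::
  "(complex \<Rightarrow> 'v::ab_group_add \<Rightarrow> 'v) \<Rightarrow> 'v set \<Rightarrow> ('v \<Rightarrow> complex) \<Rightarrow> bool" where
  "linear_form_on smul W u \<longleftrightarrow>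
     (\<forall>x\<in>W. \<forall>y\<in>W. u (x + y) = u x + u y) \<and> (\<forall>c. \<forall>x\<in>W. u (smul c x) = c * u x)"

text \<open>The direct sum of the duals $V_i^*$ inside the dual of $W=\bigoplus_i V_i$.\<close>

definition graded_dual ::
  "(complex \<Rightarrow> 'v::ab_group_add \<Rightarrow> 'v) \<Rightarrow> ('i \<Rightarrow> 'v set) \<Rightarrow> 'v set \<Rightarrow> ('v \<Rightarrow> complex) \<Rightarrow> bool" where
  "graded_dual smul V W u \<longleftrightarrow>
     linear_form_on smul W u \<and> finite {i. \<exists>v\<in>V i. u v \<noteq> 0}"


section \<open>Vertex operators\<close>

text \<open>A map $Y$ into $\mathrm{End}(F)[[z^{\mathbb R},\bar z^{\mathbb R}]]$ is given by its modes,
  \<open>Y a r s b\<close> $= a(r,s)b$ with $Y(a,\underline z)=\sum a(r,s)z^{-r-1}\bar z^{-s-1}$.\<close>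

type_synonym 'v modes = "'v \<Rightarrow> real \<Rightarrow> real \<Rightarrow> 'v \<Rightarrow> 'v"

text \<open>$Y(a,\underline z)b$, \ $u(Y(a,\underline z_1)Y(b,\underline z_2)c)$, \
  $u(Y(Y(a,\underline z_0)b,\underline z_2)c)$ and
  $u(Y(b,\underline z_2)Y(a,\underline z_1)c)$ as formal series.\<close>

definition vser :: "'v modes \<Rightarrow> 'v \<Rightarrow> 'v \<Rightarrow> 'v ser" where
  "vser Y a b = (\<lambda>s s'. Y a (- s - 1) (- s' - 1) b)"

definition corr_12 :: "'v modes \<Rightarrow> ('v \<Rightarrow> complex) \<Rightarrow> 'v \<Rightarrow> 'v \<Rightarrow> 'v \<Rightarrow> ser2" where
  "corr_12 Y u a b c = (\<lambda>s1 s1' s2 s2'. u (vser Y a (vser Y b c s2 s2') s1 s1'))"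

definition corr_20 :: "'v modes \<Rightarrow> ('v \<Rightarrow> complex) \<Rightarrow> 'v \<Rightarrow> 'v \<Rightarrow> 'v \<Rightarrow> ser2" where
  "corr_20 Y u a b c = (\<lambda>s0 s0' s2 s2'. u (vser Y (vser Y a b s0 s0') c s2 s2'))"

definition corr_21 :: "'v modes \<Rightarrow> ('v \<Rightarrow> complex) \<Rightarrow> 'v \<Rightarrow> 'v \<Rightarrow> 'v \<Rightarrow> ser2" where
  "corr_21 Y u a b c = (\<lambda>s1 s1' s2 s2'. u (vser Y b (vser Y a c s1 s1') s2 s2'))"


section \<open>Full vertex algebras\<close>

text \<open>The space $F$ is the whole type \<open>'v\<close>, and \<open>Fg h h'\<close> is $F_{h,\bar h}$.\<close>

locale full_vertex_algebra = vector_space smul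
  for smul :: "complex \<Rightarrow> 'v::ab_group_add \<Rightarrow> 'v" +
  fixes Fg :: "real \<Rightarrow> real \<Rightarrow> 'v set"
    and Y :: "'v modes"
    and vac :: 'v
  assumes grading: "direct_sum smul (\<lambda>(h, h'). Fg h h') UNIV"
    and Y_linear_right: "Vector_Spaces.linear smul smul (Y a r s)"
    and Y_linear_left: "Vector_Spaces.linear smul smul (\<lambda>a. Y a r s b)"
    and Y_int_spin: "r - s \<notin> \<int> \<Longrightarrow> Y a r s b = 0"
    and vac_degree: "vac \<in> Fg 0 0"
    and FV1: "laurent_ser (vser Y a b)"
    and FV2: "h - h' \<notin> \<int> \<Longrightarrow> Fg h h' = {0}"
    and FV3: "power_ser (vser Y a vac)" "Y a (-1) (-1) vac = a"
    and FV4: "Y vac r s b = (if r = -1 \<and> s = -1 then b else 0)"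
    and FV5: "graded_dual smul (\<lambda>(h, h'). Fg h h') UNIV u \<Longrightarrow>
        \<exists>\<mu>. gcor2 \<mu> (corr_12 Y u a b c) (corr_20 Y u a b c) (corr_21 Y u a b c)"
    and FV6: "a \<in> Fg h h' \<Longrightarrow> b \<in> Fg k k' \<Longrightarrow>
        Y a r s b \<in> Fg (h + k - r - 1) (h' + k' - s - 1)"


section \<open>Real quadratic spaces\<close>

definition fin_dim_form :: "('h::real_vector \<Rightarrow> 'h \<Rightarrow> real) \<Rightarrow> bool" where
  "fin_dim_form B \<longleftrightarrow>
     (\<exists>S::'h set. finite S \<and> span S = UNIV) \<and>
     bilinear B \<and> (\<forall>x y. B x y = B y x) \<and> (\<forall>x. (\<forall>y. B x y = 0) \<longrightarrow> x = 0)"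

text \<open>$H=H_l\oplus H_r$ is the product type, with $p=$ \<open>fst\<close> and $\bar p=$ \<open>snd\<close>.\<close>

definition lat_form ::
  "('l \<Rightarrow> 'l \<Rightarrow> real) \<Rightarrow> ('r \<Rightarrow> 'r \<Rightarrow> real) \<Rightarrow> 'l \<times> 'r \<Rightarrow> 'l \<times> 'r \<Rightarrow> real" where
  "lat_form Bl Br \<alpha> \<beta> = Bl (fst \<alpha>) (fst \<beta>) - Br (snd \<alpha>) (snd \<beta>)"


section \<open>Full H-vertex algebras\<close>

text \<open>The inclusions of $H_l$ and $H_r$ into $F$ are the injective real-linear maps \<open>il\<close>, \<open>ir\<close>.
  The modes are $h_l(n)=h_l(n,-1)$ and $h_r(n)=h_r(-1,n)$.\<close>

definition lmode :: "'v modes \<Rightarrow> ('l \<Rightarrow> 'v) \<Rightarrow> 'l \<Rightarrow> int \<Rightarrow> 'v \<Rightarrow> 'v" where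
  "lmode Y il x n = Y (il x) (of_int n) (-1)"

definition rmode :: "'v modes \<Rightarrow> ('r \<Rightarrow> 'v) \<Rightarrow> 'r \<Rightarrow> int \<Rightarrow> 'v \<Rightarrow> 'v" where
  "rmode Y ir y n = Y (ir y) (-1) (of_int n)"

definition weight_space ::
  "(complex \<Rightarrow> 'v \<Rightarrow> 'v) \<Rightarrow> 'v modes \<Rightarrow> ('l \<Rightarrow> 'v) \<Rightarrow> ('r \<Rightarrow> 'v) \<Rightarrow>
   ('l \<Rightarrow> 'l \<Rightarrow> real) \<Rightarrow> ('r \<Rightarrow> 'r \<Rightarrow> real) \<Rightarrow> 'l \<times> 'r \<Rightarrow> 'v set" where
  "weight_space smul Y il ir Bl Br \<alpha> =
     {v. (\<forall>x. lmode Y il x 0 v = smul (of_real (Bl x (fst \<alpha>))) v) \<and>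
         (\<forall>y. rmode Y ir y 0 v = smul (of_real (Br y (snd \<alpha>))) v)}"

text \<open>Over the complex numbers, a semisimple operator (possibly on an infinite-dimensional space)
  is one for which the space is spanned by eigenvectors.\<close>

definition real_semisimple ::
  "(complex \<Rightarrow> 'v::ab_group_add \<Rightarrow> 'v) \<Rightarrow> ('v \<Rightarrow> 'v) \<Rightarrow> bool" where
  "real_semisimple smul T \<longleftrightarrow>
     module.span smul (\<Union>e::real. {v. T v = smul (of_real e) v}) = UNIV"

locale full_H_vertex_algebra = full_vertex_algebra smul Fg Y vac
  for smul :: "complex \<Rightarrow> 'v::ab_group_add \<Rightarrow> 'v"
    and Fg :: "real \<Rightarrow> real \<Rightarrow> 'v set"
    and Y :: "'v modes"
    and vac :: 'v +
  fixes il :: "'l::real_vector \<Rightarrow> 'v"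
    and ir :: "'r::real_vector \<Rightarrow> 'v"
    and Bl :: "'l \<Rightarrow> 'l \<Rightarrow> real"
    and Br :: "'r \<Rightarrow> 'r \<Rightarrow> real"
  assumes form_l: "fin_dim_form Bl"
    and form_r: "fin_dim_form Br"
    and il_linear: "il (x + x') = il x + il x'" "il (c *\<^sub>R x) = smul (of_real c) (il x)"
    and ir_linear: "ir (y + y') = ir y + ir y'" "ir (c *\<^sub>R y) = smul (of_real c) (ir y)"
    and il_inj: "inj il"
    and ir_inj: "inj ir"
    and il_degree: "il x \<in> Fg 1 0"
    and ir_degree: "ir y \<in> Fg 0 1"
    and Dbar_l: "Y (il x) (-1) (-2) vac = 0"
    and D_r: "Y (ir y) (-2) (-1) vac = 0"
    and heis_l: "lmode Y il x 1 (il x') = smul (of_real (Bl x x')) vac"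
      "n = 0 \<or> n \<ge> 2 \<Longrightarrow> lmode Y il x n (il x') = 0"
    and heis_r: "rmode Y ir y 1 (ir y') = smul (of_real (Br y y')) vac"
      "n = 0 \<or> n \<ge> 2 \<Longrightarrow> rmode Y ir y n (ir y') = 0"
    and FH1: "real_semisimple smul (lmode Y il x 0)" "real_semisimple smul (rmode Y ir y 0)"
    and FH2: "\<exists>N. \<forall>t t'. t \<le> N \<or> t' \<le> N \<longrightarrow>
        Fg t t' \<inter> weight_space smul Y il ir Bl Br \<alpha> = {0}"


section \<open>The vacuum space\<close>

definition vac_weight ::
  "(complex \<Rightarrow> 'v::ab_group_add \<Rightarrow> 'v) \<Rightarrow> 'v modes \<Rightarrow> ('l \<Rightarrow> 'v) \<Rightarrow> ('r \<Rightarrow> 'v) \<Rightarrow>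
   ('l \<Rightarrow> 'l \<Rightarrow> real) \<Rightarrow> ('r \<Rightarrow> 'r \<Rightarrow> real) \<Rightarrow> 'l \<times> 'r \<Rightarrow> 'v set" where
  "vac_weight smul Y il ir Bl Br \<alpha> =
     {v \<in> weight_space smul Y il ir Bl Br \<alpha>.
        \<forall>n\<ge>1. (\<forall>x. lmode Y il x n v = 0) \<and> (\<forall>y. rmode Y ir y n v = 0)}"

definition vac_space ::
  "(complex \<Rightarrow> 'v::ab_group_add \<Rightarrow> 'v) \<Rightarrow> 'v modes \<Rightarrow> ('l \<Rightarrow> 'v) \<Rightarrow> ('r \<Rightarrow> 'v) \<Rightarrow>
   ('l \<Rightarrow> 'l \<Rightarrow> real) \<Rightarrow> ('r \<Rightarrow> 'r \<Rightarrow> real) \<Rightarrow> 'v set" where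
  "vac_space smul Y il ir Bl Br =
     module.span smul (\<Union>\<alpha>. vac_weight smul Y il ir Bl Br \<alpha>)"

definition vac_grade ::
  "(complex \<Rightarrow> 'v::ab_group_add \<Rightarrow> 'v) \<Rightarrow> (real \<Rightarrow> real \<Rightarrow> 'v set) \<Rightarrow> 'v modes \<Rightarrow>
   ('l \<Rightarrow> 'v) \<Rightarrow> ('r \<Rightarrow> 'v) \<Rightarrow> ('l \<Rightarrow> 'l \<Rightarrow> real) \<Rightarrow> ('r \<Rightarrow> 'r \<Rightarrow> real) \<Rightarrow>
   'l \<times> 'r \<Rightarrow> real \<Rightarrow> real \<Rightarrow> 'v set" where
  "vac_grade smul Fg Y il ir Bl Br \<alpha> t t' =
     Fg (t + Bl (fst \<alpha>) (fst \<alpha>) / 2) (t' + Br (snd \<alpha>) (snd \<alpha>) / 2) \<inter>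
     vac_weight smul Y il ir Bl Br \<alpha>"

text \<open>Operator-valued power series $\sum_{m,n\ge0} X_{m,n}x^m\bar x^n$ and their exponential.
  If $X_{0,0}=0$, then $X^k$ does not contribute to the coefficient of $x^m\bar x^n$ for
  $k>m+n$, so the sum in \<open>opser_exp\<close> is the whole exponential series; it is used only in
  that case.\<close>

type_synonym 'v opser = "nat \<Rightarrow> nat \<Rightarrow> 'v \<Rightarrow> 'v"

definition opser_mult :: "'v::ab_group_add opser \<Rightarrow> 'v opser \<Rightarrow> 'v opser" where
  "opser_mult P Q = (\<lambda>m n v. \<Sum>i\<le>m. \<Sum>j\<le>n. P i j (Q (m - i) (n - j) v))"

fun opser_power :: "'v::ab_group_add opser \<Rightarrow> nat \<Rightarrow> 'v opser" where
  "opser_power X 0 = (\<lambda>m n v. if m = 0 \<and> n = 0 then v else 0)"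
| "opser_power X (Suc k) = opser_mult X (opser_power X k)"

definition opser_exp :: "(complex \<Rightarrow> 'v::ab_group_add \<Rightarrow> 'v) \<Rightarrow> 'v opser \<Rightarrow> 'v opser" where
  "opser_exp smul X = (\<lambda>m n v. \<Sum>k\<le>m + n. smul (1 / fact k) (opser_power X k m n v))"

text \<open>\<open>E_minus \<dots> \<alpha> m n\<close> is the coefficient of $z^m\bar z^n$ in $E^-(\alpha,\underline z)$, and
  \<open>E_plus \<dots> \<alpha> m n\<close> that of $z^{-m}\bar z^{-n}$ in $E^+(\alpha,\underline z)$.\<close>

definition E_minus ::
  "(complex \<Rightarrow> 'v::ab_group_add \<Rightarrow> 'v) \<Rightarrow> 'v modes \<Rightarrow> ('l \<Rightarrow> 'v) \<Rightarrow> ('r \<Rightarrow> 'v) \<Rightarrow>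
   'l \<times> 'r \<Rightarrow> 'v opser" where
  "E_minus smul Y il ir \<alpha> = opser_exp smul (\<lambda>m n v.
     if m \<ge> 1 \<and> n = 0 then smul (1 / of_nat m) (lmode Y il (fst \<alpha>) (- int m) v)
     else if m = 0 \<and> n \<ge> 1 then smul (1 / of_nat n) (rmode Y ir (snd \<alpha>) (- int n) v)
     else 0)"

definition E_plus ::
  "(complex \<Rightarrow> 'v::ab_group_add \<Rightarrow> 'v) \<Rightarrow> 'v modes \<Rightarrow> ('l \<Rightarrow> 'v) \<Rightarrow> ('r \<Rightarrow> 'v) \<Rightarrow>
   'l \<times> 'r \<Rightarrow> 'v opser" where
  "E_plus smul Y il ir \<alpha> = opser_exp smul (\<lambda>m n v.
     if m \<ge> 1 \<and> n = 0 then - smul (1 / of_nat m) (lmode Y il (fst \<alpha>) (int m) v)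
     else if m = 0 \<and> n \<ge> 1 then - smul (1 / of_nat n) (rmode Y ir (snd \<alpha>) (int n) v)
     else 0)"

text \<open>The mode of
  $E^-(-\alpha,\underline z)Y(v,\underline z)E^+(-\alpha,\underline z)
   z^{(-p\alpha)(0)}\bar z^{(-\bar p\alpha)(0)}w$
  with index $(r,s)$, for $v\in\Omega^\alpha_{F,H}$ and $w\in\Omega^\beta_{F,H}$: the coefficient of
  $z^{-r-1}\bar z^{-s-1}$ collects the terms
  $z^m\bar z^n\cdot z^{-r'-1}\bar z^{-s'-1}\cdot z^{-m'}\bar z^{-n'}\cdot
   z^{(-p\alpha,p\beta)_l}\bar z^{(-\bar p\alpha,\bar p\beta)_r}$.
  On the vacuum space, only finitely many of them are nonzero.\<close>

definition vac_Y_hom ::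
  "(complex \<Rightarrow> 'v::ab_group_add \<Rightarrow> 'v) \<Rightarrow> 'v modes \<Rightarrow> ('l::ab_group_add \<Rightarrow> 'v) \<Rightarrow>
   ('r::ab_group_add \<Rightarrow> 'v) \<Rightarrow> ('l \<Rightarrow> 'l \<Rightarrow> real) \<Rightarrow> ('r \<Rightarrow> 'r \<Rightarrow> real) \<Rightarrow>
   'l \<times> 'r \<Rightarrow> 'l \<times> 'r \<Rightarrow> 'v modes" where
  "vac_Y_hom smul Y il ir Bl Br \<alpha> \<beta> v r s w =
     Sum_any (\<lambda>((m, n), (m', n')).
       E_minus smul Y il ir (- \<alpha>) m n
         (Y v (r + real m - real m' + Bl (fst (- \<alpha>)) (fst \<beta>))
              (s + real n - real n' + Br (snd (- \<alpha>)) (snd \<beta>))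
           (E_plus smul Y il ir (- \<alpha>) m' n' w)))"

text \<open>Bilinear extension to the direct sum of the $\Omega^\alpha_{F,H}$; the values on vectors outside
  the vacuum space are irrelevant.\<close>

definition vac_Y ::
  "(complex \<Rightarrow> 'v::ab_group_add \<Rightarrow> 'v) \<Rightarrow> 'v modes \<Rightarrow> ('l::ab_group_add \<Rightarrow> 'v) \<Rightarrow>
   ('r::ab_group_add \<Rightarrow> 'v) \<Rightarrow> ('l \<Rightarrow> 'l \<Rightarrow> real) \<Rightarrow> ('r \<Rightarrow> 'r \<Rightarrow> real) \<Rightarrow> 'v modes" where
  "vac_Y smul Y il ir Bl Br v r s w =
     Sum_any (\<lambda>(\<alpha>, \<beta>). vac_Y_hom smul Y il ir Bl Br \<alpha> \<beta>
       (component (vac_weight smul Y il ir Bl Br) \<alpha> v) r s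
       (component (vac_weight smul Y il ir Bl Br) \<beta> w))"


section \<open>Generalized full vertex algebras\<close>

text \<open>The products of a series with
  $z_1^az_2^b(z_1-z_2)^c|_{|z_1|>|z_2|} = z_1^{a+c}z_2^b\sum_i(-1)^i{c\choose i}(z_2/z_1)^i$, \
  $(z_2+z_0)^az_2^bz_0^c|_{|z_2|>|z_0|} = z_0^cz_2^{a+b}\sum_i{a\choose i}(z_0/z_2)^i$ \ and
  $z_1^az_2^b(z_2-z_1)^c|_{|z_2|>|z_1|} = z_1^az_2^{b+c}\sum_i(-1)^i{c\choose i}(z_1/z_2)^i$.\<close>

definition branch_12 :: "real \<Rightarrow> real \<Rightarrow> real \<Rightarrow> ser2 \<Rightarrow> ser2" where
  "branch_12 a b c S = (\<lambda>s1 s1' s2 s2'.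
     Sum_any (\<lambda>i::nat. (-1) ^ i * of_real (c gchoose i) *
       S (s1 - (a + c) + real i) s1' (s2 - b - real i) s2'))"

definition branch_20 :: "real \<Rightarrow> real \<Rightarrow> real \<Rightarrow> ser2 \<Rightarrow> ser2" where
  "branch_20 a b c S = (\<lambda>s0 s0' s2 s2'.
     Sum_any (\<lambda>i::nat. of_real (a gchoose i) *
       S (s0 - c - real i) s0' (s2 - (a + b) + real i) s2'))"

definition branch_21 :: "real \<Rightarrow> real \<Rightarrow> real \<Rightarrow> ser2 \<Rightarrow> ser2" where
  "branch_21 a b c S = (\<lambda>s1 s1' s2 s2'.
     Sum_any (\<lambda>i::nat. (-1) ^ i * of_real (c gchoose i) *
       S (s1 - a - real i) s1' (s2 - (b + c) + real i) s2'))"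

text \<open>The space \<open>\<Omega>\<close> is a subspace of the ambient type \<open>'v\<close>, and only the restriction of \<open>Y\<close>
  to \<open>\<Omega>\<close> matters. \<open>gr \<alpha> t t'\<close> is $\Omega^\alpha_{t,\bar t}$ and \<open>charge_space \<dots> \<alpha>\<close> is
  $\Omega^\alpha=\bigoplus_{t,\bar t}\Omega^\alpha_{t,\bar t}$.\<close>

definition charge_space ::
  "(complex \<Rightarrow> 'v::ab_group_add \<Rightarrow> 'v) \<Rightarrow> ('h \<Rightarrow> real \<Rightarrow> real \<Rightarrow> 'v set) \<Rightarrow> 'h \<Rightarrow> 'v set" where
  "charge_space smul gr \<alpha> = module.span smul (\<Union>t t'. gr \<alpha> t t')"

locale generalized_full_vertex_algebra = vector_space smul
  for smul :: "complex \<Rightarrow> 'v::ab_group_add \<Rightarrow> 'v" +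
  fixes \<Omega> :: "'v set"
    and gr :: "'h::real_vector \<Rightarrow> real \<Rightarrow> real \<Rightarrow> 'v set"
    and Y :: "'v modes"
    and vac :: 'v
    and B :: "'h \<Rightarrow> 'h \<Rightarrow> real"
  assumes form: "fin_dim_form B"
    and grading: "direct_sum smul (\<lambda>(\<alpha>, t, t'). gr \<alpha> t t') \<Omega>"
    and Y_closed: "a \<in> \<Omega> \<Longrightarrow> b \<in> \<Omega> \<Longrightarrow> Y a r s b \<in> \<Omega>"
    and Y_linear_right: "a \<in> \<Omega> \<Longrightarrow> b \<in> \<Omega> \<Longrightarrow> b' \<in> \<Omega> \<Longrightarrow>
          Y a r s (b + b') = Y a r s b + Y a r s b'"
        "a \<in> \<Omega> \<Longrightarrow> b \<in> \<Omega> \<Longrightarrow> Y a r s (smul k b) = smul k (Y a r s b)"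
    and Y_linear_left: "a \<in> \<Omega> \<Longrightarrow> a' \<in> \<Omega> \<Longrightarrow> b \<in> \<Omega> \<Longrightarrow>
          Y (a + a') r s b = Y a r s b + Y a' r s b"
        "a \<in> \<Omega> \<Longrightarrow> b \<in> \<Omega> \<Longrightarrow> Y (smul k a) r s b = smul k (Y a r s b)"
    and vac_degree: "vac \<in> gr 0 0 0"
    and GFV1: "a \<in> charge_space smul gr \<alpha> \<Longrightarrow> b \<in> charge_space smul gr \<beta> \<Longrightarrow>
        laurent_ser (\<lambda>s s'. vser Y a b (s - B \<alpha> \<beta>) s')"
    and GFV2: "B \<alpha> \<alpha> / 2 + t - t' \<notin> \<int> \<Longrightarrow> gr \<alpha> t t' = {0}"
    and GFV3: "a \<in> \<Omega> \<Longrightarrow> power_ser (vser Y a vac)" "a \<in> \<Omega> \<Longrightarrow> Y a (-1) (-1) vac = a"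
    and GFV4: "b \<in> \<Omega> \<Longrightarrow> Y vac r s b = (if r = -1 \<and> s = -1 then b else 0)"
    and GFV5: "a1 \<in> charge_space smul gr \<alpha>1 \<Longrightarrow> a2 \<in> charge_space smul gr \<alpha>2 \<Longrightarrow>
        a3 \<in> charge_space smul gr \<alpha>3 \<Longrightarrow>
        graded_dual smul (\<lambda>(\<alpha>, t, t'). gr \<alpha> t t') \<Omega> u \<Longrightarrow>
        \<exists>\<mu>. gcor2 \<mu>
          (branch_12 (B \<alpha>1 \<alpha>3) (B \<alpha>2 \<alpha>3) (B \<alpha>1 \<alpha>2) (corr_12 Y u a1 a2 a3))
          (branch_20 (B \<alpha>1 \<alpha>3) (B \<alpha>2 \<alpha>3) (B \<alpha>1 \<alpha>2) (corr_20 Y u a1 a2 a3))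
          (branch_21 (B \<alpha>1 \<alpha>3) (B \<alpha>2 \<alpha>3) (B \<alpha>1 \<alpha>2) (corr_21 Y u a1 a2 a3))"
    and GFV6: "a \<in> gr \<alpha> t t' \<Longrightarrow> b \<in> gr \<beta> k k' \<Longrightarrow>
        Y a r s b \<in> gr (\<alpha> + \<beta>) (t + k - r - 1) (t' + k' - s - 1)"
    and GFV7: "\<exists>N. \<forall>t t'. t \<le> N \<or> t' \<le> N \<longrightarrow> gr \<alpha> t t' = {0}"

end

theory Submission
  imports Defs
begin

text \<open>
  A vector \<open>v\<close> of $\Omega^\alpha$ is seen by the Heisenberg fields as a primary field of charge
  $\alpha$: $[h_l(n),Y(v,\underline z)]=(h_l,p\alpha)_l\,z^nY(v,\underline z)$ and likewise on the right
  (\<open>comm_L_vac\<close>, \<open>comm_R_vac\<close>). The factor $E^-(-\alpha,\underline z)$ in $\hat Y$ cancels the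
  annihilation part of this commutator, so that $\hat Y$ maps vacuum vectors to vacuum vectors
  (\<open>Yhat_VW\<close>).

  For the correlation functions, a functional on $\Omega^\gamma$ is extended to a functional on $F$ which
  kills every descendant $h(-n)w$, $n\ge1$ (\<open>vacuum_functional_extension\<close>). This is possible because
  a nonzero vacuum vector is not a sum of descendants: the Casimir operator
  $\sum_{n\ge1}\sum_is_i(-n)d_i(n)$ kills vacuum vectors, whereas descendants are killed by products of
  factors $(\mathrm{Cas}-k)$ with $k\ge1$; the lower bound on degrees in a fixed charge makes the
  induction start (\<open>VW_descendants_disjoint\<close>). Against such a functional an operator $E^-$ on the left
  disappears, and one in the middle is moved to the left through a vertex operator, or resolved by
  the iterate formula, at the cost of a binomial series. The correlation functions of $\hat Y$ are
  therefore those of \<open>Y\<close>, multiplied by $z_1^{-(\alpha_1,\alpha_3)}z_2^{-(\alpha_2,\alpha_3)}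
  (z_1-z_2)^{-(\alpha_1,\alpha_2)}$ with $(-,-)_l$ in the exponents of the holomorphic variables and
  $(-,-)_r$ in those of the antiholomorphic ones (\<open>corr_12_VY\<close>, \<open>corr_20_VY\<close>, \<open>corr_21_VY\<close>).
  The branch factors of a generalized full vertex algebra add $(-,-)_l-(-,-)_r$ to the holomorphic
  exponents only. Afterwards the two exponents agree, and the whole factor is the single-valued function
  $|z_1|^{2a}|z_2|^{2b}|z_1-z_2|^{2c}$ with $a=-(\bar p\alpha_1,\bar p\alpha_3)_r$,
  $b=-(\bar p\alpha_2,\bar p\alpha_3)_r$, $c=-(\bar p\alpha_1,\bar p\alpha_2)_r$. Multiplication by it preserves
  $\mathrm{GCor}_2$ together with the three expansions (\<open>gcor2_mult\<close>), since
  $F_{0,1,\infty}$ is closed under multiplication by $|z|^{2b}|1-z|^{2c}$.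

  The mode algebra used above is not part of the axioms, which only speak of real analytic correlation
  functions. As $\bar Dh_l=0$, the field $Y(h_l,\underline z)$ contains no $\bar z$ (\<open>chiral_modes\<close>).
  Each homogeneous component of a correlation function with $h_l$ in the first place is thus, up to
  powers of $z_2$ and $\bar z_2$, a function of $z_1/z_2$ which is real analytic on
  $\mathbb C\setminus\{0,1\}$ and holomorphic near one puncture, hence holomorphic everywhere
  (\<open>holomorphy_spreads\<close>). Being meromorphic at $0,1,\infty$ it is a rational function, and
  comparing its three Laurent expansions gives the commutator and iterate formulas
  (\<open>gcor2_chiral_borcherds\<close>). Everything about $h_r$ follows by exchanging $z$ and $\bar z$, which
  turns a full vertex algebra into another one (\<open>gcor2_swap\<close>, \<open>conjugate_full_H_vertex_algebra\<close>).
\<close>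

section \<open>Unordered sums\<close>

text \<open>Used to collect a product of series according to the total exponent of each monomial.\<close>

lemma has_sum_fibres:
  fixes F :: "'a \<Rightarrow> complex" and \<kappa> :: "'a \<Rightarrow> 'b"
  assumes "(F has_sum S) A"
  shows "((\<lambda>k. infsum F {a\<in>A. \<kappa> a = k}) has_sum S) UNIV"
proof -
  have "bij_betw (\<lambda>a. (\<kappa> a, a)) A (Sigma UNIV (\<lambda>k. {a\<in>A. \<kappa> a = k}))"
    by (rule bij_betwI[where g = snd]) auto
  from has_sum_reindex_bij_betw[OF this, of "\<lambda>(k, a). F a" S]
  have "((\<lambda>(k, a). F a) has_sum S) (Sigma UNIV (\<lambda>k. {a\<in>A. \<kappa> a = k}))"
    using assms by simp
  moreover have "((\<lambda>a. case (k, a) of (k, a) \<Rightarrow> F a) has_sum infsum F {a\<in>A. \<kappa> a = k}) {a\<in>A. \<kappa> a = k}" for k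
    using summable_on_subset_banach[OF has_sum_imp_summable[OF assms], of "{a\<in>A. \<kappa> a = k}"] by auto
  ultimately show ?thesis by (rule has_sum_Sigma')
qed

lemma has_sum_times:
  fixes f :: "'a \<Rightarrow> complex" and g :: "'b \<Rightarrow> complex"
  assumes "(f has_sum a) A" "(g has_sum b) B"
  shows "((\<lambda>(x, y). f x * g y) has_sum (a * b)) (A \<times> B)"
proof (rule has_sum_SigmaI)
  show "((\<lambda>y. case (x, y) of (x, y) \<Rightarrow> f x * g y) has_sum (f x * b)) B" for x
    using has_sum_cmult_right[OF assms(2)] by auto
  show "((\<lambda>x. f x * b) has_sum (a * b)) A" by (rule has_sum_cmult_left[OF assms(1)])
  have "(\<lambda>z. norm (case z of (x, y) \<Rightarrow> f x * g y)) summable_on A \<times> B"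
    unfolding Infinite_Sum.abs_summable_on_Sigma_iff
  proof (intro conjI ballI)
    have f: "(\<lambda>x. norm (f x)) summable_on A" and g: "(\<lambda>y. norm (g y)) summable_on B"
      using assms has_sum_imp_summable summable_on_iff_abs_summable_on_complex by blast+
    show "(\<lambda>y. norm (case (x, y) of (x, y) \<Rightarrow> f x * g y)) summable_on B" for x
      using summable_on_cmult_right[OF g, of "norm (f x)"] by (simp add: norm_mult)
    show "(\<lambda>x. norm (\<Sum>\<^sub>\<infinity>y\<in>B. norm (case (x, y) of (x, y) \<Rightarrow> f x * g y))) summable_on A"
      using summable_on_cmult_left[OF f, of "\<Sum>\<^sub>\<infinity>y\<in>B. norm (g y)"]
      by (simp add: norm_mult infsum_cmult_right' infsum_nonneg)
  qed
  then show "(\<lambda>(x, y). f x * g y) summable_on A \<times> B"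
    using summable_on_iff_abs_summable_on_complex by blast
qed

section \<open>Real analytic functions of a complex variable\<close>

definition real_analytic_at :: "(complex \<Rightarrow> complex) \<Rightarrow> complex \<Rightarrow> bool" where
  "real_analytic_at f w \<longleftrightarrow> (\<exists>r>0. \<exists>c :: nat \<Rightarrow> nat \<Rightarrow> complex. \<forall>z\<in>ball w r.
     ((\<lambda>(m, n). c m n * of_real (Re (z - w) ^ m * Im (z - w) ^ n)) has_sum f z) UNIV)"

lemma real_analytic_on_iff: "real_analytic_on f S \<longleftrightarrow> (\<forall>w\<in>S. real_analytic_at f w)"
  by (simp add: real_analytic_on_def real_analytic_at_def)

lemma real_analytic_at_cong:
  assumes "real_analytic_at f w" "e > 0" "\<And>z. z \<in> ball w e ==> f z = g z"
  shows "real_analytic_at g w"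
proof -
  from assms(1) obtain r c where "r > 0" and c: "\<forall>z\<in>ball w r.
     ((\<lambda>(m, n). c m n * of_real (Re (z - w) ^ m * Im (z - w) ^ n)) has_sum f z) UNIV"
    unfolding real_analytic_at_def by blast
  show ?thesis unfolding real_analytic_at_def
  proof (intro exI[of _ "min r e"] conjI exI[of _ c] ballI)
    fix z assume "z \<in> ball w (min r e)"
    then show "((\<lambda>(m, n). c m n * of_real (Re (z - w) ^ m * Im (z - w) ^ n)) has_sum g z) UNIV"
      using c assms(3)[of z, symmetric] by simp
  qed (use \<open>r > 0\<close> assms(2) in auto)
qed

lemma real_analytic_at_add:
  assumes "real_analytic_at f w" "real_analytic_at g w"
  shows "real_analytic_at (\<lambda>z. f z + g z) w"
proof -
  from assms(1) obtain r c where r: "r > 0" and c: "\<And>z. z\<in>ball w r ==>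
     ((\<lambda>(m, n). c m n * of_real (Re (z - w) ^ m * Im (z - w) ^ n)) has_sum f z) UNIV"
    unfolding real_analytic_at_def by blast
  from assms(2) obtain r' c' where r': "r' > 0" and c': "\<And>z. z\<in>ball w r' ==>
     ((\<lambda>(m, n). c' m n * of_real (Re (z - w) ^ m * Im (z - w) ^ n)) has_sum g z) UNIV"
    unfolding real_analytic_at_def by blast
  show ?thesis unfolding real_analytic_at_def
  proof (intro exI[of _ "min r r'"] conjI exI[of _ "\<lambda>m n. c m n + c' m n"] ballI)
    fix z assume "z \<in> ball w (min r r')"
    then have "((\<lambda>x. (case x of (m, n) \<Rightarrow> c m n * of_real (Re (z - w) ^ m * Im (z - w) ^ n))
        + (case x of (m, n) \<Rightarrow> c' m n * of_real (Re (z - w) ^ m * Im (z - w) ^ n))) has_sum f z + g z) UNIV"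
      by (intro has_sum_add c c') auto
    then show "((\<lambda>(m, n). (c m n + c' m n) * of_real (Re (z - w) ^ m * Im (z - w) ^ n)) has_sum f z + g z) UNIV"
      by (simp add: case_prod_unfold distrib_right)
  qed (use r r' in auto)
qed

lemma real_analytic_at_mult:
  assumes "real_analytic_at f w" "real_analytic_at g w"
  shows "real_analytic_at (\<lambda>z. f z * g z) w"
proof -
  from assms(1) obtain r c where r: "r > 0" and c: "\<And>z. z\<in>ball w r ==>
     ((\<lambda>(m, n). c m n * of_real (Re (z - w) ^ m * Im (z - w) ^ n)) has_sum f z) UNIV"
    unfolding real_analytic_at_def by blast
  from assms(2) obtain r' c' where r': "r' > 0" and c': "\<And>z. z\<in>ball w r' ==>
     ((\<lambda>(m, n). c' m n * of_real (Re (z - w) ^ m * Im (z - w) ^ n)) has_sum g z) UNIV"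
    unfolding real_analytic_at_def by blast
  define \<kappa> :: "(nat \<times> nat) \<times> nat \<times> nat \<Rightarrow> nat \<times> nat" where "\<kappa> = (\<lambda>((i, j), (k, l)). (i + k, j + l))"
  define d where "d m n = infsum (\<lambda>a. case a of ((i, j), (k, l)) \<Rightarrow> c i j * c' k l) {a\<in>UNIV\<times>UNIV. \<kappa> a = (m, n)}" for m n
  show ?thesis unfolding real_analytic_at_def
  proof (intro exI[of _ "min r r'"] conjI exI[of _ d] ballI)
    fix z assume z: "z \<in> ball w (min r r')"
    define F where "F = (\<lambda>(x :: nat \<times> nat, y :: nat \<times> nat).
       (case x of (m, n) \<Rightarrow> c m n * complex_of_real (Re (z - w) ^ m * Im (z - w) ^ n)) *
       (case y of (m, n) \<Rightarrow> c' m n * complex_of_real (Re (z - w) ^ m * Im (z - w) ^ n)))"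
    have "(F has_sum f z * g z) (UNIV \<times> UNIV)"
      unfolding F_def by (intro has_sum_times c c') (use z in auto)
    from has_sum_fibres[OF this, of \<kappa>]
    have "((\<lambda>k. infsum F {a \<in> UNIV \<times> UNIV. \<kappa> a = k}) has_sum f z * g z) UNIV" .
    moreover have "infsum F {a \<in> UNIV \<times> UNIV. \<kappa> a = k} =
       (case k of (m, n) \<Rightarrow> d m n * of_real (Re (z - w) ^ m * Im (z - w) ^ n))" for k
    proof -
      obtain m n where k: "k = (m, n)" by (cases k)
      have "infsum F {a \<in> UNIV \<times> UNIV. \<kappa> a = k} = infsum (\<lambda>a. (case a of ((i, j), (k, l)) \<Rightarrow> c i j * c' k l)
          * of_real (Re (z - w) ^ m * Im (z - w) ^ n)) {a \<in> UNIV \<times> UNIV. \<kappa> a = k}"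
        by (rule infsum_cong) (auto simp: F_def \<kappa>_def k power_add)
      then show ?thesis unfolding infsum_cmult_left' by (simp add: k d_def)
    qed
    ultimately show "((\<lambda>(m, n). d m n * of_real (Re (z - w) ^ m * Im (z - w) ^ n)) has_sum f z * g z) UNIV"
      by (simp only:)
  qed (use r r' in auto)
qed

lemma real_analytic_at_cnj:
  assumes "real_analytic_at f w"
  shows "real_analytic_at (\<lambda>z. cnj (f z)) w"
proof -
  from assms obtain r c where r: "r > 0" and c: "\<And>z. z\<in>ball w r ==>
     ((\<lambda>(m, n). c m n * of_real (Re (z - w) ^ m * Im (z - w) ^ n)) has_sum f z) UNIV"
    unfolding real_analytic_at_def by blast
  show ?thesis unfolding real_analytic_at_def
  proof (intro exI[of _ r] conjI exI[of _ "\<lambda>m n. cnj (c m n)"] ballI r)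
    fix z assume "z \<in> ball w r"
    from c[OF this] have "((\<lambda>x. cnj (case x of (m, n) \<Rightarrow> c m n * of_real (Re (z - w) ^ m * Im (z - w) ^ n)))
       has_sum cnj (f z)) UNIV" by (subst has_sum_cnj_iff)
    then show "((\<lambda>(m, n). cnj (c m n) * of_real (Re (z - w) ^ m * Im (z - w) ^ n)) has_sum cnj (f z)) UNIV"
      by (simp add: case_prod_unfold)
  qed
qed

lemma real_analytic_at_compose_cnj:
  assumes "real_analytic_at f (cnj w)"
  shows "real_analytic_at (\<lambda>z. f (cnj z)) w"
proof -
  from assms obtain r c where r: "r > 0" and c: "\<And>z. z\<in>ball (cnj w) r ==>
     ((\<lambda>(m, n). c m n * of_real (Re (z - cnj w) ^ m * Im (z - cnj w) ^ n)) has_sum f z) UNIV"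
    unfolding real_analytic_at_def by blast
  show ?thesis unfolding real_analytic_at_def
  proof (intro exI[of _ r] conjI exI[of _ "\<lambda>m n. c m n * (-1) ^ n"] ballI r)
    fix z assume "z \<in> ball w r"
    then have "cnj z \<in> ball (cnj w) r"
      by (simp add: dist_norm flip: complex_cnj_diff)
    from c[OF this] have "((\<lambda>(m, n). c m n * of_real (Re (cnj z - cnj w) ^ m * Im (cnj z - cnj w) ^ n))
       has_sum f (cnj z)) UNIV" .
    moreover have "Re (cnj z - cnj w) = Re (z - w)" "Im (cnj z - cnj w) ^ n = (-1) ^ n * Im (z - w) ^ n" for n
      by (simp_all flip: power_mult_distrib)
    ultimately show "((\<lambda>(m, n). c m n * (-1) ^ n * of_real (Re (z - w) ^ m * Im (z - w) ^ n)) has_sum f (cnj z)) UNIV"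
      by (simp only: of_real_mult of_real_power of_real_minus of_real_1 mult_ac)
  qed
qed

lemma holomorphic_imp_has_sum_power:
  assumes "k holomorphic_on ball w r" "norm v < r"
  shows "((\<lambda>n. (deriv ^^ n) k w / fact n * v ^ n) has_sum k (w + v)) UNIV"
    "(\<lambda>n. norm ((deriv ^^ n) k w / fact n) * norm v ^ n) summable_on UNIV"
proof -
  let ?a = "\<lambda>n. (deriv ^^ n) k w / fact n"
  have *: "(\<lambda>n. ?a n * u ^ n) sums k (w + u)" if "norm u < r" for u
    using holomorphic_power_series[OF assms(1), of "w + u"] that by (simp add: dist_norm)
  from assms(2) obtain t where t: "norm v < t" "t < r" using dense by blast
  have "norm (of_real t :: complex) < r" using t norm_ge_zero[of v] by (simp del: norm_ge_zero)
  from sums_summable[OF *[OF this]] have "summable (\<lambda>n. norm (?a n * v ^ n))"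
    by (rule powser_insidea) (use t norm_ge_zero[of v] in \<open>simp del: norm_ge_zero\<close>)
  then show "((\<lambda>n. ?a n * v ^ n) has_sum k (w + v)) UNIV"
    and "(\<lambda>n. norm (?a n) * norm v ^ n) summable_on UNIV"
    using norm_summable_imp_has_sum[OF _ *[OF assms(2)]]
    by (auto intro!: summable_nonneg_imp_summable_on simp: norm_mult norm_power norm_divide)
qed

text \<open>Expand $(x+iy)^n$ in the Taylor series by the binomial theorem and collect the monomials
  $x^my^n$. The two-variable series converges absolutely where $|x|+|y|<r$.\<close>

lemma holomorphic_imp_real_analytic_at:
  assumes "k holomorphic_on ball w r" "r > 0"
  shows "real_analytic_at k w"
proof -
  let ?a = "\<lambda>n. (deriv ^^ n) k w / fact n"
  define \<kappa> :: "nat \<times> nat \<Rightarrow> nat \<times> nat" where "\<kappa> = (\<lambda>(n, i). (i, n - i))"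
  define F where "F x y = (\<lambda>(n, i). ?a n * (of_nat (n choose i) * (of_real x ^ i * (\<i> * of_real y) ^ (n - i))))" for x y :: real
  define A where "A = Sigma UNIV (\<lambda>n::nat. {..n})"
  define d where "d m n = infsum (F 1 1) {a\<in>A. \<kappa> a = (m, n)}" for m n
  show ?thesis unfolding real_analytic_at_def
  proof (intro exI[of _ "r / 2"] conjI exI[of _ d] ballI)
    fix z assume z: "z \<in> ball w (r / 2)"
    define x y where "x = Re (z - w)" and "y = Im (z - w)"
    have zxy: "z = w + (of_real x + \<i> * of_real y)" by (simp add: x_def y_def complex_eq_iff)
    have le: "\<bar>x\<bar> + \<bar>y\<bar> < r"
      using abs_Re_le_cmod[of "z - w"] abs_Im_le_cmod[of "z - w"] z
      by (simp add: x_def y_def dist_norm norm_minus_commute)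
    have "(F x y has_sum k z) A" unfolding A_def
    proof (rule has_sum_SigmaI)
      fix n show "((\<lambda>i. F x y (n, i)) has_sum ?a n * (z - w) ^ n) {..n}"
        by (rule has_sum_finiteI)
          (simp_all add: F_def zxy binomial_ring sum_distrib_left mult_ac)
    next
      have "norm (z - w) < r" using z \<open>r > 0\<close> by (simp add: dist_norm norm_minus_commute)
      from holomorphic_imp_has_sum_power(1)[OF assms(1) this]
      show "((\<lambda>n. ?a n * (z - w) ^ n) has_sum k z) UNIV" by simp
    next
      have "(\<lambda>z. norm (F x y z)) summable_on Sigma UNIV (\<lambda>n::nat. {..n})"
        unfolding Infinite_Sum.abs_summable_on_Sigma_iff
      proof (intro conjI ballI)
        have *: "infsum (\<lambda>i. norm (F x y (n, i))) {..n} = norm (?a n) * (\<bar>x\<bar> + \<bar>y\<bar>) ^ n" for n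
          by (simp add: F_def norm_mult norm_power binomial_ring sum_distrib_left mult_ac norm_divide)
        show "(\<lambda>n. norm (infsum (\<lambda>i. norm (F x y (n, i))) {..n})) summable_on UNIV"
          unfolding * using holomorphic_imp_has_sum_power(2)[OF assms(1), of "of_real (\<bar>x\<bar> + \<bar>y\<bar>)"] le
          by (simp add: norm_mult norm_power del: of_real_add)
      qed auto
      then show "F x y summable_on Sigma UNIV (\<lambda>n::nat. {..n})"
        using summable_on_iff_abs_summable_on_complex by blast
    qed
    from has_sum_fibres[OF this, of \<kappa>]
    have "((\<lambda>k. infsum (F x y) {a \<in> A. \<kappa> a = k}) has_sum k z) UNIV" .
    moreover have "infsum (F x y) {a \<in> A. \<kappa> a = k} = (case k of (m, n) \<Rightarrow> d m n * of_real (x ^ m * y ^ n))" for k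
    proof -
      obtain m n where k: "k = (m, n)" by (cases k)
      have "infsum (F x y) {a \<in> A. \<kappa> a = k} = infsum (\<lambda>a. F 1 1 a * of_real (x ^ m * y ^ n)) {a \<in> A. \<kappa> a = k}"
        by (rule infsum_cong) (auto simp: F_def \<kappa>_def k A_def power_mult_distrib)
      then show ?thesis unfolding infsum_cmult_left' by (simp add: k d_def)
    qed
    ultimately show "((\<lambda>(m, n). d m n * of_real (Re (z - w) ^ m * Im (z - w) ^ n)) has_sum k z) UNIV"
      unfolding x_def[symmetric] y_def[symmetric] by (simp only:)
  qed (use assms in auto)
qed

lemma real_analytic_at_const: "real_analytic_at (\<lambda>_. c) w"
  by (rule holomorphic_imp_real_analytic_at[where r = 1]) auto

lemma holomorphic_zero_on_reals:
  assumes "g holomorphic_on U" "open U" "connected U" "of_real x0 \<in> U" "\<delta> > 0"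
    and "\<And>x. \<bar>x - x0\<bar> < \<delta> ==> of_real x \<in> U \<and> g (of_real x) = 0" "z \<in> U"
  shows "g z = 0"
proof (rule analytic_continuation[OF assms(1-3), of "of_real ` {x. \<bar>x - x0\<bar> < \<delta>}" "of_real x0"])
  show "complex_of_real x0 islimpt of_real ` {x. \<bar>x - x0\<bar> < \<delta>}"
  proof (subst islimpt_approachable, intro allI impI)
    fix e :: real assume "e > 0"
    then show "\<exists>x'\<in>of_real ` {x. \<bar>x - x0\<bar> < \<delta>}. x' \<noteq> complex_of_real x0 \<and> dist x' (of_real x0) < e"
      using assms(5) by (intro bexI[of _ "of_real (x0 + min e \<delta> / 2)"] imageI)
        (auto simp: dist_norm min_def simp flip: of_real_diff)
  qed
  show "of_real ` {x. \<bar>x - x0\<bar> < \<delta>} \<subseteq> U"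
    using assms(6) by blast
  show "g z = 0" if "z \<in> of_real ` {x. \<bar>x - x0\<bar> < \<delta>}" for z
    using assms(6) that by blast
qed (rule assms)+

text \<open>Weierstrass: the partial sums are dominated by the summable family at the corner $(R,R)$.\<close>

lemma two_variable_powser_holomorphic:
  fixes c :: "nat \<Rightarrow> nat \<Rightarrow> complex"
  assumes M: "(\<lambda>(m, n). norm (c m n) * R ^ m * R ^ n) summable_on UNIV"
    and "open U" "p holomorphic_on U" "q holomorphic_on U"
    and le: "\<And>x. x \<in> U ==> norm (p x) \<le> R \<and> norm (q x) \<le> R"
  shows "(\<lambda>x. infsum (\<lambda>(m, n). c m n * p x ^ m * q x ^ n) UNIV) holomorphic_on U"
proof -
  let ?f = "\<lambda>(m, n) x. c m n * p x ^ m * q x ^ n"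
  have "\<exists>d>0. (\<lambda>x. infsum (\<lambda>a. ?f a x) UNIV) holomorphic_on ball x d" if x: "x \<in> U" for x
  proof -
    obtain d where d: "d > 0" "cball x d \<subseteq> U" using \<open>open U\<close> x by (meson open_contains_cball)
    have R: "R \<ge> 0" using le[OF x] norm_ge_zero[of "p x"] by linarith
    have ul: "uniform_limit (cball x d) (\<lambda>X y. \<Sum>a\<in>X. ?f a y) (\<lambda>y. infsum (\<lambda>a. ?f a y) UNIV) (finite_subsets_at_top UNIV)"
    proof (rule Weierstrass_m_test_general[OF _ M])
      fix a y assume "y \<in> cball x d"
      then have y: "norm (p y) \<le> R" "norm (q y) \<le> R" using le[of y] subsetD[OF d(2)] by simp_all
      obtain m n :: nat where a: "a = (m, n)" by (cases a)
      have "norm (c m n) * (norm (p y) ^ m * norm (q y) ^ n) \<le> norm (c m n) * (R ^ m * R ^ n)"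
        using y R by (intro mult_left_mono mult_mono power_mono) simp_all
      then show "norm (?f a y) \<le> (case a of (m, n) \<Rightarrow> norm (c m n) * R ^ m * R ^ n)"
        by (simp add: a norm_mult norm_power mult.assoc)
    qed
    have "(\<lambda>x. infsum (\<lambda>a. ?f a x) UNIV) holomorphic_on ball x d"
    proof (rule holomorphic_uniform_limit[OF _ ul])
      have h: "(\<lambda>y. \<Sum>a\<in>X. ?f a y) holomorphic_on U" for X
      proof (rule holomorphic_on_sum)
        fix a show "?f a holomorphic_on U"
          by (cases a) (simp, intro holomorphic_intros assms)
      qed
      show "\<forall>\<^sub>F X in finite_subsets_at_top UNIV. continuous_on (cball x d) (\<lambda>y. \<Sum>a\<in>X. ?f a y) \<and> (\<lambda>y. \<Sum>a\<in>X. ?f a y) holomorphic_on ball x d"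
        by (intro always_eventually allI conjI holomorphic_on_imp_continuous_on holomorphic_on_subset[OF h]
            d(2) order_trans[OF ball_subset_cball d(2)])
    qed simp
    with d(1) show ?thesis by (intro exI[of _ d] conjI)
  qed
  then have "(\<lambda>x. infsum (\<lambda>a. ?f a x) UNIV) analytic_on U" unfolding analytic_on_def by simp
  from analytic_imp_holomorphic[OF this] show ?thesis by (simp add: case_prod_unfold)
qed

text \<open>Let $A(s,t)$ be the expansion of \<open>f\<close> in $x=\mathrm{Re}(z-w)$ and $y=\mathrm{Im}(z-w)$, continued to complex
  arguments. Where \<open>f\<close> is holomorphic, $A(s,t)=f(w+s+it)$ depends only on $s+it$, that is,
  $A(s,t)=A(s+it,0)$. By the identity theorem in each variable this persists on a polydisc around the origin,
  whose size does not depend on the point where \<open>f\<close> was known to be holomorphic, and there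
  $f(z)=A(z-w,0)$.\<close>

lemma holomorphy_spreads_locally:
  assumes "real_analytic_at f w"
  shows "\<exists>\<rho>>0. \<forall>p e. e > 0 --> p \<in> ball w \<rho> --> f holomorphic_on ball p e --> f holomorphic_on ball w \<rho>"
proof -
  from assms obtain r c where r: "r > 0" and c: "\<And>z. z\<in>ball w r ==>
     ((\<lambda>(m, n). c m n * of_real (Re (z - w) ^ m * Im (z - w) ^ n)) has_sum f z) UNIV"
    unfolding real_analytic_at_def by blast
  \<comment> \<open>The corner \<open>Complex R R\<close> must lie in the disc of convergence ($\sqrt2\,R<r$), and the estimates below need polydiscs of radius $4\rho=R/2$.\<close>
  define R where "R = r / 2"
  define \<rho> where "\<rho> = R / 8"
  have R: "R > 0" "\<rho> > 0" "R = 8 * \<rho>" using r by (auto simp: R_def \<rho>_def)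
  define A where "A s t = infsum (\<lambda>(m, n). c m n * s ^ m * t ^ n) UNIV" for s t
  have M: "(\<lambda>(m, n). norm (c m n) * R ^ m * R ^ n) summable_on UNIV"
  proof -
    have "norm (Complex R R) = sqrt 2 * R" 
      using R(1) by (simp add: cmod_def real_sqrt_mult flip: mult_2)
    also have "\<dots> < r" using r sqrt2_less_2 by (simp add: R_def)
    finally have "w + Complex R R \<in> ball w r" by (simp add: dist_norm)
    from has_sum_imp_summable[OF c[OF this]]
    have "(\<lambda>x. norm (case x of (m, n) \<Rightarrow> c m n * of_real (R ^ m * R ^ n))) summable_on UNIV"
      using summable_on_iff_abs_summable_on_complex by (fastforce simp: case_prod_unfold)
    then show ?thesis using R by (simp add: case_prod_unfold norm_mult norm_power mult.assoc)
  qed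
  have hol: "(\<lambda>x. A (p x) (q x)) holomorphic_on U"
    if "open U" "p holomorphic_on U" "q holomorphic_on U"
      "\<And>x. x \<in> U ==> norm (p x) \<le> R \<and> norm (q x) \<le> R" for p q U
    unfolding A_def by (rule two_variable_powser_holomorphic[OF M that])
  have fA: "f (w + (of_real x + \<i> * of_real y)) = A (of_real x) (of_real y)"
    if "\<bar>x\<bar> < R" "\<bar>y\<bar> < R" for x y :: real
  proof -
    have "norm (of_real x + \<i> * of_real y) \<le> \<bar>x\<bar> + \<bar>y\<bar>"
      by (rule order_trans[OF norm_triangle_ineq]) (simp add: norm_mult)
    then have "dist w (w + (of_real x + \<i> * of_real y)) < r"
      using that unfolding dist_norm norm_minus_commute[of w] by (simp add: R_def)
    then have "w + (of_real x + \<i> * of_real y) \<in> ball w r" by simp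
    from infsumI[OF c[OF this]] show ?thesis by (simp add: A_def mult.assoc)
  qed
  have "f holomorphic_on ball w \<rho>" if e0: "e0 > 0" and p: "p \<in> ball w \<rho>" and hf: "f holomorphic_on ball p e0" for p e0
  proof -
    define x0 y0 where "x0 = Re (p - w)" and "y0 = Im (p - w)"
    have p_eq: "p = w + (of_real x0 + \<i> * of_real y0)" by (simp add: x0_def y0_def complex_eq_iff)
    have x0: "\<bar>x0\<bar> < \<rho>" "\<bar>y0\<bar> < \<rho>"
      using p abs_Re_le_cmod[of "p - w"] abs_Im_le_cmod[of "p - w"]
      by (simp_all add: x0_def y0_def dist_norm norm_minus_commute)
    define \<delta> where "\<delta> = min (e0 / 4) \<rho>"
    have \<delta>: "\<delta> > 0" "4 * \<delta> \<le> e0" "\<delta> \<le> \<rho>" using e0 R by (auto simp: \<delta>_def)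
    have nx: "norm s < 2 * \<rho>" if "norm (s - of_real x) < \<delta>" "\<bar>x\<bar> < \<rho>" for s :: complex and x
      using norm_triangle_ineq[of "s - of_real x" "of_real x"] that \<delta> by simp
    have inp: "w + (s + \<i> * t) \<in> ball p e0" if "norm (s - of_real x0) < \<delta>" "norm (t - of_real y0) < \<delta>" for s t :: complex
    proof -
      have "dist p (w + (s + \<i> * t)) = norm ((s - of_real x0) + \<i> * (t - of_real y0))"
        by (simp add: p_eq dist_norm norm_minus_commute algebra_simps)
      also have "\<dots> \<le> norm (s - of_real x0) + norm (\<i> * (t - of_real y0))" by (rule norm_triangle_ineq)
      also have "\<dots> < e0" using that \<delta> by (simp add: norm_mult)
      finally show ?thesis by simp
    qed
    have hfs: "(\<lambda>x. f (w + (u x + \<i> * v x))) holomorphic_on U"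
      if "u holomorphic_on U" "v holomorphic_on U" "\<And>x. x \<in> U ==> norm (u x - of_real x0) < \<delta> \<and> norm (v x - of_real y0) < \<delta>" for u v U
    proof -
      have "(f \<circ> (\<lambda>x. w + (u x + \<i> * v x))) holomorphic_on U"
        by (rule holomorphic_on_compose_gen[OF _ hf]) (use that inp in \<open>auto intro!: holomorphic_intros\<close>)
      then show ?thesis by (simp add: o_def)
    qed
    \<comment> \<open>Both sides agree for real \<open>s\<close>, \<open>t\<close>; extend first in \<open>s\<close>, then in \<open>t\<close>.\<close>
    have near: "A s t = f (w + (s + \<i> * t))" if s: "norm (s - of_real x0) < \<delta>" and t: "norm (t - of_real y0) < \<delta>" for s t :: complex
    proof -
      have 1: "A s (of_real y) - f (w + (s + \<i> * of_real y)) = 0" if y: "\<bar>y - y0\<bar> < \<delta>" for y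
      proof (rule holomorphic_zero_on_reals[where U = "ball (of_real x0) \<delta>" and z = s])
        have y': "norm (of_real y - of_real y0 :: complex) < \<delta>" using y by (simp flip: of_real_diff)
        have nn: "norm x \<le> R \<and> norm (of_real y :: complex) \<le> R" if "x \<in> ball (of_real x0) \<delta>" for x :: complex
          using nx[of x x0] nx[of "of_real y" y0] that x0 y' R by (simp add: dist_norm norm_minus_commute)
        show "(\<lambda>s. A s (of_real y) - f (w + (s + \<i> * of_real y))) holomorphic_on ball (of_real x0) \<delta>"
          by (intro holomorphic_on_diff hol hfs holomorphic_intros)
            (use y' nn in \<open>auto simp: dist_norm norm_minus_commute\<close>)
        show "of_real x \<in> ball (complex_of_real x0) \<delta> \<and> A (of_real x) (of_real y) - f (w + (of_real x + \<i> * of_real y)) = 0"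
          if "\<bar>x - x0\<bar> < \<delta>" for x
        proof -
          have "norm (of_real x - of_real x0 :: complex) < \<delta>" using that by (simp flip: of_real_diff)
          then show ?thesis using fA[of x y] nx[of "of_real x" x0] nx[of "of_real y" y0] x0 y' R
            by (simp add: dist_norm norm_minus_commute)
        qed
      qed (use \<delta> s in \<open>auto simp: dist_norm norm_minus_commute\<close>)
      have "A s t - f (w + (s + \<i> * t)) = 0"
      proof (rule holomorphic_zero_on_reals[where U = "ball (of_real y0) \<delta>" and z = t])
        have nn: "norm s \<le> R \<and> norm x \<le> R" if "x \<in> ball (of_real y0) \<delta>" for x :: complex
          using nx[of s x0] nx[of "x" y0] that x0 s R by (simp add: dist_norm norm_minus_commute)
        show "(\<lambda>t. A s t - f (w + (s + \<i> * t))) holomorphic_on ball (of_real y0) \<delta>"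
          by (intro holomorphic_on_diff hol hfs holomorphic_intros)
            (use s nn in \<open>auto simp: dist_norm norm_minus_commute\<close>)
        show "of_real y \<in> ball (complex_of_real y0) \<delta> \<and> A s (of_real y) - f (w + (s + \<i> * of_real y)) = 0"
          if "\<bar>y - y0\<bar> < \<delta>" for y
          using 1[OF that] that by (simp add: dist_norm abs_minus_commute flip: of_real_diff)
      qed (use \<delta> t in \<open>auto simp: dist_norm norm_minus_commute\<close>)
      then show ?thesis by simp
    qed
    \<comment> \<open>Move along the line on which $s+it$ is constant: $\tau\mapsto A(s-i\tau,t+\tau)$ is constant near 0, and $\tau=-t$ is still in its domain.\<close>
    have shift: "A s t = A (s + \<i> * t) 0" if s: "norm (s - of_real x0) < \<delta>" and t: "norm (t - of_real y0) < \<delta>" for s t :: complex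
    proof -
      define D where "D = ball (- \<i> * s) R \<inter> ball (- t) R"
      have D: "norm (s - \<i> * \<tau>) < R \<and> norm (t + \<tau>) < R \<longleftrightarrow> \<tau> \<in> D" for \<tau>
      proof -
        have "s - \<i> * \<tau> = \<i> * (- \<i> * s - \<tau>)" by (simp add: algebra_simps)
        then have "norm (s - \<i> * \<tau>) = norm (- \<i> * s - \<tau>)" by (metis norm_mult norm_ii mult_1)
        then show ?thesis unfolding D_def 
          using norm_minus_cancel[of "t + \<tau>"] by (simp add: dist_norm)
      qed
      have st: "norm s < 2 * \<rho>" "norm t < 2 * \<rho>" using nx x0 s t by auto
      have st': "norm (s + \<i> * t) < R"
        using norm_triangle_ineq[of s "\<i> * t"] st R by (simp add: norm_mult)
      define V where "V = ball (0::complex) (min (\<delta> - norm (s - of_real x0)) (\<delta> - norm (t - of_real y0)))"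
      have V: "norm (s - \<i> * \<tau> - of_real x0) < \<delta>" "norm (t + \<tau> - of_real y0) < \<delta>" if "\<tau> \<in> V" for \<tau>
        using that norm_triangle_ineq[of "s - of_real x0" "- \<i> * \<tau>"] norm_triangle_ineq[of "t - of_real y0" "\<tau>"]
        by (simp_all add: V_def norm_mult algebra_simps)
      have VD: "V \<subseteq> D"
      proof
        fix \<tau> assume "\<tau> \<in> V"
        from nx[OF V(1)[OF this] x0(1)] nx[OF V(2)[OF this] x0(2)] show "\<tau> \<in> D" using R by (simp flip: D)
      qed
      have "A (s - \<i> * - t) (t + - t) = f (w + (s + \<i> * t))"
      proof (rule analytic_continuation_open[where s = V and s' = D and f = "\<lambda>\<tau>. A (s - \<i> * \<tau>) (t + \<tau>)" and g = "\<lambda>_. f (w + (s + \<i> * t))"])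
        show "(\<lambda>\<tau>. A (s - \<i> * \<tau>) (t + \<tau>)) holomorphic_on D"
        proof (intro hol holomorphic_intros)
          show "open D" by (simp add: D_def open_Int)
          show "norm (s - \<i> * x) \<le> R \<and> norm (t + x) \<le> R" if "x \<in> D" for x
            using that D[of x] by linarith
        qed
        show "connected D" unfolding D_def by (intro convex_connected convex_Int convex_ball)
        show "A (s - \<i> * \<tau>) (t + \<tau>) = f (w + (s + \<i> * t))" if "\<tau> \<in> V" for \<tau>
          using near[OF V[OF that]] by (simp add: algebra_simps)
        show "- t \<in> D" using D[of "- t"] st' R by simp
        show "V \<noteq> {}" using s t by (auto simp: V_def)
      qed (use VD in \<open>auto simp: V_def D_def\<close>)
      then show ?thesis using near[OF s t] by simp
    qed
    have nst: "norm (s + \<i> * t) \<le> R" if "norm s < 4 * \<rho>" "norm t < 4 * \<rho>" for s t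
      using norm_triangle_ineq[of s "\<i> * t"] that R by (simp add: norm_mult)
    have glob1: "A s t - A (s + \<i> * t) 0 = 0" if t: "norm (t - of_real y0) < \<delta>" and s: "norm s < 4 * \<rho>" for s t
    proof (rule analytic_continuation_open[where s = "ball (of_real x0) \<delta>" and s' = "ball 0 (4 * \<rho>)" and f = "\<lambda>s. A s t - A (s + \<i> * t) 0" and g = "\<lambda>_. 0"])
      have t2: "norm t < 2 * \<rho>" using nx x0 t by auto
      show "(\<lambda>s. A s t - A (s + \<i> * t) 0) holomorphic_on ball 0 (4 * \<rho>)"
        by (intro holomorphic_on_diff hol holomorphic_intros) (use t2 R nst in auto)
      show "ball (complex_of_real x0) \<delta> \<subseteq> ball 0 (4 * \<rho>)"
        using nx x0 R by (force simp: dist_norm norm_minus_commute)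
      show "A s t - A (s + \<i> * t) 0 = 0" if "s \<in> ball (of_real x0) \<delta>" for s
        using shift t that by (simp add: dist_norm norm_minus_commute)
    qed (use \<delta> s in auto)
    have glob: "A s t - A (s + \<i> * t) 0 = 0" if t: "norm t < 4 * \<rho>" and s: "norm s < 4 * \<rho>" for s t
    proof (rule analytic_continuation_open[where s = "ball (of_real y0) \<delta>" and s' = "ball 0 (4 * \<rho>)" and f = "\<lambda>t. A s t - A (s + \<i> * t) 0" and g = "\<lambda>_. 0"])
      show "(\<lambda>t. A s t - A (s + \<i> * t) 0) holomorphic_on ball 0 (4 * \<rho>)"
        by (intro holomorphic_on_diff hol holomorphic_intros) (use s R nst in auto)
      show "ball (complex_of_real y0) \<delta> \<subseteq> ball 0 (4 * \<rho>)"
        using nx x0 R by (force simp: dist_norm norm_minus_commute)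
      show "A s t - A (s + \<i> * t) 0 = 0" if "t \<in> ball (of_real y0) \<delta>" for t
        using glob1 s that by (simp add: dist_norm norm_minus_commute)
    qed (use \<delta> t in auto)
    have "(\<lambda>z. A (z - w) 0) holomorphic_on ball w \<rho>"
      by (intro hol holomorphic_intros) (use R in \<open>auto simp: dist_norm norm_minus_commute\<close>)
    moreover have "A (z - w) 0 = f z" if "z \<in> ball w \<rho>" for z
    proof -
      have *: "\<bar>Re (z - w)\<bar> < \<rho>" "\<bar>Im (z - w)\<bar> < \<rho>"
        using that abs_Re_le_cmod[of "z - w"] abs_Im_le_cmod[of "z - w"]
        by (simp_all add: dist_norm norm_minus_commute)
      have "complex_of_real (Re (z - w)) + \<i> * of_real (Im (z - w)) = z - w"
        by (simp add: complex_eq_iff)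
      moreover have "A (of_real (Re (z - w))) (of_real (Im (z - w))) =
          A (of_real (Re (z - w)) + \<i> * of_real (Im (z - w))) 0"
        using glob[of "of_real (Im (z - w))" "of_real (Re (z - w))"] * R by (simp del: minus_complex.sel)
      moreover have "f (w + (of_real (Re (z - w)) + \<i> * of_real (Im (z - w)))) =
          A (of_real (Re (z - w))) (of_real (Im (z - w)))"
        by (rule fA) (use * R in auto)
      ultimately show ?thesis by (simp del: minus_complex.sel)
    qed
    ultimately show ?thesis by (metis (no_types, lifting) holomorphic_transform)
  qed
  with R show ?thesis by blast
qed

text \<open>The points near which \<open>f\<close> is holomorphic form an open set, and so do the other points, because the
  radius in the local statement is uniform in the point \<open>p\<close>.\<close>

theorem holomorphy_spreads:
  assumes "real_analytic_on f S" "open S" "connected S"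
    and "e > 0" "ball p e \<subseteq> S" "f holomorphic_on ball p e"
  shows "f holomorphic_on S"
proof -
  define T where "T = {w \<in> S. \<exists>e>0. f holomorphic_on ball w e}"
  have "open T"
  proof (rule Topological_Spaces.openI)
    fix w assume "w \<in> T"
    then obtain e where e: "e > 0" "f holomorphic_on ball w e" "w \<in> S" by (auto simp: T_def)
    obtain d where d: "d > 0" "ball w d \<subseteq> S" using \<open>open S\<close> e open_contains_ball by blast
    have "ball w (min d e) \<subseteq> T"
    proof
      fix v assume v: "v \<in> ball w (min d e)"
      then obtain k where "k > 0" "ball v k \<subseteq> ball w (min d e)" by (metis open_contains_ball open_ball)
      then have "f holomorphic_on ball v k" using holomorphic_on_subset[OF e(2), of "ball v k"] by (simp add: subset_iff)
      then show "v \<in> T" using v d \<open>k > 0\<close> by (auto simp: T_def)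
    qed
    then show "\<exists>T'. open T' \<and> w \<in> T' \<and> T' \<subseteq> T" using d e by (intro exI[of _ "ball w (min d e)"]) auto
  qed
  moreover have "open (S - T)"
  proof (rule Topological_Spaces.openI)
    fix w assume w: "w \<in> S - T"
    then obtain \<rho> where \<rho>: "\<rho> > 0" "\<And>p e. e > 0 ==> p \<in> ball w \<rho> ==> f holomorphic_on ball p e ==> f holomorphic_on ball w \<rho>"
      using holomorphy_spreads_locally assms(1) unfolding real_analytic_on_iff by blast
    then have "S \<inter> ball w \<rho> \<subseteq> S - T" using w unfolding T_def by blast
    then show "\<exists>T'. open T' \<and> w \<in> T' \<and> T' \<subseteq> S - T" using w \<rho> \<open>open S\<close>
      by (intro exI[of _ "S \<inter> ball w \<rho>"]) auto
  qed
  moreover have "p \<in> T" using assms by (auto simp: T_def)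
  ultimately have "T \<inter> S \<noteq> {}" "T \<inter> (S - T) \<inter> S = {}" "S \<subseteq> T \<union> (S - T)"
      "open T" "open (S - T)"
    by (auto simp: T_def)
  with connectedD[OF \<open>connected S\<close>, of T "S - T"] have "S \<subseteq> T" by blast
  then have "\<forall>w\<in>S. \<exists>e>0. f holomorphic_on ball w e" unfolding T_def by blast
  then have "f analytic_on S" unfolding analytic_on_def .
  then show ?thesis by (rule analytic_imp_holomorphic)
qed

section \<open>Laurent series with real exponents\<close>

lemma cpow2_of_int: "cpow2 z (s' + of_int k) s' = of_real ((norm z)\<^sup>2 powr s') * z powi k"
  by (simp add: cpow2_def)

lemma cpow2_add:
  assumes "s - s' \<in> \<int>" "t - t' \<in> \<int>" "z \<noteq> 0"
  shows "cpow2 z (s + t) (s' + t') = cpow2 z s s' * cpow2 z t t'"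
proof -
  from assms obtain k l where "s - s' = of_int k" "t - t' = of_int l" by (auto elim!: Ints_cases)
  then have e: "s = s' + of_int k" "t = t' + of_int l" by simp_all
  have e2: "s + t = (s' + t') + of_int (k + l)" by (simp add: e)
  show ?thesis unfolding e2 unfolding e cpow2_of_int using assms(3)
    by (simp add: powr_add power_int_add mult_ac)
qed

lemma cpow2_diag: "cpow2 z e e = of_real ((norm z)\<^sup>2 powr e)"
  by (simp add: cpow2_def)

lemma cpow2_nat: "z \<noteq> 0 ==> cpow2 z (real m) (real n) = z ^ m * cnj z ^ n"
proof -
  assume z: "z \<noteq> 0"
  have "cpow2 z (real n + of_int (int m - int n)) (real n) = of_real ((norm z)\<^sup>2 powr real n) * z powi (int m - int n)"
    by (rule cpow2_of_int)
  also have "complex_of_real ((norm z)\<^sup>2 powr real n) = (z * cnj z) ^ n"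
    using z by (simp add: powr_realpow flip: complex_norm_square)
  also have "(z * cnj z) ^ n * z powi (int m - int n) = z ^ m * cnj z ^ n"
    using z by (simp add: power_int_diff power_mult_distrib)
  finally show ?thesis by simp
qed

lemma norm_cpow2:
  assumes "s - s' \<in> \<int>" "z \<noteq> 0"
  shows "norm (cpow2 z s s') = norm z powr (s + s')"
proof -
  from assms obtain k where "s - s' = of_int k" by (auto elim!: Ints_cases)
  then have e: "s = s' + of_int k" by simp
  have "(norm z)\<^sup>2 powr s' = norm z powr (2 * s')"
    using assms(2) by (metis powr_powr powr_numeral norm_ge_zero)
  then show ?thesis unfolding e cpow2_of_int using assms(2)
    by (simp add: norm_mult norm_power_int powr_real_of_int' powr_add flip: powr_mult_base)
qed

lemma cpow2_scale:
  assumes "s - s' \<in> \<int>" "t > 0" "z \<noteq> 0"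
  shows "cpow2 (of_real t * z) s s' = of_real (t powr (s + s')) * cpow2 z s s'"
proof -
  from assms obtain k where "s - s' = of_int k" by (auto elim!: Ints_cases)
  then have e: "s = s' + of_int k" by simp
  have "t powr (s' + of_int k + s') = (t\<^sup>2 powr s') * t powi k"
  proof -
    have "t powr (s' + of_int k + s') = t powr s' * t powr s' * t powr (of_int k)"
      by (simp only: powr_add mult_ac)
    moreover have "t\<^sup>2 powr s' = t powr s' * t powr s'"
      using assms(2) by (simp only: power2_eq_square powr_mult)
    ultimately show ?thesis using assms(2) by (simp add: powr_real_of_int')
  qed
  then show ?thesis unfolding e cpow2_of_int using assms(2)
    by (simp add: norm_mult power_mult_distrib powr_mult power_int_mult_distrib)
qed

lemma cpow2_cnj:
  assumes "s - s' \<in> \<int>"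
  shows "cpow2 (cnj z) s s' = cpow2 z s' s"
proof (cases "z = 0")
  case False
  from assms obtain k where "s - s' = of_int k" by (auto elim!: Ints_cases)
  then have e: "s = s' + of_int k" by simp
  have "cpow2 z s' s = cpow2 z ((s' + of_int k) + of_int (- k)) (s' + of_int k)" by (simp add: e)
  also have "\<dots> = of_real ((norm z)\<^sup>2 powr (s' + of_int k)) * z powi (- k)" by (rule cpow2_of_int)
  also have "\<dots> = of_real ((norm z)\<^sup>2 powr s') * ((of_real ((norm z)\<^sup>2) powi k) * z powi (- k))"
    using False by (simp add: powr_add powr_real_of_int')
  also have "(of_real ((norm z)\<^sup>2) powi k) * z powi (- k) = cnj z powi k"
    using False by (simp only: complex_norm_square) (simp add: power_int_mult_distrib power_int_minus)
  finally show ?thesis unfolding e cpow2_of_int by simp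
qed (simp add: cpow2_def)

text \<open>After multiplication by a power of \<open>e\<close> the sum is a polynomial with infinitely many zeros.\<close>

lemma trig_poly_zero:
  fixes a :: "'x \<Rightarrow> complex" and k :: "'x \<Rightarrow> int"
  assumes "finite D" "inj_on k D" "\<And>e. norm e = 1 ==> (\<Sum>x\<in>D. a x * e powi k x) = 0" "x \<in> D"
  shows "a x = 0"
proof -
  obtain K where K: "\<And>x. x \<in> D ==> k x + K \<ge> 0"
  proof
    fix x assume "x \<in> D"
    then have "- k x \<le> Max ((\<lambda>x. - k x) ` D)" using assms(1) by (intro Max_ge) auto
    then show "k x + Max ((\<lambda>x. - k x) ` D) \<ge> 0" by linarith
  qed
  define P where "P = (\<Sum>x\<in>D. monom (a x) (nat (k x + K)))"
  have "poly P e = 0" if "norm e = 1" for e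
  proof -
    have e: "e \<noteq> 0" using that by auto
    have "poly P e = (\<Sum>x\<in>D. a x * e powi (k x) * e powi K)"
      unfolding P_def poly_sum
    proof (rule sum.cong[OF refl])
      fix x assume "x \<in> D"
      from K[OF this] have "e ^ nat (k x + K) = e powi (k x + K)" by (simp add: power_int_def)
      then show "poly (monom (a x) (nat (k x + K))) e = a x * e powi (k x) * e powi K"
        using e by (simp add: poly_monom power_int_add)
    qed
    also have "\<dots> = 0" using assms(3)[OF that] by (simp flip: sum_distrib_right)
    finally show ?thesis .
  qed
  moreover have "infinite {e::complex. norm e = 1}"
  proof
    assume "finite {e::complex. norm e = 1}"
    then have "finite (Re ` {e::complex. norm e = 1})" by simp
    moreover have "{-1..1} \<subseteq> Re ` {e::complex. norm e = 1}"
    proof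
      fix x :: real assume "x \<in> {-1..1}"
      then have "x\<^sup>2 \<le> 1" by (simp add: abs_square_le_1 abs_le_iff)
      then have "norm (Complex x (sqrt (1 - x\<^sup>2))) = 1" by (simp add: cmod_def)
      then show "x \<in> Re ` {e::complex. norm e = 1}" by (intro image_eqI[of _ _ "Complex x (sqrt (1 - x\<^sup>2))"]) auto
    qed
    ultimately have "finite {-1..1::real}" by (rule rev_finite_subset)
    then show False using infinite_Icc[of "-1::real" 1] by simp
  qed
  ultimately have "P = 0"
    using poly_roots_finite[of P] finite_subset[of "{e. norm e = 1}" "{x. poly P x = 0}"] by blast
  then have "0 = coeff P (nat (k x + K))" by simp
  also have "\<dots> = (\<Sum>y\<in>D. if y = x then a x else 0)"
    unfolding P_def coeff_sum
  proof (rule sum.cong[OF refl])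
    fix y assume y: "y \<in> D"
    have "nat (k y + K) = nat (k x + K) \<longleftrightarrow> y = x"
      using K[OF y] K[OF assms(4)] inj_onD[OF assms(2) _ y assms(4)] by (auto simp: eq_nat_nat_iff)
    then show "coeff (monom (a y) (nat (k y + K))) (nat (k x + K)) = (if y = x then a x else 0)"
      by simp
  qed
  also have "\<dots> = a x" using assms(1,4) by simp
  finally show ?thesis by simp
qed

lemma laurent_ser_int: "laurent_ser a ==> a s s' \<noteq> 0 ==> s - s' \<in> \<int>"
  unfolding laurent_ser_def by blast

text \<open>Otherwise let \<open>d\<close> be the lowest total degree $s+s'$ of a nonzero term. There are finitely many terms
  of degree \<open>d\<close>, and the next degree is at least $d+\delta$. On the circle of radius \<open>t\<close> the degree \<open>d\<close> part
  dominates as $t\to0$, so it vanishes on the unit circle. It is a trigonometric polynomial, in which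
  $s-s'$ determines the term.\<close>

lemma laurent_series_unique_zero:
  fixes a :: "complex ser"
  assumes a: "laurent_ser a" and r: "r > 0"
    and z: "\<And>z. 0 < norm z ==> norm z < r ==> ((\<lambda>(s, s'). a s s' * cpow2 z s s') has_sum 0) UNIV"
  shows "a s s' = 0"
proof (rule ccontr)
  assume nz: "a s s' \<noteq> 0"
  define \<sigma> :: "real \<times> real \<Rightarrow> real" where "\<sigma> = (\<lambda>x. fst x + snd x)"
  define A where "A x = a (fst x) (snd x)" for x
  define L where "L R = {x. A x \<noteq> 0 \<and> \<sigma> x \<le> R}" for R
  have L: "finite (L R)" for R
    using a unfolding laurent_ser_def L_def \<sigma>_def A_def by (auto simp: case_prod_unfold)
  define d where "d = Min (\<sigma> ` L (s + s'))"
  have ne: "(s, s') \<in> L (s + s')" using nz by (simp add: L_def \<sigma>_def A_def)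
  have d_le: "d \<le> \<sigma> x" if "A x \<noteq> 0" for x
  proof (cases "\<sigma> x \<le> s + s'")
    case True
    then show ?thesis unfolding d_def using L that by (intro Min_le) (auto simp: L_def)
  next
    case False
    have "d \<le> s + s'" unfolding d_def using L ne by (intro Min_le) (auto simp: \<sigma>_def intro!: image_eqI[of _ _ "(s, s')"])
    with False show ?thesis by simp
  qed
  define D where "D = {x \<in> L d. \<sigma> x = d}"
  have finD: "finite D" unfolding D_def using L by simp
  have "d \<in> \<sigma> ` L (s + s')" unfolding d_def using L ne by (intro Min_in) auto
  then obtain x0 where x0: "x0 \<in> D" by (auto simp: D_def L_def)
  have D_iff: "x \<in> D \<longleftrightarrow> A x \<noteq> 0 \<and> \<sigma> x = d" for x by (auto simp: D_def L_def)
  obtain \<delta> where \<delta>: "\<delta> > 0" "\<And>x. A x \<noteq> 0 ==> x \<notin> D ==> d + \<delta> \<le> \<sigma> x"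
  proof
    let ?S = "insert 1 ((\<lambda>x. \<sigma> x - d) ` (L (d + 1) - D))"
    have fin: "finite ?S" using L by simp
    have pos: "y > 0" if "y \<in> ?S" for y
      using that d_le by (fastforce simp: L_def D_iff)
    show "Min ?S > 0" using fin pos by (subst Min_gr_iff) auto
    show "d + Min ?S \<le> \<sigma> x" if "A x \<noteq> 0" "x \<notin> D" for x
    proof (cases "\<sigma> x \<le> d + 1")
      case True
      then have "Min ?S \<le> \<sigma> x - d" using that fin by (intro Min_le) (auto simp: L_def)
      then show ?thesis by simp
    next
      case False
      have "Min ?S \<le> 1" using fin by (intro Min_le) auto
      with False show ?thesis by simp
    qed
  qed
  define \<rho> where "\<rho> = r / 2"
  have \<rho>: "\<rho> > 0" "\<rho> < r" using r by (auto simp: \<rho>_def)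
  define w where "w x = \<sigma> x" for x :: "real \<times> real"
  have int: "fst x - snd x \<in> \<int>" if "A x \<noteq> 0" for x
    using laurent_ser_int[OF a] that by (simp add: A_def)
  have z': "((\<lambda>x. A x * cpow2 z (fst x) (snd x)) has_sum 0) UNIV" if "0 < norm z" "norm z < r" for z
    using z[OF that] by (simp add: A_def case_prod_unfold)
  have summ: "(\<lambda>x. norm (A x) * \<rho> powr \<sigma> x) summable_on UNIV"
  proof -
    have "(\<lambda>x. norm (A x * cpow2 (of_real \<rho>) (fst x) (snd x))) summable_on UNIV"
      using has_sum_imp_summable[OF z'[of "of_real \<rho>"]] \<rho> summable_on_iff_abs_summable_on_complex[of "\<lambda>x. A x * cpow2 (of_real \<rho>) (fst x) (snd x)"] by simp
    also have "(\<lambda>x. norm (A x * cpow2 (of_real \<rho>) (fst x) (snd x))) = (\<lambda>x. norm (A x) * \<rho> powr \<sigma> x)"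
    proof
      fix x show "norm (A x * cpow2 (of_real \<rho>) (fst x) (snd x)) = norm (A x) * \<rho> powr \<sigma> x"
        using int[of x] \<rho> by (cases "A x = 0") (simp_all add: norm_mult norm_cpow2 \<sigma>_def)
    qed
    finally show ?thesis .
  qed
  define M where "M = infsum (\<lambda>x. norm (A x) * \<rho> powr \<sigma> x) (UNIV - D)"
  have "(\<Sum>x\<in>D. A x * cpow2 e (fst x) (snd x)) = 0" if e: "norm e = 1" for e
  proof (rule ccontr)
    define p where "p = (\<Sum>x\<in>D. A x * cpow2 e (fst x) (snd x))"
    assume "\<not> ?thesis"
    then have p: "norm p > 0" by (simp add: p_def)
    have e0: "e \<noteq> 0" using e by auto
    have bound: "norm p \<le> t powr \<delta> * (M * \<rho> powr (- (d + \<delta>)))" if t: "0 < t" "t < \<rho>" for t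
    proof -
      let ?F = "\<lambda>x. A x * cpow2 (of_real t * e) (fst x) (snd x)"
      have te: "norm (of_real t * e) = t" using t e by (simp add: norm_mult)
      have F: "?F x = of_real (t powr \<sigma> x) * (A x * cpow2 e (fst x) (snd x))" for x
        using int[of x] t e0 by (cases "A x = 0") (simp_all add: cpow2_scale \<sigma>_def)
      have "(?F has_sum 0) UNIV" by (rule z') (use te t \<rho> in auto)
      then have "(?F has_sum (0 - sum ?F D)) (UNIV - D)"
        by (intro has_sum_Diff has_sum_finite finD) auto
      moreover have "sum ?F D = of_real (t powr d) * p"
        unfolding p_def sum_distrib_left F by (rule sum.cong) (auto simp: D_iff)
      ultimately have hs: "(?F has_sum (- of_real (t powr d) * p)) (UNIV - D)" by simp
      have s1: "(\<lambda>x. norm (A x) * \<rho> powr \<sigma> x) summable_on (UNIV - D)"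
        using summable_on_subset_banach[OF summ] by blast
      have "((\<lambda>x. (t / \<rho>) powr (d + \<delta>) * (norm (A x) * \<rho> powr \<sigma> x)) has_sum ((t / \<rho>) powr (d + \<delta>) * M)) (UNIV - D)"
        unfolding M_def by (intro has_sum_cmult_right has_sum_infsum s1)
      moreover have "norm (?F x) \<le> (t / \<rho>) powr (d + \<delta>) * (norm (A x) * \<rho> powr \<sigma> x)" if "x \<in> UNIV - D" for x
      proof (cases "A x = 0")
        case False
        have "norm (?F x) = norm (A x) * t powr \<sigma> x"
          using False int[OF False] e0 t e by (simp add: F norm_mult norm_cpow2)
        also have "t powr \<sigma> x = (t / \<rho>) powr \<sigma> x * \<rho> powr \<sigma> x"
          using t \<rho> by (simp add: powr_divide)
        also have "(t / \<rho>) powr \<sigma> x \<le> (t / \<rho>) powr (d + \<delta>)"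
          using \<delta>(2)[OF False] that t \<rho> by (intro powr_mono') auto
        finally show ?thesis by (simp add: mult_ac mult_left_mono mult_right_mono)
      qed simp
      ultimately have "norm (- of_real (t powr d) * p) \<le> (t / \<rho>) powr (d + \<delta>) * M"
        using norm_infsum_le[OF hs] by blast
      then have "t powr d * norm p \<le> t powr d * (t powr \<delta> * (M * \<rho> powr (- (d + \<delta>))))"
      proof -
        have "(t / \<rho>) powr (d + \<delta>) = t powr d * (t powr \<delta> * \<rho> powr (- (d + \<delta>)))"
          unfolding powr_minus using t \<rho> by (subst powr_divide) (auto simp: powr_add[of t] divide_inverse)
        moreover assume "norm (- of_real (t powr d) * p) \<le> (t / \<rho>) powr (d + \<delta>) * M"
        ultimately show ?thesis by (simp add: norm_mult mult_ac)
      qed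
      then show ?thesis using t by simp
    qed
    have lim: "((\<lambda>t. t powr \<delta> * (M * \<rho> powr (- (d + \<delta>)))) \<longlongrightarrow> 0 powr \<delta> * (M * \<rho> powr (- (d + \<delta>)))) (at_right 0)"
      using \<delta>(1) by (intro tendsto_intros) (auto simp: eventually_at_right_less intro!: eventually_mono[OF eventually_at_right_less])
    have "eventually (\<lambda>t. norm p \<le> t powr \<delta> * (M * \<rho> powr (- (d + \<delta>)))) (at_right 0)"
      using bound \<rho> unfolding eventually_at_right_field by blast
    from tendsto_lowerbound[OF lim this] have "norm p \<le> 0" by simp
    with p show False by simp
  qed
  moreover have "cpow2 e (fst x) (snd x) = e powi \<lfloor>fst x - snd x\<rfloor>" if "norm e = 1" for e x
    using that by (simp add: cpow2_def)
  ultimately have *: "(\<Sum>x\<in>D. A x * e powi \<lfloor>fst x - snd x\<rfloor>) = 0" if "norm e = 1" for e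
    using that by simp
  have "inj_on (\<lambda>x. \<lfloor>fst x - snd x\<rfloor>) D"
  proof (rule inj_onI)
    fix x y assume "x \<in> D" "y \<in> D" and eq: "\<lfloor>fst x - snd x\<rfloor> = \<lfloor>fst y - snd y\<rfloor>"
    then have "fst x - snd x \<in> \<int>" "fst y - snd y \<in> \<int>" "\<sigma> x = \<sigma> y" by (auto simp: D_iff int)
    with eq have "fst x - snd x = fst y - snd y" "fst x + snd x = fst y + snd y"
      by (auto elim!: Ints_cases simp: \<sigma>_def)
    then show "x = y" by (intro prod_eqI) linarith+
  qed
  from trig_poly_zero[OF finD this * x0] x0 show False by (simp add: D_iff)
qed

lemma laurent_ser_add: 
  fixes a b :: "complex ser"
  assumes "laurent_ser a" "laurent_ser b"
  shows "laurent_ser (\<lambda>s s'. a s s' + b s s')"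
  unfolding laurent_ser_def
proof (intro conjI allI impI)
  obtain N N' where N: "\<forall>s s'. s \<le> N \<or> s' \<le> N --> a s s' = 0" "\<forall>s s'. s \<le> N' \<or> s' \<le> N' --> b s s' = 0"
    using assms unfolding laurent_ser_def by blast
  show "\<exists>N. \<forall>s s'. s \<le> N \<or> s' \<le> N --> a s s' + b s s' = 0"
    by (rule exI[of _ "min N N'"]) (use N in auto)
  fix R
  have "finite ({(s, s'). a s s' \<noteq> 0 \<and> s + s' \<le> R} \<union> {(s, s'). b s s' \<noteq> 0 \<and> s + s' \<le> R})"
    using assms unfolding laurent_ser_def by blast
  then show "finite {(s, s'). a s s' + b s s' \<noteq> 0 \<and> s + s' \<le> R}" by (rule rev_finite_subset) auto
qed (use assms in \<open>auto simp: laurent_ser_def\<close>)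

lemma laurent_ser_scale: 
  fixes a :: "complex ser"
  assumes "laurent_ser a"
  shows "laurent_ser (\<lambda>s s'. c * a s s')"
  unfolding laurent_ser_def
proof (intro conjI allI impI)
  obtain N where N: "\<forall>s s'. s \<le> N \<or> s' \<le> N --> a s s' = 0"
    using assms unfolding laurent_ser_def by blast
  then show "\<exists>N. \<forall>s s'. s \<le> N \<or> s' \<le> N --> c * a s s' = 0" by auto
  fix R
  have "finite {(s, s'). a s s' \<noteq> 0 \<and> s + s' \<le> R}" using assms unfolding laurent_ser_def by blast
  then show "finite {(s, s'). c * a s s' \<noteq> 0 \<and> s + s' \<le> R}" by (rule rev_finite_subset) auto
qed (use assms in \<open>auto simp: laurent_ser_def\<close>)

lemma laurent_series_unique:
  fixes a b :: "complex ser"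
  assumes "laurent_ser a" "laurent_ser b" "r > 0"
    and "\<And>z. 0 < norm z ==> norm z < r ==> ((\<lambda>(s, s'). a s s' * cpow2 z s s') has_sum F z) UNIV"
    and "\<And>z. 0 < norm z ==> norm z < r ==> ((\<lambda>(s, s'). b s s' * cpow2 z s s') has_sum F z) UNIV"
  shows "a = b"
proof (intro ext)
  fix s s'
  have "a s s' + (-1) * b s s' = 0"
  proof (rule laurent_series_unique_zero[OF _ assms(3)])
    show "laurent_ser (\<lambda>s s'. a s s' + (-1) * b s s')" by (intro laurent_ser_add laurent_ser_scale assms)
    fix z :: complex assume "0 < norm z" "norm z < r"
    from has_sum_add[OF assms(4)[OF this] has_sum_uminusI[OF assms(5)[OF this]]]
    show "((\<lambda>(s, s'). (a s s' + (-1) * b s s') * cpow2 z s s') has_sum 0) UNIV"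
      by (simp add: case_prod_unfold algebra_simps)
  qed
  then show "a s s' = b s s'" by simp
qed

text \<open>Multiplication by power series in $z,\bar z$ and by $|z|^{2e}$ produces only exponents of this form.
  All growth conditions survive because $i,j\ge0$ are bounded in each bounded range of degrees.\<close>

lemma laurent_ser_mono:
  fixes a :: "'w::zero ser" and b :: "'x::zero ser"
  assumes a: "laurent_ser a"
    and b: "\<And>s s'. b s s' \<noteq> 0 ==> \<exists>i j. a (s - e - real i) (s' - e - real j) \<noteq> 0"
  shows "laurent_ser b"
  unfolding laurent_ser_def
proof (intro conjI allI impI)
  fix s s' :: real assume "s - s' \<notin> \<int>"
  show "b s s' = 0"
  proof (rule ccontr)
    assume "b s s' \<noteq> 0"
    from b[OF this] obtain i j where "a (s - e - real i) (s' - e - real j) \<noteq> 0" by blast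
    from laurent_ser_int[OF a this] have "(s - s') - (real i - real j) \<in> \<int>" by (simp add: algebra_simps)
    then have "(s - s') - (real i - real j) + (real i - real j) \<in> \<int>"
      by (rule Ints_add) simp
    then have "s - s' \<in> \<int>" by (simp only: diff_add_cancel)
    with \<open>s - s' \<notin> \<int>\<close> show False ..
  qed
next
  from a obtain N where N: "\<And>s s'. s \<le> N \<or> s' \<le> N ==> a s s' = 0" unfolding laurent_ser_def by blast
  have "b s s' = 0" if "s \<le> N + e \<or> s' \<le> N + e" for s s'
  proof (rule ccontr)
    assume "b s s' \<noteq> 0"
    from b[OF this] obtain i j where "a (s - e - real i) (s' - e - real j) \<noteq> 0" by blast
    with N[of "s - e - real i" "s' - e - real j"] that show False by auto
  qed
  then show "\<exists>N. \<forall>s s'. s \<le> N \<or> s' \<le> N --> b s s' = 0" by blast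
  fix R
  define R' where "R' = R - 2 * e"
  define n where "n = nat \<lceil>R' - 2 * N\<rceil>"
  have "{(s, s'). b s s' \<noteq> 0 \<and> s + s' \<le> R} \<subseteq>
    (\<lambda>((p, p'), (i, j)). (p + e + real i, p' + e + real j)) ` ({(p, p'). a p p' \<noteq> 0 \<and> p + p' \<le> R'} \<times> ({..n} \<times> {..n}))"
  proof clarify
    fix s s' assume "b s s' \<noteq> 0" and le: "s + s' \<le> R"
    from b[OF this(1)] obtain i j where nz: "a (s - e - real i) (s' - e - real j) \<noteq> 0" by blast
    then have "s - e - real i > N" "s' - e - real j > N"
      using N[of "s - e - real i" "s' - e - real j"] by fastforce+
    then have "real i \<le> R' - 2 * N" "real j \<le> R' - 2 * N" using le by (simp_all add: R'_def)
    then have "i \<le> n" "j \<le> n" unfolding n_def by linarith+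
    then show "(s, s') \<in> (\<lambda>((p, p'), (i, j)). (p + e + real i, p' + e + real j)) ` ({(p, p'). a p p' \<noteq> 0 \<and> p + p' \<le> R'} \<times> ({..n} \<times> {..n}))"
      using nz le by (intro image_eqI[of _ _ "((s - e - real i, s' - e - real j), (i, j))"]) (auto simp: R'_def)
  qed
  moreover have "finite ({(p, p'). a p p' \<noteq> 0 \<and> p + p' \<le> R'})" using a unfolding laurent_ser_def by blast
  ultimately show "finite {(s, s'). b s s' \<noteq> 0 \<and> s + s' \<le> R}" by (auto intro: finite_subset)
qed

text \<open>Summability at a single point gives absolute convergence with $R=|z|$, as $|z^s\bar z^{s'}|=|z|^{s+s'}$.\<close>

lemma abs_conv_at_0_if_summable:
  fixes a :: "complex ser"
  assumes a: "laurent_ser a" and z: "z \<noteq> 0"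
    and s: "(\<lambda>(s, s'). a s s' * cpow2 z s s') summable_on UNIV"
  shows "abs_conv_at_0 a"
proof -
  from a obtain N where N: "\<And>s s'. s \<le> N \<or> s' \<le> N ==> a s s' = 0" unfolding laurent_ser_def by blast
  show ?thesis unfolding abs_conv_at_0_def
  proof (rule exI[of _ "- N"], intro conjI allI impI, goal_cases)
    case (1 s s')
    with N[of s s'] show ?case by fastforce
  next
    case (2 s s')
    with N[of s s'] show ?case by fastforce
  next
    case 3
    have "(\<lambda>x. norm (case x of (s, s') \<Rightarrow> a s s' * cpow2 z s s')) summable_on UNIV"
      using s summable_on_iff_abs_summable_on_complex by blast
    then have "(\<lambda>x. norm (case x of (s, s') \<Rightarrow> a s s' * cpow2 z s s') * norm z powr (- 2 * N)) summable_on UNIV"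
      by (rule summable_on_cmult_left)
    also have "(\<lambda>x. norm (case x of (s, s') \<Rightarrow> a s s' * cpow2 z s s') * norm z powr (- 2 * N)) =
        (\<lambda>(s, s'). norm (a s s') * norm z powr (s + - N + (s' + - N)))"
    proof (rule ext, clarify)
      fix s s'
      show "norm (a s s' * cpow2 z s s') * norm z powr (- 2 * N) = norm (a s s') * norm z powr (s + - N + (s' + - N))"
        using laurent_ser_int[OF a, of s s'] z
        by (cases "a s s' = 0") (simp_all add: norm_mult norm_cpow2 flip: powr_add)
    qed
    finally show ?case using z by (intro exI[of _ "norm z"]) simp
  qed
qed

section \<open>The action of power series\<close>

text \<open>The part of the Laurent condition that makes products with power series finite in each
  coefficient.\<close>

definition lower_bounded :: "'w::zero ser \<Rightarrow> bool" where
  "lower_bounded a \<longleftrightarrow> (\<exists>N. \<forall>s s'. s \<le> N \<or> s' \<le> N --> a s s' = 0)"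

lemma laurent_ser_lower_bounded: "laurent_ser a ==> lower_bounded a"
  by (simp add: laurent_ser_def lower_bounded_def)

definition conv2 :: "complex fps \<Rightarrow> complex fps \<Rightarrow> (nat \<Rightarrow> nat \<Rightarrow> complex) \<Rightarrow> complex" where
  "conv2 P Q g = Sum_any (\<lambda>(i, k). fps_nth P i * fps_nth Q k * g i k)"

text \<open>Multiplication of a series by $P(z)\,Q(\bar z)$.\<close>

definition act :: "complex fps \<Rightarrow> complex fps \<Rightarrow> complex ser \<Rightarrow> complex ser" where
  "act P Q a = (\<lambda>s s'. conv2 P Q (\<lambda>i k. a (s - real i) (s' - real k)))"

definition shift_ser :: "real \<Rightarrow> real \<Rightarrow> complex ser \<Rightarrow> complex ser" where
  "shift_ser e e' a = (\<lambda>s s'. a (s - e) (s' - e'))"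

lemma conv2_eq_sum:
  assumes "\<And>i k. i \<ge> n \<or> k \<ge> n ==> g i k = 0"
  shows "conv2 P Q g = (\<Sum>i<n. \<Sum>k<n. fps_nth P i * fps_nth Q k * g i k)"
proof -
  have "{x. (case x of (i, k) \<Rightarrow> fps_nth P i * fps_nth Q k * g i k) \<noteq> 0} \<subseteq> {..<n} \<times> {..<n}"
    using assms by (force simp: not_le[symmetric])
  then have "conv2 P Q g = sum (\<lambda>(i, k). fps_nth P i * fps_nth Q k * g i k) ({..<n} \<times> {..<n})"
    unfolding conv2_def by (intro Sum_any.expand_superset) auto
  then show ?thesis by (simp add: sum.cartesian_product)
qed

lemma fps_conv_sum:
  fixes P P' :: "complex fps"
  assumes "\<And>m. m \<ge> n ==> h m = 0"
  shows "(\<Sum>i<n. \<Sum>j<n. fps_nth P i * fps_nth P' j * h (i + j)) = (\<Sum>m<n. fps_nth (P * P') m * h m)"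
proof -
  let ?g = "\<lambda>i j. fps_nth P i * fps_nth P' j * h (i + j)"
  have "?g i j = 0" if "\<not> i + j < n" for i j using assms[of "i + j"] that by simp
  then have "(\<Sum>i<n. \<Sum>j<n. ?g i j) = (\<Sum>(i, j)\<in>{(i, j). i + j < n}. ?g i j)"
    unfolding sum.cartesian_product by (intro sum.mono_neutral_right) fastforce+
  also have "\<dots> = (\<Sum>k<n. \<Sum>i\<le>k. ?g i (k - i))" by (rule sum.triangle_reindex)
  also have "\<dots> = (\<Sum>m<n. fps_nth (P * P') m * h m)"
    by (intro sum.cong refl) (simp add: fps_mult_nth atLeast0AtMost sum_distrib_right)
  finally show ?thesis .
qed

lemma conv2_conv2:
  assumes g: "\<And>i k. i \<ge> n \<or> k \<ge> n ==> g i k = 0"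
  shows "conv2 P Q (\<lambda>i k. conv2 P' Q' (\<lambda>j l. g (i + j) (k + l))) = conv2 (P * P') (Q * Q') g"
proof -
  let ?P = "fps_nth P" and ?Q = "fps_nth Q" and ?P' = "fps_nth P'" and ?Q' = "fps_nth Q'"
  have 1: "conv2 P' Q' (\<lambda>j l. g (i + j) (k + l)) = (\<Sum>j<n. \<Sum>l<n. ?P' j * ?Q' l * g (i + j) (k + l))" for i k
    by (rule conv2_eq_sum) (use g in auto)
  have "conv2 P Q (\<lambda>i k. conv2 P' Q' (\<lambda>j l. g (i + j) (k + l))) =
     (\<Sum>i<n. \<Sum>k<n. ?P i * ?Q k * (\<Sum>j<n. \<Sum>l<n. ?P' j * ?Q' l * g (i + j) (k + l)))"
    unfolding 1 by (rule conv2_eq_sum) (use g in \<open>auto intro!: sum.neutral\<close>)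
  also have "\<dots> = (\<Sum>i<n. \<Sum>j<n. ?P i * ?P' j * (\<Sum>k<n. \<Sum>l<n. ?Q k * ?Q' l * g (i + j) (k + l)))"
    unfolding sum_distrib_left
  proof (rule sum.cong[OF refl])
    fix i
    show "(\<Sum>k<n. \<Sum>j<n. \<Sum>l<n. ?P i * ?Q k * (?P' j * ?Q' l * g (i + j) (k + l))) =
      (\<Sum>j<n. \<Sum>k<n. \<Sum>l<n. ?P i * ?P' j * (?Q k * ?Q' l * g (i + j) (k + l)))"
      by (subst sum.swap) (simp add: mult_ac)
  qed
  also have "\<dots> = (\<Sum>i<n. \<Sum>j<n. ?P i * ?P' j * (\<Sum>k<n. fps_nth (Q * Q') k * g (i + j) k))"
    by (intro sum.cong refl arg_cong2[where f = "(*)"] fps_conv_sum) (use g in auto)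
  also have "\<dots> = (\<Sum>m<n. fps_nth (P * P') m * (\<Sum>k<n. fps_nth (Q * Q') k * g m k))"
    by (rule fps_conv_sum) (use g in auto)
  also have "\<dots> = conv2 (P * P') (Q * Q') g"
    by (subst conv2_eq_sum[OF g]) (simp_all add: sum_distrib_left mult_ac)
  finally show ?thesis .
qed

lemma lower_bounded_offsets:
  assumes "lower_bounded a"
  shows "\<exists>n. \<forall>i k. i \<ge> n \<or> k \<ge> n --> a (s - real i) (s' - real k) = 0"
proof -
  from assms obtain N where N: "\<And>s s'. s \<le> N \<or> s' \<le> N ==> a s s' = 0" unfolding lower_bounded_def by blast
  show ?thesis
  proof (intro exI[of _ "nat \<lceil>max (s - N) (s' - N)\<rceil>"] allI impI N)
    fix i k assume "i \<ge> nat \<lceil>max (s - N) (s' - N)\<rceil> \<or> k \<ge> nat \<lceil>max (s - N) (s' - N)\<rceil>"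
    then have "max (s - N) (s' - N) \<le> real i \<or> max (s - N) (s' - N) \<le> real k"
      by (metis of_nat_ceiling of_nat_mono order_trans)
    then show "s - real i \<le> N \<or> s' - real k \<le> N" by auto
  qed
qed

lemma act_act:
  assumes "lower_bounded a"
  shows "act P Q (act P' Q' a) = act (P * P') (Q * Q') a"
proof (intro ext)
  fix s s'
  obtain n where n: "\<And>i k. i \<ge> n \<or> k \<ge> n ==> a (s - real i) (s' - real k) = 0"
    using lower_bounded_offsets[OF assms] by metis
  have *: "s - real i - real j = s - real (i + j)" for s i j by simp
  show "act P Q (act P' Q' a) s s' = act (P * P') (Q * Q') a s s'"
    unfolding act_def * using n by (rule conv2_conv2)
qed

lemma conv2_nonzero:
  assumes "conv2 P Q g \<noteq> 0" shows "\<exists>i k. g i k \<noteq> 0"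
proof (rule ccontr)
  assume "\<not> ?thesis"
  then have "conv2 P Q g = 0" unfolding conv2_def by (simp add: case_prod_unfold)
  with assms show False by simp
qed

lemma lower_bounded_act:
  assumes "lower_bounded a" shows "lower_bounded (act P Q a)"
proof -
  from assms obtain N where N: "\<And>s s'. s \<le> N \<or> s' \<le> N ==> a s s' = 0" unfolding lower_bounded_def by blast
  have "act P Q a s s' = 0" if "s \<le> N \<or> s' \<le> N" for s s'
  proof (rule ccontr)
    assume "act P Q a s s' \<noteq> 0"
    then obtain i k where "a (s - real i) (s' - real k) \<noteq> 0" unfolding act_def using conv2_nonzero by blast
    with N[of "s - real i" "s' - real k"] that show False by auto
  qed
  then show ?thesis unfolding lower_bounded_def by blast
qed

lemma act_one: "act 1 1 a = a"
proof (intro ext)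
  fix s s'
  have "(\<lambda>(i, k). fps_nth 1 i * fps_nth 1 k * a (s - real i) (s' - real k)) = 
     (\<lambda>x. if x = (0, 0) then (case x of (i, k) \<Rightarrow> a (s - real i) (s' - real k)) else (0::complex))"
    by (auto simp: fun_eq_iff)
  then show "act 1 1 a s s' = a s s'" by (simp only: act_def conv2_def Sum_any.delta) simp
qed

lemma act_shift_ser: "act P Q (shift_ser e e' a) = shift_ser e e' (act P Q a)"
  by (simp add: act_def shift_ser_def algebra_simps)

lemma lower_bounded_shift_ser: 
  assumes "lower_bounded a" shows "lower_bounded (shift_ser e e' a)"
proof -
  from assms obtain N where N: "\<And>s s'. s \<le> N \<or> s' \<le> N ==> a s s' = 0" unfolding lower_bounded_def by blast
  show ?thesis unfolding lower_bounded_def shift_ser_def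
    by (rule exI[of _ "N + min e e'"]) (auto intro!: N)
qed

lemma conv2_add:
  assumes "\<And>i k. i \<ge> n \<or> k \<ge> n ==> g i k = 0" "\<And>i k. i \<ge> n' \<or> k \<ge> n' ==> g' i k = 0"
  shows "conv2 P Q (\<lambda>i k. g i k + g' i k) = conv2 P Q g + conv2 P Q g'"
proof -
  have "conv2 P Q g = (\<Sum>i<max n n'. \<Sum>k<max n n'. fps_nth P i * fps_nth Q k * g i k)"
    "conv2 P Q g' = (\<Sum>i<max n n'. \<Sum>k<max n n'. fps_nth P i * fps_nth Q k * g' i k)"
    "conv2 P Q (\<lambda>i k. g i k + g' i k) = (\<Sum>i<max n n'. \<Sum>k<max n n'. fps_nth P i * fps_nth Q k * (g i k + g' i k))"
    by (rule conv2_eq_sum; use assms in auto)+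
  then show ?thesis by (simp add: distrib_left sum.distrib)
qed

lemma conv2_scale:
  assumes "\<And>i k. i \<ge> n \<or> k \<ge> n ==> g i k = 0"
  shows "conv2 P Q (\<lambda>i k. c * g i k) = c * conv2 P Q g"
proof -
  have "conv2 P Q g = (\<Sum>i<n. \<Sum>k<n. fps_nth P i * fps_nth Q k * g i k)"
    "conv2 P Q (\<lambda>i k. c * g i k) = (\<Sum>i<n. \<Sum>k<n. fps_nth P i * fps_nth Q k * (c * g i k))"
    by (rule conv2_eq_sum; use assms in auto)+
  then show ?thesis by (simp add: sum_distrib_left mult_ac)
qed

lemma act_add:
  assumes "lower_bounded a" "lower_bounded b"
  shows "act P Q (\<lambda>s s'. a s s' + b s s') s s' = act P Q a s s' + act P Q b s s'"
proof -
  obtain n n' where "\<And>i k. i \<ge> n \<or> k \<ge> n ==> a (s - real i) (s' - real k) = 0"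
    "\<And>i k. i \<ge> n' \<or> k \<ge> n' ==> b (s - real i) (s' - real k) = 0"
    using lower_bounded_offsets[OF assms(1)] lower_bounded_offsets[OF assms(2)] by metis
  then show ?thesis unfolding act_def by (rule conv2_add)
qed

lemma act_scale:
  assumes "lower_bounded a"
  shows "act P Q (\<lambda>s s'. c * a s s') s s' = c * act P Q a s s'"
proof -
  obtain n where "\<And>i k. i \<ge> n \<or> k \<ge> n ==> a (s - real i) (s' - real k) = 0"
    using lower_bounded_offsets[OF assms(1)] by metis
  then show ?thesis unfolding act_def by (rule conv2_scale)
qed

text \<open>The binomial series $(1+x)^c$ and $(1-x)^c$.\<close>

definition bin_pos :: "real \<Rightarrow> complex fps" where
  "bin_pos c = fps_binomial (of_real c)"

definition bin_neg :: "real \<Rightarrow> complex fps" where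
  "bin_neg c = Abs_fps (\<lambda>i. (-1) ^ i * (of_real c gchoose i))"

lemma gbinomial_of_real: "(of_real c gchoose k) = (of_real (c gchoose k) :: complex)"
  by (simp add: gbinomial_prod_rev)

lemma bin_pos_nth: "fps_nth (bin_pos c) i = of_real (c gchoose i)"
  by (simp add: bin_pos_def gbinomial_of_real)

lemma bin_neg_nth: "fps_nth (bin_neg c) i = (-1) ^ i * of_real (c gchoose i)"
  by (simp add: bin_neg_def gbinomial_of_real)

lemma bin_pos_mult: "bin_pos c * bin_pos d = bin_pos (c + d)"
  by (simp add: bin_pos_def fps_binomial_add_mult)

lemma bin_neg_mult: "bin_neg c * bin_neg d = bin_neg (c + d)"
proof (rule fps_ext)
  fix n
  have "fps_nth (bin_neg c * bin_neg d) n = (\<Sum>i=0..n. (-1) ^ n * (fps_nth (bin_pos c) i * fps_nth (bin_pos d) (n - i)))"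
    unfolding fps_mult_nth
  proof (rule sum.cong[OF refl])
    fix i assume "i \<in> {0..n}"
    then have "(-1 :: complex) ^ n = (-1) ^ i * (-1) ^ (n - i)" by (simp flip: power_add)
    then show "fps_nth (bin_neg c) i * fps_nth (bin_neg d) (n - i) = (-1) ^ n * (fps_nth (bin_pos c) i * fps_nth (bin_pos d) (n - i))"
      by (simp add: bin_neg_nth bin_pos_nth)
  qed
  also have "\<dots> = (-1) ^ n * fps_nth (bin_pos c * bin_pos d) n" by (simp add: fps_mult_nth sum_distrib_left)
  also have "\<dots> = fps_nth (bin_neg (c + d)) n" by (simp add: bin_pos_mult bin_pos_nth bin_neg_nth)
  finally show "fps_nth (bin_neg c * bin_neg d) n = fps_nth (bin_neg (c + d)) n" .
qed

section \<open>Chart expansions\<close>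

lemma infsum_eq_Sum_any:
  fixes f :: "'a \<Rightarrow> complex"
  assumes "finite {x. f x \<noteq> 0}"
  shows "infsum f UNIV = Sum_any f"
proof -
  have "infsum f UNIV = infsum f {x. f x \<noteq> 0}" by (rule infsum_cong_neutral) auto
  also have "\<dots> = Sum_any f" using assms by (simp add: Sum_any.expand_set)
  finally show ?thesis .
qed

lemma chart_expansion_unique:
  assumes "chart_expansion f U \<phi> a" "chart_expansion f U \<phi> b"
  shows "a = b"
proof -
  from assms(1) obtain r where r: "r > 0" and a: "\<And>z. 0 < norm z ==> norm z < r ==> 
      ((\<lambda>(s, s'). a s s' * cpow2 z s s') has_sum f (the_inv_into U \<phi> z)) UNIV"
    unfolding chart_expansion_def by blast
  from assms(2) obtain r' where r': "r' > 0" and b: "\<And>z. 0 < norm z ==> norm z < r' ==> 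
      ((\<lambda>(s, s'). b s s' * cpow2 z s s') has_sum f (the_inv_into U \<phi> z)) UNIV"
    unfolding chart_expansion_def by blast
  show ?thesis
    by (rule laurent_series_unique[where r = "min r r'" and F = "\<lambda>z. f (the_inv_into U \<phi> z)"])
      (use assms r r' a b in \<open>auto simp: chart_expansion_def\<close>)
qed

lemma laurent_ser_shift:
  fixes a :: "complex ser"
  assumes a: "laurent_ser a" and ee: "e - e' \<in> \<int>"
  shows "laurent_ser (shift_ser e e' a)"
  unfolding laurent_ser_def shift_ser_def
proof (intro conjI allI impI)
  fix s s' :: real assume s: "s - s' \<notin> \<int>"
  show "a (s - e) (s' - e') = 0"
  proof (rule ccontr)
    assume "a (s - e) (s' - e') \<noteq> 0"
    from Ints_add[OF laurent_ser_int[OF a this] ee] s show False by simp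
  qed
next
  from a obtain N where N: "\<And>s s'. s \<le> N \<or> s' \<le> N ==> a s s' = 0" unfolding laurent_ser_def by blast
  show "\<exists>N. \<forall>s s'. s \<le> N \<or> s' \<le> N --> a (s - e) (s' - e') = 0"
    by (rule exI[of _ "N + min e e'"]) (auto intro!: N)
  fix R
  have "finite ((\<lambda>(p, p'). (p + e, p' + e')) ` {(p, p'). a p p' \<noteq> 0 \<and> p + p' \<le> R - e - e'})"
    using a unfolding laurent_ser_def by blast
  then show "finite {(s, s'). a (s - e) (s' - e') \<noteq> 0 \<and> s + s' \<le> R}"
  proof (rule rev_finite_subset, clarify)
    fix s s' assume "a (s - e) (s' - e') \<noteq> 0" "s + s' \<le> R"
    then show "(s, s') \<in> (\<lambda>(p, p'). (p + e, p' + e')) ` {(p, p'). a p p' \<noteq> 0 \<and> p + p' \<le> R - e - e'}"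
      by (intro image_eqI[of _ _ "(s - e, s' - e')"]) auto
  qed
qed

text \<open>The Cauchy product of the expansion of \<open>f\<close> with the Taylor series of the factors of \<open>M\<close>, collected by
  total exponents.\<close>

lemma chart_expansion_mult:
  assumes f: "chart_expansion f U \<phi> a"
    and r0: "r0 > 0"
    and K: "\<And>z. norm z < r0 ==> ((\<lambda>n. fps_nth k n * z ^ n) has_sum K z) UNIV"
    and K2: "\<And>z. norm z < r0 ==> ((\<lambda>n. fps_nth k2 n * z ^ n) has_sum K2 z) UNIV"
    and ee: "e - e' \<in> \<int>"
    and M: "\<And>z. 0 < norm z ==> norm z < r0 ==>
      M (the_inv_into U \<phi> z) = cpow2 z e e' * (K z * cnj (K2 z))"
  shows "chart_expansion (\<lambda>w. f w * M w) U \<phi> (act k (Abs_fps (\<lambda>n. cnj (fps_nth k2 n))) (shift_ser e e' a))"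
proof -
  let ?k' = "Abs_fps (\<lambda>n. cnj (fps_nth k2 n))"
  let ?b = "act k ?k' (shift_ser e e' a)"
  from f obtain r where r: "r > 0" and phi: "\<And>z. 0 < norm z ==> norm z < r ==> z \<in> \<phi> ` U"
    and a: "\<And>z. 0 < norm z ==> norm z < r ==> 
      ((\<lambda>(s, s'). a s s' * cpow2 z s s') has_sum f (the_inv_into U \<phi> z)) UNIV"
    unfolding chart_expansion_def by blast
  have la: "laurent_ser a" using f unfolding chart_expansion_def by blast
  have lb: "laurent_ser ?b"
  proof (rule laurent_ser_mono[OF laurent_ser_shift[OF la ee], where e = 0])
    fix s s' assume "?b s s' \<noteq> 0"
    then obtain i j where "shift_ser e e' a (s - real i) (s' - real j) \<noteq> 0"
      unfolding act_def using conv2_nonzero by blast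
    then show "\<exists>i j. shift_ser e e' a (s - 0 - real i) (s' - 0 - real j) \<noteq> 0"
      by (intro exI[of _ i] exI[of _ j]) simp
  qed
  have sum: "((\<lambda>(s, s'). ?b s s' * cpow2 z s s') has_sum f (the_inv_into U \<phi> z) * M (the_inv_into U \<phi> z)) UNIV"
    if z: "0 < norm z" "norm z < min r r0" for z
  proof -
    have z0: "z \<noteq> 0" using z by auto
    have k1: "((\<lambda>n. fps_nth k n * z ^ n) has_sum K z) UNIV" using K z by simp
    have "((\<lambda>n. fps_nth k2 n * z ^ n) has_sum K2 z) UNIV" using K2 z by simp
    then have "((\<lambda>n. cnj (fps_nth k2 n * z ^ n)) has_sum cnj (K2 z)) UNIV" by (subst has_sum_cnj_iff)
    then have k2: "((\<lambda>n. fps_nth ?k' n * cnj z ^ n) has_sum cnj (K2 z)) UNIV" by simp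
    define F where "F = (\<lambda>(x, y). (case x of (s, s') \<Rightarrow> a s s' * cpow2 z s s') *
       (cpow2 z e e' * (case y of (m, n) \<Rightarrow> (fps_nth k m * z ^ m) * (fps_nth ?k' n * cnj z ^ n))))"
    define \<kappa> where "\<kappa> = (\<lambda>(x, y). case x of (s, s') \<Rightarrow> case y of (m, n) \<Rightarrow> (s + e + real m, s' + e' + real n))"
    have "(F has_sum f (the_inv_into U \<phi> z) * (cpow2 z e e' * (K z * cnj (K2 z)))) (UNIV \<times> UNIV)"
      unfolding F_def
      by (intro has_sum_times has_sum_cmult_right a) (use z has_sum_times[OF k1 k2] in auto)
    from has_sum_fibres[OF this, of \<kappa>]
    have "((\<lambda>k. infsum F {a \<in> UNIV \<times> UNIV. \<kappa> a = k}) has_sum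
        f (the_inv_into U \<phi> z) * (cpow2 z e e' * (K z * cnj (K2 z)))) UNIV" .
    moreover have "infsum F {a \<in> UNIV \<times> UNIV. \<kappa> a = x} = (case x of (s, s') \<Rightarrow> ?b s s' * cpow2 z s s')" for x
    proof -
      obtain s s' where x: "x = (s, s')" by (cases x)
      define h where "h = (\<lambda>y. case y of (m, n) \<Rightarrow> ((s - e - real m, s' - e' - real n), (m, n)))"
      have "bij_betw h UNIV {a \<in> UNIV \<times> UNIV. \<kappa> a = x}"
        by (rule bij_betwI[where g = snd]) (auto simp: h_def \<kappa>_def x)
      from infsum_reindex_bij_betw[OF this, of F]
      have "infsum F {a \<in> UNIV \<times> UNIV. \<kappa> a = x} = infsum (\<lambda>y. F (h y)) UNIV" by simp
      also have "\<dots> = infsum (\<lambda>y. (case y of (m, n) \<Rightarrow> fps_nth k m * fps_nth ?k' n * a (s - e - real m) (s' - e' - real n)) * cpow2 z s s') UNIV"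
      proof (rule infsum_cong, clarify)
        fix m n
        show "F (h (m, n)) = fps_nth k m * fps_nth ?k' n * a (s - e - real m) (s' - e' - real n) * cpow2 z s s'"
        proof (cases "a (s - e - real m) (s' - e' - real n) = 0")
          case False
          have i: "(s - e - real m) - (s' - e' - real n) \<in> \<int>" by (rule laurent_ser_int[OF la False])
          have "cpow2 z (s - e - real m) (s' - e' - real n) * cpow2 z (real m) (real n) * cpow2 z e e' = cpow2 z s s'"
            using cpow2_add[OF i _ z0, of "real m" "real n"] 
              cpow2_add[OF _ _ z0, of "(s - e - real m) + real m" "(s' - e' - real n) + real n" e e']
              Ints_add[OF i, of "real m - real n"] ee by (simp add: algebra_simps)
          then show ?thesis using z0 by (simp add: F_def h_def cpow2_nat algebra_simps)
        qed (simp add: F_def h_def)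
      qed
      also have "\<dots> = infsum (\<lambda>y. (case y of (m, n) \<Rightarrow> fps_nth k m * fps_nth ?k' n * a (s - e - real m) (s' - e' - real n))) UNIV * cpow2 z s s'"
        by (rule infsum_cmult_left')
      also have "infsum (\<lambda>y. (case y of (m, n) \<Rightarrow> fps_nth k m * fps_nth ?k' n * a (s - e - real m) (s' - e' - real n))) UNIV = ?b s s'"
      proof (subst infsum_eq_Sum_any)
        obtain n where n: "\<And>i k. i \<ge> n \<or> k \<ge> n ==> a ((s - e) - real i) ((s' - e') - real k) = 0"
          using lower_bounded_offsets[OF laurent_ser_lower_bounded[OF la]] by metis
        have "{x. (case x of (m, n) \<Rightarrow> fps_nth k m * fps_nth ?k' n * a (s - e - real m) (s' - e' - real n)) \<noteq> 0} \<subseteq> {..<n} \<times> {..<n}"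
          using n by (force simp: not_le[symmetric])
        then show "finite {x. (case x of (m, n) \<Rightarrow> fps_nth k m * fps_nth ?k' n * a (s - e - real m) (s' - e' - real n)) \<noteq> 0}"
          by (rule finite_subset) auto
        show "Sum_any (\<lambda>y. case y of (m, n) \<Rightarrow> fps_nth k m * fps_nth ?k' n * a (s - e - real m) (s' - e' - real n)) = ?b s s'"
          unfolding act_def conv2_def shift_ser_def by (simp add: algebra_simps)
      qed
      finally show ?thesis by (simp add: x)
    qed
    moreover have "cpow2 z e e' * (K z * cnj (K2 z)) = M (the_inv_into U \<phi> z)"
      using M z by simp
    ultimately show ?thesis by (simp only:)
  qed
  define z1 where "z1 = complex_of_real (min r r0 / 2)"
  have z1: "0 < norm z1" "norm z1 < min r r0" using r r0 by (auto simp: z1_def)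
  have "abs_conv_at_0 ?b"
    by (rule abs_conv_at_0_if_summable[OF lb _ has_sum_imp_summable[OF sum[OF z1]]]) (use z1 in auto)
  then show ?thesis unfolding chart_expansion_def using lb r r0 phi sum
    by (intro conjI exI[of _ "min r r0"]) auto
qed

lemma chart_expansion_cong:
  assumes "chart_expansion f U \<phi> a" "inj_on \<phi> U" "\<phi> p = 0"
    and "\<And>w. w \<in> U ==> w \<noteq> p ==> f w = g w"
  shows "chart_expansion g U \<phi> a"
proof -
  from assms(1) obtain r where r: "r > 0" and phi: "\<And>z. 0 < norm z ==> norm z < r ==> z \<in> \<phi> ` U"
    and a: "\<And>z. 0 < norm z ==> norm z < r ==> 
      ((\<lambda>(s, s'). a s s' * cpow2 z s s') has_sum f (the_inv_into U \<phi> z)) UNIV"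
    unfolding chart_expansion_def by blast
  have "f (the_inv_into U \<phi> z) = g (the_inv_into U \<phi> z)" if "0 < norm z" "norm z < r" for z
  proof (rule assms(4))
    show "the_inv_into U \<phi> z \<in> U" using the_inv_into_into[OF assms(2) phi[OF that]] by blast
    show "the_inv_into U \<phi> z \<noteq> p" using f_the_inv_into_f[OF assms(2) phi[OF that]] assms(3) that by auto
  qed
  with assms(1) r phi a show ?thesis unfolding chart_expansion_def by (intro conjI exI[of _ r]) auto
qed

text \<open>Take $k=e^{eg}$ for a holomorphic logarithm \<open>g\<close> of \<open>h\<close>. This splits a real power of $|h|^2$ into a holomorphic
  and an antiholomorphic factor, to which the multiplication of chart expansions applies.\<close>

lemma nonvanishing_norm_powr:
  assumes "h holomorphic_on ball p r" "\<And>z. z \<in> ball p r ==> h z \<noteq> 0" "r > 0"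
  obtains k where "k holomorphic_on ball p r"
    "\<And>z. z \<in> ball p r ==> of_real ((norm (h z))\<^sup>2 powr e) = k z * cnj (k z)"
proof -
  obtain g where g: "g holomorphic_on ball p r" "\<And>z. z \<in> ball p r ==> exp (g z) = h z"
    using holomorphic_logarithm_exists[of "ball p r" h p] assms by auto
  show ?thesis
  proof (rule that[of "\<lambda>z. exp (of_real e * g z)"])
    show "(\<lambda>z. exp (of_real e * g z)) holomorphic_on ball p r" by (intro holomorphic_intros g)
    fix z assume z: "z \<in> ball p r"
    have "(norm (h z))\<^sup>2 powr e = exp (2 * (e * Re (g z)))"
      using g(2)[OF z, symmetric] by (simp add: powr_def ln_realpow)
    also have "\<dots> = (norm (exp (of_real e * g z)))\<^sup>2" by (simp add: exp_double)
    finally show "of_real ((norm (h z))\<^sup>2 powr e) = exp (of_real e * g z) * cnj (exp (of_real e * g z))"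
      by (simp only: complex_norm_square)
  qed
qed

text \<open>The multiplier $|z|^{2b}|1-z|^{2c}$.\<close>

definition absfac :: "real \<Rightarrow> real \<Rightarrow> complex \<Rightarrow> complex" where
  "absfac b c z = of_real ((norm z)\<^sup>2 powr b * (norm (1 - z))\<^sup>2 powr c)"

text \<open>The coordinate change at infinity permutes the three exponents, the one at infinity being $-b-c$.\<close>

lemma absfac_inverse:
  assumes "w \<noteq> 0"
  shows "absfac b c (inverse w) = absfac (- b - c) c w"
proof -
  define x y where "x = norm w" and "y = norm (1 - w)"
  have x: "x > 0" using assms by (simp add: x_def)
  have "1 - inverse w = - (inverse w * (1 - w))" using assms by (simp add: field_simps)
  then have n: "norm (1 - inverse w) = y * inverse x"
    by (simp only: norm_minus_cancel norm_mult norm_inverse x_def y_def mult.commute)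
  have inv: "(inverse x)\<^sup>2 powr d = x\<^sup>2 powr (- d)" for d
    using x by (simp add: inverse_powr powr_minus power_inverse)
  have "(inverse x)\<^sup>2 powr b * (y * inverse x)\<^sup>2 powr c = x\<^sup>2 powr (- b - c) * y\<^sup>2 powr c"
    using x by (simp only: power_mult_distrib powr_mult zero_le_power2 inv diff_conv_add_uminus powr_add mult_ac)
  then show ?thesis unfolding absfac_def norm_inverse n by (simp add: x_def y_def)
qed

lemma real_analytic_at_norm_powr:
  assumes "w \<noteq> q"
  shows "real_analytic_at (\<lambda>z. of_real ((norm (z - q))\<^sup>2 powr e)) w"
proof -
  define r where "r = dist w q"
  have r: "r > 0" using assms by (simp add: r_def)
  have "z - q \<noteq> 0" if "z \<in> ball w r" for z using that by (auto simp: r_def)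
  moreover have "(\<lambda>z. z - q) holomorphic_on ball w r" by (intro holomorphic_intros)
  ultimately obtain k where k: "k holomorphic_on ball w r" "\<And>z. z \<in> ball w r ==> of_real ((norm (z - q))\<^sup>2 powr e) = k z * cnj (k z)"
    using nonvanishing_norm_powr[of "\<lambda>z. z - q" w r e] r by blast
  have "real_analytic_at k w" using holomorphic_imp_real_analytic_at[OF k(1) r] .
  then have "real_analytic_at (\<lambda>z. k z * cnj (k z)) w" by (intro real_analytic_at_mult real_analytic_at_cnj)
  then show ?thesis by (rule real_analytic_at_cong[OF _ r]) (use k(2) in auto)
qed

lemma real_analytic_on_mult_absfac:
  assumes "real_analytic_on f (- {0, 1})"
  shows "real_analytic_on (\<lambda>z. f z * absfac b c z) (- {0, 1})"
  unfolding real_analytic_on_iff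
proof
  fix w assume w: "w \<in> - {0, 1::complex}"
  have "real_analytic_at (\<lambda>z. f z * (of_real ((norm (z - 0))\<^sup>2 powr b) * of_real ((norm (z - 1))\<^sup>2 powr c))) w"
    by (intro real_analytic_at_mult real_analytic_at_norm_powr) (use w assms in \<open>auto simp: real_analytic_on_iff\<close>)
  then show "real_analytic_at (\<lambda>z. f z * absfac b c z) w"
    by (simp add: absfac_def norm_minus_commute)
qed

text \<open>Division of $\psi(z)-p$ by $z$ leaves a holomorphic function, nonzero at 0 because a chart has nonzero
  derivative.\<close>

lemma chart_inverse:
  assumes "chart_at p U \<phi>"
  obtains r \<kappa> where "r > 0" "\<kappa> holomorphic_on ball 0 r" "the_inv_into U \<phi> holomorphic_on ball 0 r"
    "\<And>z. z \<in> ball 0 r ==> z \<in> \<phi> ` U"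
    "\<And>z. z \<in> ball 0 r ==> \<kappa> z \<noteq> 0"
    "\<And>z. z \<in> ball 0 r ==> the_inv_into U \<phi> z = p + z * \<kappa> z"
proof -
  let ?\<psi> = "the_inv_into U \<phi>"
  have *: "open U" "p \<in> U" "\<phi> holomorphic_on U" "inj_on \<phi> U" "\<phi> p = 0" using assms by (auto simp: chart_at_def)
  obtain g where g: "g holomorphic_on (\<phi> ` U)" "\<And>z. z \<in> U ==> deriv \<phi> z * deriv g (\<phi> z) = 1"
    "\<And>z. z \<in> U ==> g (\<phi> z) = z"
    using holomorphic_has_inverse[OF *(3,1,4)] by blast
  have op: "open (\<phi> ` U)" by (rule open_mapping_thm3[OF *(3,1,4)])
  have gpsi: "g z = ?\<psi> z" if "z \<in> \<phi> ` U" for z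
    using that g(3) the_inv_into_f_f[OF *(4)] by force
  have z0: "0 \<in> \<phi> ` U" using *(2,5) by force
  have g0: "g 0 = p" using g(3)[OF *(2)] *(5) by simp
  have dg: "deriv g 0 \<noteq> 0" using g(2)[OF *(2)] *(5) by auto
  define \<kappa> where "\<kappa> = (\<lambda>z. if z = 0 then deriv g 0 else (g z - g 0) / (z - 0))"
  have k: "\<kappa> holomorphic_on (\<phi> ` U)" unfolding \<kappa>_def by (rule pole_lemma_open[OF g(1) op])
  have "continuous_on (\<phi> ` U) \<kappa>" using k by (rule holomorphic_on_imp_continuous_on)
  then have "isCont \<kappa> 0" using z0 unfolding continuous_on_eq_continuous_at[OF op] by blast
  moreover have "\<kappa> 0 \<noteq> 0" using dg by (simp add: \<kappa>_def)
  ultimately obtain d where d: "d > 0" "\<And>z. dist z 0 < d ==> \<kappa> z \<noteq> 0"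
    using continuous_at_avoid[of 0 \<kappa> 0] by (metis dist_commute)
  obtain d' where d': "d' > 0" "ball 0 d' \<subseteq> \<phi> ` U" using op z0 open_contains_ball by metis
  show ?thesis
  proof (rule that[of "min d d'" \<kappa>])
    have sub: "ball 0 (min d d') \<subseteq> \<phi> ` U" using d' by auto
    show "\<kappa> holomorphic_on ball 0 (min d d')" by (rule holomorphic_on_subset[OF k sub])
    have "g holomorphic_on ball 0 (min d d')" by (rule holomorphic_on_subset[OF g(1) sub])
    then show "?\<psi> holomorphic_on ball 0 (min d d')"
      by (rule holomorphic_transform) (use sub gpsi in blast)
    fix z :: complex assume z: "z \<in> ball 0 (min d d')"
    show zU: "z \<in> \<phi> ` U" using sub z by blast
    show "\<kappa> z \<noteq> 0" using d(2) z by (simp add: dist_commute)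
    show "?\<psi> z = p + z * \<kappa> z" using gpsi[OF zU] g0 by (cases "z = 0") (simp_all add: \<kappa>_def)
  qed (use d d' in auto)
qed

text \<open>In the chart, $|w-p|^{2e}$ becomes $|z|^{2e}|\kappa(z)|^{2e}$ with $\kappa$ nonvanishing, and $|w-q|^{2e'}$ is
  nonvanishing near $p$.\<close>

lemma chart_expansion_mult_exists:
  assumes ch: "chart_at p U \<phi>" and f: "chart_expansion f U \<phi> a"
    and M: "M = (\<lambda>w. of_real ((norm (w - p))\<^sup>2 powr e * (norm (w - q))\<^sup>2 powr e'))" and pq: "p \<noteq> q"
  shows "\<exists>b. chart_expansion (\<lambda>w. f w * M w) U \<phi> b"
proof -
  let ?\<psi> = "the_inv_into U \<phi>"
  obtain r \<kappa> where r: "r > 0" and k: "\<kappa> holomorphic_on ball 0 r" "?\<psi> holomorphic_on ball 0 r"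
    "\<And>z. z \<in> ball 0 r ==> z \<in> \<phi> ` U"
    "\<And>z. z \<in> ball 0 r ==> \<kappa> z \<noteq> 0"
    "\<And>z. z \<in> ball 0 r ==> ?\<psi> z = p + z * \<kappa> z"
    by (rule chart_inverse[OF ch]) blast
  have "isCont ?\<psi> 0" using k(2) r by (meson centre_in_ball continuous_on_eq_continuous_at holomorphic_on_imp_continuous_on open_ball)
  moreover have "?\<psi> 0 \<noteq> q" using k(5)[of 0] r pq by simp
  ultimately obtain d where d: "d > 0" "\<And>z. dist z 0 < d ==> ?\<psi> z \<noteq> q"
    using continuous_at_avoid[of 0 ?\<psi> q] by (metis dist_commute)
  define \<rho> where "\<rho> = min r d"
  have \<rho>: "\<rho> > 0" using r d by (simp add: \<rho>_def)
  have sub: "ball 0 \<rho> \<subseteq> ball (0::complex) r" unfolding \<rho>_def by (rule subset_ball) simp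
  obtain k1 where k1: "k1 holomorphic_on ball 0 \<rho>" "\<And>z. z \<in> ball 0 \<rho> ==> of_real ((norm (\<kappa> z))\<^sup>2 powr e) = k1 z * cnj (k1 z)"
    using nonvanishing_norm_powr[of \<kappa> 0 \<rho> e] \<rho> k(4) sub holomorphic_on_subset[OF k(1) sub] by blast
  obtain k2 where k2: "k2 holomorphic_on ball 0 \<rho>" "\<And>z. z \<in> ball 0 \<rho> ==> of_real ((norm (?\<psi> z - q))\<^sup>2 powr e') = k2 z * cnj (k2 z)"
  proof (rule nonvanishing_norm_powr[of "\<lambda>z. ?\<psi> z - q" 0 \<rho> e'])
    show "(\<lambda>z. ?\<psi> z - q) holomorphic_on ball 0 \<rho>" by (intro holomorphic_intros holomorphic_on_subset[OF k(2) sub])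
    show "?\<psi> z - q \<noteq> 0" if "z \<in> ball 0 \<rho>" for z using d(2)[of z] that by (simp add: \<rho>_def dist_commute)
  qed (use \<rho> in auto)
  define K where "K = (\<lambda>z. k1 z * k2 z)"
  have K: "K holomorphic_on ball 0 \<rho>" unfolding K_def by (intro holomorphic_intros k1 k2)
  let ?k = "Abs_fps (\<lambda>n. (deriv ^^ n) K 0 / fact n)"
  have "chart_expansion (\<lambda>w. f w * M w) U \<phi> (act ?k (Abs_fps (\<lambda>n. cnj (fps_nth ?k n))) (shift_ser e e a))"
  proof (rule chart_expansion_mult[OF f \<rho>])
    fix z :: complex assume z: "norm z < \<rho>"
    show "((\<lambda>n. fps_nth ?k n * z ^ n) has_sum K z) UNIV" "((\<lambda>n. fps_nth ?k n * z ^ n) has_sum K z) UNIV"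
      using holomorphic_imp_has_sum_power(1)[OF K z] by simp_all
  next
    fix z :: complex assume z: "0 < norm z" "norm z < \<rho>"
    then have zb: "z \<in> ball 0 \<rho>" by simp
    have "?\<psi> z - p = z * \<kappa> z" using k(5)[of z] zb sub by auto
    then have "M (?\<psi> z) = of_real ((norm z)\<^sup>2 powr e) * (of_real ((norm (\<kappa> z))\<^sup>2 powr e) * of_real ((norm (?\<psi> z - q))\<^sup>2 powr e'))"
      by (simp add: M norm_mult power_mult_distrib powr_mult)
    also have "\<dots> = of_real ((norm z)\<^sup>2 powr e) * (K z * cnj (K z))"
      by (simp only: k1(2)[OF zb] k2(2)[OF zb]) (simp add: K_def)
    finally show "M (?\<psi> z) = cpow2 z e e * (K z * cnj (K z))" by (simp add: cpow2_diag)
  qed simp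
  then show ?thesis by blast
qed

lemma chart_expansion_mult_absfac_0:
  assumes "chart_at 0 U \<phi>" "chart_expansion f U \<phi> a"
  shows "\<exists>b'. chart_expansion (\<lambda>w. f w * absfac b c w) U \<phi> b'"
  by (rule chart_expansion_mult_exists[OF assms, where q = 1 and e = b and e' = c])
    (auto simp: absfac_def fun_eq_iff norm_minus_commute)

text \<open>Real analyticity is preserved away from the zeros of the factor; at a puncture the factor is a power
  of $|z|^2$ times a positive real analytic function of the form $k\bar k$.\<close>

lemma F01inf_mult_absfac:
  assumes "F01inf f"
  shows "F01inf (\<lambda>z. f z * absfac b c z)"
  unfolding F01inf_def
proof (intro conjI allI impI)
  show "real_analytic_on (\<lambda>z. f z * absfac b c z) (- {0, 1})"
    using assms by (intro real_analytic_on_mult_absfac) (auto simp: F01inf_def)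
  fix U \<phi>
  show "\<exists>a. chart_expansion (\<lambda>z. f z * absfac b c z) U \<phi> a" if "chart_at 0 U \<phi>"
    using assms that chart_expansion_mult_absfac_0 unfolding F01inf_def by blast
  show "\<exists>a. chart_expansion (\<lambda>z. f z * absfac b c z) U \<phi> a" if ch: "chart_at 1 U \<phi>"
  proof -
    obtain a where "chart_expansion f U \<phi> a" using assms ch unfolding F01inf_def by blast
    then show ?thesis
      by (rule chart_expansion_mult_exists[OF ch, where q = 0 and e = c and e' = b])
        (auto simp: absfac_def fun_eq_iff norm_minus_commute)
  qed
  show "\<exists>a. chart_expansion (\<lambda>w. f (inverse w) * absfac b c (inverse w)) U \<phi> a" if ch: "chart_at 0 U \<phi>"
  proof -
    obtain a where "chart_expansion (\<lambda>w. f (inverse w)) U \<phi> a" using assms ch unfolding F01inf_def by blast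
    from chart_expansion_mult_absfac_0[OF ch this, of "- b - c" c]
    obtain b' where "chart_expansion (\<lambda>w. f (inverse w) * absfac (- b - c) c w) U \<phi> b'" by blast
    then have "chart_expansion (\<lambda>w. f (inverse w) * absfac b c (inverse w)) U \<phi> b'"
      by (rule chart_expansion_cong[where p = 0]) (use ch in \<open>auto simp: chart_at_def absfac_inverse\<close>)
    then show ?thesis by blast
  qed
qed

lemma bin_neg_cnj: "Abs_fps (\<lambda>n. cnj (fps_nth (bin_neg c) n)) = bin_neg c"
  by (rule fps_ext) (simp add: bin_neg_nth)

lemma bin_neg_has_sum:
  assumes "norm z < 1"
  shows "((\<lambda>n. fps_nth (bin_neg c) n * z ^ n) has_sum (1 - z) powr of_real c) UNIV"
proof -
  have *: "(\<lambda>n. fps_nth (bin_neg c) n * u ^ n) sums (1 - u) powr of_real c" if "norm u < 1" for u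
  proof -
    have "fps_nth (bin_neg c) n * u ^ n = (of_real c gchoose n) * (- u) ^ n" for n
      by (simp add: bin_neg_def power_minus[of u n])
    then show ?thesis using gen_binomial_complex[of "- u" "of_real c"] that by simp
  qed
  obtain t where t: "norm z < t" "t < 1" using assms dense by blast
  have "norm (of_real t :: complex) < 1" using t norm_ge_zero[of z] by (simp del: norm_ge_zero)
  from sums_summable[OF *[OF this]] have "summable (\<lambda>n. norm (fps_nth (bin_neg c) n * z ^ n))"
    by (rule powser_insidea) (use t norm_ge_zero[of z] in \<open>simp del: norm_ge_zero\<close>)
  from norm_summable_imp_has_sum[OF this *[OF assms]] show ?thesis .
qed

lemma powr_mult_cnj:
  "(1 - z) powr complex_of_real c * cnj ((1 - z) powr of_real c) = of_real ((norm (1 - z))\<^sup>2 powr c)"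
proof -
  have "(1 - z) powr complex_of_real c * cnj ((1 - z) powr of_real c) = of_real ((norm ((1 - z) powr of_real c))\<^sup>2)"
    by (simp only: complex_norm_square)
  also have "(norm ((1 - z) powr complex_of_real c))\<^sup>2 = (norm (1 - z))\<^sup>2 powr c"
    by (simp add: norm_powr_real_powr' power2_eq_square powr_mult)
  finally show ?thesis .
qed

lemma chart_expansion_mult_bin_neg:
  assumes f: "chart_expansion f U \<phi> a"
    and M: "\<And>z. 0 < norm z ==> norm z < 1 ==>
      M (the_inv_into U \<phi> z) = of_real ((norm z)\<^sup>2 powr e * (norm (1 - z))\<^sup>2 powr c)"
  shows "chart_expansion (\<lambda>w. f w * M w) U \<phi> (act (bin_neg c) (bin_neg c) (shift_ser e e a))"
  using chart_expansion_mult[OF f zero_less_one bin_neg_has_sum bin_neg_has_sum, of e e M c c] M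
  by (simp add: cpow2_diag powr_mult_cnj bin_neg_cnj)

lemma the_inv_into_id: "the_inv_into UNIV (\<lambda>z. z) z = z"
  by (rule the_inv_into_f_eq) auto

lemma inj_on_chart_1: "inj_on (\<lambda>z. 1 - inverse z) (- {0::complex})"
  by (auto simp: inj_on_def)

lemma the_inv_into_chart_1:
  assumes "z \<noteq> 1"
  shows "the_inv_into (- {0}) (\<lambda>z. 1 - inverse z) z = inverse (1 - z :: complex)"
  by (rule the_inv_into_f_eq[OF inj_on_chart_1]) (use assms in auto)

lemma chart_expansion_absfac:
  shows "chart_expansion f UNIV (\<lambda>z. z) a ==>
      chart_expansion (\<lambda>z. f z * absfac b c z) UNIV (\<lambda>z. z) (act (bin_neg c) (bin_neg c) (shift_ser b b a))"
    and "chart_expansion f (- {0}) (\<lambda>z. 1 - inverse z) a ==>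
      chart_expansion (\<lambda>z. f z * absfac b c z) (- {0}) (\<lambda>z. 1 - inverse z)
        (act (bin_neg (- b - c)) (bin_neg (- b - c)) (shift_ser c c a))"
    and "chart_expansion (\<lambda>w. f (inverse w)) UNIV (\<lambda>w. w) a ==>
      chart_expansion (\<lambda>w. f (inverse w) * absfac b c (inverse w)) UNIV (\<lambda>w. w)
        (act (bin_neg c) (bin_neg c) (shift_ser (- b - c) (- b - c) a))"
proof -
  assume "chart_expansion f UNIV (\<lambda>z. z) a"
  then show "chart_expansion (\<lambda>z. f z * absfac b c z) UNIV (\<lambda>z. z) (act (bin_neg c) (bin_neg c) (shift_ser b b a))"
    by (rule chart_expansion_mult_bin_neg) (simp add: the_inv_into_id absfac_def)
next
  assume "chart_expansion f (- {0}) (\<lambda>z. 1 - inverse z) a"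
  then show "chart_expansion (\<lambda>z. f z * absfac b c z) (- {0}) (\<lambda>z. 1 - inverse z)
        (act (bin_neg (- b - c)) (bin_neg (- b - c)) (shift_ser c c a))"
  proof (rule chart_expansion_mult_bin_neg)
    fix z :: complex assume z: "0 < norm z" "norm z < 1"
    then have z1: "z \<noteq> 1" "1 - z \<noteq> 0" by auto
    have "absfac b c (inverse (1 - z)) = absfac (- b - c) c (1 - z)" using z1 by (intro absfac_inverse) auto
    also have "\<dots> = of_real ((norm z)\<^sup>2 powr c * (norm (1 - z))\<^sup>2 powr (- b - c))"
      by (simp add: absfac_def)
    finally show "absfac b c (the_inv_into (- {0}) (\<lambda>z. 1 - inverse z) z) = of_real ((norm z)\<^sup>2 powr c * (norm (1 - z))\<^sup>2 powr (- b - c))"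
      using z1 by (simp add: the_inv_into_chart_1)
  qed
next
  assume "chart_expansion (\<lambda>w. f (inverse w)) UNIV (\<lambda>w. w) a"
  then show "chart_expansion (\<lambda>w. f (inverse w) * absfac b c (inverse w)) UNIV (\<lambda>w. w)
        (act (bin_neg c) (bin_neg c) (shift_ser (- b - c) (- b - c) a))"
  proof (rule chart_expansion_mult_bin_neg)
    fix z :: complex assume "0 < norm z"
    then have "absfac b c (inverse z) = absfac (- b - c) c z" by (intro absfac_inverse) auto
    then show "absfac b c (inverse (the_inv_into UNIV (\<lambda>w. w) z)) = of_real ((norm z)\<^sup>2 powr (- b - c) * (norm (1 - z))\<^sup>2 powr c)"
      by (simp add: the_inv_into_id absfac_def[of "- b - c"])
  qed
qed

section \<open>Expansions of correlation functions on lines\<close>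

text \<open>A series in two pairs of variables is determined by its restrictions to the lines of fixed total exponents
  $(\alpha,\beta)$; on each of them it is a series in $z_2/z_1$ (or $z_1/z_2$, $z_0/z_2$ in the case of
  \<open>line21\<close>).\<close>

definition line12 :: "real \<Rightarrow> real \<Rightarrow> ser2 \<Rightarrow> complex ser" where
  "line12 \<alpha> \<beta> A = (\<lambda>s s'. A (\<alpha> - s) (\<beta> - s') s s')"

definition line21 :: "real \<Rightarrow> real \<Rightarrow> ser2 \<Rightarrow> complex ser" where
  "line21 \<alpha> \<beta> A = (\<lambda>s s'. A s s' (\<alpha> - s) (\<beta> - s'))"

text \<open>The substitution $z\mapsto-z$.\<close>

definition sgn_ser :: "complex ser \<Rightarrow> complex ser" where
  "sgn_ser a = (\<lambda>s s'. (-1) powi \<lfloor>s - s'\<rfloor> * a s s')"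

lemma sgn_ser_lower_bounded: "lower_bounded a ==> lower_bounded (sgn_ser a)"
  unfolding lower_bounded_def sgn_ser_def by fastforce

lemma sgn_ser_shift: "sgn_ser (shift_ser c c a) = shift_ser c c (sgn_ser a)"
  by (simp add: sgn_ser_def shift_ser_def)

text \<open>$(1-z)^c$ becomes $(1+z)^c$ under $z\mapsto-z$.\<close>

lemma sgn_ser_act:
  assumes a: "laurent_ser a"
  shows "sgn_ser (act (bin_neg c) (bin_neg d) a) = act (bin_pos c) (bin_pos d) (sgn_ser a)"
proof (intro ext)
  fix s s'
  obtain n where n: "\<And>i k. i \<ge> n \<or> k \<ge> n ==> a (s - real i) (s' - real k) = 0"
    using lower_bounded_offsets[OF laurent_ser_lower_bounded[OF a]] by metis
  have *: "(-1) powi \<lfloor>s - s'\<rfloor> * (fps_nth (bin_neg c) i * fps_nth (bin_neg d) k * a (s - real i) (s' - real k)) =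
      fps_nth (bin_pos c) i * fps_nth (bin_pos d) k * sgn_ser a (s - real i) (s' - real k)" for i k
  proof (cases "a (s - real i) (s' - real k) = 0")
    case False
    from laurent_ser_int[OF a this] obtain l where l: "(s - real i) - (s' - real k) = of_int l" by (auto elim: Ints_cases)
    then have e: "s - s' = of_int (l + int i - int k)" by simp
    have "(-1 :: complex) powi (l + int i - int k) = (-1) powi l * (-1) ^ i * (-1) ^ k"
      by (simp add: power_int_add power_int_diff minus_one_power_iff)
    then have "(-1 :: complex) powi \<lfloor>s - s'\<rfloor> * ((-1) ^ i * (-1) ^ k) = (-1) powi l"
      unfolding e floor_of_int by (simp add: mult.assoc minus_one_power_iff)
    then show ?thesis by (simp add: bin_neg_nth bin_pos_nth sgn_ser_def l mult_ac)
  qed (simp add: sgn_ser_def)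
  have "act (bin_neg c) (bin_neg d) a s s' = (\<Sum>i<n. \<Sum>k<n. fps_nth (bin_neg c) i * fps_nth (bin_neg d) k * a (s - real i) (s' - real k))"
    unfolding act_def by (rule conv2_eq_sum) (rule n)
  then have "sgn_ser (act (bin_neg c) (bin_neg d) a) s s' =
     (\<Sum>i<n. \<Sum>k<n. (-1) powi \<lfloor>s - s'\<rfloor> * (fps_nth (bin_neg c) i * fps_nth (bin_neg d) k * a (s - real i) (s' - real k)))"
    by (simp only: sgn_ser_def sum_distrib_left)
  also have "\<dots> = (\<Sum>i<n. \<Sum>k<n. fps_nth (bin_pos c) i * fps_nth (bin_pos d) k * sgn_ser a (s - real i) (s' - real k))"
    by (simp only: *)
  also have "\<dots> = act (bin_pos c) (bin_pos d) (sgn_ser a) s s'"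
    unfolding act_def by (rule conv2_eq_sum[symmetric]) (use n in \<open>auto simp: sgn_ser_def\<close>)
  finally show "sgn_ser (act (bin_neg c) (bin_neg d) a) s s' = act (bin_pos c) (bin_pos d) (sgn_ser a) s s'" .
qed

text \<open>Multiplication by $z_1^{e_1}\bar z_1^{e_1'}z_2^{e_2}\bar z_2^{e_2'}P(z_2/z_1)Q(\bar z_2/\bar z_1)$, computed on each
  line. For \<open>mul21\<close> the power series are in the quotient of the first variable by the second, which
  covers both $|z_2|>|z_1|$ and $|z_2|>|z_0|$.\<close>

definition mul12 :: "complex fps \<Rightarrow> complex fps \<Rightarrow> real \<Rightarrow> real \<Rightarrow> real \<Rightarrow> real \<Rightarrow> ser2 \<Rightarrow> ser2" where
  "mul12 P Q e1 e1' e2 e2' A = (\<lambda>s1 s1' s2 s2'.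
     act P Q (line12 (s1 + s2 - e1 - e2) (s1' + s2' - e1' - e2') A) (s2 - e2) (s2' - e2'))"

definition mul21 :: "complex fps \<Rightarrow> complex fps \<Rightarrow> real \<Rightarrow> real \<Rightarrow> real \<Rightarrow> real \<Rightarrow> ser2 \<Rightarrow> ser2" where
  "mul21 P Q e1 e1' e2 e2' A = (\<lambda>s1 s1' s2 s2'.
     act P Q (line21 (s1 + s2 - e1 - e2) (s1' + s2' - e1' - e2') A) (s1 - e1) (s1' - e1'))"

lemma line12_mul12: "line12 \<alpha> \<beta> (mul12 P Q e1 e1' e2 e2' A) =
    shift_ser e2 e2' (act P Q (line12 (\<alpha> - e1 - e2) (\<beta> - e1' - e2') A))"
  by (simp add: line12_def mul12_def shift_ser_def)

lemma line21_mul21: "line21 \<alpha> \<beta> (mul21 P Q e1 e1' e2 e2' A) =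
    shift_ser e1 e1' (act P Q (line21 (\<alpha> - e1 - e2) (\<beta> - e1' - e2') A))"
  by (simp add: line21_def mul21_def shift_ser_def)

lemma mul12_mul12:
  assumes "\<And>\<alpha> \<beta>. lower_bounded (line12 \<alpha> \<beta> A)"
  shows "mul12 P Q e1 e1' e2 e2' (mul12 P' Q' d1 d1' d2 d2' A) =
    mul12 (P * P') (Q * Q') (e1 + d1) (e1' + d1') (e2 + d2) (e2' + d2') A"
  unfolding mul12_def[of P] mul12_def[of "P * P'"] line12_mul12 act_shift_ser act_act[OF assms]
  by (simp add: shift_ser_def algebra_simps)

lemma mul21_mul21:
  assumes "\<And>\<alpha> \<beta>. lower_bounded (line21 \<alpha> \<beta> A)"
  shows "mul21 P Q e1 e1' e2 e2' (mul21 P' Q' d1 d1' d2 d2' A) =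
    mul21 (P * P') (Q * Q') (e1 + d1) (e1' + d1') (e2 + d2) (e2' + d2') A"
  unfolding mul21_def[of P] mul21_def[of "P * P'"] line21_mul21 act_shift_ser act_act[OF assms]
  by (simp add: shift_ser_def algebra_simps)

lemma conv2_one_right:
  assumes "\<And>i k. i \<ge> n \<or> k \<ge> n ==> g i k = 0"
  shows "conv2 P 1 g = Sum_any (\<lambda>i. fps_nth P i * g i 0)"
proof -
  have "Sum_any (\<lambda>i. fps_nth P i * g i 0) = (\<Sum>i<n. fps_nth P i * g i 0)"
    by (intro Sum_any.expand_superset) (use assms in \<open>auto simp: not_le[symmetric]\<close>)
  moreover have "(\<Sum>k<n. fps_nth P i * fps_nth 1 k * g i k) = fps_nth P i * g i 0" for i
  proof (cases n)
    case 0 then show ?thesis using assms[of i 0] by simp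
  next
    case (Suc m) then show ?thesis by (simp add: sum.lessThan_Suc_shift del: sum.lessThan_Suc)
  qed
  moreover have "conv2 P 1 g = (\<Sum>i<n. \<Sum>k<n. fps_nth P i * fps_nth 1 k * g i k)"
    by (rule conv2_eq_sum) (rule assms)
  ultimately show ?thesis by simp
qed

lemma branch_12_mul12:
  assumes "\<And>\<alpha> \<beta>. lower_bounded (line12 \<alpha> \<beta> A)"
  shows "branch_12 a b c A = mul12 (bin_neg c) 1 (a + c) 0 b 0 A"
proof (intro ext)
  fix s1 s1' s2 s2'
  obtain n where n: "\<And>i k. i \<ge> n \<or> k \<ge> n ==>
      line12 (s1 + s2 - (a + c) - b) (s1' + s2' - 0 - 0) A (s2 - b - real i) (s2' - 0 - real k) = 0"
    using lower_bounded_offsets[OF assms] by metis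
  have "mul12 (bin_neg c) 1 (a + c) 0 b 0 A s1 s1' s2 s2' =
     Sum_any (\<lambda>i. fps_nth (bin_neg c) i * line12 (s1 + s2 - (a + c) - b) (s1' + s2' - 0 - 0) A (s2 - b - real i) (s2' - 0 - real 0))"
    unfolding mul12_def act_def by (rule conv2_one_right) (rule n)
  then show "branch_12 a b c A s1 s1' s2 s2' = mul12 (bin_neg c) 1 (a + c) 0 b 0 A s1 s1' s2 s2'"
    by (simp add: branch_12_def line12_def bin_neg_nth algebra_simps)
qed

lemma branch_20_mul21:
  assumes "\<And>\<alpha> \<beta>. lower_bounded (line21 \<alpha> \<beta> A)"
  shows "branch_20 a b c A = mul21 (bin_pos a) 1 c 0 (a + b) 0 A"
proof (intro ext)
  fix s1 s1' s2 s2'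
  obtain n where n: "\<And>i k. i \<ge> n \<or> k \<ge> n ==>
      line21 (s1 + s2 - c - (a + b)) (s1' + s2' - 0 - 0) A (s1 - c - real i) (s1' - 0 - real k) = 0"
    using lower_bounded_offsets[OF assms] by metis
  have "mul21 (bin_pos a) 1 c 0 (a + b) 0 A s1 s1' s2 s2' =
     Sum_any (\<lambda>i. fps_nth (bin_pos a) i * line21 (s1 + s2 - c - (a + b)) (s1' + s2' - 0 - 0) A (s1 - c - real i) (s1' - 0 - real 0))"
    unfolding mul21_def act_def by (rule conv2_one_right) (rule n)
  then show "branch_20 a b c A s1 s1' s2 s2' = mul21 (bin_pos a) 1 c 0 (a + b) 0 A s1 s1' s2 s2'"
    by (simp add: branch_20_def line21_def bin_pos_nth algebra_simps)
qed

lemma branch_21_mul21: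
  assumes "\<And>\<alpha> \<beta>. lower_bounded (line21 \<alpha> \<beta> A)"
  shows "branch_21 a b c A = mul21 (bin_neg c) 1 a 0 (b + c) 0 A"
proof (intro ext)
  fix s1 s1' s2 s2'
  obtain n where n: "\<And>i k. i \<ge> n \<or> k \<ge> n ==>
      line21 (s1 + s2 - a - (b + c)) (s1' + s2' - 0 - 0) A (s1 - a - real i) (s1' - 0 - real k) = 0"
    using lower_bounded_offsets[OF assms] by metis
  have "mul21 (bin_neg c) 1 a 0 (b + c) 0 A s1 s1' s2 s2' =
     Sum_any (\<lambda>i. fps_nth (bin_neg c) i * line21 (s1 + s2 - a - (b + c)) (s1' + s2' - 0 - 0) A (s1 - a - real i) (s1' - 0 - real 0))"
    unfolding mul21_def act_def by (rule conv2_one_right) (rule n)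
  then show "branch_21 a b c A s1 s1' s2 s2' = mul21 (bin_neg c) 1 a 0 (b + c) 0 A s1 s1' s2 s2'"
    by (simp add: branch_21_def line21_def bin_neg_nth algebra_simps)
qed

section \<open>Homogeneous components of correlation functions\<close>

lemma chart_expansion_laurent: "chart_expansion f U \<phi> a ==> laurent_ser a"
  by (simp add: chart_expansion_def)

lemma chart_expansion_lower_bounded: "chart_expansion f U \<phi> a ==> lower_bounded a"
  by (simp add: chart_expansion_laurent laurent_ser_lower_bounded)

text \<open>The sum over $i,k$ in the expansion around $z_1=z_2$ is multiplication by the binomial series of
  $(1+z_0/z_2)^\alpha$ and its conjugate.\<close>

lemma gen_exp_20_act: "gen_exp_20 \<alpha> \<beta> b s0 s0' s2 s2' =
    (if s2 = \<alpha> - s0 \<and> s2' = \<beta> - s0' then act (bin_pos \<alpha>) (bin_pos \<beta>) (sgn_ser b) s0 s0' else 0)"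
  by (simp add: gen_exp_20_def act_def conv2_def sgn_ser_def bin_pos_nth)

lemma line12_gen: "line12 \<alpha>' \<beta>' (gen_exp_12 \<alpha> \<beta> a) = (if \<alpha>' = \<alpha> \<and> \<beta>' = \<beta> then a else (\<lambda>_ _. 0))"
  by (auto simp: line12_def gen_exp_12_def fun_eq_iff)

lemma line20_gen: "line21 \<alpha>' \<beta>' (gen_exp_20 \<alpha> \<beta> b) =
    (if \<alpha>' = \<alpha> \<and> \<beta>' = \<beta> then act (bin_pos \<alpha>) (bin_pos \<beta>) (sgn_ser b) else (\<lambda>_ _. 0))"
  by (auto simp: line21_def gen_exp_20_act fun_eq_iff)

lemma line21_gen: "line21 \<alpha>' \<beta>' (gen_exp_21 \<alpha> \<beta> c) =
    (if \<alpha>' = \<alpha> \<and> \<beta>' = \<beta> then shift_ser \<alpha> \<beta> c else (\<lambda>_ _. 0))"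
  by (auto simp: line21_def gen_exp_21_def shift_ser_def fun_eq_iff)

lemma line12_add: "line12 \<alpha> \<beta> (\<lambda>s s' t t'. A s s' t t' + A' s s' t t') = (\<lambda>s s'. line12 \<alpha> \<beta> A s s' + line12 \<alpha> \<beta> A' s s')"
  and line21_add: "line21 \<alpha> \<beta> (\<lambda>s s' t t'. A s s' t t' + A' s s' t t') = (\<lambda>s s'. line21 \<alpha> \<beta> A s s' + line21 \<alpha> \<beta> A' s s')"
  and line12_scale: "line12 \<alpha> \<beta> (\<lambda>s s' t t'. k * A s s' t t') = (\<lambda>s s'. k * line12 \<alpha> \<beta> A s s')"
  and line21_scale: "line21 \<alpha> \<beta> (\<lambda>s s' t t'. k * A s s' t t') = (\<lambda>s s'. k * line21 \<alpha> \<beta> A s s')"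
  and line12_zero: "line12 \<alpha> \<beta> (\<lambda>_ _ _ _. 0) = (\<lambda>_ _. 0)" and line21_zero: "line21 \<alpha> \<beta> (\<lambda>_ _ _ _. 0) = (\<lambda>_ _. 0)"
  by (simp_all add: line12_def line21_def)

lemma lower_bounded_zero: "lower_bounded (\<lambda>_ _. 0 :: complex)"
  and lower_bounded_scale: "lower_bounded a ==> lower_bounded (\<lambda>s s'. k * a s s' :: complex)"
  by (fastforce simp: lower_bounded_def)+

lemma lower_bounded_add:
  fixes a b :: "complex ser"
  assumes "lower_bounded a" "lower_bounded b"
  shows "lower_bounded (\<lambda>s s'. a s s' + b s s')"
proof -
  obtain N N' where N: "\<forall>s s'. s \<le> N \<or> s' \<le> N --> a s s' = 0" "\<forall>s s'. s \<le> N' \<or> s' \<le> N' --> b s s' = 0"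
    using assms unfolding lower_bounded_def by blast
  show ?thesis unfolding lower_bounded_def by (rule exI[of _ "min N N'"]) (use N in auto)
qed

lemma gcor2_lower_bounded:
  assumes "gcor2 \<mu> A B C"
  shows "lower_bounded (line12 \<alpha> \<beta> A)" "lower_bounded (line21 \<alpha> \<beta> B)" "lower_bounded (line21 \<alpha> \<beta> C)"
  using assms
  by (induction rule: gcor2.induct)
    (auto simp: line12_gen line20_gen line21_gen line12_add line21_add line12_scale line21_scale line12_zero line21_zero
      intro!: lower_bounded_add lower_bounded_scale lower_bounded_zero lower_bounded_act sgn_ser_lower_bounded
        lower_bounded_shift_ser dest: chart_expansion_lower_bounded)

lemma gcor2_nonint:
  assumes "gcor2 \<mu> A B C" "\<alpha> - \<beta> \<notin> \<int>"
  shows "line12 \<alpha> \<beta> A = (\<lambda>_ _. 0)" "line21 \<alpha> \<beta> B = (\<lambda>_ _. 0)" "line21 \<alpha> \<beta> C = (\<lambda>_ _. 0)"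
  using assms
  by (induction rule: gcor2.induct)
    (auto simp: line12_gen line20_gen line21_gen line12_add line21_add line12_scale line21_scale line12_zero line21_zero)

text \<open>Multiplication by $|z_1|^{2a}|z_2|^{2b}|z_1-z_2|^{2c}$. On a generator it replaces \<open>f\<close> by
  $f\cdot|z|^{2b}|1-z|^{2c}$ and adds $a+b+c$ to both exponents of $z_1$. In the expansion around $z_1=z_2$ the chart
  $1-z^{-1}$ gives the exponent $-b-c$ of $1-z$, which combines with the binomial series of
  $(z_0+z_2)^{a+b+c}$ to one with exponent \<open>a\<close>.\<close>

lemma gcor2_mult:
  assumes "gcor2 \<mu> A B C"
  shows "\<exists>\<mu>'. gcor2 \<mu>'
     (mul12 (bin_neg c) (bin_neg c) (a + c) (a + c) b b A)
     (mul21 (bin_pos a) (bin_pos a) c c (a + b) (a + b) B)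
     (mul21 (bin_neg c) (bin_neg c) a a (b + c) (b + c) C)"
  using assms
proof (induction rule: gcor2.induct)
  case (gen f \<alpha> \<beta> a0 b0 c0)
  let ?\<alpha> = "\<alpha> + a + b + c" and ?\<beta> = "\<beta> + a + b + c"
  have lb: "laurent_ser b0" by (rule chart_expansion_laurent) fact
  have 1: "mul12 (bin_neg c) (bin_neg c) (a + c) (a + c) b b (gen_exp_12 \<alpha> \<beta> a0) =
      gen_exp_12 ?\<alpha> ?\<beta> (act (bin_neg c) (bin_neg c) (shift_ser b b a0))"
  proof (intro ext)
    fix s1 s1' s2 s2'
    show "mul12 (bin_neg c) (bin_neg c) (a + c) (a + c) b b (gen_exp_12 \<alpha> \<beta> a0) s1 s1' s2 s2' =
      gen_exp_12 ?\<alpha> ?\<beta> (act (bin_neg c) (bin_neg c) (shift_ser b b a0)) s1 s1' s2 s2'"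
    proof (cases "s1 = ?\<alpha> - s2 \<and> s1' = ?\<beta> - s2'")
      case True
      then show ?thesis
        by (simp add: mul12_def line12_gen act_shift_ser) (simp add: gen_exp_12_def shift_ser_def algebra_simps)
    next
      case False
      then have "\<not> (s1 + s2 - (a + c) - b = \<alpha> \<and> s1' + s2' - (a + c) - b = \<beta>)" by auto
      moreover have "gen_exp_12 ?\<alpha> ?\<beta> x s1 s1' s2 s2' = 0" for x using False by (auto simp: gen_exp_12_def)
      ultimately show ?thesis by (auto simp: mul12_def line12_gen act_def conv2_def)
    qed
  qed
  have 2: "mul21 (bin_neg c) (bin_neg c) a a (b + c) (b + c) (gen_exp_21 \<alpha> \<beta> c0) =
      gen_exp_21 ?\<alpha> ?\<beta> (act (bin_neg c) (bin_neg c) (shift_ser (- b - c) (- b - c) c0))"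
  proof (intro ext)
    fix s1 s1' s2 s2'
    show "mul21 (bin_neg c) (bin_neg c) a a (b + c) (b + c) (gen_exp_21 \<alpha> \<beta> c0) s1 s1' s2 s2' =
      gen_exp_21 ?\<alpha> ?\<beta> (act (bin_neg c) (bin_neg c) (shift_ser (- b - c) (- b - c) c0)) s1 s1' s2 s2'"
    proof (cases "s1 = ?\<alpha> - s2 \<and> s1' = ?\<beta> - s2'")
      case True
      then show ?thesis
        by (simp add: mul21_def line21_gen act_shift_ser) (simp add: gen_exp_21_def shift_ser_def algebra_simps)
    next
      case False
      then have "\<not> (s1 + s2 - a - (b + c) = \<alpha> \<and> s1' + s2' - a - (b + c) = \<beta>)" by auto
      moreover have "gen_exp_21 ?\<alpha> ?\<beta> x s1 s1' s2 s2' = 0" for x using False by (auto simp: gen_exp_21_def)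
      ultimately show ?thesis by (auto simp: mul21_def line21_gen act_def conv2_def)
    qed
  qed
  have 3: "mul21 (bin_pos a) (bin_pos a) c c (a + b) (a + b) (gen_exp_20 \<alpha> \<beta> b0) =
      gen_exp_20 ?\<alpha> ?\<beta> (act (bin_neg (- b - c)) (bin_neg (- b - c)) (shift_ser c c b0))"
  proof (intro ext)
    fix s1 s1' s2 s2'
    have "act (bin_pos ?\<alpha>) (bin_pos ?\<beta>) (sgn_ser (act (bin_neg (- b - c)) (bin_neg (- b - c)) (shift_ser c c b0))) =
       act (bin_pos ?\<alpha> * bin_pos (- b - c)) (bin_pos ?\<beta> * bin_pos (- b - c)) (shift_ser c c (sgn_ser b0))"
      using lb by (subst sgn_ser_act) (simp_all add: laurent_ser_shift sgn_ser_shift act_act sgn_ser_lower_bounded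
          lower_bounded_shift_ser laurent_ser_lower_bounded)
    also have "\<dots> = shift_ser c c (act (bin_pos a * bin_pos \<alpha>) (bin_pos a * bin_pos \<beta>) (sgn_ser b0))"
      by (simp add: act_shift_ser bin_pos_mult algebra_simps)
    also have "\<dots> = shift_ser c c (act (bin_pos a) (bin_pos a) (act (bin_pos \<alpha>) (bin_pos \<beta>) (sgn_ser b0)))"
      using lb by (simp add: act_act sgn_ser_lower_bounded laurent_ser_lower_bounded)
    finally have *: "act (bin_pos ?\<alpha>) (bin_pos ?\<beta>) (sgn_ser (act (bin_neg (- b - c)) (bin_neg (- b - c)) (shift_ser c c b0))) =
       shift_ser c c (act (bin_pos a) (bin_pos a) (act (bin_pos \<alpha>) (bin_pos \<beta>) (sgn_ser b0)))" .
    show "mul21 (bin_pos a) (bin_pos a) c c (a + b) (a + b) (gen_exp_20 \<alpha> \<beta> b0) s1 s1' s2 s2' =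
      gen_exp_20 ?\<alpha> ?\<beta> (act (bin_neg (- b - c)) (bin_neg (- b - c)) (shift_ser c c b0)) s1 s1' s2 s2'"
    proof (cases "s2 = ?\<alpha> - s1 \<and> s2' = ?\<beta> - s1'")
      case True
      then show ?thesis unfolding gen_exp_20_act[of ?\<alpha>] * by (simp add: mul21_def line20_gen shift_ser_def)
    next
      case False
      then have "\<not> (s1 + s2 - c - (a + b) = \<alpha> \<and> s1' + s2' - c - (a + b) = \<beta>)" by auto
      moreover have "gen_exp_20 ?\<alpha> ?\<beta> x s1 s1' s2 s2' = 0" for x using False by (auto simp: gen_exp_20_def)
      ultimately show ?thesis by (auto simp: mul21_def line20_gen act_def conv2_def)
    qed
  qed
  define g where "g = (\<lambda>z. f z * absfac b c z)"
  have "F01inf g" unfolding g_def by (rule F01inf_mult_absfac) (rule gen(1))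
  moreover have "?\<alpha> - ?\<beta> \<in> \<int>" using gen(2) by simp
  moreover have "chart_expansion g UNIV (\<lambda>z. z) (act (bin_neg c) (bin_neg c) (shift_ser b b a0))"
    unfolding g_def by (rule chart_expansion_absfac(1)) (rule gen(3))
  moreover have "chart_expansion g (- {0}) (\<lambda>z. 1 - inverse z)
      (act (bin_neg (- b - c)) (bin_neg (- b - c)) (shift_ser c c b0))"
    unfolding g_def by (rule chart_expansion_absfac(2)) (rule gen(4))
  moreover have "chart_expansion (\<lambda>w. g (inverse w)) UNIV (\<lambda>w. w)
      (act (bin_neg c) (bin_neg c) (shift_ser (- b - c) (- b - c) c0))"
    unfolding g_def by (rule chart_expansion_absfac(3)) (rule gen(5))
  ultimately have "gcor2 (\<lambda>z1 z2. cpow2 z1 ?\<alpha> ?\<beta> * g (z2 / z1))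
      (gen_exp_12 ?\<alpha> ?\<beta> (act (bin_neg c) (bin_neg c) (shift_ser b b a0)))
      (gen_exp_20 ?\<alpha> ?\<beta> (act (bin_neg (- b - c)) (bin_neg (- b - c)) (shift_ser c c b0)))
      (gen_exp_21 ?\<alpha> ?\<beta> (act (bin_neg c) (bin_neg c) (shift_ser (- b - c) (- b - c) c0)))"
    by (intro gcor2.gen)
  then have "gcor2 (\<lambda>z1 z2. cpow2 z1 ?\<alpha> ?\<beta> * g (z2 / z1))
     (mul12 (bin_neg c) (bin_neg c) (a + c) (a + c) b b (gen_exp_12 \<alpha> \<beta> a0))
     (mul21 (bin_pos a) (bin_pos a) c c (a + b) (a + b) (gen_exp_20 \<alpha> \<beta> b0))
     (mul21 (bin_neg c) (bin_neg c) a a (b + c) (b + c) (gen_exp_21 \<alpha> \<beta> c0))"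
    by (simp only: 1 2 3)
  then show ?case by (intro exI)
next
  case zero
  have "mul12 (bin_neg c) (bin_neg c) (a + c) (a + c) b b (\<lambda>_ _ _ _. 0) = (\<lambda>_ _ _ _. 0)"
     "mul21 (bin_pos a) (bin_pos a) c c (a + b) (a + b) (\<lambda>_ _ _ _. 0) = (\<lambda>_ _ _ _. 0)"
     "mul21 (bin_neg c) (bin_neg c) a a (b + c) (b + c) (\<lambda>_ _ _ _. 0) = (\<lambda>_ _ _ _. 0)"
    by (auto simp: mul12_def mul21_def line12_def line21_def act_def conv2_def fun_eq_iff)
  then show ?case using gcor2.zero by auto
next
  case (add \<mu> A B C \<mu>' A' B' C')
  obtain \<mu>1 \<mu>2 where 1: "gcor2 \<mu>1
     (mul12 (bin_neg c) (bin_neg c) (a + c) (a + c) b b A)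
     (mul21 (bin_pos a) (bin_pos a) c c (a + b) (a + b) B)
     (mul21 (bin_neg c) (bin_neg c) a a (b + c) (b + c) C)"
     "gcor2 \<mu>2
     (mul12 (bin_neg c) (bin_neg c) (a + c) (a + c) b b A')
     (mul21 (bin_pos a) (bin_pos a) c c (a + b) (a + b) B')
     (mul21 (bin_neg c) (bin_neg c) a a (b + c) (b + c) C')" using add by blast
  from gcor2.add[OF this] show ?case
    using add(1,2) by (auto simp: mul12_def mul21_def line12_add line21_add act_add gcor2_lower_bounded)
next
  case (scale \<mu> A B C k)
  then obtain \<mu>1 where 1: "gcor2 \<mu>1
     (mul12 (bin_neg c) (bin_neg c) (a + c) (a + c) b b A)
     (mul21 (bin_pos a) (bin_pos a) c c (a + b) (a + b) B)
     (mul21 (bin_neg c) (bin_neg c) a a (b + c) (b + c) C)" by blast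
  from gcor2.scale[OF this, of k] show ?case
    using scale(1) by (auto simp: mul12_def mul21_def line12_scale line21_scale act_scale gcor2_lower_bounded)
qed

text \<open>The conditions on \<open>f\<close> and its three standard expansions which are stable under sums, in contrast to
  being a generator with a given pair of exponents.\<close>

definition cor_fun :: "(complex \<Rightarrow> complex) \<Rightarrow> complex ser \<Rightarrow> complex ser \<Rightarrow> complex ser \<Rightarrow> bool" where
  "cor_fun f a b c \<longleftrightarrow> real_analytic_on f (- {0, 1}) \<and> chart_expansion f UNIV (\<lambda>z. z) a \<and>
     chart_expansion f (- {0}) (\<lambda>z. 1 - inverse z) b \<and>
     chart_expansion (\<lambda>w. f (inverse w)) UNIV (\<lambda>w. w) c"

lemma chart_expansion_if_has_sum:
  assumes "laurent_ser a" "r > 0"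
    and "\<And>z. 0 < norm z ==> norm z < r ==> z \<in> \<phi> ` U"
    and sum: "\<And>z. 0 < norm z ==> norm z < r ==>
      ((\<lambda>(s, s'). a s s' * cpow2 z s s') has_sum f (the_inv_into U \<phi> z)) UNIV"
  shows "chart_expansion f U \<phi> a"
proof -
  define z1 where "z1 = complex_of_real (r / 2)"
  have z1: "0 < norm z1" "norm z1 < r" using assms(2) by (auto simp: z1_def)
  have "abs_conv_at_0 a"
    by (rule abs_conv_at_0_if_summable[OF assms(1) _ has_sum_imp_summable[OF sum[OF z1]]]) (use z1 in auto)
  with assms show ?thesis unfolding chart_expansion_def by blast
qed

lemma chart_expansion_add:
  assumes "chart_expansion f U \<phi> a" "chart_expansion g U \<phi> b"
  shows "chart_expansion (\<lambda>w. f w + g w) U \<phi> (\<lambda>s s'. a s s' + b s s')"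
proof -
  from assms(1) obtain r where r: "r > 0" and a: "\<And>z. 0 < norm z ==> norm z < r ==> z \<in> \<phi> ` U \<and>
      ((\<lambda>(s, s'). a s s' * cpow2 z s s') has_sum f (the_inv_into U \<phi> z)) UNIV"
    unfolding chart_expansion_def by blast
  from assms(2) obtain r' where r': "r' > 0" and b: "\<And>z. 0 < norm z ==> norm z < r' ==> z \<in> \<phi> ` U \<and>
      ((\<lambda>(s, s'). b s s' * cpow2 z s s') has_sum g (the_inv_into U \<phi> z)) UNIV"
    unfolding chart_expansion_def by blast
  show ?thesis
  proof (rule chart_expansion_if_has_sum[where r = "min r r'"])
    fix z :: complex assume z: "0 < norm z" "norm z < min r r'"
    then have "((\<lambda>(s, s'). a s s' * cpow2 z s s') has_sum f (the_inv_into U \<phi> z)) UNIV"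
      "((\<lambda>(s, s'). b s s' * cpow2 z s s') has_sum g (the_inv_into U \<phi> z)) UNIV"
      using a[of z] b[of z] by auto
    from has_sum_add[OF this]
    show "((\<lambda>(s, s'). (a s s' + b s s') * cpow2 z s s') has_sum f (the_inv_into U \<phi> z) + g (the_inv_into U \<phi> z)) UNIV"
      by (simp add: case_prod_unfold distrib_right)
  qed (use assms r r' a in \<open>auto intro: laurent_ser_add chart_expansion_laurent\<close>)
qed

lemma chart_expansion_scale:
  assumes "chart_expansion f U \<phi> a"
  shows "chart_expansion (\<lambda>w. k * f w) U \<phi> (\<lambda>s s'. k * a s s')"
proof -
  from assms(1) obtain r where r: "r > 0" and a: "\<And>z. 0 < norm z ==> norm z < r ==> z \<in> \<phi> ` U \<and>
      ((\<lambda>(s, s'). a s s' * cpow2 z s s') has_sum f (the_inv_into U \<phi> z)) UNIV"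
    unfolding chart_expansion_def by blast
  show ?thesis
  proof (rule chart_expansion_if_has_sum[OF _ r])
    fix z :: complex assume z: "0 < norm z" "norm z < r"
    then have "((\<lambda>x. k * (case x of (s, s') \<Rightarrow> a s s' * cpow2 z s s')) has_sum k * f (the_inv_into U \<phi> z)) UNIV"
      using a by (intro has_sum_cmult_right) auto
    then show "((\<lambda>(s, s'). k * a s s' * cpow2 z s s') has_sum k * f (the_inv_into U \<phi> z)) UNIV"
      by (simp add: case_prod_unfold mult.assoc)
  qed (use assms a in \<open>auto intro: laurent_ser_scale chart_expansion_laurent\<close>)
qed

lemma laurent_ser_zero: "laurent_ser (\<lambda>_ _. 0)"
  by (simp add: laurent_ser_def)

lemma cor_fun_zero: "cor_fun (\<lambda>_. 0) (\<lambda>_ _. 0) (\<lambda>_ _. 0) (\<lambda>_ _. 0)"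
proof -
  have "z \<in> (\<lambda>z. 1 - inverse z) ` (- {0})" if "norm z < 1" for z :: complex
    using that by (intro image_eqI[of _ _ "inverse (1 - z)"]) auto
  then show ?thesis unfolding cor_fun_def real_analytic_on_iff
    by (auto intro!: real_analytic_at_const chart_expansion_if_has_sum[where r = 1] laurent_ser_zero
        simp: case_prod_unfold)
qed

lemma cor_fun_add: "cor_fun f a b c ==> cor_fun f' a' b' c' ==>
    cor_fun (\<lambda>z. f z + f' z) (\<lambda>s s'. a s s' + a' s s') (\<lambda>s s'. b s s' + b' s s') (\<lambda>s s'. c s s' + c' s s')"
  by (simp add: cor_fun_def real_analytic_on_iff real_analytic_at_add chart_expansion_add)

lemma cor_fun_scale: "cor_fun f a b c ==>
    cor_fun (\<lambda>z. k * f z) (\<lambda>s s'. k * a s s') (\<lambda>s s'. k * b s s') (\<lambda>s s'. k * c s s')"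
  by (simp add: cor_fun_def real_analytic_on_iff real_analytic_at_mult real_analytic_at_const chart_expansion_scale)

text \<open>The generators with exponents $(\alpha,\beta)$ add up to one function of $z_2/z_1$; the others do not meet this
  line.\<close>

lemma gcor2_component:
  assumes "gcor2 \<mu> A B C"
  shows "\<exists>f a b c. cor_fun f a b c \<and> line12 \<alpha> \<beta> A = a \<and>
    line21 \<alpha> \<beta> B = act (bin_pos \<alpha>) (bin_pos \<beta>) (sgn_ser b) \<and> line21 \<alpha> \<beta> C = shift_ser \<alpha> \<beta> c"
  using assms
proof (induction rule: gcor2.induct)
  case (gen f \<alpha>' \<beta>' a b c)
  show ?case
  proof (cases "\<alpha> = \<alpha>' \<and> \<beta> = \<beta>'")
    case True
    have "cor_fun f a b c" using gen unfolding cor_fun_def F01inf_def by blast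
    then show ?thesis using True by (auto simp: line12_gen line20_gen line21_gen)
  next
    case False
    show ?thesis using False cor_fun_zero
      by (intro exI[of _ "\<lambda>_. 0"] exI[of _ "\<lambda>_ _. 0"])
        (auto simp: line12_gen line20_gen line21_gen act_def conv2_def sgn_ser_def shift_ser_def fun_eq_iff)
  qed
next
  case zero
  show ?case using cor_fun_zero
      by (intro exI[of _ "\<lambda>_. 0"] exI[of _ "\<lambda>_ _. 0"])
        (auto simp: line12_zero line21_zero act_def conv2_def sgn_ser_def shift_ser_def fun_eq_iff)
next
  case (add \<mu> A B C \<mu>' A' B' C')
  then obtain f a b c f' a' b' c' where 
    1: "cor_fun f a b c" "line12 \<alpha> \<beta> A = a"
      "line21 \<alpha> \<beta> B = act (bin_pos \<alpha>) (bin_pos \<beta>) (sgn_ser b)" "line21 \<alpha> \<beta> C = shift_ser \<alpha> \<beta> c" and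
    2: "cor_fun f' a' b' c'" "line12 \<alpha> \<beta> A' = a'"
      "line21 \<alpha> \<beta> B' = act (bin_pos \<alpha>) (bin_pos \<beta>) (sgn_ser b')" "line21 \<alpha> \<beta> C' = shift_ser \<alpha> \<beta> c'"
    by blast
  have lb: "lower_bounded (sgn_ser b)" "lower_bounded (sgn_ser b')"
    using 1(1) 2(1) by (auto simp: cor_fun_def intro!: sgn_ser_lower_bounded dest: chart_expansion_lower_bounded)
  have "sgn_ser (\<lambda>s s'. b s s' + b' s s') = (\<lambda>s s'. sgn_ser b s s' + sgn_ser b' s s')"
    by (simp add: sgn_ser_def distrib_left)
  note eq = this
  have "(\<lambda>s s'. act (bin_pos \<alpha>) (bin_pos \<beta>) (sgn_ser b) s s' + act (bin_pos \<alpha>) (bin_pos \<beta>) (sgn_ser b') s s') =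
      act (bin_pos \<alpha>) (bin_pos \<beta>) (sgn_ser (\<lambda>s s'. b s s' + b' s s'))"
    unfolding eq by (intro ext) (simp only: act_add[OF lb])
  note eq2 = this
  show ?case
    by (intro exI conjI, rule cor_fun_add[OF 1(1) 2(1)]) (simp_all add: line12_add line21_add shift_ser_def 1 2 eq2)
next
  case (scale \<mu> A B C k)
  then obtain f a b c where 
    1: "cor_fun f a b c" "line12 \<alpha> \<beta> A = a"
      "line21 \<alpha> \<beta> B = act (bin_pos \<alpha>) (bin_pos \<beta>) (sgn_ser b)" "line21 \<alpha> \<beta> C = shift_ser \<alpha> \<beta> c" 
    by blast
  have lb: "lower_bounded (sgn_ser b)"
    using 1(1) by (auto simp: cor_fun_def intro!: sgn_ser_lower_bounded dest: chart_expansion_lower_bounded)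
  have "sgn_ser (\<lambda>s s'. k * b s s') = (\<lambda>s s'. k * sgn_ser b s s')"
    by (simp add: sgn_ser_def mult_ac)
  note eq = this
  have "(\<lambda>s s'. k * act (bin_pos \<alpha>) (bin_pos \<beta>) (sgn_ser b) s s') =
      act (bin_pos \<alpha>) (bin_pos \<beta>) (sgn_ser (\<lambda>s s'. k * b s s'))"
    unfolding eq by (intro ext) (simp only: act_scale[OF lb])
  note eq2 = this
  show ?case
    by (intro exI conjI, rule cor_fun_scale[OF 1(1)]) (simp_all add: line12_scale line21_scale shift_ser_def 1 eq2)
qed

section \<open>Holomorphic correlation functions\<close>

lemma connected_punctured_plane: "connected (- {0, 1 :: complex})"
  using connected_open_delete_finite[of "UNIV :: complex set" "{0, 1}"] by (simp add: Compl_eq_Diff_UNIV connected_UNIV)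

text \<open>A constant is holomorphic, so the function is holomorphic on the connected domain and the identity
  theorem applies.\<close>

lemma analytic_const_near_0:
  assumes "real_analytic_on f (- {0, 1})" "r > 0"
    and "\<And>z. 0 < norm z ==> norm z < r ==> f z = \<kappa>" "z \<in> - {0, 1}"
  shows "f z = \<kappa>"
proof -
  define \<rho> where "\<rho> = min r 1 / 2"
  define B where "B = ball (complex_of_real \<rho>) \<rho>"
  have \<rho>: "\<rho> > 0" "2 * \<rho> \<le> r" "2 * \<rho> \<le> 1" using assms(2) by (auto simp: \<rho>_def)
  have B: "0 < norm z \<and> norm z < r \<and> norm z < 1" if "z \<in> B" for z
  proof -
    have d: "norm (z - of_real \<rho>) < \<rho>" using that by (simp add: B_def dist_norm norm_minus_commute)
    then have "z \<noteq> 0" using \<rho> by auto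
    moreover have "norm z < 2 * \<rho>" using norm_triangle_ineq[of "z - of_real \<rho>" "of_real \<rho>"] d \<rho> by simp
    ultimately show ?thesis using \<rho> by simp
  qed
  have sub: "B \<subseteq> - {0, 1}" using B by fastforce
  have "f holomorphic_on B"
    by (rule holomorphic_transform[of "\<lambda>_. \<kappa>"]) (use B assms(3) in auto)
  then have "f holomorphic_on - {0, 1}"
    using holomorphy_spreads[OF assms(1) _ connected_punctured_plane \<rho>(1), of "of_real \<rho>"] sub
    by (simp add: B_def open_Compl)
  then show ?thesis
    using analytic_continuation_open[of B "- {0, 1}" f "\<lambda>_. \<kappa>" z] B sub assms(3,4) connected_punctured_plane \<rho>(1)
    by (auto simp: B_def open_Compl)
qed

text \<open>The function of $z_2/z_1$ on this line is constant near 0, hence everywhere, and the component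
  of the correlation function is $\kappa z_1^\alpha\bar z_1^\beta$ with $z_1=z_0+z_2$. The coefficient of $\bar z_0$ in its
  expansion is $\beta\kappa$.\<close>

lemma gcor2_const:
  assumes "gcor2 \<mu> A B C"
    and A: "line12 \<alpha> \<beta> A = (\<lambda>s s'. if s = 0 \<and> s' = 0 then \<kappa> else 0)"
  shows "line21 \<alpha> \<beta> B 0 1 = of_real \<beta> * \<kappa>"
proof -
  obtain f a b c where f: "cor_fun f a b c" and a: "line12 \<alpha> \<beta> A = a"
    and b: "line21 \<alpha> \<beta> B = act (bin_pos \<alpha>) (bin_pos \<beta>) (sgn_ser b)"
    using gcor2_component[OF assms(1)] by blast
  define \<delta> where "\<delta> = (\<lambda>(s :: real) (s' :: real). if s = 0 \<and> s' = (0::real) then \<kappa> else (0::complex))"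
  have \<delta>: "laurent_ser \<delta>"
    unfolding laurent_ser_def
  proof (intro conjI allI impI)
    show "\<exists>N. \<forall>s s'. s \<le> N \<or> s' \<le> N --> \<delta> s s' = 0" by (rule exI[of _ "-1"]) (auto simp: \<delta>_def)
    show "finite {(s, s'). \<delta> s s' \<noteq> 0 \<and> s + s' \<le> R}" for R
      by (rule finite_subset[of _ "{(0, 0)}"]) (auto simp: \<delta>_def split: if_splits)
  qed (auto simp: \<delta>_def)
  have \<delta>_sum: "((\<lambda>(s, s'). \<delta> s s' * cpow2 z s s') has_sum \<kappa>) UNIV" if "z \<noteq> 0" for z
    by (rule has_sum_finite_neutralI[of "{(0, 0)}"]) (use that in \<open>auto simp: \<delta>_def cpow2_def split: if_splits\<close>)
  have "chart_expansion f UNIV (\<lambda>z. z) \<delta>" using f A a by (simp add: cor_fun_def \<delta>_def)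
  then obtain r where r: "r > 0" "\<And>z. 0 < norm z ==> norm z < r ==>
        ((\<lambda>(s, s'). \<delta> s s' * cpow2 z s s') has_sum f z) UNIV"
    unfolding chart_expansion_def the_inv_into_id by blast
  have near: "f z = \<kappa>" if z: "0 < norm z" "norm z < r" for z
    using has_sum_unique[OF r(2)[OF z] \<delta>_sum] z by auto
  have f_const: "f z = \<kappa>" if "z \<in> - {0, 1}" for z
    by (rule analytic_const_near_0[OF _ r(1) near that]) (use f in \<open>auto simp: cor_fun_def\<close>)
  have "chart_expansion f (- {0}) (\<lambda>z. 1 - inverse z) \<delta>"
  proof (rule chart_expansion_if_has_sum[OF \<delta> zero_less_one])
    fix z :: complex assume z: "0 < norm z" "norm z < 1"
    then have z': "1 - z \<noteq> 0" "z \<noteq> 0" "z \<noteq> 1" by auto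
    show "z \<in> (\<lambda>z. 1 - inverse z) ` (- {0})" using z' by (intro image_eqI[of _ _ "inverse (1 - z)"]) auto
    have "f (inverse (1 - z)) = \<kappa>" using z' by (intro f_const) (auto simp: inverse_eq_1_iff)
    then show "((\<lambda>(s, s'). \<delta> s s' * cpow2 z s s') has_sum f (the_inv_into (- {0}) (\<lambda>z. 1 - inverse z) z)) UNIV"
      using \<delta>_sum z' by (simp add: the_inv_into_chart_1)
  qed
  moreover have "chart_expansion f (- {0}) (\<lambda>z. 1 - inverse z) b" using f by (simp add: cor_fun_def)
  ultimately have "b = \<delta>" using chart_expansion_unique by blast
  then have "line21 \<alpha> \<beta> B 0 1 = act (bin_pos \<alpha>) (bin_pos \<beta>) (sgn_ser \<delta>) 0 1" using b by simp
  also have "\<dots> = (\<Sum>i<2. \<Sum>k<2. fps_nth (bin_pos \<alpha>) i * fps_nth (bin_pos \<beta>) k * sgn_ser \<delta> (0 - real i) (1 - real k))"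
    unfolding act_def by (rule conv2_eq_sum) (auto simp: sgn_ser_def \<delta>_def)
  also have "\<dots> = of_real \<beta> * \<kappa>"
    by (simp add: numeral_2_eq_2 sgn_ser_def \<delta>_def bin_pos_nth)
  finally show ?thesis .
qed

text \<open>A convergent Laurent expansion with finite principal part, as a statement about \<open>has_sum\<close>.\<close>

definition lau :: "(complex \<Rightarrow> complex) \<Rightarrow> (int \<Rightarrow> complex) \<Rightarrow> bool" where
  "lau F c \<longleftrightarrow> (\<exists>K::nat. \<forall>k < - int K. c k = 0) \<and>
     (\<exists>r>0. \<forall>z. 0 < norm z --> norm z < r --> ((\<lambda>k. c k * z powi k) has_sum F z) UNIV)"

lemma lau_from_laurent_ser:
  assumes a: "laurent_ser a" and supp: "\<And>s s'. a s s' \<noteq> 0 ==> s' = 0"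
    and r: "r > 0" and sum: "\<And>z. 0 < norm z ==> norm z < r ==>
      ((\<lambda>(s, s'). a s s' * cpow2 z s s') has_sum F z) UNIV"
  shows "lau F (\<lambda>k. a (of_int k) 0)"
  unfolding lau_def
proof (intro conjI exI[of _ r] allI impI r)
  obtain N where N: "\<And>s s'. s \<le> N \<or> s' \<le> N ==> a s s' = 0" using a unfolding laurent_ser_def by blast
  show "\<exists>K::nat. \<forall>k < - int K. a (of_int k) 0 = 0"
  proof (intro exI[of _ "nat \<lceil>- N\<rceil>"] allI impI N)
    fix k assume "k < - int (nat \<lceil>- N\<rceil>)" then show "of_int k \<le> N \<or> 0 \<le> N" by linarith
  qed
  fix z :: complex assume z: "0 < norm z" "norm z < r"
  define h where "h = (\<lambda>k::int. (of_int k :: real, 0 :: real))"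
  have "((\<lambda>(s, s'). a s s' * cpow2 z s s') has_sum F z) UNIV \<longleftrightarrow>
        ((\<lambda>(s, s'). a s s' * cpow2 z s s') has_sum F z) (range h)"
  proof (rule has_sum_cong_neutral)
    fix x assume "x \<in> UNIV - range h"
    moreover obtain s s' where x: "x = (s, s')" by (cases x)
    ultimately have "\<not> (s' = 0 \<and> s - s' \<in> \<int>)" by (auto simp: h_def elim!: Ints_cases)
    then have "a s s' = 0" using supp laurent_ser_int[OF a] by blast
    then show "(case x of (s, s') \<Rightarrow> a s s' * cpow2 z s s') = 0" by (simp add: x)
  qed auto
  also have "\<dots> \<longleftrightarrow> ((\<lambda>k. case h k of (s, s') \<Rightarrow> a s s' * cpow2 z s s') has_sum F z) UNIV"
    by (subst has_sum_reindex) (auto simp: h_def inj_on_def o_def)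
  finally show "((\<lambda>k. a (of_int k) 0 * z powi k) has_sum F z) UNIV"
    using sum[OF z] z by (simp add: h_def cpow2_def)
qed

lemma lau_unique:
  assumes "lau F c" "lau F d"
  shows "c = d"
proof -
  define emb where "emb c s s' = (if s' = 0 \<and> s \<in> \<int> then c \<lfloor>s\<rfloor> else 0)" for c :: "int \<Rightarrow> complex" and s s' :: real
  have 1: "laurent_ser (emb c) \<and> (\<exists>r>0. \<forall>z. 0 < norm z --> norm z < r --> ((\<lambda>(s, s'). emb c s s' * cpow2 z s s') has_sum F z) UNIV)"
    if l: "lau F c" for c
  proof (intro conjI)
    obtain K :: nat where K: "\<And>k. k < - int K ==> c k = 0" using l unfolding lau_def by blast
    show "laurent_ser (emb c)" unfolding laurent_ser_def
    proof (intro conjI allI impI)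
      show "\<exists>N. \<forall>s s'. s \<le> N \<or> s' \<le> N --> emb c s s' = 0"
        by (rule exI[of _ "- real K - 1"]) (auto simp: emb_def intro!: K elim!: Ints_cases)
      fix R :: real
      show "finite {(s, s'). emb c s s' \<noteq> 0 \<and> s + s' \<le> R}"
      proof (rule finite_subset)
        show "{(s, s'). emb c s s' \<noteq> 0 \<and> s + s' \<le> R} \<subseteq> (\<lambda>k::int. (of_int k, 0)) ` {- int K..\<lfloor>R\<rfloor>}"
        proof clarify
          fix s s' assume nz: "emb c s s' \<noteq> 0" and le: "s + s' \<le> R"
          then obtain k where k: "s = of_int k" "s' = 0" "c k \<noteq> 0" by (auto simp: emb_def elim!: Ints_cases split: if_splits)
          have "k \<ge> - int K" by (rule ccontr) (use K[of k] k in auto)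
          with k le show "(s, s') \<in> (\<lambda>k::int. (of_int k, 0)) ` {- int K..\<lfloor>R\<rfloor>}"
            by (intro image_eqI[of _ _ k]) (auto simp: le_floor_iff)
        qed
      qed simp
    qed (auto simp: emb_def)
    obtain r where r: "r > 0" "\<And>z. 0 < norm z ==> norm z < r ==> ((\<lambda>k. c k * z powi k) has_sum F z) UNIV"
      using l unfolding lau_def by blast
    show "\<exists>r>0. \<forall>z. 0 < norm z --> norm z < r --> ((\<lambda>(s, s'). emb c s s' * cpow2 z s s') has_sum F z) UNIV"
    proof (intro exI[of _ r] conjI r allI impI)
      fix z :: complex assume z: "0 < norm z" "norm z < r"
      define h where "h = (\<lambda>k::int. (of_int k :: real, 0 :: real))"
      have "((\<lambda>(s, s'). emb c s s' * cpow2 z s s') has_sum F z) UNIV \<longleftrightarrow>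
            ((\<lambda>(s, s'). emb c s s' * cpow2 z s s') has_sum F z) (range h)"
        by (rule has_sum_cong_neutral) (auto simp: emb_def h_def elim!: Ints_cases)
      also have "\<dots> \<longleftrightarrow> ((\<lambda>k. case h k of (s, s') \<Rightarrow> emb c s s' * cpow2 z s s') has_sum F z) UNIV"
        by (subst has_sum_reindex) (auto simp: h_def inj_on_def o_def)
      finally show "((\<lambda>(s, s'). emb c s s' * cpow2 z s s') has_sum F z) UNIV"
        using r(2)[OF z] z by (simp add: h_def cpow2_def emb_def)
    qed
  qed
  from 1[OF assms(1)] 1[OF assms(2)] obtain r r' where r: "r > 0" "r' > 0"
    "\<And>z. 0 < norm z ==> norm z < r ==> ((\<lambda>(s, s'). emb c s s' * cpow2 z s s') has_sum F z) UNIV"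
    "\<And>z. 0 < norm z ==> norm z < r' ==> ((\<lambda>(s, s'). emb d s s' * cpow2 z s s') has_sum F z) UNIV"
    by blast
  have "emb c = emb d"
    by (rule laurent_series_unique[where r = "min r r'" and F = F]) (use 1[OF assms(1)] 1[OF assms(2)] r in auto)
  then have "emb c (of_int k) 0 = emb d (of_int k) 0" for k by simp
  then show ?thesis by (auto simp: emb_def)
qed

lemma lau_add:
  assumes "lau F c" "lau G d"
  shows "lau (\<lambda>z. F z + G z) (\<lambda>k. c k + d k)"
proof -
  obtain K K' :: nat where K: "\<And>k. k < - int K ==> c k = 0" "\<And>k. k < - int K' ==> d k = 0"
    using assms unfolding lau_def by blast
  obtain r where r: "r > 0" "\<And>z. 0 < norm z ==> norm z < r ==> ((\<lambda>k. c k * z powi k) has_sum F z) UNIV"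
    using assms(1) unfolding lau_def by blast
  obtain r' where r': "r' > 0" "\<And>z. 0 < norm z ==> norm z < r' ==> ((\<lambda>k. d k * z powi k) has_sum G z) UNIV"
    using assms(2) unfolding lau_def by blast
  show ?thesis unfolding lau_def
  proof (intro conjI exI[of _ "max K K'"] exI[of _ "min r r'"] allI impI)
    fix z :: complex assume "0 < norm z" "norm z < min r r'"
    then show "((\<lambda>k. (c k + d k) * z powi k) has_sum F z + G z) UNIV"
      unfolding distrib_right by (intro has_sum_add r r') auto
  qed (use K r r' in auto)
qed

lemma lau_scale:
  assumes "lau F c"
  shows "lau (\<lambda>z. k * F z) (\<lambda>n. k * c n)"
proof -
  obtain K :: nat where K: "\<And>k. k < - int K ==> c k = 0"
    using assms unfolding lau_def by blast
  obtain r where r: "r > 0" "\<And>z. 0 < norm z ==> norm z < r ==> ((\<lambda>k. c k * z powi k) has_sum F z) UNIV"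
    using assms(1) unfolding lau_def by blast
  show ?thesis unfolding lau_def
  proof (intro conjI exI[of _ K] exI[of _ r] allI impI)
    fix z :: complex assume "0 < norm z" "norm z < r"
    then show "((\<lambda>n. k * c n * z powi n) has_sum k * F z) UNIV"
      unfolding mult.assoc by (intro has_sum_cmult_right r) auto
  qed (use K r in auto)
qed

lemma lau_zero: "lau (\<lambda>_. 0) (\<lambda>_. 0)"
  unfolding lau_def by (auto intro: exI[of _ 1])

lemma lau_sum:
  assumes "finite I" "\<And>i. i \<in> I ==> lau (F i) (c i)"
  shows "lau (\<lambda>z. \<Sum>i\<in>I. F i z) (\<lambda>k. \<Sum>i\<in>I. c i k)"
  using assms by (induction I rule: finite_induct) (auto intro: lau_zero lau_add)

lemma lau_cong:
  assumes "lau F c" "r > 0" "\<And>z. 0 < norm z ==> norm z < r ==> F z = G z"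
  shows "lau G c"
proof -
  obtain r' where r': "r' > 0" "\<And>z. 0 < norm z ==> norm z < r' ==> ((\<lambda>k. c k * z powi k) has_sum F z) UNIV"
    using assms(1) unfolding lau_def by blast
  have "\<exists>r>0. \<forall>z. 0 < norm z --> norm z < r --> ((\<lambda>k. c k * z powi k) has_sum G z) UNIV"
  proof (intro exI[of _ "min r r'"] conjI allI impI)
    fix z :: complex assume z: "0 < norm z" "norm z < min r r'"
    then show "((\<lambda>k. c k * z powi k) has_sum G z) UNIV" using r'(2)[of z] assms(3)[of z] by simp
  qed (use r' assms(2) in auto)
  with assms(1) show ?thesis unfolding lau_def by blast
qed

lemma lau_powi_powser:
  assumes r: "r > 0" and sum: "\<And>z. norm z < r ==> ((\<lambda>n. p n * z ^ n) has_sum F z) UNIV"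
  shows "lau (\<lambda>z. z powi m * F z) (\<lambda>k. if k \<ge> m then p (nat (k - m)) else 0)"
  unfolding lau_def
proof (intro conjI exI[of _ r] allI impI r)
  show "\<exists>K::nat. \<forall>k < - int K. (if k \<ge> m then p (nat (k - m)) else 0) = 0"
    by (rule exI[of _ "nat (- m)"]) auto
  fix z :: complex assume z: "0 < norm z" "norm z < r"
  let ?f = "\<lambda>k. (if k \<ge> m then p (nat (k - m)) else 0) * z powi k"
  define h where "h = (\<lambda>n. m + int n)"
  have "((\<lambda>n. z powi m * (p n * z ^ n)) has_sum z powi m * F z) UNIV"
    by (intro has_sum_cmult_right sum z)
  moreover have "?f (h n) = z powi m * (p n * z ^ n)" for n
    using z by (simp add: h_def power_int_add)
  ultimately have "((?f \<circ> h) has_sum z powi m * F z) UNIV" by (simp add: o_def)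
  then have "(?f has_sum z powi m * F z) (range h)"
    by (subst has_sum_reindex) (auto simp: h_def inj_on_def)
  moreover have "(?f has_sum z powi m * F z) (range h) \<longleftrightarrow> (?f has_sum z powi m * F z) UNIV"
  proof (rule has_sum_cong_neutral)
    fix k assume "k \<in> UNIV - range h"
    have "\<not> k \<ge> m"
    proof
      assume "k \<ge> m"
      then have "k = h (nat (k - m))" by (simp add: h_def)
      with \<open>k \<in> UNIV - range h\<close> show False by blast
    qed
    then show "?f k = 0" by simp
  qed auto
  ultimately show "(?f has_sum z powi m * F z) UNIV" by simp
qed

lemma lau_holomorphic_part:
  assumes "lau F c" "\<And>k. k < - int K ==> c k = 0"
  obtains r G where "r > 0" "G holomorphic_on ball 0 r"
    "\<And>z. 0 < norm z ==> norm z < r ==> F z = G z + (\<Sum>j=1..K. c (- int j) * z powi (- int j))"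
proof -
  obtain r where r: "r > 0" "\<And>z. 0 < norm z ==> norm z < r ==> ((\<lambda>k. c k * z powi k) has_sum F z) UNIV"
    using assms(1) unfolding lau_def by blast
  define P where "P z = (\<Sum>j=1..K. c (- int j) * z powi (- int j))" for z
  have sum: "((\<lambda>n. c (int n) * z ^ n) has_sum F z - P z) UNIV" if z: "0 < norm z" "norm z < r" for z
  proof -
    let ?f = "\<lambda>k. c k * z powi k"
    have fin: "((?f) has_sum (\<Sum>k\<in>(\<lambda>j. - int j) ` {1..K}. ?f k)) ((\<lambda>j. - int j) ` {1..K})"
      by (rule has_sum_finite) simp
    have "(\<Sum>k\<in>(\<lambda>j. - int j) ` {1..K}. ?f k) = P z"
      unfolding P_def by (subst sum.reindex) (auto simp: inj_on_def)
    with fin have fin': "(?f has_sum P z) ((\<lambda>j. - int j) ` {1..K})" by (simp only:)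
    have "(?f has_sum (F z - P z)) (UNIV - (\<lambda>j. - int j) ` {1..K})"
      by (rule has_sum_Diff[OF r(2)[OF z] fin']) simp
    also have "?this \<longleftrightarrow> (?f has_sum (F z - P z)) (range int)"
    proof (rule has_sum_cong_neutral)
      fix k assume k: "k \<in> UNIV - (\<lambda>j. - int j) ` {1..K} - range int"
      have "k < 0"
      proof (rule ccontr)
        assume "\<not> k < 0"
        then have "k = int (nat k)" by simp
        with k show False by blast
      qed
      moreover have "k < - int K"
      proof (rule ccontr)
        assume "\<not> k < - int K"
        with \<open>k < 0\<close> have "k = - int (nat (- k))" "nat (- k) \<in> {1..K}" by auto
        with k show False by blast
      qed
      then show "?f k = 0" using assms(2) by simp
    qed auto
    also have "\<dots> \<longleftrightarrow> ((?f \<circ> int) has_sum (F z - P z)) UNIV"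
      by (rule has_sum_reindex) simp
    finally show ?thesis by (simp add: o_def)
  qed
  define G where "G z = (if z = 0 then c 0 else F z - P z)" for z
  have "G holomorphic_on ball 0 r"
  proof (rule power_series_holomorphic[where a = "\<lambda>n. c (int n)"])
    fix w :: complex assume w: "w \<in> ball 0 r"
    show "(\<lambda>n. c (int n) * (w - 0) ^ n) sums G w"
    proof (cases "w = 0")
      case True
      then show ?thesis using powser_sums_zero[of "\<lambda>n. c (int n)"] by (simp add: G_def)
    next
      case False
      then show ?thesis using has_sum_imp_sums[OF sum[of w]] w by (simp add: G_def)
    qed
  qed
  then show ?thesis using that[of r G] r(1) by (auto simp: G_def P_def)
qed

lemma bin_pos_has_sum:
  assumes "norm z < 1"
  shows "((\<lambda>n. fps_nth (bin_pos c) n * z ^ n) has_sum (1 + z) powr of_real c) UNIV"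
proof -
  have "fps_nth (bin_pos c) n * z ^ n = fps_nth (bin_neg c) n * (- z) ^ n" for n
    by (simp add: bin_pos_nth bin_neg_nth power_minus[of z n])
  then show ?thesis using bin_neg_has_sum[of "- z" c] assms by simp
qed

lemma powr_of_real_int: "z \<noteq> 0 ==> z powr complex_of_real (of_int k) = z powi k"
  using complex_powr_of_int[of z k] by simp

lemma lau_powi: "lau (\<lambda>z. z powi m) (\<lambda>k. if k = m then 1 else 0)"
proof -
  have "((\<lambda>n. (if n = 0 then 1 else 0) * z ^ n) has_sum 1) UNIV" for z :: complex
    by (rule has_sum_finite_neutralI[of "{0}"]) auto
  from lau_powi_powser[OF zero_less_one this, of m]
  have "lau (\<lambda>z. z powi m) (\<lambda>k. if k \<ge> m then if nat (k - m) = 0 then 1 else 0 else 0)" by simp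
  also have "(\<lambda>k. if k \<ge> m then if nat (k - m) = 0 then 1 else 0 else 0) = (\<lambda>k. if k = m then 1 else (0::complex))"
    by auto
  finally show ?thesis .
qed

lemma lau_pole_at_0: "lau (\<lambda>z. (z - 1) powi (- int j))
    (\<lambda>k. if k \<ge> 0 then (-1) ^ j * fps_nth (bin_neg (- real j)) (nat k) else 0)"
proof -
  have "((\<lambda>n. (-1) ^ j * fps_nth (bin_neg (- real j)) n * z ^ n) has_sum (-1) ^ j * (1 - z) powr of_real (- real j)) UNIV"
    if "norm z < 1" for z
    unfolding mult.assoc by (intro has_sum_cmult_right bin_neg_has_sum that)
  from lau_powi_powser[OF zero_less_one this, of 0]
  have "lau (\<lambda>z. (-1) ^ j * (1 - z) powr of_real (- real j)) (\<lambda>k. if k \<ge> 0 then (-1) ^ j * fps_nth (bin_neg (- real j)) (nat k) else 0)"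
    by (simp only: diff_zero power_int_0_right mult_1_left)
  then show ?thesis
  proof (rule lau_cong[OF _ zero_less_one])
    fix z :: complex assume "norm z < 1"
    then have "1 - z \<noteq> 0" by auto
    then have "(1 - z) powr of_real (- real j) = (1 - z) powi (- int j)"
      using powr_of_real_int[of "1 - z" "- int j"] by simp
    moreover have "(z - 1) powi (- int j) = (-1) powi (- int j) * (1 - z) powi (- int j)"
      by (simp flip: power_int_mult_distrib)
    ultimately show "(-1) ^ j * (1 - z) powr of_real (- real j) = (z - 1) powi (- int j)"
      by (simp add: power_int_minus minus_one_power_iff)
  qed
qed

lemma lau_pole_at_inf: "lau (\<lambda>w. (inverse w - 1) powi (- int j))
    (\<lambda>k. if k \<ge> int j then fps_nth (bin_neg (- real j)) (nat (k - int j)) else 0)"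
proof -
  from lau_powi_powser[OF zero_less_one bin_neg_has_sum, of "int j" "- real j"]
  show ?thesis
  proof (rule lau_cong[OF _ zero_less_one])
    fix w :: complex assume w: "0 < norm w" "norm w < 1"
    then have "1 - w \<noteq> 0" "w \<noteq> 0" by auto
    moreover from this have "(1 - w) powr of_real (- real j) = (1 - w) powi (- int j)"
      using powr_of_real_int[of "1 - w" "- int j"] by simp
    moreover have "inverse w - 1 = inverse w * (1 - w)" using w by (simp add: field_simps)
    ultimately show "w powi int j * (1 - w) powr of_real (- real j) = (inverse w - 1) powi (- int j)"
      by (simp add: power_int_mult_distrib power_int_minus power_int_inverse power_mult_distrib power_inverse)
  qed
qed

lemma lau_powi_at_1: "lau (\<lambda>t. (1 + t) powi l) (\<lambda>k. if k \<ge> 0 then fps_nth (bin_pos (of_int l)) (nat k) else 0)"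
proof -
  from lau_powi_powser[OF zero_less_one bin_pos_has_sum, of 0 "of_int l"]
  have "lau (\<lambda>t. (1 + t) powr of_real (of_int l)) (\<lambda>k. if k \<ge> 0 then fps_nth (bin_pos (of_int l)) (nat k) else 0)" by (simp only: diff_zero power_int_0_right mult_1_left)
  then show ?thesis
  proof (rule lau_cong[OF _ zero_less_one])
    fix t :: complex assume "norm t < 1"
    then have "1 + t \<noteq> 0" by (metis add_eq_0_iff less_irrefl norm_minus_cancel norm_one)
    then show "(1 + t) powr of_real (of_int l) = (1 + t) powi l" by (rule powr_of_real_int)
  qed
qed

text \<open>Subtracting from $\Phi$ its principal parts at 0 and 1 leaves an entire function of polynomial growth, which
  is a polynomial. So $\Phi$ is the sum of a Laurent polynomial with coefficients \<open>e\<close> and the polar terms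
  $q_j(z-1)^{-j}$, each of which is expanded at the three points.\<close>

lemma three_point_expansion:
  assumes hol: "\<Phi> holomorphic_on - {0, 1}"
    and C: "lau \<Phi> C" and B: "lau (\<lambda>t. \<Phi> (1 + t)) B" and A: "lau (\<lambda>w. \<Phi> (inverse w)) (\<lambda>k. A (- k))"
  obtains K :: nat and e :: "int \<Rightarrow> complex" and q :: "nat \<Rightarrow> complex" where
    "\<And>k. A k = e k + (\<Sum>j=1..K. q j * (if - k \<ge> int j then fps_nth (bin_neg (- real j)) (nat (- k - int j)) else 0))"
    "\<And>k. C k = e k + (\<Sum>j=1..K. q j * (if k \<ge> 0 then (-1) ^ j * fps_nth (bin_neg (- real j)) (nat k) else 0))"
    "\<And>k. B k = (\<Sum>l\<in>{- int K..int K}. e l * (if k \<ge> 0 then fps_nth (bin_pos (of_int l)) (nat k) else 0)) +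
        (\<Sum>j=1..K. q j * (if k = - int j then 1 else 0))"
    "\<And>k. \<bar>k\<bar> > int K ==> e k = 0"
proof -
  obtain K0 K1 K2 :: nat where K012: "\<And>k. k < - int K0 ==> C k = 0" "\<And>k. k < - int K1 ==> B k = 0"
    "\<And>k. k < - int K2 ==> A (- k) = 0"
    using A B C unfolding lau_def by blast
  define K where "K = K0 + K1 + K2"
  have K: "\<And>k. k < - int K ==> C k = 0" "\<And>k. k < - int K ==> B k = 0" "\<And>k. k < - int K ==> A (- k) = 0"
    by (auto simp: K_def intro!: K012)
  define P where "P z = (\<Sum>j=1..K. C (- int j) * z powi (- int j))" for z
  define Q where "Q z = (\<Sum>j=1..K. B (- int j) * z powi (- int j))" for z
  obtain r0 G0 where G0: "r0 > 0" "G0 holomorphic_on ball 0 r0"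
    "\<And>z. 0 < norm z ==> norm z < r0 ==> \<Phi> z = G0 z + P z"
    using lau_holomorphic_part[OF C K(1)] unfolding P_def by blast
  obtain r1 G1 where G1: "r1 > 0" "G1 holomorphic_on ball 0 r1"
    "\<And>t. 0 < norm t ==> norm t < r1 ==> \<Phi> (1 + t) = G1 t + Q t"
    using lau_holomorphic_part[OF B K(2)] unfolding Q_def by blast
  obtain r2 G2 where G2: "r2 > 0" "G2 holomorphic_on ball 0 r2"
    "\<And>w. 0 < norm w ==> norm w < r2 ==> \<Phi> (inverse w) = G2 w + (\<Sum>j=1..K. A (int j) * w powi (- int j))"
    using lau_holomorphic_part[OF A K(3)] by (metis (no_types, lifting) minus_minus sum.cong)
  have P: "P holomorphic_on S" if "0 \<notin> S" for S
    unfolding P_def using that by (intro holomorphic_intros) auto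
  have Q: "(\<lambda>z. Q (z - 1)) holomorphic_on S" if "1 \<notin> S" for S
    unfolding Q_def using that by (intro holomorphic_intros) auto
  \<comment> \<open>$\Phi$ minus its principal parts, with the removable singularities filled in.\<close>
  define E where "E z = (if z = 0 then G0 0 - Q (- 1) else if z = 1 then G1 0 - P 1 else \<Phi> z - P z - Q (z - 1))" for z
  have "E holomorphic_on - {0, 1}"
    by (rule holomorphic_transform[of "\<lambda>z. \<Phi> z - P z - Q (z - 1)"])
      (auto simp: E_def intro!: holomorphic_intros hol P Q)
  moreover have "E holomorphic_on ball 0 (min r0 1)"
  proof (rule holomorphic_transform[of "\<lambda>z. G0 z - Q (z - 1)"])
    show "(\<lambda>z. G0 z - Q (z - 1)) holomorphic_on ball 0 (min r0 1)"
      by (intro holomorphic_intros Q holomorphic_on_subset[OF G0(2)]) auto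
    fix z :: complex assume "z \<in> ball 0 (min r0 1)"
    then show "G0 z - Q (z - 1) = E z" using G0(3)[of z] by (auto simp: E_def)
  qed
  moreover have "E holomorphic_on ball 1 (min r1 1)"
  proof (rule holomorphic_transform[of "\<lambda>z. G1 (z - 1) - P z"])
    have "(G1 \<circ> (\<lambda>z. z - 1)) holomorphic_on ball 1 (min r1 1)"
      by (rule holomorphic_on_compose_gen[OF _ G1(2)]) (auto intro!: holomorphic_intros simp: dist_norm norm_minus_commute)
    then show "(\<lambda>z. G1 (z - 1) - P z) holomorphic_on ball 1 (min r1 1)"
      by (intro holomorphic_intros P) (auto simp: o_def)
    fix z :: complex assume "z \<in> ball 1 (min r1 1)"
    then show "G1 (z - 1) - P z = E z" using G1(3)[of "z - 1"] by (auto simp: E_def dist_norm norm_minus_commute)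
  qed
  ultimately have "E holomorphic_on (- {0, 1} \<union> ball 0 (min r0 1)) \<union> ball 1 (min r1 1)"
    by (intro holomorphic_on_Un) (auto simp: open_Compl)
  moreover have "(- {0, 1} \<union> ball 0 (min r0 1)) \<union> ball 1 (min r1 1) = (UNIV :: complex set)"
    using G0(1) G1(1) by auto
  ultimately have E: "E holomorphic_on UNIV" by simp
  have "compact (cball (0::complex) (r2 / 2))" "continuous_on (cball 0 (r2 / 2)) G2"
    using G2(1) by (auto intro!: holomorphic_on_imp_continuous_on holomorphic_on_subset[OF G2(2)])
  then have "bounded (G2 ` cball 0 (r2 / 2))" by (intro compact_imp_bounded compact_continuous_image)
  then obtain M where M: "\<And>w. norm w \<le> r2 / 2 ==> norm (G2 w) \<le> M"
    unfolding bounded_iff by (metis image_eqI mem_cball_0)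
  define M' where "M' = M + (\<Sum>j=1..K. norm (A (int j))) + (\<Sum>j=1..K. norm (C (- int j))) + (\<Sum>j=1..K. norm (B (- int j)))"
  have growth: "norm (E z) \<le> M' * norm z ^ K" if z: "max 2 (2 / r2) \<le> norm z" for z
  proof -
    have z2: "norm z \<ge> 2" "norm z \<ge> 2 / r2" using z by auto
    then have z0: "z \<noteq> 0" "z \<noteq> 1" by auto
    have z1: "norm z ^ K \<ge> 1" "norm z \<ge> 1" using z2 by (auto intro: one_le_power)
    have zm1: "norm (z - 1) \<ge> 1" using norm_triangle_ineq2[of z 1] z2 by simp
    have small: "norm (x powi (- int j)) \<le> 1" if "norm x \<ge> 1" for x :: complex and j
      using that by (simp add: power_int_minus norm_inverse norm_power inverse_le_1_iff one_le_power)
    have "norm (inverse z) \<le> r2 / 2"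
    proof -
      have "2 \<le> r2 * norm z" using z2(2) G2(1) by (simp add: pos_divide_le_eq mult.commute)
      then have "inverse (norm z) * 2 \<le> inverse (norm z) * (r2 * norm z)" using z0 by (intro mult_left_mono) auto
      moreover have "inverse (norm z) * (r2 * norm z) = r2" using z0 by simp
      ultimately show ?thesis by (simp add: norm_inverse)
    qed
    moreover from this have "norm (inverse z) < r2" using G2(1) by simp
    moreover have "inverse z powi (- int j) = z ^ j" for j
      using z0 by (simp add: power_int_minus power_inverse)
    ultimately have "\<Phi> z = G2 (inverse z) + (\<Sum>j=1..K. A (int j) * z ^ j)" "norm (G2 (inverse z)) \<le> M"
      using G2(3)[of "inverse z"] M[of "inverse z"] z0 by simp_all
    moreover have "norm (\<Sum>j=1..K. A (int j) * z ^ j) \<le> (\<Sum>j=1..K. norm (A (int j)) * norm z ^ K)"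
      using z1 by (intro sum_norm_le) (auto simp: norm_mult norm_power intro!: mult_left_mono power_increasing)
    ultimately have "norm (G2 (inverse z) + (\<Sum>j=1..K. A (int j) * z ^ j)) \<le> M + (\<Sum>j=1..K. norm (A (int j)) * norm z ^ K)"
      using norm_triangle_ineq[of "G2 (inverse z)" "\<Sum>j=1..K. A (int j) * z ^ j"] by linarith
    with \<open>\<Phi> z = _\<close> have "norm (\<Phi> z) \<le> M + (\<Sum>j=1..K. norm (A (int j)) * norm z ^ K)" by (simp only:)
    moreover have "M \<ge> 0" using M[of 0] G2(1) norm_ge_zero[of "G2 0"] by (simp del: norm_ge_zero)
    then have "M \<le> M * norm z ^ K" using z1 by (simp add: mult_le_cancel_left1)
    ultimately have 1: "norm (\<Phi> z) \<le> (M + (\<Sum>j=1..K. norm (A (int j)))) * norm z ^ K"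
      by (simp add: distrib_right sum_distrib_right)
    have "norm (P z) \<le> (\<Sum>j=1..K. norm (C (- int j)) * 1)"
      unfolding P_def norm_mult[symmetric] using small[OF z1(2)] by (intro sum_norm_le) (simp add: norm_mult mult_left_le)
    also have "\<dots> \<le> (\<Sum>j=1..K. norm (C (- int j))) * norm z ^ K"
      unfolding sum_distrib_right[symmetric] by (intro mult_left_mono z1 sum_nonneg norm_ge_zero)
    finally have 2: "norm (P z) \<le> (\<Sum>j=1..K. norm (C (- int j))) * norm z ^ K" .
    have "norm (Q (z - 1)) \<le> (\<Sum>j=1..K. norm (B (- int j)) * 1)"
      unfolding Q_def norm_mult[symmetric] using small[OF zm1] by (intro sum_norm_le) (simp add: norm_mult mult_left_le)
    also have "\<dots> \<le> (\<Sum>j=1..K. norm (B (- int j))) * norm z ^ K"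
      unfolding sum_distrib_right[symmetric] by (intro mult_left_mono z1 sum_nonneg norm_ge_zero)
    finally have 3: "norm (Q (z - 1)) \<le> (\<Sum>j=1..K. norm (B (- int j))) * norm z ^ K" .
    have "norm (E z) \<le> norm (\<Phi> z) + norm (P z) + norm (Q (z - 1))"
      using z0 norm_triangle_ineq4[of "\<Phi> z - P z" "Q (z - 1)"] norm_triangle_ineq4[of "\<Phi> z" "P z"]
      by (simp add: E_def)
    then show ?thesis using 1 2 3 by (simp add: M'_def algebra_simps)
  qed
  define \<psi> where "\<psi> k = (deriv ^^ k) E 0 / fact k" for k
  have poly: "E z = (\<Sum>k\<le>K. \<psi> k * z ^ k)" for z
    unfolding \<psi>_def by (rule Liouville_polynomial[OF E growth])
  define e where "e k = (if k < 0 then C k else if k \<le> int K then \<psi> (nat k) else 0)" for k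
  define q where "q j = B (- int j)" for j
  have sum_split: "(\<Sum>l\<in>{- int K..int K}. e l * f l) = (\<Sum>k\<le>K. \<psi> k * f (int k)) + (\<Sum>j=1..K. C (- int j) * f (- int j))" for f :: "int \<Rightarrow> complex"
  proof -
    have "{- int K..int K} = int ` {..K} \<union> (\<lambda>j. - int j) ` {1..K}"
    proof (intro set_eqI iffI)
      fix l assume l: "l \<in> {- int K..int K}"
      show "l \<in> int ` {..K} \<union> (\<lambda>j. - int j) ` {1..K}"
      proof (cases "l \<ge> 0")
        case True then show ?thesis using l by (intro UnI1 image_eqI[of _ _ "nat l"]) auto
      next
        case False then show ?thesis using l by (intro UnI2 image_eqI[of _ _ "nat (- l)"]) auto
      qed
    qed auto
    then have "(\<Sum>l\<in>{- int K..int K}. e l * f l) = (\<Sum>l\<in>int ` {..K}. e l * f l) + (\<Sum>l\<in>(\<lambda>j. - int j) ` {1..K}. e l * f l)"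
      by (simp only:) (rule sum.union_disjoint, auto)
    also have "(\<Sum>l\<in>int ` {..K}. e l * f l) = (\<Sum>k\<le>K. \<psi> k * f (int k))"
      by (subst sum.reindex) (auto simp: e_def)
    also have "(\<Sum>l\<in>(\<lambda>j. - int j) ` {1..K}. e l * f l) = (\<Sum>j=1..K. C (- int j) * f (- int j))"
      by (subst sum.reindex) (auto simp: e_def inj_on_def intro!: sum.cong)
    finally show ?thesis .
  qed
  have \<Phi>: "\<Phi> z = (\<Sum>l\<in>{- int K..int K}. e l * z powi l) + (\<Sum>j=1..K. q j * (z - 1) powi (- int j))" if "z \<noteq> 0" "z \<noteq> 1" for z
    using poly[of z] that unfolding sum_split by (simp add: E_def P_def Q_def q_def algebra_simps)
  have e_sum: "(\<Sum>l\<in>{- int K..int K}. e l * (if k = l then 1 else 0)) = e k" for k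
  proof -
    have "(\<Sum>l\<in>{- int K..int K}. e l * (if k = l then 1 else 0)) = (\<Sum>l\<in>{- int K..int K}. if l = k then e k else 0)"
      by (rule sum.cong) auto
    also have "\<dots> = (if k \<in> {- int K..int K} then e k else 0)" by (simp add: sum.delta)
    also have "\<dots> = e k" using K(1)[of k] by (auto simp: e_def)
    finally show ?thesis .
  qed
  show ?thesis
  proof (rule that)
    have "lau (\<lambda>z. (\<Sum>l\<in>{- int K..int K}. e l * z powi l) + (\<Sum>j=1..K. q j * (z - 1) powi (- int j)))
      (\<lambda>k. (\<Sum>l\<in>{- int K..int K}. e l * (if k = l then 1 else 0)) +
        (\<Sum>j=1..K. q j * (if k \<ge> 0 then (-1) ^ j * fps_nth (bin_neg (- real j)) (nat k) else 0)))"
      by (intro lau_add lau_sum lau_scale lau_powi lau_pole_at_0) auto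
    then have "lau \<Phi> (\<lambda>k. (\<Sum>l\<in>{- int K..int K}. e l * (if k = l then 1 else 0)) +
        (\<Sum>j=1..K. q j * (if k \<ge> 0 then (-1) ^ j * fps_nth (bin_neg (- real j)) (nat k) else 0)))"
      by (rule lau_cong[OF _ zero_less_one]) (subst \<Phi>, auto)
    from lau_unique[OF C this]
    show "C k = e k + (\<Sum>j=1..K. q j * (if k \<ge> 0 then (-1) ^ j * fps_nth (bin_neg (- real j)) (nat k) else 0))" for k
      unfolding e_sum by (rule fun_cong)
    have "lau (\<lambda>w. (\<Sum>l\<in>{- int K..int K}. e l * w powi (- l)) + (\<Sum>j=1..K. q j * (inverse w - 1) powi (- int j)))
      (\<lambda>k. (\<Sum>l\<in>{- int K..int K}. e l * (if k = - l then 1 else 0)) +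
        (\<Sum>j=1..K. q j * (if k \<ge> int j then fps_nth (bin_neg (- real j)) (nat (k - int j)) else 0)))"
      by (intro lau_add lau_sum lau_scale lau_powi lau_pole_at_inf) auto
    then have "lau (\<lambda>w. \<Phi> (inverse w)) (\<lambda>k. (\<Sum>l\<in>{- int K..int K}. e l * (if k = - l then 1 else 0)) +
        (\<Sum>j=1..K. q j * (if k \<ge> int j then fps_nth (bin_neg (- real j)) (nat (k - int j)) else 0)))"
    proof (rule lau_cong[OF _ zero_less_one])
      fix w :: complex assume "0 < norm w" "norm w < 1"
      then have "inverse w \<noteq> 0" "inverse w \<noteq> 1" by (auto simp: inverse_eq_1_iff)
      from \<Phi>[OF this] show "(\<Sum>l\<in>{- int K..int K}. e l * w powi (- l)) + (\<Sum>j=1..K. q j * (inverse w - 1) powi (- int j)) = \<Phi> (inverse w)"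
        by (simp only: power_int_inverse power_int_minus)
    qed
    from fun_cong[OF lau_unique[OF A this], of "- k" for k]
    have "A (- (- k)) = (\<Sum>l\<in>{- int K..int K}. e l * (if - k = - l then 1 else 0)) +
        (\<Sum>j=1..K. q j * (if - k \<ge> int j then fps_nth (bin_neg (- real j)) (nat (- k - int j)) else 0))" for k .
    then show "A k = e k + (\<Sum>j=1..K. q j * (if - k \<ge> int j then fps_nth (bin_neg (- real j)) (nat (- k - int j)) else 0))" for k
      unfolding neg_equal_iff_equal e_sum minus_minus .
    have "lau (\<lambda>t. (\<Sum>l\<in>{- int K..int K}. e l * (1 + t) powi l) + (\<Sum>j=1..K. q j * t powi (- int j)))
      (\<lambda>k. (\<Sum>l\<in>{- int K..int K}. e l * (if k \<ge> 0 then fps_nth (bin_pos (of_int l)) (nat k) else 0)) +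
        (\<Sum>j=1..K. q j * (if k = - int j then 1 else 0)))"
      by (intro lau_add lau_sum lau_scale lau_powi lau_powi_at_1) auto
    then have "lau (\<lambda>t. \<Phi> (1 + t)) (\<lambda>k. (\<Sum>l\<in>{- int K..int K}. e l * (if k \<ge> 0 then fps_nth (bin_pos (of_int l)) (nat k) else 0)) +
        (\<Sum>j=1..K. q j * (if k = - int j then 1 else 0)))"
    proof (rule lau_cong[OF _ zero_less_one])
      fix t :: complex assume t: "0 < norm t" "norm t < 1"
      then have "1 + t \<noteq> 0" by (metis add_eq_0_iff less_irrefl norm_minus_cancel norm_one)
      moreover have "1 + t \<noteq> 1" using t by auto
      ultimately show "(\<Sum>l\<in>{- int K..int K}. e l * (1 + t) powi l) + (\<Sum>j=1..K. q j * t powi (- int j)) = \<Phi> (1 + t)"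
        using \<Phi>[of "1 + t"] by simp
    qed
    from lau_unique[OF B this]
    show "B k = (\<Sum>l\<in>{- int K..int K}. e l * (if k \<ge> 0 then fps_nth (bin_pos (of_int l)) (nat k) else 0)) +
        (\<Sum>j=1..K. q j * (if k = - int j then 1 else 0))" for k by (rule fun_cong)
    show "e k = 0" if "\<bar>k\<bar> > int K" for k using that K(1)[of k] by (auto simp: e_def)
  qed
qed

lemma choose_sym: "(a + b) choose a = (a + b) choose (b :: nat)"
  using binomial_symmetric[of a "a + b"] by simp

lemma bin_neg_minus_nth:
  assumes "j \<ge> 1"
  shows "fps_nth (bin_neg (- real j)) n = of_nat ((j + n - 1) choose n)"
proof -
  have "(- real j gchoose n) = (-1) ^ n * (real j + of_nat n - 1 gchoose n)" by (rule gbinomial_minus)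
  also have "real j + of_nat n - 1 = real (j + n - 1)" using assms by (simp add: of_nat_diff)
  also have "(real (j + n - 1) gchoose n) = real ((j + n - 1) choose n)" by (rule binomial_gbinomial[symmetric])
  finally have "(- real j gchoose n) = (-1) ^ n * real ((j + n - 1) choose n)" .
  then show ?thesis by (simp add: bin_neg_nth flip: power_mult_distrib mult.assoc)
qed

text \<open>Both sides are linear in $\Phi$. The Laurent polynomial part contributes equally to \<open>A\<close> and \<open>C\<close>, and the
  difference of the two expansions of $(z-1)^{-j}$ has the coefficients ${n\choose j-1}$.\<close>

lemma three_point_commutator:
  assumes hol: "\<Phi> holomorphic_on - {0, 1}"
    and C: "lau \<Phi> C" and B: "lau (\<lambda>t. \<Phi> (1 + t)) B" and A: "lau (\<lambda>w. \<Phi> (inverse w)) (\<lambda>k. A (- k))"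
  shows "A (- n - 1) - C (- n - 1) = Sum_any (\<lambda>j::nat. of_real (of_int n gchoose j) * B (- int j - 1))"
proof -
  obtain K :: nat and e :: "int \<Rightarrow> complex" and q :: "nat \<Rightarrow> complex" where
    A: "\<And>k. A k = e k + (\<Sum>j=1..K. q j * (if - k \<ge> int j then fps_nth (bin_neg (- real j)) (nat (- k - int j)) else 0))" and
    C: "\<And>k. C k = e k + (\<Sum>j=1..K. q j * (if k \<ge> 0 then (-1) ^ j * fps_nth (bin_neg (- real j)) (nat k) else 0))" and
    B: "\<And>k. B k = (\<Sum>l\<in>{- int K..int K}. e l * (if k \<ge> 0 then fps_nth (bin_pos (of_int l)) (nat k) else 0)) +
        (\<Sum>j=1..K. q j * (if k = - int j then 1 else 0))"
    by (rule three_point_expansion[OF assms]) blast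
  have B': "B (- int i - 1) = (if i < K then q (Suc i) else 0)" for i
  proof -
    have "(\<Sum>j=1..K. q j * (if - int i - 1 = - int j then 1 else 0)) = (\<Sum>j=1..K. if j = Suc i then q (Suc i) else 0)"
      by (rule sum.cong) auto
    then show ?thesis unfolding B by (simp add: sum.delta)
  qed
  have "Sum_any (\<lambda>j::nat. of_real (of_int n gchoose j) * B (- int j - 1)) = (\<Sum>j<K. of_real (of_int n gchoose j) * B (- int j - 1))"
    by (rule Sum_any.expand_superset) (auto simp: B')
  also have "\<dots> = (\<Sum>j<K. of_real (of_int n gchoose j) * q (Suc j))" by (rule sum.cong) (auto simp: B')
  also have "\<dots> = (\<Sum>j=1..K. of_real (of_int n gchoose (j - 1)) * q j)"
    by (rule sum.reindex_bij_witness[of _ "\<lambda>j. j - 1" Suc]) auto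
  also have "\<dots> = (\<Sum>j=1..K. q j * (if - (- n - 1) \<ge> int j then fps_nth (bin_neg (- real j)) (nat (- (- n - 1) - int j)) else 0)) -
     (\<Sum>j=1..K. q j * (if - n - 1 \<ge> 0 then (-1) ^ j * fps_nth (bin_neg (- real j)) (nat (- n - 1)) else 0))"
    unfolding sum_subtractf[symmetric]
  proof (rule sum.cong[OF refl])
    fix j assume j: "j \<in> {1..K}"
    have "complex_of_real (of_int n gchoose (j - 1)) =
       (if - (- n - 1) \<ge> int j then fps_nth (bin_neg (- real j)) (nat (- (- n - 1) - int j)) else 0) -
       (if - n - 1 \<ge> 0 then (-1) ^ j * fps_nth (bin_neg (- real j)) (nat (- n - 1)) else 0)"
    proof (cases "n \<ge> 0")
      case True
      then obtain m where n: "n = int m" by (metis nonneg_int_cases)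
      have g: "of_int n gchoose (j - 1) = real (m choose (j - 1))" by (simp add: n binomial_gbinomial)
      show ?thesis
      proof (cases "j \<le> Suc m")
        case True
        have m: "m = (j - 1) + (Suc m - j)" using j True by simp
        have "fps_nth (bin_neg (- real j)) (Suc m - j) = of_nat ((j + (Suc m - j) - 1) choose (Suc m - j))"
          using j by (intro bin_neg_minus_nth) simp
        also have "j + (Suc m - j) - 1 = (j - 1) + (Suc m - j)" using j by simp
        also have "((j - 1) + (Suc m - j)) choose (Suc m - j) = ((j - 1) + (Suc m - j)) choose (j - 1)"
          by (rule choose_sym[symmetric])
        finally have "fps_nth (bin_neg (- real j)) (Suc m - j) = of_nat (m choose (j - 1))"
          by (simp only: m[symmetric])
        moreover have "nat (- (- n - 1) - int j) = Suc m - j" using True by (simp add: n nat_diff_distrib')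
        ultimately show ?thesis using True by (simp only: g) (simp add: n)
      next
        case False
        then have "m choose (j - 1) = 0" by (intro binomial_eq_0) auto
        then have g0: "of_int n gchoose (j - 1) = (0 :: real)" using g by simp
        show ?thesis using False by (simp only: g0) (simp add: n)
      qed
    next
      case False
      define k where "k = nat (- n - 1)"
      have n: "n = - int (Suc k)" using False by (simp add: k_def)
      have "(of_int n gchoose (j - 1)) = (- real (Suc k) gchoose (j - 1))" by (simp add: n)
      also have "\<dots> = (-1) ^ (j - 1) * (real (Suc k) + of_nat (j - 1) - 1 gchoose (j - 1))" by (rule gbinomial_minus)
      also have "real (Suc k) + of_nat (j - 1) - 1 = real (j + k - 1)" using j by (simp add: of_nat_diff)
      also have "(real (j + k - 1) gchoose (j - 1)) = real ((j + k - 1) choose (j - 1))" by (rule binomial_gbinomial[symmetric])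
      also have "(j + k - 1) choose (j - 1) = (j + k - 1) choose k"
        using choose_sym[of "j - 1" k] j by simp
      finally have "of_int n gchoose (j - 1) = (-1) ^ (j - 1) * real ((j + k - 1) choose k)" .
      moreover have "(-1 :: complex) ^ j = - ((-1) ^ (j - 1))" using j by (cases j) auto
      ultimately show ?thesis using j False by (simp add: bin_neg_minus_nth k_def)
    qed
    then show "of_real (of_int n gchoose (j - 1)) * q j =
       q j * (if - (- n - 1) \<ge> int j then fps_nth (bin_neg (- real j)) (nat (- (- n - 1) - int j)) else 0) -
       q j * (if - n - 1 \<ge> 0 then (-1) ^ j * fps_nth (bin_neg (- real j)) (nat (- n - 1)) else 0)"
      by (simp only: right_diff_distrib[symmetric] mult.commute)
  qed
  also have "\<dots> = A (- n - 1) - C (- n - 1)" unfolding A C by simp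
  finally show ?thesis by simp
qed

text \<open>Only the Laurent polynomial part contributes to the coefficients of nonnegative powers of $z-1$ and to those
  coefficients of \<open>A\<close> and \<open>C\<close> which occur here. The exponents $l\ge0$ give the terms in \<open>A\<close>, and
  $l<0$ those in \<open>C\<close>, by ${-j-1\choose p-1}=(-1)^{p-1}{p+j-1\choose j}$.\<close>

lemma three_point_iterate:
  assumes hol: "\<Phi> holomorphic_on - {0, 1}"
    and C: "lau \<Phi> C" and B: "lau (\<lambda>t. \<Phi> (1 + t)) B" and A: "lau (\<lambda>w. \<Phi> (inverse w)) (\<lambda>k. A (- k))"
    and p: "p \<ge> 1"
  shows "B (int p - 1) = Sum_any (\<lambda>j::nat. of_nat ((p + j - 1) choose j) * (A (int (p + j) - 1) - (-1) ^ p * C (- int j - 1)))"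
proof -
  obtain K :: nat and e :: "int \<Rightarrow> complex" and q :: "nat \<Rightarrow> complex" where
    A: "\<And>k. A k = e k + (\<Sum>j=1..K. q j * (if - k \<ge> int j then fps_nth (bin_neg (- real j)) (nat (- k - int j)) else 0))" and
    C: "\<And>k. C k = e k + (\<Sum>j=1..K. q j * (if k \<ge> 0 then (-1) ^ j * fps_nth (bin_neg (- real j)) (nat k) else 0))" and
    B: "\<And>k. B k = (\<Sum>l\<in>{- int K..int K}. e l * (if k \<ge> 0 then fps_nth (bin_pos (of_int l)) (nat k) else 0)) +
        (\<Sum>j=1..K. q j * (if k = - int j then 1 else 0))" and
    e: "\<And>k. \<bar>k\<bar> > int K ==> e k = 0"
    by (rule three_point_expansion[OF assms(1-4)]) blast
  have A': "A (int (p + j) - 1) = e (int (p + j) - 1)" for j unfolding A using p by (auto intro!: sum.neutral)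
  have C': "C (- int j - 1) = e (- int j - 1)" for j unfolding C by (auto intro!: sum.neutral)
  have "B (int p - 1) = (\<Sum>l\<in>{- int K..int K}. e l * fps_nth (bin_pos (of_int l)) (p - 1))"
  proof -
    have "nat (int p - 1) = p - 1" using p by simp
    moreover have "(\<Sum>j=1..K. q j * (if int p - 1 = - int j then 1 else 0)) = 0" using p by (intro sum.neutral) auto
    ultimately show ?thesis unfolding B using p by simp
  qed
  also have "\<dots> = (\<Sum>l\<in>{0..int K}. e l * fps_nth (bin_pos (of_int l)) (p - 1)) + (\<Sum>l\<in>{- int K..-1}. e l * fps_nth (bin_pos (of_int l)) (p - 1))"
  proof -
    have "{- int K..int K} = {0..int K} \<union> {- int K..-1}" by auto
    then show ?thesis by (simp only:) (rule sum.union_disjoint, auto)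
  qed
  also have "(\<Sum>l\<in>{0..int K}. e l * fps_nth (bin_pos (of_int l)) (p - 1)) = (\<Sum>j\<le>K. of_nat ((p + j - 1) choose j) * e (int (p + j) - 1))"
  proof -
    have "(\<Sum>j\<le>K. of_nat ((p + j - 1) choose j) * e (int (p + j) - 1)) = (\<Sum>l\<in>{int p - 1..int (p + K) - 1}. e l * fps_nth (bin_pos (of_int l)) (p - 1))"
    proof (rule sum.reindex_bij_witness[of _ "\<lambda>l. nat (l - (int p - 1))" "\<lambda>j. int (p + j) - 1"])
      fix j assume "j \<in> {..K}"
      have "real_of_int (int (p + j) - 1) = real (p + j - 1)" using p by (simp add: of_nat_diff)
      moreover have "(p + j - 1) choose (p - 1) = (p + j - 1) choose j"
        using choose_sym[of "p - 1" j] p by simp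
      ultimately have "fps_nth (bin_pos (of_int (int (p + j) - 1))) (p - 1) = of_nat ((p + j - 1) choose j)"
        by (simp only: bin_pos_nth binomial_gbinomial[symmetric] of_real_of_nat_eq)
      then show "e (int (p + j) - 1) * fps_nth (bin_pos (of_int (int (p + j) - 1))) (p - 1) = of_nat ((p + j - 1) choose j) * e (int (p + j) - 1)"
        by (simp only: mult.commute)
    qed (use p in auto)
    also have "\<dots> = (\<Sum>l\<in>{0..int (p + K) - 1}. e l * fps_nth (bin_pos (of_int l)) (p - 1))"
    proof (rule sum.mono_neutral_left)
      show "\<forall>l\<in>{0..int (p + K) - 1} - {int p - 1..int (p + K) - 1}. e l * fps_nth (bin_pos (of_int l)) (p - 1) = 0"
      proof
        fix l assume l: "l \<in> {0..int (p + K) - 1} - {int p - 1..int (p + K) - 1}"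
        then have "real_of_int l = real (nat l)" by simp
        then have "(real_of_int l gchoose (p - 1)) = real (nat l choose (p - 1))" by (simp only: binomial_gbinomial)
        also have "nat l choose (p - 1) = 0" using l by (intro binomial_eq_0) auto
        finally show "e l * fps_nth (bin_pos (of_int l)) (p - 1) = 0" by (simp add: bin_pos_nth)
      qed
    qed (use p in auto)
    also have "\<dots> = (\<Sum>l\<in>{0..int K}. e l * fps_nth (bin_pos (of_int l)) (p - 1))"
      using p by (intro sum.mono_neutral_right) (auto simp: e)
    finally show ?thesis by simp
  qed
  also have "(\<Sum>l\<in>{- int K..-1}. e l * fps_nth (bin_pos (of_int l)) (p - 1)) = (\<Sum>j\<le>K. of_nat ((p + j - 1) choose j) * (- ((-1) ^ p * e (- int j - 1))))"
  proof -
    have "(\<Sum>j<K. of_nat ((p + j - 1) choose j) * (- ((-1) ^ p * e (- int j - 1)))) = (\<Sum>l\<in>{- int K..-1}. e l * fps_nth (bin_pos (of_int l)) (p - 1))"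
    proof (rule sum.reindex_bij_witness[of _ "\<lambda>l. nat (- l - 1)" "\<lambda>j. - int j - 1"])
      fix j assume "j \<in> {..<K}"
      have "real_of_int (- int j - 1) = - real (Suc j)" by simp
      then have "(of_int (- int j - 1) gchoose (p - 1)) = (- real (Suc j) gchoose (p - 1))" by (simp only:)
      also have "\<dots> = (-1) ^ (p - 1) * (real (Suc j) + of_nat (p - 1) - 1 gchoose (p - 1))" by (rule gbinomial_minus)
      also have "real (Suc j) + of_nat (p - 1) - 1 = real (p + j - 1)" using p by (simp add: of_nat_diff)
      also have "(real (p + j - 1) gchoose (p - 1)) = real ((p + j - 1) choose (p - 1))" by (rule binomial_gbinomial[symmetric])
      also have "(p + j - 1) choose (p - 1) = (p + j - 1) choose j"
        using choose_sym[of "p - 1" j] p by simp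
      finally have "fps_nth (bin_pos (of_int (- int j - 1))) (p - 1) = (-1) ^ (p - 1) * of_nat ((p + j - 1) choose j)"
        by (simp add: bin_pos_nth)
      moreover have "(-1 :: complex) ^ p = - ((-1) ^ (p - 1))" using p by (cases p) auto
      ultimately show "e (- int j - 1) * fps_nth (bin_pos (of_int (- int j - 1))) (p - 1) =
          of_nat ((p + j - 1) choose j) * (- ((-1) ^ p * e (- int j - 1)))"
        by (simp only: minus_mult_left[symmetric] minus_mult_right[symmetric] minus_minus mult_ac)
    qed auto
    moreover have "{..K} = insert K {..<K}" by auto
    ultimately show ?thesis by (simp add: e)
  qed
  also have "(\<Sum>j\<le>K. of_nat ((p + j - 1) choose j) * e (int (p + j) - 1)) + (\<Sum>j\<le>K. of_nat ((p + j - 1) choose j) * (- ((-1) ^ p * e (- int j - 1))))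
     = (\<Sum>j\<le>K. of_nat ((p + j - 1) choose j) * (A (int (p + j) - 1) - (-1) ^ p * C (- int j - 1)))"
    unfolding A' C' sum.distrib[symmetric] by (simp add: algebra_simps)
  also have "\<dots> = Sum_any (\<lambda>j::nat. of_nat ((p + j - 1) choose j) * (A (int (p + j) - 1) - (-1) ^ p * C (- int j - 1)))"
  proof (rule Sum_any.expand_superset[symmetric])
    show "{j. of_nat ((p + j - 1) choose j) * (A (int (p + j) - 1) - (-1) ^ p * C (- int j - 1)) \<noteq> 0} \<subseteq> {..K}"
    proof (rule subsetI, rule ccontr)
      fix j assume nz: "j \<in> {j. of_nat ((p + j - 1) choose j) * (A (int (p + j) - 1) - (-1) ^ p * C (- int j - 1)) \<noteq> 0}" and "j \<notin> {..K}"
      then have "e (int (p + j) - 1) = 0" "e (- int j - 1) = 0" using p by (auto intro!: e)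
      then show False using nz A'[of j] C'[of j] by simp
    qed
  qed simp
  finally show ?thesis .
qed

lemma cpow2_inverse:
  assumes "z \<noteq> 0" "s - s' \<in> \<int>"
  shows "cpow2 (inverse z) (- s) (- s') = cpow2 z s s'"
proof -
  obtain m where "s - s' = of_int m" using assms(2) by (auto elim: Ints_cases)
  then have e: "s = s' + of_int m" by simp
  have "- s = - s' + of_int (- m)" by (simp add: e)
  then have "cpow2 (inverse z) (- s) (- s') = of_real ((norm (inverse z))\<^sup>2 powr (- s')) * inverse z powi (- m)"
    by (simp only: cpow2_of_int)
  also have "(norm (inverse z))\<^sup>2 powr (- s') = (norm z)\<^sup>2 powr s'"
    using assms(1) by (simp add: norm_inverse power_inverse inverse_powr powr_minus)
  also have "inverse z powi (- m) = z powi m" by (simp add: power_int_inverse power_int_minus)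
  finally show ?thesis unfolding e cpow2_of_int .
qed

lemma cpow2_powr:
  assumes "z \<noteq> 0" "\<alpha> - \<beta> \<in> \<int>"
  shows "cpow2 z \<alpha> \<beta> = z powr of_real \<alpha> * cnj (z powr of_real \<beta>)"
proof -
  obtain m where "\<alpha> - \<beta> = of_int m" using assms(2) by (auto elim: Ints_cases)
  then have e: "\<alpha> = \<beta> + of_int m" by simp
  have "z powr of_real \<alpha> = z powr of_real \<beta> * z powi m"
    using powr_of_real_int[OF assms(1), of m] by (simp add: e powr_add)
  moreover have "z powr of_real \<beta> * cnj (z powr of_real \<beta>) = of_real ((norm z)\<^sup>2 powr \<beta>)"
    using powr_mult_cnj[of "1 - z" \<beta>] by (simp only: diff_diff_eq2 add_diff_cancel_left')
  ultimately show ?thesis unfolding e cpow2_of_int by (simp add: mult_ac)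
qed

lemma real_analytic_on_mult_cpow2:
  assumes "real_analytic_on f (- {0, 1})"
  shows "real_analytic_on (\<lambda>z. f z * cpow2 z \<alpha> \<beta>) (- {0, 1})"
  unfolding real_analytic_on_iff
proof
  fix w assume w: "w \<in> - {0, 1::complex}"
  have "real_analytic_at (\<lambda>z. z powi \<lfloor>\<alpha> - \<beta>\<rfloor>) w"
  proof (rule holomorphic_imp_real_analytic_at)
    show "(\<lambda>z. z powi \<lfloor>\<alpha> - \<beta>\<rfloor>) holomorphic_on ball w (norm w)"
      by (intro holomorphic_intros) (auto simp: dist_norm)
  qed (use w in auto)
  moreover have "real_analytic_at (\<lambda>z. of_real ((norm (z - 0))\<^sup>2 powr \<beta>)) w"
    by (rule real_analytic_at_norm_powr) (use w in auto)
  ultimately have "real_analytic_at (\<lambda>z. f z * (of_real ((norm (z - 0))\<^sup>2 powr \<beta>) * z powi \<lfloor>\<alpha> - \<beta>\<rfloor>)) w"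
    by (intro real_analytic_at_mult) (use w assms in \<open>auto simp: real_analytic_on_iff\<close>)
  then show "real_analytic_at (\<lambda>z. f z * cpow2 z \<alpha> \<beta>) w" by (simp add: cpow2_def)
qed

text \<open>A convergent Laurent expansion makes the function holomorphic on a disc next to the origin.\<close>

lemma lau_holomorphic:
  assumes "real_analytic_on G (- {0, 1})" "lau G c"
  shows "G holomorphic_on - {0, 1}"
proof -
  obtain K :: nat where K: "\<And>k. k < - int K ==> c k = 0" using assms(2) unfolding lau_def by blast
  obtain r H where r: "r > 0" and H: "H holomorphic_on ball 0 r"
    "\<And>z. 0 < norm z ==> norm z < r ==> G z = H z + (\<Sum>j=1..K. c (- int j) * z powi (- int j))"
    using lau_holomorphic_part[OF assms(2) K] by blast
  define \<rho> where "\<rho> = min r 1 / 2"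
  have \<rho>: "\<rho> > 0" "2 * \<rho> \<le> r" "2 * \<rho> \<le> 1" using r by (auto simp: \<rho>_def)
  have B: "0 < norm z \<and> norm z < r \<and> norm z < 1" if "z \<in> ball (of_real \<rho>) \<rho>" for z :: complex
  proof -
    have d: "norm (z - of_real \<rho>) < \<rho>" using that by (simp add: dist_norm norm_minus_commute)
    then have "z \<noteq> 0" using \<rho> by auto
    moreover have "norm z < 2 * \<rho>" using norm_triangle_ineq[of "z - of_real \<rho>" "of_real \<rho>"] d \<rho> by simp
    ultimately show ?thesis using \<rho> by simp
  qed
  have "G holomorphic_on ball (of_real \<rho>) \<rho>"
  proof (rule holomorphic_transform)
    show "(\<lambda>z. H z + (\<Sum>j=1..K. c (- int j) * z powi (- int j))) holomorphic_on ball (of_real \<rho>) \<rho>"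
      by (intro holomorphic_intros holomorphic_on_subset[OF H(1)]) (use B in \<open>force+\<close>)
    show "H z + (\<Sum>j=1..K. c (- int j) * z powi (- int j)) = G z" if "z \<in> ball (of_real \<rho>) \<rho>" for z
      using H(2)[of z] B[OF that] by simp
  qed
  moreover have "ball (of_real \<rho>) \<rho> \<subseteq> - {0, 1 :: complex}" using B by fastforce
  ultimately show ?thesis
    using holomorphy_spreads[OF assms(1) _ connected_punctured_plane \<rho>(1)] by (simp add: open_Compl)
qed

lemma lau_neg:
  assumes "lau F c"
  shows "lau (\<lambda>z. F (- z)) (\<lambda>k. (-1) powi k * c k)"
proof -
  obtain r where r: "r > 0" "\<And>z. 0 < norm z ==> norm z < r ==> ((\<lambda>k. c k * z powi k) has_sum F z) UNIV"
    using assms unfolding lau_def by blast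
  have "((\<lambda>k. (-1) powi k * c k * z powi k) has_sum F (- z)) UNIV" if "0 < norm z" "norm z < r" for z
  proof -
    have "((\<lambda>k. c k * (- z) powi k) has_sum F (- z)) UNIV" by (rule r) (use that in auto)
    moreover have "(- z) powi k = (-1) powi k * z powi k" for k by (simp flip: power_int_mult_distrib)
    ultimately show ?thesis by (simp add: mult_ac)
  qed
  moreover obtain K :: nat where "\<And>k. k < - int K ==> c k = 0" using assms unfolding lau_def by blast
  ultimately show ?thesis unfolding lau_def using r(1) by (intro conjI exI[of _ K] exI[of _ r]) auto
qed

lemma fps_one_has_sum: "((\<lambda>n. fps_nth (1 :: complex fps) n * z ^ n) has_sum 1) UNIV"
  by (rule has_sum_finite_neutralI[of "{0}"]) auto

lemma chart_expansion_mult_cpow2: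
  assumes "chart_expansion f U \<phi> a" "e - e' \<in> \<int>"
    and M: "\<And>z. 0 < norm z ==> norm z < 1 ==> M (the_inv_into U \<phi> z) = cpow2 z e e'"
  shows "chart_expansion (\<lambda>w. f w * M w) U \<phi> (shift_ser e e' a)"
proof -
  have "chart_expansion (\<lambda>w. f w * M w) U \<phi> (act 1 (Abs_fps (\<lambda>n. cnj (fps_nth 1 n))) (shift_ser e e' a))"
    by (rule chart_expansion_mult[OF assms(1) zero_less_one fps_one_has_sum fps_one_has_sum assms(2)]) (simp add: M)
  moreover have "Abs_fps (\<lambda>n. cnj (fps_nth (1 :: complex fps) n)) = 1" by (rule fps_ext) simp
  ultimately show ?thesis by (simp only: act_one)
qed

text \<open>With $z=z_2/z_1$, the component on the line is $z_1^\alpha\bar z_1^\beta f(z)=z_2^\alpha\bar z_2^\beta G(z)$ for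
  $G(z)=f(z)z^{-\alpha}\bar z^{-\beta}$. The hypotheses say that the expansions of \<open>G\<close> contain no antiholomorphic variable,
  so \<open>G\<close> is holomorphic. The function $\Phi$ is \<open>G\<close> in the variable $z_1/z_2$.\<close>

lemma gcor2_chiral:
  assumes g: "gcor2 \<mu> A B C" and int: "\<alpha> - \<beta> \<in> \<int>"
    and A: "\<And>s s' t t'. A s s' t t' \<noteq> 0 ==> s' = 0"
    and B: "\<And>s s' t t'. B s s' t t' \<noteq> 0 ==> s' = 0"
    and C: "\<And>s s' t t'. C s s' t t' \<noteq> 0 ==> s' = 0"
  obtains \<Phi> where "\<Phi> holomorphic_on - {0, 1}"
    "lau \<Phi> (\<lambda>k. C (of_int k) 0 (\<alpha> - of_int k) \<beta>)"
    "lau (\<lambda>t. \<Phi> (1 + t)) (\<lambda>k. B (of_int k) 0 (\<alpha> - of_int k) \<beta>)"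
    "lau (\<lambda>w. \<Phi> (inverse w)) (\<lambda>k. A (of_int (- k)) 0 (\<alpha> - of_int (- k)) \<beta>)"
proof -
  obtain f a b c where f: "cor_fun f a b c" and a: "line12 \<alpha> \<beta> A = a"
    and b: "line21 \<alpha> \<beta> B = act (bin_pos \<alpha>) (bin_pos \<beta>) (sgn_ser b)" and c: "line21 \<alpha> \<beta> C = shift_ser \<alpha> \<beta> c"
    using gcor2_component[OF g] by blast
  define G where "G z = f z * cpow2 z (- \<alpha>) (- \<beta>)" for z
  have int': "- \<alpha> - (- \<beta>) \<in> \<int>" using Ints_minus[OF int] by simp
  have ra: "real_analytic_on G (- {0, 1})"
    unfolding G_def by (rule real_analytic_on_mult_cpow2) (use f in \<open>simp add: cor_fun_def\<close>)
  have lau_chart: "lau (\<lambda>z. F (the_inv_into U \<phi> z)) (\<lambda>k. x (of_int k) 0)"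
    if ce: "chart_expansion F U \<phi> x" and supp: "\<And>s s'. x s s' \<noteq> 0 ==> s' = 0" for F U \<phi> x
  proof -
    from ce obtain r where r: "r > 0" "\<And>z. 0 < norm z ==> norm z < r ==> 
      ((\<lambda>(s, s'). x s s' * cpow2 z s s') has_sum F (the_inv_into U \<phi> z)) UNIV"
      unfolding chart_expansion_def by blast
    show ?thesis
      by (rule lau_from_laurent_ser[OF chart_expansion_laurent[OF ce] _ r(1)]) (use supp r(2) in blast)+
  qed
  have "chart_expansion G UNIV (\<lambda>z. z) (shift_ser (- \<alpha>) (- \<beta>) a)"
    unfolding G_def[abs_def]
    by (rule chart_expansion_mult_cpow2[OF _ int']) (use f in \<open>simp_all add: cor_fun_def the_inv_into_id\<close>)
  moreover have a1: "shift_ser (- \<alpha>) (- \<beta>) a s s' = A (- s) (- s') (\<alpha> + s) (\<beta> + s')" for s s'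
    unfolding a[symmetric] by (simp add: shift_ser_def line12_def add.commute)
  ultimately have "lau (\<lambda>z. G (the_inv_into UNIV (\<lambda>z. z) z)) (\<lambda>k. shift_ser (- \<alpha>) (- \<beta>) a (of_int k) 0)"
    using A by (intro lau_chart) fastforce+
  then have G0: "lau G (\<lambda>k. A (of_int (- k)) 0 (\<alpha> - of_int (- k)) \<beta>)"
    by (simp only: a1 the_inv_into_id of_int_minus minus_zero diff_minus_eq_add add_0_right)
  have fc: "chart_expansion (\<lambda>w. f (inverse w) * cpow2 w \<alpha> \<beta>) UNIV (\<lambda>w. w) (shift_ser \<alpha> \<beta> c)"
    by (rule chart_expansion_mult_cpow2[OF _ int]) (use f in \<open>simp_all add: cor_fun_def the_inv_into_id\<close>)
  have Gc: "chart_expansion (\<lambda>w. G (inverse w)) UNIV (\<lambda>w. w) (shift_ser \<alpha> \<beta> c)"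
    by (rule chart_expansion_cong[OF fc, where p = 0]) (auto simp: G_def cpow2_inverse int)
  have c1: "shift_ser \<alpha> \<beta> c s s' = C s s' (\<alpha> - s) (\<beta> - s')" for s s'
    unfolding c[symmetric] by (simp add: line21_def)
  have "lau (\<lambda>z. G (inverse (the_inv_into UNIV (\<lambda>z. z) z))) (\<lambda>k. shift_ser \<alpha> \<beta> c (of_int k) 0)"
    by (rule lau_chart[OF Gc]) (unfold c1, erule C)
  then have Ginf: "lau (\<lambda>w. G (inverse w)) (\<lambda>k. C (of_int k) 0 (\<alpha> - of_int k) \<beta>)"
    by (simp only: c1 the_inv_into_id diff_zero)
  have fb: "chart_expansion f (- {0}) (\<lambda>z. 1 - inverse z) b" using f by (simp add: cor_fun_def)
  have lb: "laurent_ser b" by (rule chart_expansion_laurent[OF fb])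
  \<comment> \<open>The expansion of \<open>G\<close> in the chart $1-z^{-1}$, where $z=(1-t)^{-1}$ and $z^{-\alpha}=(1-t)^\alpha$; $t=-z_0/z_2$.\<close>
  define b2 where "b2 = act (bin_neg \<alpha>) (bin_neg \<beta>) (shift_ser 0 0 b)"
  have "chart_expansion G (- {0}) (\<lambda>z. 1 - inverse z)
      (act (bin_neg \<alpha>) (Abs_fps (\<lambda>n. cnj (fps_nth (bin_neg \<beta>) n))) (shift_ser 0 0 b))"
    unfolding G_def[abs_def]
  proof (rule chart_expansion_mult[OF _ zero_less_one bin_neg_has_sum bin_neg_has_sum])
    show "chart_expansion f (- {0}) (\<lambda>z. 1 - inverse z) b" by (rule fb)
    fix z :: complex assume z: "0 < norm z" "norm z < 1"
    then have "1 - z \<noteq> 0" "z \<noteq> 1" by auto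
    then show "cpow2 (the_inv_into (- {0}) (\<lambda>z. 1 - inverse z) z) (- \<alpha>) (- \<beta>) =
       cpow2 z 0 0 * ((1 - z) powr of_real \<alpha> * cnj ((1 - z) powr of_real \<beta>))"
      using z by (simp add: the_inv_into_chart_1 cpow2_inverse int cpow2_powr cpow2_def[of z] del: complex_cnj_diff)
  qed auto
  then have Gb: "chart_expansion G (- {0}) (\<lambda>z. 1 - inverse z) b2"
    by (simp only: b2_def bin_neg_cnj)
  have b2: "sgn_ser b2 s s' = B s s' (\<alpha> - s) (\<beta> - s')" for s s'
  proof -
    have "shift_ser 0 0 b = b" by (simp add: shift_ser_def)
    then have "sgn_ser b2 = line21 \<alpha> \<beta> B" unfolding b2_def b by (simp add: sgn_ser_act lb)
    then show ?thesis by (simp add: line21_def)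
  qed
  have supp2: "s' = 0" if "b2 s s' \<noteq> 0" for s s'
  proof -
    have "sgn_ser b2 s s' \<noteq> 0" using that by (simp add: sgn_ser_def)
    then show ?thesis unfolding b2 by (rule B)
  qed
  have "lau (\<lambda>z. G (the_inv_into (- {0}) (\<lambda>z. 1 - inverse z) z)) (\<lambda>k. b2 (of_int k) 0)"
    by (rule lau_chart[OF Gb supp2])
  from lau_neg[OF this]
  have "lau (\<lambda>z. G (the_inv_into (- {0}) (\<lambda>z. 1 - inverse z) (- z))) (\<lambda>k. sgn_ser b2 (of_int k) 0)"
    by (simp add: sgn_ser_def)
  then have "lau (\<lambda>z. G (inverse (1 + z))) (\<lambda>k. sgn_ser b2 (of_int k) 0)"
  proof (rule lau_cong[OF _ zero_less_one])
    fix z :: complex assume "norm z < 1"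
    then have "- z \<noteq> 1" by (metis norm_minus_cancel norm_one less_irrefl)
    from the_inv_into_chart_1[OF this] show "G (the_inv_into (- {0}) (\<lambda>z. 1 - inverse z) (- z)) = G (inverse (1 + z))" by simp
  qed
  then have G1: "lau (\<lambda>z. G (inverse (1 + z))) (\<lambda>k. B (of_int k) 0 (\<alpha> - of_int k) \<beta>)"
    by (simp only: b2 diff_zero)
  have "G holomorphic_on - {0, 1}" by (rule lau_holomorphic[OF ra G0])
  then have "(G \<circ> inverse) holomorphic_on - {0, 1}"
    by (rule holomorphic_on_compose_gen[rotated]) (auto intro!: holomorphic_intros simp: inverse_eq_1_iff)
  then have "(\<lambda>z. G (inverse z)) holomorphic_on - {0, 1}" by (simp add: o_def)
  from that[OF this Ginf G1] G0 show ?thesis by simp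
qed

text \<open>The residue theorem for $z_1$ around $0$, $z_2$ and infinity, in the form of identities between the coefficients.
  If $\alpha-\beta$ is not an integer, all components vanish.\<close>

theorem gcor2_chiral_borcherds:
  assumes g: "gcor2 \<mu> A B C"
    and A: "\<And>s s' t t'. A s s' t t' \<noteq> 0 ==> s' = 0"
    and B: "\<And>s s' t t'. B s s' t t' \<noteq> 0 ==> s' = 0"
    and C: "\<And>s s' t t'. C s s' t t' \<noteq> 0 ==> s' = 0"
  shows "A (of_int (- n - 1)) 0 (\<alpha> - of_int (- n - 1)) \<beta> - C (of_int (- n - 1)) 0 (\<alpha> - of_int (- n - 1)) \<beta> =
      Sum_any (\<lambda>j::nat. of_real (of_int n gchoose j) * B (of_int (- int j - 1)) 0 (\<alpha> - of_int (- int j - 1)) \<beta>)"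
    and "p \<ge> 1 ==> B (of_int (int p - 1)) 0 (\<alpha> - of_int (int p - 1)) \<beta> =
      Sum_any (\<lambda>j::nat. of_nat ((p + j - 1) choose j) * (A (of_int (int (p + j) - 1)) 0 (\<alpha> - of_int (int (p + j) - 1)) \<beta>
         - (-1) ^ p * C (of_int (- int j - 1)) 0 (\<alpha> - of_int (- int j - 1)) \<beta>))"
proof -
  have *: "(A (of_int (- n - 1)) 0 (\<alpha> - of_int (- n - 1)) \<beta> - C (of_int (- n - 1)) 0 (\<alpha> - of_int (- n - 1)) \<beta> =
      Sum_any (\<lambda>j::nat. of_real (of_int n gchoose j) * B (of_int (- int j - 1)) 0 (\<alpha> - of_int (- int j - 1)) \<beta>)) \<and>
    (p \<ge> 1 --> B (of_int (int p - 1)) 0 (\<alpha> - of_int (int p - 1)) \<beta> =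
      Sum_any (\<lambda>j::nat. of_nat ((p + j - 1) choose j) * (A (of_int (int (p + j) - 1)) 0 (\<alpha> - of_int (int (p + j) - 1)) \<beta>
         - (-1) ^ p * C (of_int (- int j - 1)) 0 (\<alpha> - of_int (- int j - 1)) \<beta>)))"
  proof (cases "\<alpha> - \<beta> \<in> \<int>")
    case True
    obtain \<Phi> where \<Phi>: "\<Phi> holomorphic_on - {0, 1}"
      "lau \<Phi> (\<lambda>k. C (of_int k) 0 (\<alpha> - of_int k) \<beta>)"
      "lau (\<lambda>t. \<Phi> (1 + t)) (\<lambda>k. B (of_int k) 0 (\<alpha> - of_int k) \<beta>)"
      "lau (\<lambda>w. \<Phi> (inverse w)) (\<lambda>k. A (of_int (- k)) 0 (\<alpha> - of_int (- k)) \<beta>)"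
      using A B C by (rule gcor2_chiral[OF g True])
    show ?thesis
      using three_point_commutator[OF \<Phi>(1,2,3), of "\<lambda>k. A (of_int k) 0 (\<alpha> - of_int k) \<beta>" n, OF \<Phi>(4)]
        three_point_iterate[OF \<Phi>(1,2,3), of "\<lambda>k. A (of_int k) 0 (\<alpha> - of_int k) \<beta>" p, OF \<Phi>(4)]
      by blast
  next
    case False
    have "A s 0 (\<alpha> - s) \<beta> = 0" "B s 0 (\<alpha> - s) \<beta> = 0" "C s 0 (\<alpha> - s) \<beta> = 0" for s
      using fun_cong[OF fun_cong[OF gcor2_nonint(1)[OF g False]], of "\<alpha> - s" \<beta>]
        fun_cong[OF fun_cong[OF gcor2_nonint(2)[OF g False]], of s 0]
        fun_cong[OF fun_cong[OF gcor2_nonint(3)[OF g False]], of s 0]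
      by (simp_all add: line12_def line21_def)
    then show ?thesis by simp
  qed
  then show "A (of_int (- n - 1)) 0 (\<alpha> - of_int (- n - 1)) \<beta> - C (of_int (- n - 1)) 0 (\<alpha> - of_int (- n - 1)) \<beta> =
      Sum_any (\<lambda>j::nat. of_real (of_int n gchoose j) * B (of_int (- int j - 1)) 0 (\<alpha> - of_int (- int j - 1)) \<beta>)" by blast
  show "B (of_int (int p - 1)) 0 (\<alpha> - of_int (int p - 1)) \<beta> =
      Sum_any (\<lambda>j::nat. of_nat ((p + j - 1) choose j) * (A (of_int (int (p + j) - 1)) 0 (\<alpha> - of_int (int (p + j) - 1)) \<beta>
         - (-1) ^ p * C (of_int (- int j - 1)) 0 (\<alpha> - of_int (- int j - 1)) \<beta>))" if "p \<ge> 1"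
    using * that by blast
qed

section \<open>Exchanging the holomorphic and the antiholomorphic variable\<close>

definition swap_ser :: "'w ser \<Rightarrow> 'w ser" where "swap_ser a = (\<lambda>s s'. a s' s)"

definition swap_ser2 :: "ser2 \<Rightarrow> ser2" where "swap_ser2 A = (\<lambda>s s' t t'. A s' s t' t)"

lemma Ints_minus_commute: "s - s' \<in> \<int> ==> s' - s \<in> (\<int> :: real set)"
  using Ints_minus[of "s - s'"] by simp

lemma laurent_ser_swap:
  assumes "laurent_ser a" shows "laurent_ser (swap_ser a)"
  unfolding laurent_ser_def swap_ser_def
proof (intro conjI allI impI)
  show "a s' s = 0" if "s - s' \<notin> \<int>" for s s'
    using assms that Ints_minus_commute unfolding laurent_ser_def by blast
  show "\<exists>N. \<forall>s s'. s \<le> N \<or> s' \<le> N --> a s' s = 0"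
    using assms unfolding laurent_ser_def by blast
  fix R
  have "finite ((\<lambda>(s, s'). (s', s)) ` {(s, s'). a s s' \<noteq> 0 \<and> s + s' \<le> R})"
    using assms unfolding laurent_ser_def by blast
  then show "finite {(s, s'). a s' s \<noteq> 0 \<and> s + s' \<le> R}"
  proof (rule rev_finite_subset, clarify)
    fix s s' assume "a s' s \<noteq> 0" "s + s' \<le> R"
    then show "(s, s') \<in> (\<lambda>(s, s'). (s', s)) ` {(s, s'). a s s' \<noteq> 0 \<and> s + s' \<le> R}"
      by (intro image_eqI[of _ _ "(s', s)"]) auto
  qed
qed

lemma holomorphic_on_cnj_cnj:
  assumes "f holomorphic_on U" "open U"
  shows "(\<lambda>z. cnj (f (cnj z))) holomorphic_on (cnj ` U)"
proof (rule holomorphic_onI)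
  fix z assume "z \<in> cnj ` U"
  then have "cnj z \<in> U" by auto
  then obtain F where "(f has_field_derivative F) (at (cnj z))"
    using holomorphic_on_imp_differentiable_at[OF assms] unfolding field_differentiable_def by blast
  then have "((cnj \<circ> f \<circ> cnj) has_field_derivative cnj F) (at z)"
    by (rule has_field_derivative_cnj_cnj)
  then show "(\<lambda>z. cnj (f (cnj z))) field_differentiable at z within cnj ` U"
    unfolding field_differentiable_def o_def using has_field_derivative_at_within by blast
qed

lemma open_image_cnj: "open U ==> open (cnj ` U)"
proof -
  assume "open U"
  moreover have "cnj ` U = cnj -` U"
  proof (intro set_eqI iffI)
    fix x assume "x \<in> cnj -` U"
    then have "cnj (cnj x) \<in> cnj ` U" by (intro imageI) simp
    then show "x \<in> cnj ` U" by simp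
  qed auto
  moreover have "continuous_on UNIV cnj" by (intro continuous_intros)
  ultimately show ?thesis by (simp add: open_vimage)
qed

lemma chart_at_cnj:
  assumes "chart_at p U \<phi>" "cnj p = p"
  shows "chart_at p (cnj ` U) (\<lambda>z. cnj (\<phi> (cnj z)))"
proof -
  have *: "open U" "p \<in> U" "\<phi> holomorphic_on U" "inj_on \<phi> U" "\<phi> p = 0" using assms by (auto simp: chart_at_def)
  have "p \<in> cnj ` U" using imageI[OF *(2), of cnj] assms(2) by simp
  moreover have "inj_on (\<lambda>z. cnj (\<phi> (cnj z))) (cnj ` U)" using *(4) by (simp add: inj_on_def)
  ultimately show ?thesis unfolding chart_at_def
    using * assms(2) open_image_cnj holomorphic_on_cnj_cnj by simp
qed

text \<open>Conjugating source and target of a chart gives a chart, and $\bar z^s z^{s'}$ has the exponents exchanged.\<close>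

lemma chart_expansion_cnj:
  assumes inj: "inj_on \<phi> U" and f: "chart_expansion f (cnj ` U) (\<lambda>z. cnj (\<phi> (cnj z))) a"
  shows "chart_expansion (\<lambda>z. f (cnj z)) U \<phi> (swap_ser a)"
proof -
  let ?\<phi>' = "\<lambda>z. cnj (\<phi> (cnj z))"
  from f obtain r where r: "r > 0" and a: "\<And>z. 0 < norm z ==> norm z < r ==> z \<in> ?\<phi>' ` (cnj ` U) \<and>
      ((\<lambda>(s, s'). a s s' * cpow2 z s s') has_sum f (the_inv_into (cnj ` U) ?\<phi>' z)) UNIV"
    unfolding chart_expansion_def by blast
  have la: "laurent_ser a" by (rule chart_expansion_laurent[OF f])
  have inj': "inj_on ?\<phi>' (cnj ` U)" using inj by (auto simp: inj_on_def)
  show ?thesis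
  proof (rule chart_expansion_if_has_sum[OF laurent_ser_swap[OF la] r])
    fix z :: complex assume z: "0 < norm z" "norm z < r"
    then have a': "cnj z \<in> ?\<phi>' ` (cnj ` U)"
      "((\<lambda>(s, s'). a s s' * cpow2 (cnj z) s s') has_sum f (the_inv_into (cnj ` U) ?\<phi>' (cnj z))) UNIV"
      using a[of "cnj z"] by simp_all
    then obtain u where u: "u \<in> U" "cnj z = cnj (\<phi> u)" by auto
    then have zu: "z = \<phi> u" by simp
    then show "z \<in> \<phi> ` U" using u by blast
    have "the_inv_into U \<phi> z = u" using the_inv_into_f_f[OF inj u(1)] zu by simp
    moreover have "the_inv_into (cnj ` U) ?\<phi>' (cnj z) = cnj u"
      using the_inv_into_f_f[OF inj', of "cnj u"] u by simp
    ultimately have "((\<lambda>(s, s'). a s s' * cpow2 (cnj z) s s') has_sum f (cnj (the_inv_into U \<phi> z))) (UNIV \<times> UNIV)"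
      using a'(2) by simp
    then have "((\<lambda>(s, s'). (\<lambda>(s, s'). a s s' * cpow2 (cnj z) s s') (s', s)) has_sum f (cnj (the_inv_into U \<phi> z))) (UNIV \<times> UNIV)"
      by (subst (asm) has_sum_swap)
    moreover have "(\<lambda>(s, s'). (\<lambda>(s, s'). a s s' * cpow2 (cnj z) s s') (s', s)) = (\<lambda>(s, s'). swap_ser a s s' * cpow2 z s s')"
    proof (rule ext, clarify)
      fix s s'
      show "a s' s * cpow2 (cnj z) s' s = swap_ser a s s' * cpow2 z s s'"
        using laurent_ser_int[OF la, of s' s] by (cases "a s' s = 0") (auto simp: swap_ser_def cpow2_cnj)
    qed
    ultimately show "((\<lambda>(s, s'). swap_ser a s s' * cpow2 z s s') has_sum f (cnj (the_inv_into U \<phi> z))) UNIV" by simp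
  qed
qed

lemma F01inf_cnj:
  assumes "F01inf f" shows "F01inf (\<lambda>z. f (cnj z))"
  unfolding F01inf_def
proof (intro conjI allI impI)
  show "real_analytic_on (\<lambda>z. f (cnj z)) (- {0, 1})"
    unfolding real_analytic_on_iff
  proof
    fix w assume w: "w \<in> - {0, 1::complex}"
    have "cnj w \<in> - {0, 1}" using w by (auto simp: complex_cnj_cancel_iff[of w 1, simplified])
    then show "real_analytic_at (\<lambda>z. f (cnj z)) w"
      using assms by (intro real_analytic_at_compose_cnj) (auto simp: F01inf_def real_analytic_on_iff)
  qed
  fix U \<phi>
  have *: "\<exists>a. chart_expansion (\<lambda>z. g (cnj z)) U \<phi> a"
    if ex: "\<And>U \<phi>. chart_at p U \<phi> ==> \<exists>a. chart_expansion g U \<phi> a" and ch: "chart_at p U \<phi>" and p: "cnj p = p" for p g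
  proof -
    obtain a where "chart_expansion g (cnj ` U) (\<lambda>z. cnj (\<phi> (cnj z))) a"
      using ex[OF chart_at_cnj[OF ch p]] by (elim exE)
    moreover have "inj_on \<phi> U" using ch by (simp add: chart_at_def)
    ultimately have "chart_expansion (\<lambda>z. g (cnj z)) U \<phi> (swap_ser a)" by (intro chart_expansion_cnj)
    then show ?thesis by blast
  qed
  show "\<exists>a. chart_expansion (\<lambda>z. f (cnj z)) U \<phi> a" if "chart_at 0 U \<phi>"
    by (rule *[OF _ that]) (use assms in \<open>auto simp: F01inf_def\<close>)
  show "\<exists>a. chart_expansion (\<lambda>z. f (cnj z)) U \<phi> a" if "chart_at 1 U \<phi>"
    by (rule *[OF _ that]) (use assms in \<open>auto simp: F01inf_def\<close>)
  have "\<exists>a. chart_expansion (\<lambda>z. (\<lambda>w. f (inverse w)) (cnj z)) U \<phi> a" if "chart_at 0 U \<phi>"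
    by (rule *[OF _ that]) (use assms in \<open>auto simp: F01inf_def\<close>)
  then show "\<exists>a. chart_expansion (\<lambda>w. f (cnj (inverse w))) U \<phi> a" if "chart_at 0 U \<phi>" using that by simp
qed

lemma conv2_swap: "conv2 P Q g = conv2 Q P (\<lambda>i k. g k i)"
  unfolding conv2_def
  by (rule Sum_any.reindex_cong[OF bij_swap]) (simp add: fun_eq_iff mult_ac)

lemma act_swap: "swap_ser (act P Q a) = act Q P (swap_ser a)"
  unfolding swap_ser_def act_def by (intro ext) (rule conv2_swap)

lemma sgn_ser_swap:
  assumes "laurent_ser a" shows "swap_ser (sgn_ser a) = sgn_ser (swap_ser a)"
proof (intro ext)
  fix s s'
  show "swap_ser (sgn_ser a) s s' = sgn_ser (swap_ser a) s s'"
  proof (cases "a s' s = 0")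
    case False
    from laurent_ser_int[OF assms this] obtain k where k: "s' - s = of_int k" by (auto elim: Ints_cases)
    then have k': "s - s' = of_int (- k)" by simp
    show ?thesis unfolding swap_ser_def sgn_ser_def k k' floor_of_int by (simp add: power_int_minus)
       (simp add: power_int_def minus_one_power_iff)
  qed (simp add: swap_ser_def sgn_ser_def)
qed

lemma surj_cnj: "range cnj = UNIV"
  by (rule surjI[of _ cnj]) simp

text \<open>The expansions of $\mu(\bar z_1,\bar z_2)$. It belongs to $\mathrm{GCor}_2$ because $f(\bar z)$ belongs to
  $F_{0,1,\infty}$.\<close>

theorem gcor2_swap:
  assumes "gcor2 \<mu> A B C"
  shows "\<exists>\<mu>'. gcor2 \<mu>' (swap_ser2 A) (swap_ser2 B) (swap_ser2 C)"
  using assms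
proof (induction rule: gcor2.induct)
  case (gen f \<alpha> \<beta> a b c)
  define g where "g = (\<lambda>z. f (cnj z))"
  have lb: "laurent_ser b" by (rule chart_expansion_laurent) (rule gen(4))
  have "F01inf g" unfolding g_def by (rule F01inf_cnj) (rule gen(1))
  moreover have "\<beta> - \<alpha> \<in> \<int>" using gen(2) by (rule Ints_minus_commute)
  moreover have "chart_expansion g UNIV (\<lambda>z. z) (swap_ser a)"
    unfolding g_def by (rule chart_expansion_cnj) (use gen(3) in \<open>auto simp: surj_cnj\<close>)
  moreover have "cnj ` (- {0}) = - {0}" by (force intro: image_eqI[of _ cnj "cnj _"])
  then have "chart_expansion g (- {0}) (\<lambda>z. 1 - inverse z) (swap_ser b)"
    unfolding g_def by (intro chart_expansion_cnj) (use gen(4) in \<open>auto simp: inj_on_chart_1\<close>)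
  moreover have "chart_expansion (\<lambda>w. (\<lambda>w. f (inverse w)) (cnj w)) UNIV (\<lambda>w. w) (swap_ser c)"
    by (rule chart_expansion_cnj) (use gen(5) in \<open>auto simp: surj_cnj\<close>)
  then have "chart_expansion (\<lambda>w. g (inverse w)) UNIV (\<lambda>w. w) (swap_ser c)" by (simp add: g_def)
  ultimately have 0: "gcor2 (\<lambda>z1 z2. cpow2 z1 \<beta> \<alpha> * g (z2 / z1))
      (gen_exp_12 \<beta> \<alpha> (swap_ser a)) (gen_exp_20 \<beta> \<alpha> (swap_ser b)) (gen_exp_21 \<beta> \<alpha> (swap_ser c))"
    by (intro gcor2.gen)
  have 1: "swap_ser2 (gen_exp_12 \<alpha> \<beta> a) = gen_exp_12 \<beta> \<alpha> (swap_ser a)"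
    unfolding swap_ser2_def gen_exp_12_def swap_ser_def by (intro ext) (simp add: conj_commute)
  have 2: "swap_ser2 (gen_exp_21 \<alpha> \<beta> c) = gen_exp_21 \<beta> \<alpha> (swap_ser c)"
    unfolding swap_ser2_def gen_exp_21_def swap_ser_def by (intro ext) (simp add: conj_commute)
  have "act (bin_pos \<beta>) (bin_pos \<alpha>) (sgn_ser (swap_ser b)) = swap_ser (act (bin_pos \<alpha>) (bin_pos \<beta>) (sgn_ser b))"
    by (simp only: act_swap sgn_ser_swap[OF lb])
  then have 3: "swap_ser2 (gen_exp_20 \<alpha> \<beta> b) = gen_exp_20 \<beta> \<alpha> (swap_ser b)"
    unfolding swap_ser2_def gen_exp_20_act by (intro ext) (simp add: swap_ser_def conj_commute)
  from 0 have "gcor2 (\<lambda>z1 z2. cpow2 z1 \<beta> \<alpha> * g (z2 / z1)) (swap_ser2 (gen_exp_12 \<alpha> \<beta> a))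
     (swap_ser2 (gen_exp_20 \<alpha> \<beta> b)) (swap_ser2 (gen_exp_21 \<alpha> \<beta> c))" by (simp only: 1 2 3)
  then show ?case by (intro exI)
next
  case zero
  have "swap_ser2 (\<lambda>_ _ _ _. 0) = (\<lambda>_ _ _ _. 0)" by (simp add: swap_ser2_def)
  then show ?case using gcor2.zero by auto
next
  case (add \<mu> A B C \<mu>' A' B' C')
  then obtain \<mu>1 \<mu>2 where "gcor2 \<mu>1 (swap_ser2 A) (swap_ser2 B) (swap_ser2 C)" "gcor2 \<mu>2 (swap_ser2 A') (swap_ser2 B') (swap_ser2 C')"
    by blast
  from gcor2.add[OF this] show ?case by (auto simp: swap_ser2_def)
next
  case (scale \<mu> A B C k)
  then obtain \<mu>1 where "gcor2 \<mu>1 (swap_ser2 A) (swap_ser2 B) (swap_ser2 C)" by blast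
  from gcor2.scale[OF this, of k] show ?case by (auto simp: swap_ser2_def)
qed

section \<open>Linear forms and direct sums\<close>

lemma Sum_any_additive:
  fixes f :: "'i \<Rightarrow> 'a::ab_group_add" and u :: "'a \<Rightarrow> 'b::ab_group_add"
  assumes fin: "finite {i. f i \<noteq> 0}" and add: "\<And>x y. u (x + y) = u x + u y"
  shows "u (Sum_any f) = Sum_any (\<lambda>i. u (f i))"
proof -
  have u0: "u 0 = 0" using add[of 0 0] by simp
  have "u (sum f A) = (\<Sum>i\<in>A. u (f i))" if "finite A" for A
    using that by (induction A rule: finite_induct) (simp_all add: u0 add)
  then have "u (Sum_any f) = (\<Sum>i\<in>{i. f i \<noteq> 0}. u (f i))" using fin by (simp add: Sum_any.expand_set)
  also have "\<dots> = Sum_any (\<lambda>i. u (f i))"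
    by (rule Sum_any.expand_superset[symmetric]) (use fin u0 in auto)
  finally show ?thesis .
qed

lemma finite_nat_support:
  fixes f :: "nat \<Rightarrow> 'a::zero"
  assumes "\<And>j. j \<ge> J ==> f j = 0"
  shows "finite {j. f j \<noteq> 0}"
proof (rule finite_subset)
  show "{j. f j \<noteq> 0} \<subseteq> {..<J}"
  proof
    fix j assume "j \<in> {j. f j \<noteq> 0}" then show "j \<in> {..<J}" using assms[of j] by (cases "j < J") auto
  qed
qed simp

text \<open>Extend the values on a basis of \<open>W\<close> to a basis of the whole space.\<close>

lemma functional_extension:
  fixes smul :: "complex \<Rightarrow> 'v::ab_group_add \<Rightarrow> 'v"
  assumes vs: "vector_space smul" and W: "module.subspace smul W" and u: "linear_form_on smul W u"
  shows "\<exists>l. (\<forall>x y. l (x + y) = l x + l y) \<and> (\<forall>c x. l (smul c x) = c * l x) \<and> (\<forall>w\<in>W. l w = u w)"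
proof -
  interpret V: vector_space smul by fact
  interpret P: vector_space_pair smul "(*) :: complex \<Rightarrow> complex \<Rightarrow> complex"
    by (intro vector_space_pair.intro V.vector_space_axioms vector_space_over_itself.vector_space_axioms)
  obtain B where B: "B \<subseteq> W" "V.independent B" "W \<subseteq> V.span B"
    using V.maximal_independent_subset[of W] by metis
  obtain l where l: "Vector_Spaces.linear smul ((*) :: complex \<Rightarrow> complex \<Rightarrow> complex) l" "\<forall>x\<in>B. l x = u x"
    using P.linear_independent_extend[OF B(2), of u] by blast
  interpret l: Vector_Spaces.linear smul "(*) :: complex \<Rightarrow> complex \<Rightarrow> complex" l by fact
  have "w \<in> W \<and> l w = u w" if "w \<in> V.span B" for w
    using that
  proof (induction rule: V.span_induct_alt)
    case base
    have "u (smul 0 0) = 0 * u 0" using u V.subspace_0[OF W] unfolding linear_form_on_def by blast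
    then show ?case using V.subspace_0[OF W] by (simp add: l.zero)
  next
    case (step c x y)
    have "x \<in> W" "smul c x \<in> W" using step B(1) V.subspace_scale[OF W] by auto
    then have "u (smul c x + y) = c * u x + u y" using u step unfolding linear_form_on_def by auto
    then show ?case using step l(2) V.subspace_add[OF W] \<open>smul c x \<in> W\<close> by (auto simp: l.add l.scale)
  qed
  then show ?thesis using B(3) l.add l.scale by (intro exI[of _ l]) auto
qed

lemma component_eqI:
  assumes "\<And>f g. decomposition V v f ==> decomposition V v g ==> f = g" "decomposition V v f"
  shows "component V i v = f i"
proof -
  have "(THE f. decomposition V v f) = f" using assms by blast
  then show ?thesis by (simp add: component_def)
qed

lemma decomposition_sum:
  assumes "vector_space smul" and V: "\<And>i. module.subspace smul (V i)"
    and f: "decomposition V v f" and g: "decomposition V w g"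
  shows "decomposition V (v + w) (\<lambda>i. f i + g i)"
proof -
  interpret vector_space smul by fact
  have fin: "finite {i. f i \<noteq> 0}" "finite {i. g i \<noteq> 0}" using f g unfolding decomposition_def by auto
  show ?thesis unfolding decomposition_def
  proof (intro conjI allI)
    show "f i + g i \<in> V i" for i using f g subspace_add[OF V] unfolding decomposition_def by auto
    show "finite {i. f i + g i \<noteq> 0}" by (rule finite_subset[OF _ finite_UnI[OF fin]]) auto
    show "v + w = Sum_any (\<lambda>i. f i + g i)"
      using f g Sum_any.distrib[OF fin] unfolding decomposition_def by simp
  qed
qed

lemma decomposition_smul:
  assumes "vector_space smul" and V: "\<And>i. module.subspace smul (V i)" and f: "decomposition V v f"
  shows "decomposition V (smul c v) (\<lambda>i. smul c (f i))"
proof -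
  interpret vector_space smul by fact
  have fin: "finite {i. f i \<noteq> 0}" using f unfolding decomposition_def by auto
  show ?thesis unfolding decomposition_def
  proof (intro conjI allI)
    show "smul c (f i) \<in> V i" for i using f subspace_scale[OF V] unfolding decomposition_def by auto
    show "finite {i. smul c (f i) \<noteq> 0}" by (rule finite_subset[OF _ fin]) auto
    show "smul c v = Sum_any (\<lambda>i. smul c (f i))"
      using f Sum_any_additive[OF fin, of "smul c"] unfolding decomposition_def by (simp add: scale_right_distrib)
  qed
qed

lemma decomposition_single:
  assumes "vector_space smul" and V: "\<And>i. module.subspace smul (V i)" and v: "v \<in> V i"
  shows "decomposition V v (\<lambda>j. if j = i then v else 0)"
proof -
  interpret vector_space smul by fact
  show ?thesis unfolding decomposition_def
  proof (intro conjI allI)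
    show "(if j = i then v else 0) \<in> V j" for j using v subspace_0[OF V] by auto
    show "finite {j. (if j = i then v else 0) \<noteq> 0}" by (rule finite_subset[of _ "{i}"]) auto
    show "v = Sum_any (\<lambda>j. if j = i then v else 0)" by simp
  qed
qed

lemma direct_sum_unique:
  fixes V :: "'i \<Rightarrow> 'v::ab_group_add set"
  assumes "direct_sum smul V W" "v \<in> W" "decomposition V v f" "decomposition V v g"
  shows "f = g"
proof -
  have "\<forall>v\<in>W. \<exists>!f. decomposition V v f" using assms(1) unfolding direct_sum_def by (elim conjE)
  from bspec[OF this assms(2)] show ?thesis
  proof (rule ex1E)
    fix h assume u: "\<forall>k. decomposition V v k --> k = h"
    show "f = g" using mp[OF spec[OF u] assms(3)] mp[OF spec[OF u] assms(4)] by simp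
  qed
qed

lemma direct_sum_component:
  fixes V :: "'i \<Rightarrow> 'v::ab_group_add set"
  assumes "direct_sum smul V W" "v \<in> W"
  shows "decomposition V v (\<lambda>i. component V i v)" and "decomposition V v f ==> component V i v = f i"
proof -
  show c: "component V i v = f i" if d: "decomposition V v f" for f i
    by (rule component_eqI[OF direct_sum_unique[OF assms] d])
  have "\<forall>v\<in>W. \<exists>!f. decomposition V v f" using assms(1) unfolding direct_sum_def by (elim conjE)
  from bspec[OF this assms(2)] obtain f where f: "decomposition V v f" by (rule ex1E)
  have "(\<lambda>i. component V i v) = f" using c[OF f] by (rule ext)
  then show "decomposition V v (\<lambda>i. component V i v)" using f by (simp only:)
qed

section \<open>Duality in a full vertex algebra\<close>

context full_vertex_algebra
begin

abbreviation "Fp \<equiv> (\<lambda>(h, h'). Fg h h')"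
abbreviation "gdual u \<equiv> graded_dual smul Fp UNIV u"

lemma Fp_subspace: "module.subspace smul (Fg h h')"
  using grading unfolding direct_sum_def by auto

lemma Fp_subspace': "subspace (Fp i)"
  using Fp_subspace by (cases i) simp

lemma comp_decomp: "decomposition Fp v (\<lambda>i. component Fp i v)"
  by (rule direct_sum_component(1)[OF grading UNIV_I])

lemma comp_mem: "component Fp (h, h') v \<in> Fg h h'"
  using comp_decomp[of v] unfolding decomposition_def by auto

lemma comp_finite: "finite {i. component Fp i v \<noteq> 0}"
  using comp_decomp[of v] unfolding decomposition_def by auto

lemma comp_sum: "v = Sum_any (\<lambda>i. component Fp i v)"
  using comp_decomp[of v] unfolding decomposition_def by auto

lemma comp_add: "component Fp i (v + w) = component Fp i v + component Fp i w"
  by (rule direct_sum_component(2)[OF grading UNIV_I], rule decomposition_sum[where smul = smul])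
    (rule vector_space_axioms Fp_subspace' comp_decomp)+

lemma comp_scale: "component Fp i (smul c v) = smul c (component Fp i v)"
  by (rule direct_sum_component(2)[OF grading UNIV_I], rule decomposition_smul[where smul = smul])
    (rule vector_space_axioms Fp_subspace' comp_decomp)+

lemma comp_homogeneous:
  assumes "v \<in> Fg h h'"
  shows "component Fp i v = (if i = (h, h') then v else 0)"
proof -
  have "decomposition Fp v (\<lambda>i. if i = (h, h') then v else 0)"
    by (rule decomposition_single[where V = Fp and smul = smul, OF vector_space_axioms Fp_subspace']) (simp add: assms)
  from direct_sum_component(2)[OF grading UNIV_I this] show ?thesis .
qed

lemma gdualI:
  assumes "\<And>x y. u (x + y) = u x + u y" "\<And>c x. u (smul c x) = c * u x"
    and "finite D" "\<And>h h' v. (h, h') \<notin> D ==> v \<in> Fg h h' ==> u v = 0"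
  shows "gdual u"
  unfolding graded_dual_def linear_form_on_def
proof (intro conjI ballI allI assms(1,2))
  show "finite {i. \<exists>v\<in>Fp i. u v \<noteq> 0}"
    by (rule finite_subset[OF _ assms(3)]) (use assms(4) in fastforce)
qed

text \<open>Cutting off a linear form to finitely many degrees puts it into the graded dual.\<close>

lemma gdual_comp:
  assumes l: "\<And>x y. l (x + y) = l x + l y" "\<And>c x. l (smul c x) = c * l x" and D: "finite D"
  shows "gdual (\<lambda>v. \<Sum>i\<in>D. l (component Fp i v))"
proof (rule gdualI[OF _ _ D])
  have l0: "l 0 = 0" using l(1)[of 0 0] by simp
  fix h h' v assume "(h, h') \<notin> D" "v \<in> Fg h h'"
  then show "(\<Sum>i\<in>D. l (component Fp i v)) = 0"
    by (intro sum.neutral) (auto simp: comp_homogeneous l0)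
qed (simp_all add: comp_add comp_scale l sum.distrib sum_distrib_left)

text \<open>Apply a linear form that is nonzero on a nonzero component, and cut it off to that degree. Identities between vectors can
  therefore be tested on matrix coefficients, where the correlation functions live.\<close>

lemma gdual_separates:
  assumes "v \<noteq> 0"
  shows "\<exists>u. gdual u \<and> u v \<noteq> 0"
proof -
  have "\<exists>i. component Fp i v \<noteq> 0"
  proof (rule ccontr)
    assume "\<not> ?thesis"
    then have "(\<lambda>i. component Fp i v) = (\<lambda>_. 0)" by blast
    then have "Sum_any (\<lambda>i. component Fp i v) = 0" by (simp only: Sum_any.neutral)
    with assms show False using comp_sum[of v] by (simp only:)
  qed
  then obtain i where i: "component Fp i v \<noteq> 0" by blast
  let ?x = "component Fp i v"
  define u where "u w = (SOME c. w = smul c ?x)" for w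
  have u: "u (smul c ?x) = c" for c
  proof -
    have "smul c ?x = smul (u (smul c ?x)) ?x" unfolding u_def by (rule someI[of _ c]) simp
    then show ?thesis using i by (simp add: scale_right_imp_eq scale_cancel_right)
  qed
  have sp: "w \<in> range (\<lambda>c. smul c ?x) \<longleftrightarrow> w \<in> span {?x}" for w by (simp add: span_singleton)
  have "linear_form_on smul (span {?x}) u"
    unfolding linear_form_on_def span_singleton
  proof safe
    fix c d show "u (smul c ?x + smul d ?x) = u (smul c ?x) + u (smul d ?x)"
      using u[of "c + d"] u by (simp add: scale_left_distrib)
    fix e show "u (smul e (smul c ?x)) = e * u (smul c ?x)" using u[of "e * c"] u by simp
  qed
  from functional_extension[OF vector_space_axioms subspace_span this] obtain l where
    l: "\<And>x y. l (x + y) = l x + l y" "\<And>c x. l (smul c x) = c * l x" "\<forall>w\<in>span {?x}. l w = u w" by blast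
  have "l ?x = u ?x" using l(3) by (simp add: span_base)
  moreover have "u ?x = 1" using u[of 1] by simp
  ultimately have "(\<Sum>i\<in>{i}. l (component Fp i v)) \<noteq> 0" by simp
  with gdual_comp[OF l(1,2), of "{i}"] show ?thesis by (intro exI[of _ "\<lambda>v. \<Sum>i\<in>{i}. l (component Fp i v)"]) simp
qed

lemma gdual_eqI:
  assumes "\<And>u. gdual u ==> u v = u w"
  shows "v = w"
proof (rule ccontr)
  assume "v \<noteq> w"
  then have "v - w \<noteq> 0" by simp
  then obtain u where u: "gdual u" "u (v - w) \<noteq> 0" using gdual_separates by blast
  have "u ((v - w) + w) = u (v - w) + u w" using u(1) unfolding graded_dual_def linear_form_on_def by blast
  with assms[OF u(1)] u(2) show False by simp
qed

lemma gdual_add: "gdual u ==> u (x + y) = u x + u y"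
  and gdual_scale: "gdual u ==> u (smul c x) = c * u x"
  unfolding graded_dual_def linear_form_on_def by blast+

lemma gdual_0: "gdual u ==> u 0 = 0" using gdual_add[of u 0 0] by simp

lemma gdual_minus: "gdual u ==> u (- x) = - u x"
  using gdual_add[of u x "- x"] gdual_0[of u] by (simp add: eq_neg_iff_add_eq_0 add.commute)

lemma gdual_diff: "gdual u ==> u (x - y) = u x - u y"
  using gdual_add[of u x "- y"] gdual_minus[of u y] by simp

lemma gdual_Sum_any: "gdual u ==> finite {i. f i \<noteq> 0} ==> u (Sum_any f) = Sum_any (\<lambda>i. u (f i))"
  by (rule Sum_any_additive) (auto intro: gdual_add)

sublocale Yr: Vector_Spaces.linear smul smul "Y a r s" for a r s by (rule Y_linear_right)
sublocale Yl: Vector_Spaces.linear smul smul "\<lambda>a. Y a r s b" for r s b by (rule Y_linear_left)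

lemmas Y_lin = Yr.add Yr.scale Yr.zero Yr.neg Yr.diff Yl.add Yl.scale Yl.zero Yl.neg Yl.diff

section \<open>Chiral vectors\<close>

text \<open>Correlation functions with the vacuum in the middle do not depend on $z_2$, so the component is
  $\kappa z_1^\alpha\bar z_1^\beta$ with $\kappa$ a matrix coefficient of the mode in question. Expanded around $z_1=z_2$, its coefficient at $\bar z_0$
  is $\beta\kappa$, but it comes from $\bar Da=0$.\<close>

lemma chiral_modes:
  assumes "Y a (-1) (-2) vac = 0" "s \<noteq> -1"
  shows "Y a r s c = 0"
proof (rule gdual_eqI)
  fix u assume u: "gdual u"
  define \<alpha> \<beta> where "\<alpha> = - r - 1" and "\<beta> = - s - 1"
  obtain \<mu> where g: "gcor2 \<mu> (corr_12 Y u a vac c) (corr_20 Y u a vac c) (corr_21 Y u a vac c)"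
    using FV5[OF u] by blast
  define \<kappa> where "\<kappa> = u (Y a r s c)"
  have v: "vser Y vac c t t' = (if t = 0 \<and> t' = 0 then c else 0)" for t t'
    by (auto simp: vser_def FV4)
  have "line12 \<alpha> \<beta> (corr_12 Y u a vac c) = (\<lambda>t t'. if t = 0 \<and> t' = 0 then \<kappa> else 0)"
    unfolding line12_def corr_12_def v by (auto simp: fun_eq_iff vser_def \<alpha>_def \<beta>_def \<kappa>_def Y_lin gdual_0[OF u])
  from gcor2_const[OF g this] have "line21 \<alpha> \<beta> (corr_20 Y u a vac c) 0 1 = of_real \<beta> * \<kappa>" .
  moreover have "vser Y a vac 0 1 = 0" using assms(1) by (simp add: vser_def)
  then have "line21 \<alpha> \<beta> (corr_20 Y u a vac c) 0 1 = 0"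
    by (simp add: line21_def corr_20_def vser_def Y_lin gdual_0[OF u])
  ultimately have "of_real \<beta> * \<kappa> = 0" by simp
  moreover have "\<beta> \<noteq> 0" using assms(2) by (simp add: \<beta>_def)
  ultimately show "u (Y a r s c) = u 0" by (simp add: \<kappa>_def gdual_0[OF u])
qed

lemma vser_bounded: "\<exists>N. \<forall>s s'. s \<le> N \<or> s' \<le> N --> vser Y a b s s' = 0"
  using FV1[of a b] unfolding laurent_ser_def by blast

lemma vser_eventually_zero: "\<exists>J::nat. \<forall>j\<ge>J. vser Y a b (t - real j) t' = 0"
proof -
  obtain N where N: "\<And>s s'. s \<le> N \<or> s' \<le> N ==> vser Y a b s s' = 0" using vser_bounded by metis
  show ?thesis
  proof (intro exI[of _ "nat \<lceil>t - N\<rceil>"] allI impI N)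
    fix j assume "j \<ge> nat \<lceil>t - N\<rceil>" then have "t - N \<le> real j" by linarith
    then show "t - real j \<le> N \<or> t' \<le> N" by simp
  qed
qed

lemma mode_eventually_zero: "\<exists>J::nat. \<forall>j\<ge>J. Y a (real j) (-1) b = 0"
  using vser_eventually_zero[of a b "-1" 0] by (simp add: vser_def)

lemma chiral_commutator:
  assumes a: "Y a (-1) (-2) vac = 0"
  shows "Y a (of_int n) (-1) (vser Y b c s s') - vser Y b (Y a (of_int n) (-1) c) s s' =
    Sum_any (\<lambda>j::nat. smul (of_real (of_int n gchoose j)) (vser Y (Y a (real j) (-1) b) c (s - of_int n + real j) s'))"
proof (rule gdual_eqI)
  fix u assume u: "gdual u"
  obtain \<mu> where g: "gcor2 \<mu> (corr_12 Y u a b c) (corr_20 Y u a b c) (corr_21 Y u a b c)"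
    using FV5[OF u] by blast
  have ch: "vser Y a x t t' = 0" if "t' \<noteq> 0" for x t t'
    unfolding vser_def by (rule chiral_modes[OF a]) (use that in auto)
  have "t' = 0" if "corr_12 Y u a b c t t' v v' \<noteq> 0" for t t' v v'
    using that ch[of t' "vser Y b c v v'" t] gdual_0[OF u] by (cases "t' = 0") (auto simp: corr_12_def)
  moreover have "t' = 0" if "corr_20 Y u a b c t t' v v' \<noteq> 0" for t t' v v'
    using that ch[of t' b t] gdual_0[OF u] by (cases "t' = 0") (auto simp: corr_20_def vser_def Y_lin)
  moreover have "t' = 0" if "corr_21 Y u a b c t t' v v' \<noteq> 0" for t t' v v'
    using that ch[of t' c t] gdual_0[OF u] by (cases "t' = 0") (auto simp: corr_21_def vser_def Y_lin)
  ultimately have b: "corr_12 Y u a b c (of_int (- n - 1)) 0 (s - of_int n - 1 - of_int (- n - 1)) s' -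
        corr_21 Y u a b c (of_int (- n - 1)) 0 (s - of_int n - 1 - of_int (- n - 1)) s' =
      Sum_any (\<lambda>j::nat. of_real (of_int n gchoose j) * corr_20 Y u a b c (of_int (- int j - 1)) 0 (s - of_int n - 1 - of_int (- int j - 1)) s')"
    by (rule gcor2_chiral_borcherds(1)[OF g])
  obtain J where J: "\<And>j. j \<ge> J ==> Y a (real j) (-1) b = 0" using mode_eventually_zero by metis
  let ?f = "\<lambda>j::nat. smul (of_real (of_int n gchoose j)) (vser Y (Y a (real j) (-1) b) c (s - of_int n + real j) s')"
  have fin: "finite {j. ?f j \<noteq> 0}"
    by (rule finite_nat_support[of J]) (simp add: J, simp add: vser_def Y_lin)
  have "u (Sum_any ?f) = Sum_any (\<lambda>j. u (?f j))" by (rule gdual_Sum_any[OF u fin])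
  also have "\<dots> = u (Y a (of_int n) (-1) (vser Y b c s s') - vser Y b (Y a (of_int n) (-1) c) s s')"
    using b[symmetric] by (simp add: corr_12_def corr_20_def corr_21_def vser_def gdual_diff[OF u] gdual_scale[OF u] algebra_simps)
  finally show "u (Y a (of_int n) (-1) (vser Y b c s s') - vser Y b (Y a (of_int n) (-1) c) s s') = u (Sum_any ?f)" by simp
qed

lemma chiral_iterate:
  assumes a: "Y a (-1) (-2) vac = 0" and p: "p \<ge> 1"
  shows "vser Y (Y a (- real p) (-1) b) c t t' =
    Sum_any (\<lambda>j::nat. smul (of_nat ((p + j - 1) choose j)) (Y a (- real (p + j)) (-1) (vser Y b c (t - real j) t')
       - smul ((-1) ^ p) (vser Y b (Y a (real j) (-1) c) (t + real (p + j)) t')))"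
proof (rule gdual_eqI)
  fix u assume u: "gdual u"
  obtain \<mu> where g: "gcor2 \<mu> (corr_12 Y u a b c) (corr_20 Y u a b c) (corr_21 Y u a b c)"
    using FV5[OF u] by blast
  have ch: "vser Y a x t t' = 0" if "t' \<noteq> 0" for x t t'
    unfolding vser_def by (rule chiral_modes[OF a]) (use that in auto)
  have "t' = 0" if "corr_12 Y u a b c t t' v v' \<noteq> 0" for t t' v v'
    using that ch[of t' "vser Y b c v v'" t] gdual_0[OF u] by (cases "t' = 0") (auto simp: corr_12_def)
  moreover have "t' = 0" if "corr_20 Y u a b c t t' v v' \<noteq> 0" for t t' v v'
    using that ch[of t' b t] gdual_0[OF u] by (cases "t' = 0") (auto simp: corr_20_def vser_def Y_lin)
  moreover have "t' = 0" if "corr_21 Y u a b c t t' v v' \<noteq> 0" for t t' v v'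
    using that ch[of t' c t] gdual_0[OF u] by (cases "t' = 0") (auto simp: corr_21_def vser_def Y_lin)
  ultimately have b: "corr_20 Y u a b c (of_int (int p - 1)) 0 (t + real p - 1 - of_int (int p - 1)) t' =
      Sum_any (\<lambda>j::nat. of_nat ((p + j - 1) choose j) * (corr_12 Y u a b c (of_int (int (p + j) - 1)) 0 (t + real p - 1 - of_int (int (p + j) - 1)) t'
         - (-1) ^ p * corr_21 Y u a b c (of_int (- int j - 1)) 0 (t + real p - 1 - of_int (- int j - 1)) t'))"
    by (rule gcor2_chiral_borcherds(2)[OF g _ _ _ p])
  obtain J where J: "\<And>j. j \<ge> J ==> Y a (real j) (-1) c = 0" using mode_eventually_zero by metis
  obtain J' where J': "\<And>j. j \<ge> J' ==> vser Y b c (t - real j) t' = 0" using vser_eventually_zero by metis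
  let ?f = "\<lambda>j::nat. smul (of_nat ((p + j - 1) choose j)) (Y a (- real (p + j)) (-1) (vser Y b c (t - real j) t')
       - smul ((-1) ^ p) (vser Y b (Y a (real j) (-1) c) (t + real (p + j)) t'))"
  have "?f j = 0" if "j \<ge> max J J'" for j
  proof -
    have "Y a (real j) (-1) c = 0" "vser Y b c (t - real j) t' = 0" using J J' that by auto
    then show ?thesis by (simp only: Yr.zero) (simp add: vser_def Y_lin)
  qed
  then have fin: "finite {j. ?f j \<noteq> 0}" by (rule finite_nat_support)
  have "u (Sum_any ?f) = Sum_any (\<lambda>j. u (?f j))" by (rule gdual_Sum_any[OF u fin])
  also have "\<dots> = u (vser Y (Y a (- real p) (-1) b) c t t')"
    using b[symmetric] by (simp add: corr_12_def corr_20_def corr_21_def vser_def gdual_diff[OF u] gdual_scale[OF u] algebra_simps)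
  finally show "u (vser Y (Y a (- real p) (-1) b) c t t') = u (Sum_any ?f)" by simp
qed

end

section \<open>The conjugate algebra\<close>

lemma direct_sum_swap:
  fixes Fg :: "'a \<Rightarrow> 'a \<Rightarrow> 'b::ab_group_add set"
  assumes "direct_sum smul (\<lambda>(h, h'). Fg h h') W"
  shows "direct_sum smul (\<lambda>(h, h'). Fg h' h) W"
proof -
  have *: "decomposition (\<lambda>(h, h'). Fg h h') v f ==> decomposition (\<lambda>(h, h'). Fg h' h) v (f \<circ> prod.swap)" for Fg :: "'a \<Rightarrow> 'a \<Rightarrow> 'b set" and v f
    unfolding decomposition_def
  proof (intro conjI allI)
    assume a: "(\<forall>i. f i \<in> (case i of (h, h') \<Rightarrow> Fg h h')) \<and> finite {i. f i \<noteq> 0} \<and> v = Sum_any f"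
    show "(f \<circ> prod.swap) i \<in> (case i of (h, h') \<Rightarrow> Fg h' h)" for i
    proof -
      obtain h h' where i: "i = (h, h')" by (cases i)
      show ?thesis using conjunct1[OF a, rule_format, of "(h', h)"] by (simp add: i)
    qed
    have "{i. (f \<circ> prod.swap) i \<noteq> 0} = prod.swap ` {i. f i \<noteq> 0}" by (auto simp: image_iff)
    then show "finite {i. (f \<circ> prod.swap) i \<noteq> 0}" using a by simp
    show "v = Sum_any (f \<circ> prod.swap)"
      using a Sum_any.reindex_cong[OF bij_swap, of f "f \<circ> prod.swap"] by simp
  qed
  have u: "\<exists>!f. decomposition (\<lambda>(h, h'). Fg h' h) v f" if v: "v \<in> W" for v
  proof -
    obtain f where f: "decomposition (\<lambda>(h, h'). Fg h h') v f" using assms v unfolding direct_sum_def by blast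
    show ?thesis
    proof (rule ex1I[of _ "f \<circ> prod.swap"])
      show "decomposition (\<lambda>(h, h'). Fg h' h) v (f \<circ> prod.swap)" by (rule *[OF f])
      fix g assume "decomposition (\<lambda>(h, h'). Fg h' h) v g"
      from *[OF this] have "g \<circ> prod.swap = f" using f assms v unfolding direct_sum_def by blast
      then show "g = f \<circ> prod.swap" by (auto simp: fun_eq_iff)
    qed
  qed
  have W: "module.subspace smul W" using assms by (simp add: direct_sum_def)
  have "\<forall>i. module.subspace smul ((\<lambda>(h, h'). Fg h h') i) \<and> (\<lambda>(h, h'). Fg h h') i \<subseteq> W"
    using assms by (simp add: direct_sum_def)
  then have "module.subspace smul (Fg h h') \<and> Fg h h' \<subseteq> W" for h h' by fast
  then show ?thesis using u W unfolding direct_sum_def by (auto split: prod.split)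
qed

lemma graded_dual_swap:
  assumes "graded_dual smul (\<lambda>(h, h'). Fg h' h) W u"
  shows "graded_dual smul (\<lambda>(h, h'). Fg h h') W u"
proof -
  have "finite (prod.swap ` {i. \<exists>v\<in>(\<lambda>(h, h'). Fg h' h) i. u v \<noteq> 0})"
    using assms by (simp add: graded_dual_def)
  moreover have "{i. \<exists>v\<in>(\<lambda>(h, h'). Fg h h') i. u v \<noteq> 0} \<subseteq> prod.swap ` {i. \<exists>v\<in>(\<lambda>(h, h'). Fg h' h) i. u v \<noteq> 0}"
  proof clarify
    fix h h' v assume "v \<in> Fg h h'" "u v \<noteq> 0"
    then show "(h, h') \<in> prod.swap ` {i. \<exists>v\<in>(\<lambda>(h, h'). Fg h' h) i. u v \<noteq> 0}"
      by (intro image_eqI[of _ _ "(h', h)"]) auto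
  qed
  ultimately show ?thesis using assms finite_subset unfolding graded_dual_def by blast
qed

context full_vertex_algebra
begin

lemma swap_vser: "vser (\<lambda>a r s. Y a s r) a b = swap_ser (vser Y a b)"
  by (simp add: vser_def swap_ser_def)

lemma conjugate_full_vertex_algebra:
  "full_vertex_algebra smul (\<lambda>h h'. Fg h' h) (\<lambda>a r s. Y a s r) vac"
proof unfold_locales
  show "direct_sum smul (\<lambda>(h, h'). Fg h' h) UNIV" by (rule direct_sum_swap[OF grading])
  show "Y a s r b = 0" if "r - s \<notin> \<int>" for a r s b
    using Y_int_spin that Ints_minus_commute by blast
  show "vac \<in> Fg 0 0" by (rule vac_degree)
  show "laurent_ser (vser (\<lambda>a r s. Y a s r) a b)" for a b unfolding swap_vser
    using FV1[of a b] unfolding laurent_ser_def swap_ser_def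
  proof (intro conjI allI impI, goal_cases)
    case (1 s s') then show ?case using Ints_minus_commute by blast
  next
    case 2 then show ?case by blast
  next
    case (3 R)
    then have "finite (prod.swap ` {(s, s'). vser Y a b s s' \<noteq> 0 \<and> s + s' \<le> R})" by blast
    then show ?case
    proof (rule rev_finite_subset, clarify)
      fix s s' assume "vser Y a b s' s \<noteq> 0" "s + s' \<le> R"
      then show "(s, s') \<in> prod.swap ` {(s, s'). vser Y a b s s' \<noteq> 0 \<and> s + s' \<le> R}"
        by (intro image_eqI[of _ _ "(s', s)"]) auto
    qed
  qed
  show "Fg h' h = {0}" if "h - h' \<notin> \<int>" for h h' using FV2 that Ints_minus_commute by blast
  show "power_ser (vser (\<lambda>a r s. Y a s r) a vac)" for a
    using FV3(1)[of a] unfolding swap_vser power_ser_def swap_ser_def by blast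
  show "Y a (-1) (-1) vac = a" for a by (rule FV3(2))
  show "Y vac s r b = (if r = -1 \<and> s = -1 then b else 0)" for r s b by (simp add: FV4 conj_commute)
  show "\<exists>\<mu>. gcor2 \<mu> (corr_12 (\<lambda>a r s. Y a s r) u a b c) (corr_20 (\<lambda>a r s. Y a s r) u a b c) (corr_21 (\<lambda>a r s. Y a s r) u a b c)"
    if u: "graded_dual smul (\<lambda>(h, h'). Fg h' h) UNIV u" for u a b c
  proof -
    obtain \<mu> where "gcor2 \<mu> (corr_12 Y u a b c) (corr_20 Y u a b c) (corr_21 Y u a b c)"
      using FV5[OF graded_dual_swap[OF u]] by blast
    from gcor2_swap[OF this] show ?thesis
      by (simp add: swap_ser2_def corr_12_def corr_20_def corr_21_def swap_vser swap_ser_def)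
  qed
  show "Y a s r b \<in> Fg (h' + k' - s - 1) (h + k - r - 1)" if "a \<in> Fg h' h" "b \<in> Fg k' k" for a h h' b k k' r s
    by (rule FV6[OF that])
qed

end

section \<open>Heisenberg modes\<close>

text \<open>Differences in \<open>n\<close> lower the index of the binomial coefficients, so all $v_j$ with $j\ge1$ vanish by
  induction, and then $v_0$ does.\<close>

lemma binomial_combination_zero:
  fixes v :: "nat \<Rightarrow> 'v::ab_group_add"
  assumes "vector_space smul"
    and "\<And>n::nat. n \<ge> N ==> (\<Sum>j<J. smul (of_nat (n choose j) :: complex) (v j)) = 0" "j < J"
  shows "v j = 0"
  using assms(2,3)
proof (induction J arbitrary: v j)
  case (Suc J)
  interpret vector_space smul by fact
  have shift: "(\<Sum>j<J. smul (of_nat (n choose j) :: complex) (v (Suc j))) = 0" if "n \<ge> N" for n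
  proof -
    have "(\<Sum>j<Suc J. smul (of_nat (Suc n choose j) :: complex) (v j)) - (\<Sum>j<Suc J. smul (of_nat (n choose j) :: complex) (v j)) = 0"
      using Suc.prems(1)[of n] Suc.prems(1)[of "Suc n"] that by simp
    also have "(\<Sum>j<Suc J. smul (of_nat (Suc n choose j) :: complex) (v j)) - (\<Sum>j<Suc J. smul (of_nat (n choose j) :: complex) (v j)) =
       (\<Sum>j<J. smul (of_nat (n choose j) :: complex) (v (Suc j)))"
      unfolding sum.lessThan_Suc_shift by (simp add: sum_subtractf[symmetric] scale_left_distrib del: sum.lessThan_Suc)
    finally show ?thesis .
  qed
  have vS: "v (Suc i) = 0" if "i < J" for i by (rule Suc.IH[OF shift that])
  show ?case
  proof (cases j)
    case 0
    have "(\<Sum>j<Suc J. smul (of_nat (N choose j) :: complex) (v j)) = v 0"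
      unfolding sum.lessThan_Suc_shift using vS by simp
    then show ?thesis using Suc.prems(1)[of N] 0 by simp
  next
    case (Suc i) then show ?thesis using vS Suc.prems(2) by simp
  qed
qed simp

context full_H_vertex_algebra
begin

abbreviation "L \<equiv> lmode Y il"
abbreviation "R \<equiv> rmode Y ir"
abbreviation "WS \<equiv> weight_space smul Y il ir Bl Br"
abbreviation "VW \<equiv> vac_weight smul Y il ir Bl Br"

lemma L_lin: "L x n (v + w) = L x n v + L x n w" "L x n (smul c v) = smul c (L x n v)" "L x n 0 = 0"
   "L x n (- v) = - L x n v" "L x n (v - w) = L x n v - L x n w"
  and R_lin: "R y n (v + w) = R y n v + R y n w" "R y n (smul c v) = smul c (R y n v)" "R y n 0 = 0"
   "R y n (- v) = - R y n v" "R y n (v - w) = R y n v - R y n w"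
  by (simp_all add: lmode_def rmode_def Y_lin)

lemma L_linx: "L (x + x') n v = L x n v + L x' n v" "L (c *\<^sub>R x) n v = smul (of_real c) (L x n v)"
  and R_linx: "R (y + y') n v = R y n v + R y' n v" "R (c *\<^sub>R y) n v = smul (of_real c) (R y n v)"
  by (simp_all add: lmode_def rmode_def il_linear ir_linear Y_lin)

lemma weight_space_swap: "weight_space smul (\<lambda>a r s. Y a s r) ir il Br Bl \<alpha> = WS (prod.swap \<alpha>)"
  by (auto simp: weight_space_def lmode_def rmode_def)

lemma vac_weight_swap: "vac_weight smul (\<lambda>a r s. Y a s r) ir il Br Bl \<alpha> = VW (prod.swap \<alpha>)"
  unfolding vac_weight_def weight_space_swap by (auto simp: lmode_def rmode_def)

lemma conjugate_full_H_vertex_algebra: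
  "full_H_vertex_algebra smul (\<lambda>h h'. Fg h' h) (\<lambda>a r s. Y a s r) vac ir il Br Bl"
proof -
  interpret c: full_vertex_algebra smul "\<lambda>h h'. Fg h' h" "\<lambda>a r s. Y a s r" vac
    by (rule conjugate_full_vertex_algebra)
  show ?thesis
  proof unfold_locales
    show "fin_dim_form Br" "fin_dim_form Bl" by (rule form_r form_l)+
    show "inj ir" "inj il" by (rule ir_inj il_inj)+
    show "real_semisimple smul (lmode (\<lambda>a r s. Y a s r) ir x 0)" for x
      using FH1(2)[of x] by (simp add: lmode_def rmode_def)
    show "real_semisimple smul (rmode (\<lambda>a r s. Y a s r) il y 0)" for y
      using FH1(1)[of y] by (simp add: lmode_def rmode_def)
    show "\<exists>N. \<forall>t t'. t \<le> N \<or> t' \<le> N --> Fg t' t \<inter> weight_space smul (\<lambda>a r s. Y a s r) ir il Br Bl \<alpha> = {0}" for \<alpha>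
      unfolding weight_space_swap using FH2[of "prod.swap \<alpha>"] by blast
    show "lmode (\<lambda>a r s. Y a s r) ir x 1 (ir x') = smul (of_real (Br x x')) vac" for x x'
      using heis_r(1)[of x x'] by (simp add: lmode_def rmode_def)
    show "lmode (\<lambda>a r s. Y a s r) ir x n (ir x') = 0" if "n = 0 \<or> 2 \<le> n" for n x x'
      using heis_r(2)[OF that, of x x'] by (simp add: lmode_def rmode_def)
    show "rmode (\<lambda>a r s. Y a s r) il y 1 (il y') = smul (of_real (Bl y y')) vac" for y y'
      using heis_l(1)[of y y'] by (simp add: lmode_def rmode_def)
    show "rmode (\<lambda>a r s. Y a s r) il y n (il y') = 0" if "n = 0 \<or> 2 \<le> n" for n y y'
      using heis_l(2)[OF that, of y y'] by (simp add: lmode_def rmode_def)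
  qed (simp_all add: il_linear ir_linear il_degree ir_degree Dbar_l D_r)
qed

lemma L_modes: "s \<noteq> -1 ==> Y (il x) r s c = 0"
  by (rule chiral_modes[OF Dbar_l])

lemma R_modes: "r \<noteq> -1 ==> Y (ir y) r s c = 0"
proof -
  interpret c: full_H_vertex_algebra smul "\<lambda>h h'. Fg h' h" "\<lambda>a r s. Y a s r" vac ir il Br Bl
    by (rule conjugate_full_H_vertex_algebra)
  show "r \<noteq> -1 ==> Y (ir y) r s c = 0" by (rule c.L_modes)
qed

lemma L_vser: "L x n c = vser Y (il x) c (- of_int n - 1) 0"
  and R_vser: "R y n c = vser Y (ir y) c 0 (- of_int n - 1)"
  by (simp_all add: lmode_def rmode_def vser_def)

lemma comm_L:
  "L x n (vser Y b c s s') = vser Y b (L x n c) s s' +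
    Sum_any (\<lambda>j::nat. smul (of_real (of_int n gchoose j)) (vser Y (L x (int j) b) c (s - of_int n + real j) s'))"
  using chiral_commutator[OF Dbar_l[of x], of n b c s s'] by (simp add: lmode_def diff_eq_eq add.commute)

text \<open>In the commutator formula only the product $h_l(1)h_l'=(h_l,h_l')_l\mathbf 1$ contributes.\<close>

lemma comm_LL:
  "L x m (L x' n c) = L x' n (L x m c) + (if m + n = 0 then smul (of_real (of_int m * Bl x x')) c else 0)"
proof -
  have h: "L x (int j) (il x') = (if j = 1 then smul (of_real (Bl x x')) vac else 0)" for j
  proof -
    have "j = 1 \<or> int j = 0 \<or> int j \<ge> 2" by linarith
    then show ?thesis using heis_l(1)[of x x'] heis_l(2)[of "int j" x x'] by auto
  qed
  have v: "vser Y vac c t t' = (if t = 0 \<and> t' = 0 then c else 0)" for t t' by (auto simp: vser_def FV4)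
  have l0: "vser Y 0 c t t' = 0" for t t' by (simp add: vser_def Y_lin)
  have ls: "vser Y (smul k b) c t t' = smul k (vser Y b c t t')" for k b t t' by (simp add: vser_def Y_lin)
  have "Sum_any (\<lambda>j::nat. smul (of_real (of_int m gchoose j)) (vser Y (L x (int j) (il x')) c (- of_int n - 1 - of_int m + real j) 0))
    = Sum_any (\<lambda>j::nat. if j = 1 then smul (of_real (of_int m gchoose j)) (smul (of_real (Bl x x')) (vser Y vac c (- of_int n - 1 - of_int m + real j) 0)) else 0)"
    by (rule Sum_any.cong) (simp add: h l0 ls)
  also have "\<dots> = (if m + n = 0 then smul (of_real (of_int m * Bl x x')) c else 0)"
  proof -
    have "- real_of_int n - 1 - of_int m + real 1 = 0 \<longleftrightarrow> m + n = 0" by linarith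
    then show ?thesis by (simp only: Sum_any.delta v) simp
  qed
  finally show ?thesis
    using comm_L[of x m "il x'" c "- of_int n - 1" 0] by (simp only: L_vser[symmetric])
qed

text \<open>The field of \<open>ir y\<close> contains no holomorphic variable, so its commutators with $h_l(n)$ contribute, for
  large \<open>n\<close> and a suitable power of \<open>z\<close>, nothing but a vanishing sum of ${n\choose i}h_l(i)$ applied to \<open>ir y\<close>.\<close>

lemma L_annihilates_ir: "L x (int j) (ir y) = 0"
proof -
  define V where "V i = vser Y (L x (int i) (ir y)) vac (real i - real j) 0" for i
  obtain J where J: "\<And>i. i \<ge> J ==> Y (il x) (real i) (-1) (ir y) = 0" using mode_eventually_zero by metis
  have J': "V i = 0" if "i \<ge> J" for i using J[OF that] by (simp add: V_def lmode_def vser_def Y_lin)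
  have "V j = 0"
  proof (rule binomial_combination_zero[OF vector_space_axioms, where N = "Suc j" and J = "max J (Suc j)"])
    fix n assume n: "Suc j \<le> n"
    have r0: "vser Y (ir y) c (real n - real j) 0 = 0" for c
      unfolding vser_def by (rule R_modes) (use n in auto)
    have "Sum_any (\<lambda>i::nat. smul (of_real (of_int (int n) gchoose i)) (vser Y (L x (int i) (ir y)) vac ((real n - real j) - of_int (int n) + real i) 0)) = 0"
      using comm_L[of x "int n" "ir y" vac "real n - real j" 0] by (simp add: r0 L_lin)
    moreover have "(real n - real j) - of_int (int n) + real i = real i - real j" for i by simp
    ultimately have "Sum_any (\<lambda>i::nat. smul (of_nat (n choose i)) (V i)) = 0"
      by (simp only: V_def) (simp add: binomial_gbinomial gbinomial_of_real[symmetric])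
    also have "Sum_any (\<lambda>i::nat. smul (of_nat (n choose i)) (V i)) = (\<Sum>i<max J (Suc j). smul (of_nat (n choose i)) (V i))"
    proof (rule Sum_any.expand_superset, simp, rule subsetI, rule ccontr)
      fix i assume "i \<in> {i. smul (of_nat (n choose i)) (V i) \<noteq> 0}" "i \<notin> {..<max J (Suc j)}"
      moreover from this(2) have "J \<le> i" by simp
      ultimately show False using J'[of i] by simp
    qed
    finally show "(\<Sum>i<max J (Suc j). smul (of_nat (n choose i)) (V i)) = 0" .
  qed auto
  then show ?thesis by (simp add: V_def vser_def FV3(2))
qed

lemma comm_LR: "L x m (R y n c) = R y n (L x m c)"
  using comm_L[of x m "ir y" c 0 "- of_int n - 1"]
  by (simp add: R_vser L_annihilates_ir) (simp add: vser_def Y_lin)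

lemma weight_spaceD:
  assumes "v \<in> WS \<alpha>"
  shows "L x 0 v = smul (of_real (Bl x (fst \<alpha>))) v" "R y 0 v = smul (of_real (Br y (snd \<alpha>))) v"
  using assms by (auto simp: weight_space_def)

lemma vac_weightD:
  assumes "v \<in> VW \<alpha>"
  shows "v \<in> WS \<alpha>" "n \<ge> 1 ==> L x n v = 0" "n \<ge> 1 ==> R y n v = 0"
  using assms by (auto simp: vac_weight_def)

text \<open>For a vacuum vector only the term $j=0$ of the commutator formula survives.\<close>

lemma comm_L_vac:
  assumes v: "v \<in> VW \<alpha>"
  shows "L x n (vser Y v c s s') = vser Y v (L x n c) s s' + smul (of_real (Bl x (fst \<alpha>))) (vser Y v c (s - of_int n) s')"
proof -
  have h: "L x (int j) v = (if j = 0 then smul (of_real (Bl x (fst \<alpha>))) v else 0)" for j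
    using weight_spaceD(1)[OF vac_weightD(1)[OF v], of x] vac_weightD(2)[OF v, of "int j" x] by (cases j) auto
  have "Sum_any (\<lambda>j::nat. smul (of_real (of_int n gchoose j)) (vser Y (L x (int j) v) c (s - of_int n + real j) s'))
    = Sum_any (\<lambda>j::nat. if j = 0 then smul (of_real (of_int n gchoose j)) (vser Y (smul (of_real (Bl x (fst \<alpha>))) v) c (s - of_int n + real j) s') else 0)"
    by (rule Sum_any.cong) (simp add: h, simp add: vser_def Y_lin)
  also have "\<dots> = smul (of_real (Bl x (fst \<alpha>))) (vser Y v c (s - of_int n) s')"
    by (simp only: Sum_any.delta) (simp add: vser_def Y_lin)
  finally show ?thesis using comm_L[of x n v c s s'] by simp
qed

lemma comm_R_vac:
  assumes v: "v \<in> VW \<alpha>"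
  shows "R y n (vser Y v c s s') = vser Y v (R y n c) s s' + smul (of_real (Br y (snd \<alpha>))) (vser Y v c s (s' - of_int n))"
proof -
  interpret c: full_H_vertex_algebra smul "\<lambda>h h'. Fg h' h" "\<lambda>a r s. Y a s r" vac ir il Br Bl
    by (rule conjugate_full_H_vertex_algebra)
  have "v \<in> c.VW (prod.swap \<alpha>)" using v by (simp add: vac_weight_swap)
  from c.comm_L_vac[OF this, of y n c s' s] show ?thesis by (simp add: lmode_def rmode_def vser_def)
qed

lemma vser_L_weight:
  assumes "b \<in> WS \<beta>" "c \<in> WS \<gamma>"
  shows "L x 0 (vser Y b c s s') = smul (of_real (Bl x (fst (\<beta> + \<gamma>)))) (vser Y b c s s')"
proof -
  have bil: "Bl x (a + b) = Bl x a + Bl x b" for a b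
    using form_l unfolding fin_dim_form_def bilinear_def by (meson linear_add)
  have "Sum_any (\<lambda>j::nat. smul (of_real (of_int 0 gchoose j)) (vser Y (L x (int j) b) c (s - of_int 0 + real j) s'))
    = Sum_any (\<lambda>j::nat. if j = 0 then vser Y (L x 0 b) c s s' else 0)"
    by (rule Sum_any.cong) (auto simp: gbinomial_0_left)
  also have "\<dots> = smul (of_real (Bl x (fst \<beta>))) (vser Y b c s s')"
    by (simp add: weight_spaceD(1)[OF assms(1)] vser_def Y_lin)
  finally have "L x 0 (vser Y b c s s') = smul (of_real (Bl x (fst \<gamma>))) (vser Y b c s s') + smul (of_real (Bl x (fst \<beta>))) (vser Y b c s s')"
    using comm_L[of x 0 b c s s'] weight_spaceD(1)[OF assms(2), of x] by (simp add: vser_def Y_lin)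
  then show ?thesis by (simp add: bil scale_left_distrib add.commute)
qed

lemma vser_weight:
  assumes "b \<in> WS \<beta>" "c \<in> WS \<gamma>"
  shows "vser Y b c s s' \<in> WS (\<beta> + \<gamma>)"
proof -
  interpret c: full_H_vertex_algebra smul "\<lambda>h h'. Fg h' h" "\<lambda>a r s. Y a s r" vac ir il Br Bl
    by (rule conjugate_full_H_vertex_algebra)
  have "b \<in> c.WS (prod.swap \<beta>)" "c \<in> c.WS (prod.swap \<gamma>)" using assms by (simp_all add: weight_space_swap)
  from c.vser_L_weight[OF this, of _ s' s]
  have "R y 0 (vser Y b c s s') = smul (of_real (Br y (snd (\<beta> + \<gamma>)))) (vser Y b c s s')" for y
    by (simp add: lmode_def rmode_def vser_def)
  with vser_L_weight[OF assms] show ?thesis by (simp add: weight_space_def)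
qed

lemma L_weight: "v \<in> WS \<alpha> ==> L x n v \<in> WS \<alpha>"
  unfolding weight_space_def mem_Collect_eq
  by (auto simp: comm_LL[of _ 0] comm_LR[symmetric] L_lin)

lemma R_weight: "v \<in> WS \<alpha> ==> R y n v \<in> WS \<alpha>"
proof -
  interpret c: full_H_vertex_algebra smul "\<lambda>h h'. Fg h' h" "\<lambda>a r s. Y a s r" vac ir il Br Bl
    by (rule conjugate_full_H_vertex_algebra)
  show "v \<in> WS \<alpha> ==> R y n v \<in> WS \<alpha>"
    using c.L_weight[of v "prod.swap \<alpha>" y n] by (simp add: weight_space_swap lmode_def rmode_def)
qed

lemma comm_RR:
  "R y m (R y' n c) = R y' n (R y m c) + (if m + n = 0 then smul (of_real (of_int m * Br y y')) c else 0)"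
proof -
  interpret c: full_H_vertex_algebra smul "\<lambda>h h'. Fg h' h" "\<lambda>a r s. Y a s r" vac ir il Br Bl
    by (rule conjugate_full_H_vertex_algebra)
  show ?thesis using c.comm_LL[of y m y' n c] by (simp add: lmode_def rmode_def)
qed

lemma L_degree: "v \<in> Fg h h' ==> L x n v \<in> Fg (h - of_int n) h'"
  using FV6[OF il_degree[of x], of v h h' "of_int n" "-1"] by (simp add: lmode_def)

lemma R_degree: "v \<in> Fg h h' ==> R y n v \<in> Fg h (h' - of_int n)"
  using FV6[OF ir_degree[of y], of v h h' "-1" "of_int n"] by (simp add: rmode_def)

lemma L_eventually_zero: "\<exists>J::nat. \<forall>j\<ge>J. L x (int j) b = 0"
  using mode_eventually_zero[of "il x" b] by (simp add: lmode_def)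

end

context full_H_vertex_algebra
begin

text \<open>In the iterate formula, the terms with $h_l$ on the left are killed by \<open>u\<close>, and of the others
  only $h_l(0)$ acts nontrivially on \<open>w\<close>.\<close>

lemma iterate_L_vac:
  assumes u: "gdual u" and w: "w \<in> VW \<gamma>" and p: "p \<ge> 1" and b: "b \<in> WS \<beta>"
    and kill: "\<And>m z. m \<ge> 1 ==> z \<in> WS (\<beta> + \<gamma>) ==> u (L x (- int m) z) = 0"
  shows "u (vser Y (L x (- int p) b) w t t') = - ((-1) ^ p * of_real (Bl x (fst \<gamma>)) * u (vser Y b w (t + real p) t'))"
proof -
  let ?f = "\<lambda>j::nat. smul (of_nat ((p + j - 1) choose j)) (Y (il x) (- real (p + j)) (-1) (vser Y b w (t - real j) t')
       - smul ((-1) ^ p) (vser Y b (Y (il x) (real j) (-1) w) (t + real (p + j)) t'))"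
  have it: "vser Y (Y (il x) (- real p) (-1) b) w t t' = Sum_any ?f" by (rule chiral_iterate[OF Dbar_l p])
  obtain J where J: "\<And>j. j \<ge> J ==> L x (int j) w = 0" using L_eventually_zero by metis
  obtain J' where J': "\<And>j. j \<ge> J' ==> vser Y b w (t - real j) t' = 0" using vser_eventually_zero by metis
  have "?f j = 0" if "j \<ge> max J J'" for j
  proof -
    have "Y (il x) (real j) (-1) w = 0" "vser Y b w (t - real j) t' = 0" using J[of j] J'[of j] that by (auto simp: lmode_def)
    then show ?thesis by (simp only: Yr.zero) (simp add: vser_def Y_lin)
  qed
  then have fin: "finite {j. ?f j \<noteq> 0}" by (rule finite_nat_support)
  have A: "u (Y (il x) (- real (p + j)) (-1) (vser Y b w (t - real j) t')) = 0" for j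
    using kill[of "p + j" "vser Y b w (t - real j) t'"] p vser_weight[OF b vac_weightD(1)[OF w]] by (simp add: lmode_def)
  have h: "Y (il x) (real j) (-1) w = (if j = 0 then smul (of_real (Bl x (fst \<gamma>))) w else 0)" for j
    using weight_spaceD(1)[OF vac_weightD(1)[OF w], of x] vac_weightD(2)[OF w, of "int j" x] by (cases j) (auto simp: lmode_def)
  have B: "vser Y b (Y (il x) (real j) (-1) w) (t + real (p + j)) t' =
      (if j = 0 then smul (of_real (Bl x (fst \<gamma>))) (vser Y b w (t + real p) t') else 0)" for j
    by (cases "j = 0") (simp_all add: h h[of 0, simplified], simp_all add: vser_def Y_lin)
  have "u (?f j) = (if j = 0 then - ((-1) ^ p * of_real (Bl x (fst \<gamma>)) * u (vser Y b w (t + real p) t')) else 0)" for j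
    unfolding B gdual_scale[OF u] gdual_diff[OF u] A by (simp add: gdual_scale[OF u] gdual_0[OF u])
  then have "Sum_any (\<lambda>j. u (?f j)) = - ((-1) ^ p * of_real (Bl x (fst \<gamma>)) * u (vser Y b w (t + real p) t'))"
    by (simp only: Sum_any.delta)
  then show ?thesis using gdual_Sum_any[OF u fin] it by (simp add: lmode_def)
qed

lemma iterate_R_vac:
  assumes u: "gdual u" and w: "w \<in> VW \<gamma>" and p: "p \<ge> 1" and b: "b \<in> WS \<beta>"
    and kill: "\<And>m z. m \<ge> 1 ==> z \<in> WS (\<beta> + \<gamma>) ==> u (R y (- int m) z) = 0"
  shows "u (vser Y (R y (- int p) b) w t t') = - ((-1) ^ p * of_real (Br y (snd \<gamma>)) * u (vser Y b w t (t' + real p)))"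
proof -
  interpret c: full_H_vertex_algebra smul "\<lambda>h h'. Fg h' h" "\<lambda>a r s. Y a s r" vac ir il Br Bl
    by (rule conjugate_full_H_vertex_algebra)
  have eq: "prod.swap (prod.swap \<beta> + prod.swap \<gamma>) = \<beta> + \<gamma>" by (simp add: prod_eq_iff)
  have k: "u (c.L y (- int m) z) = 0" if "m \<ge> 1" "z \<in> c.WS (prod.swap \<beta> + prod.swap \<gamma>)" for m z
  proof -
    have "z \<in> WS (\<beta> + \<gamma>)" using that(2) unfolding weight_space_swap eq .
    from kill[OF that(1) this] show ?thesis by (simp add: lmode_def rmode_def)
  qed
  have gd: "c.gdual u" by (rule graded_dual_swap) (rule u)
  have w': "w \<in> c.VW (prod.swap \<gamma>)" and b': "b \<in> c.WS (prod.swap \<beta>)"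
    using w b by (simp_all add: vac_weight_swap weight_space_swap)
  have "u (vser (\<lambda>a r s. Y a s r) (c.L y (- int p) b) w t' t) =
      - ((-1) ^ p * of_real (Br y (fst (prod.swap \<gamma>))) * u (vser (\<lambda>a r s. Y a s r) b w (t' + real p) t))"
    by (rule c.iterate_L_vac[OF gd w' p b' k])
  then show ?thesis by (simp add: lmode_def rmode_def vser_def)
qed

end

section \<open>Exponentials of operator-valued series\<close>

lemma sum_triangle_swap:
  fixes g :: "nat \<Rightarrow> nat \<Rightarrow> 'a::comm_monoid_add"
  shows "(\<Sum>i\<le>m. \<Sum>j\<le>m - i. g i j) = (\<Sum>j\<le>m. \<Sum>i\<le>m - j. g i j)"
proof -
  have *: "(\<Sum>i\<le>m. \<Sum>j\<le>m - i. h i j) = (\<Sum>i\<le>m. \<Sum>j | j \<in> {..m} \<and> i + j \<le> m. h i j)" for h :: "nat \<Rightarrow> nat \<Rightarrow> 'a"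
    by (intro sum.cong refl) auto
  have "(\<Sum>i\<le>m. \<Sum>j\<le>m - i. g i j) = (\<Sum>j\<le>m. \<Sum>i | i \<in> {..m} \<and> i + j \<le> m. g i j)"
    unfolding * by (rule sum.swap_restrict) auto
  also have "\<dots> = (\<Sum>j\<le>m. \<Sum>i\<le>m - j. g i j)"
    unfolding *[of "\<lambda>j i. g i j"] by (simp add: add.commute)
  finally show ?thesis .
qed

lemma additive_sum:
  fixes u :: "'a::ab_group_add \<Rightarrow> 'b::ab_group_add"
  assumes "\<And>x y. u (x + y) = u x + u y"
  shows "u (sum f A) = (\<Sum>i\<in>A. u (f i))"
proof -
  have "u 0 = 0" using assms[of 0 0] by simp
  then show ?thesis by (induction A rule: infinite_finite_induct) (simp_all add: assms)
qed

text \<open>Both sides are the same fourfold sum; this contains the associativity of the product that is needed below.\<close>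

lemma opser_mult_left_commute:
  fixes P Q S :: "'v::ab_group_add opser"
  assumes P: "\<And>i j v w. P i j (v + w) = P i j v + P i j w"
    and Q: "\<And>i j v w. Q i j (v + w) = Q i j v + Q i j w"
    and comm: "\<And>i j i' j' v. P i j (Q i' j' v) = Q i' j' (P i j v)"
  shows "opser_mult P (opser_mult Q S) m n v = opser_mult Q (opser_mult P S) m n v"
proof -
  have e: "opser_mult P (opser_mult Q S) m n v =
      (\<Sum>i\<le>m. \<Sum>i'\<le>m - i. \<Sum>j\<le>n. \<Sum>j'\<le>n - j. P i j (Q i' j' (S (m - i - i') (n - j - j') v)))"
    if P: "\<And>i j v w. P i j (v + w) = P i j v + P i j w" for P Q :: "'v opser"
  proof -
    have Ps: "P i j (sum f A) = (\<Sum>k\<in>A. P i j (f k))" for i j f and A :: "nat set"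
      by (rule additive_sum) (rule P)
    show ?thesis
      unfolding opser_mult_def Ps
      by (rule sum.cong[OF refl], rule sum.swap)
  qed
  have "(\<Sum>i\<le>m. \<Sum>i'\<le>m - i. \<Sum>j\<le>n. \<Sum>j'\<le>n - j. P i j (Q i' j' (S (m - i - i') (n - j - j') v)))
     = (\<Sum>i'\<le>m. \<Sum>i\<le>m - i'. \<Sum>j'\<le>n. \<Sum>j\<le>n - j'. P i j (Q i' j' (S (m - i - i') (n - j - j') v)))"
    by (subst sum_triangle_swap, subst sum_triangle_swap) (rule refl)
  also have "\<dots> = (\<Sum>i'\<le>m. \<Sum>i\<le>m - i'. \<Sum>j'\<le>n. \<Sum>j\<le>n - j'. Q i' j' (P i j (S (m - i' - i) (n - j' - j) v)))"
    unfolding comm by (intro sum.cong refl) (simp only: diff_commute)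
  finally show ?thesis unfolding e[OF P] e[OF Q] .
qed

lemma opser_power_vanish:
  fixes X :: "'v::ab_group_add opser"
  assumes X: "\<And>i j v w. X i j (v + w) = X i j v + X i j w" and X0: "\<And>v. X 0 0 v = 0"
  shows "k > m + n ==> opser_power X k m n v = 0"
proof (induction k arbitrary: m n)
  case (Suc k)
  have Xz: "X i j 0 = 0" for i j using X[of i j 0 0] by simp
  have "X i j (opser_power X k (m - i) (n - j) v) = 0" if "i \<le> m" "j \<le> n" for i j
  proof (cases "i = 0 \<and> j = 0")
    case False
    then have "opser_power X k (m - i) (n - j) v = 0" using that Suc.prems by (intro Suc.IH) auto
    then show ?thesis by (simp add: Xz)
  qed (simp add: X0)
  then show ?case by (simp add: opser_mult_def)
qed simp

context vector_space
begin

text \<open>The Euler derivation $x\,\partial_x$ satisfies the Leibniz rule, and commuting coefficients allow the usual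
  formula for the derivative of a power.\<close>

lemma opser_power_derivative:
  assumes X: "\<And>i j v w. X i j (v + w) = X i j v + X i j w" "\<And>i j c v. X i j (scale c v) = scale c (X i j v)"
    and comm: "\<And>i j i' j' v. X i j (X i' j' v) = X i' j' (X i j v)"
  shows "scale (of_nat m) (opser_power X (Suc k) m n v) =
    scale (of_nat (Suc k)) (opser_mult (\<lambda>i j v. scale (of_nat i) (X i j v)) (opser_power X k) m n v)"
proof (induction k arbitrary: m n v)
  case 0
  have *: "(\<Sum>i\<le>m. \<Sum>j\<le>n. f i j (if m - i = 0 \<and> n - j = 0 then v else 0)) = f m n v"
    if f: "\<And>i j. f i j 0 = 0" for f :: "nat \<Rightarrow> nat \<Rightarrow> 'b \<Rightarrow> 'b"
  proof -
    have "(\<Sum>i\<le>m. \<Sum>j\<le>n. f i j (if m - i = 0 \<and> n - j = 0 then v else 0)) =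
        (\<Sum>i\<le>m. if i = m then (\<Sum>j\<le>n. if j = n then f m n v else 0) else 0)"
    proof (rule sum.cong[OF refl])
      fix i assume i: "i \<in> {..m}"
      have "(\<Sum>j\<le>n. f i j (if m - i = 0 \<and> n - j = 0 then v else 0)) = (\<Sum>j\<le>n. if i = m \<and> j = n then f m n v else 0)"
        by (rule sum.cong[OF refl]) (use i in \<open>auto simp: f\<close>)
      then show "(\<Sum>j\<le>n. f i j (if m - i = 0 \<and> n - j = 0 then v else 0)) = (if i = m then (\<Sum>j\<le>n. if j = n then f m n v else 0) else 0)"
        by simp
    qed
    then show ?thesis by simp
  qed
  have Xz: "X i j 0 = 0" for i j using X(1)[of i j 0 0] by simp
  have "opser_mult X (opser_power X 0) m n v = X m n v"
    unfolding opser_mult_def opser_power.simps by (rule *) (rule Xz)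
  moreover have "opser_mult (\<lambda>i j v. scale (of_nat i) (X i j v)) (opser_power X 0) m n v = scale (of_nat m) (X m n v)"
    unfolding opser_mult_def opser_power.simps by (rule *[of "\<lambda>i j v. scale (of_nat i) (X i j v)"]) (simp add: Xz)
  ultimately show ?case by (simp only: opser_power.simps(2) of_nat_Suc of_nat_0 add_0_right scale_one)
next
  case (Suc k)
  let ?D = "\<lambda>i j v. scale (of_nat i) (X i j v)"
  let ?Q = "opser_power X (Suc k)"
  have leib: "scale (of_nat m) (opser_mult X ?Q m n v) =
      opser_mult ?D ?Q m n v + opser_mult X (\<lambda>i j v. scale (of_nat i) (?Q i j v)) m n v"
    unfolding opser_mult_def scale_sum_right sum.distrib[symmetric]
  proof (intro sum.cong refl)
    fix i j assume "i \<in> {..m}" "j \<in> {..n}"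
    then have "(of_nat m :: 'a) = of_nat i + of_nat (m - i)" by (simp flip: of_nat_add)
    then show "scale (of_nat m) (X i j (?Q (m - i) (n - j) v)) =
       ?D i j (?Q (m - i) (n - j) v) + X i j (scale (of_nat (m - i)) (?Q (m - i) (n - j) v))"
      by (simp only: scale_left_distrib X(2))
  qed
  have "opser_mult X (\<lambda>i j v. scale (of_nat i) (?Q i j v)) m n v =
      scale (of_nat (Suc k)) (opser_mult X (opser_mult ?D (opser_power X k)) m n v)"
    unfolding Suc.IH by (simp only: opser_mult_def[of X] X(2) scale_sum_right)
  also have "opser_mult X (opser_mult ?D (opser_power X k)) m n v = opser_mult ?D (opser_mult X (opser_power X k)) m n v"
    by (rule opser_mult_left_commute) (simp_all add: X scale_right_distrib comm)
  finally have "opser_mult X (\<lambda>i j v. scale (of_nat i) (?Q i j v)) m n v = scale (of_nat (Suc k)) (opser_mult ?D ?Q m n v)"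
    by (simp only: opser_power.simps)
  with leib show ?case by (simp only: opser_power.simps(2)[of X "Suc k"] of_nat_Suc[of "Suc k"] scale_left_distrib scale_one)
qed

end

text \<open>The logarithmic derivative: $x\,\partial_xe^X=(x\,\partial_xX)e^X$.\<close>

lemma opser_exp_recursion:
  fixes smul :: "complex \<Rightarrow> 'v::ab_group_add \<Rightarrow> 'v"
  assumes vs: "vector_space smul"
    and X: "\<And>i j v w. X i j (v + w) = X i j v + X i j w" "\<And>i j c v. X i j (smul c v) = smul c (X i j v)"
    and X0: "\<And>v. X 0 0 v = 0"
    and comm: "\<And>i j i' j' v. X i j (X i' j' v) = X i' j' (X i j v)"
  shows "smul (of_nat m) (opser_exp smul X m n v) =
    (\<Sum>i\<le>m. \<Sum>j\<le>n. smul (of_nat i) (X i j (opser_exp smul X (m - i) (n - j) v)))"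
proof -
  interpret vector_space smul by fact
  have Xz: "X i j 0 = 0" for i j using X(1)[of i j 0 0] by simp
  have Xs: "X i j (\<Sum>k\<in>A. f k) = (\<Sum>k\<in>A. X i j (f k))" for i j f and A :: "nat set" by (rule additive_sum) (rule X(1))
  have ext: "opser_exp smul X m' n' v = (\<Sum>k\<le>K. smul (1 / fact k) (opser_power X k m' n' v))" if "m' + n' \<le> K" for m' n' K
    unfolding opser_exp_def
    by (rule sum.mono_neutral_left) (use that in \<open>auto simp: opser_power_vanish[of X, OF X(1) X0]\<close>)
  let ?Q = "\<lambda>k. opser_mult (\<lambda>i j v. smul (of_nat i) (X i j v)) (opser_power X k) m n v"
  have st: "smul (of_nat m) (smul (1 / fact (Suc k)) (opser_power X (Suc k) m n v)) = smul (1 / fact k) (?Q k)" for k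
  proof -
    have "smul (of_nat m) (smul (1 / fact (Suc k)) (opser_power X (Suc k) m n v)) =
        smul (1 / fact (Suc k)) (smul (of_nat m) (opser_power X (Suc k) m n v))" by (rule scale_left_commute)
    also have "smul (of_nat m) (opser_power X (Suc k) m n v) = smul (of_nat (Suc k)) (?Q k)"
      by (rule opser_power_derivative[OF X comm])
    finally have "smul (of_nat m) (smul (1 / fact (Suc k)) (opser_power X (Suc k) m n v)) =
        smul (1 / fact (Suc k)) (smul (of_nat (Suc k)) (?Q k))" .
    also have "\<dots> = smul (1 / fact k) (?Q k)"
      unfolding scale_scale by (intro arg_cong2[of _ _ _ _ smul]) (simp_all add: field_simps del: of_nat_Suc)
    finally show ?thesis .
  qed
  have "smul (of_nat m) (opser_exp smul X m n v) = (\<Sum>k\<le>Suc (m + n). smul (of_nat m) (smul (1 / fact k) (opser_power X k m n v)))"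
    unfolding ext[OF le_SucI[OF order_refl]] scale_sum_right ..
  also have "\<dots> = (\<Sum>k\<le>m + n. smul (1 / fact k) (?Q k))"
    unfolding sum.atMost_Suc_shift st by simp
  also have "\<dots> = (\<Sum>k\<le>m + n. \<Sum>i\<le>m. \<Sum>j\<le>n. smul (of_nat i) (X i j (smul (1 / fact k) (opser_power X k (m - i) (n - j) v))))"
    unfolding opser_mult_def scale_sum_right X(2) by (intro sum.cong refl) (rule scale_left_commute)
  also have "\<dots> = (\<Sum>i\<le>m. \<Sum>j\<le>n. \<Sum>k\<le>m + n. smul (of_nat i) (X i j (smul (1 / fact k) (opser_power X k (m - i) (n - j) v))))"
    by (rule trans[OF sum.swap], rule sum.cong[OF refl], rule sum.swap)
  also have "\<dots> = (\<Sum>i\<le>m. \<Sum>j\<le>n. smul (of_nat i) (X i j (opser_exp smul X (m - i) (n - j) v)))"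
  proof (intro sum.cong refl)
    fix i j assume "i \<in> {..m}" "j \<in> {..n}"
    show "(\<Sum>k\<le>m + n. smul (of_nat i) (X i j (smul (1 / fact k) (opser_power X k (m - i) (n - j) v)))) =
       smul (of_nat i) (X i j (opser_exp smul X (m - i) (n - j) v))"
      by (subst ext[of "m - i" "n - j" "m + n"]) (simp_all add: Xs scale_sum_right)
  qed
  finally show ?thesis .
qed

lemma opser_mult_swap: "opser_mult (\<lambda>m n. P n m) (\<lambda>m n. Q n m) m n v = opser_mult P Q n m v"
  unfolding opser_mult_def by (rule sum.swap)

lemma opser_power_swap: "opser_power (\<lambda>m n. X n m) k = (\<lambda>m n. opser_power X k n m)"
proof (induction k)
  case (Suc k)
  show ?case
    unfolding opser_power.simps(2) Suc.IH by (intro ext) (rule opser_mult_swap)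
qed (auto simp: fun_eq_iff)

lemma opser_exp_swap: "opser_exp smul (\<lambda>m n. X n m) m n v = opser_exp smul X n m v"
  unfolding opser_exp_def opser_power_swap[of X] add.commute[of m n] ..

lemma opser_power_annihilated:
  assumes "\<And>i j. X i j w = 0" "\<And>i j. X i j 0 = 0"
  shows "opser_power X (Suc k) m n w = 0"
proof (induction k arbitrary: m n)
  case 0
  have "X i j (if m - i = 0 \<and> n - j = 0 then w else 0) = 0" for i j using assms by auto
  then show ?case by (simp only: opser_power.simps opser_mult_def sum.neutral_const)
next
  case (Suc k)
  show ?case unfolding opser_power.simps(2)[of X "Suc k"] opser_mult_def by (simp only: Suc.IH assms(2) sum.neutral_const)
qed

lemma opser_exp_annihilated:
  assumes "vector_space smul" "\<And>i j. X i j w = 0" "\<And>i j. X i j 0 = 0"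
  shows "opser_exp smul X m n w = (if m = 0 \<and> n = 0 then w else 0)"
proof -
  interpret vector_space smul by fact
  have "(\<Sum>k\<le>m + n. smul (1 / fact k) (opser_power X k m n w)) = (\<Sum>k\<le>m + n. if k = 0 then (if m = 0 \<and> n = 0 then w else 0) else 0)"
  proof (intro sum.cong refl)
    fix k show "smul (1 / fact k) (opser_power X k m n w) = (if k = 0 then (if m = 0 \<and> n = 0 then w else 0) else 0)"
      using opser_power_annihilated[of X w, OF assms(2,3)] by (cases k) (simp_all del: opser_power.simps(2))
  qed
  then show ?thesis by (simp add: opser_exp_def)
qed

section \<open>The operators \<open>E\<^sup>\<plusminus>\<close>\<close>

context full_H_vertex_algebra
begin

abbreviation "EM \<equiv> E_minus smul Y il ir"

definition Xop :: "'l \<times> 'r \<Rightarrow> 'v opser" where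
  "Xop \<alpha> m n v = (if m \<ge> 1 \<and> n = 0 then smul (1 / of_nat m) (L (fst \<alpha>) (- int m) v)
     else if m = 0 \<and> n \<ge> 1 then smul (1 / of_nat n) (R (snd \<alpha>) (- int n) v) else 0)"

lemma EM_Xop: "EM \<alpha> = opser_exp smul (Xop \<alpha>)"
  unfolding E_minus_def by (intro arg_cong[of _ _ "opser_exp smul"]) (auto simp: fun_eq_iff Xop_def)

lemma Xop_lin: "Xop \<alpha> i j (v + w) = Xop \<alpha> i j v + Xop \<alpha> i j w" "Xop \<alpha> i j (smul c v) = smul c (Xop \<alpha> i j v)"
  by (simp_all add: Xop_def L_lin R_lin scale_right_distrib)

lemma Xop_comm: "Xop \<alpha> i j (Xop \<alpha> i' j' v) = Xop \<alpha> i' j' (Xop \<alpha> i j v)"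
proof -
  have LL: "L x (- int p) (L x' (- int q) c) = L x' (- int q) (L x (- int p) c)" if "p \<ge> 1" for p q x x' c
    using comm_LL[of x "- int p" x' "- int q" c] that by (simp split: if_splits)
  have RR: "R x (- int p) (R x' (- int q) c) = R x' (- int q) (R x (- int p) c)" if "p \<ge> 1" for p q x x' c
    using comm_RR[of x "- int p" x' "- int q" c] that by (simp split: if_splits)
  have ll: "Xop \<alpha> i 0 (Xop \<alpha> i' 0 v) = Xop \<alpha> i' 0 (Xop \<alpha> i 0 v)"
    using LL[of i "fst \<alpha>" "fst \<alpha>" i' v] by (simp add: Xop_def L_lin R_lin mult.commute)
  have rr: "Xop \<alpha> 0 j (Xop \<alpha> 0 j' v) = Xop \<alpha> 0 j' (Xop \<alpha> 0 j v)"
    using RR[of j "snd \<alpha>" "snd \<alpha>" j' v] by (simp add: Xop_def L_lin R_lin mult.commute)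
  have lr: "Xop \<alpha> i 0 (Xop \<alpha> 0 j v) = Xop \<alpha> 0 j (Xop \<alpha> i 0 v)" for i j
    by (simp add: Xop_def L_lin R_lin comm_LR mult.commute)
  have "Xop \<alpha> k l v = 0" if "k \<noteq> 0" "l \<noteq> 0" for k l v using that by (simp add: Xop_def)
  moreover have "Xop \<alpha> k l 0 = 0" for k l by (simp add: Xop_def L_lin R_lin)
  ultimately show ?thesis using ll rr lr[of i j'] lr[of i' j] by (cases "i = 0"; cases "j = 0"; cases "i' = 0"; cases "j' = 0") auto
qed

lemma EM_swap: "E_minus smul (\<lambda>a r s. Y a s r) ir il \<alpha> m n v = EM (prod.swap \<alpha>) n m v"
proof -
  have "E_minus smul (\<lambda>a r s. Y a s r) ir il \<alpha> = opser_exp smul (\<lambda>m n. Xop (prod.swap \<alpha>) n m)"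
    unfolding E_minus_def by (intro arg_cong[of _ _ "opser_exp smul"]) (auto simp: fun_eq_iff Xop_def lmode_def rmode_def)
  then show ?thesis unfolding EM_Xop by (simp only: opser_exp_swap[of smul "Xop (prod.swap \<alpha>)"])
qed

lemma EM_00: "EM \<alpha> 0 0 v = v" by (simp add: EM_Xop opser_exp_def)

text \<open>This recursion, its mirror image and the constant term determine $E^-$; all properties of $E^-$ below
  are proved from them by induction.\<close>

lemma EM_recursion_l: "smul (of_nat m) (EM \<alpha> m n v) = (\<Sum>i=1..m. L (fst \<alpha>) (- int i) (EM \<alpha> (m - i) n v))"
proof -
  have X0: "Xop \<alpha> 0 0 v = 0" for v by (simp add: Xop_def)
  have "smul (of_nat m) (EM \<alpha> m n v) = (\<Sum>i\<le>m. \<Sum>j\<le>n. smul (of_nat i) (Xop \<alpha> i j (EM \<alpha> (m - i) (n - j) v)))"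
    unfolding EM_Xop by (rule opser_exp_recursion[OF vector_space_axioms]) (rule Xop_lin X0 Xop_comm)+
  also have "\<dots> = (\<Sum>i\<le>m. \<Sum>j\<le>n. if j = 0 then (if i = 0 then 0 else L (fst \<alpha>) (- int i) (EM \<alpha> (m - i) n v)) else 0)"
    by (intro sum.cong refl) (auto simp: Xop_def)
  also have "\<dots> = (\<Sum>i\<le>m. if i = 0 then 0 else L (fst \<alpha>) (- int i) (EM \<alpha> (m - i) n v))" by simp
  also have "\<dots> = (\<Sum>i=1..m. L (fst \<alpha>) (- int i) (EM \<alpha> (m - i) n v))"
    by (rule sum.mono_neutral_cong_right) auto
  finally show ?thesis .
qed

lemma EM_recursion_r: "smul (of_nat n) (EM \<alpha> m n v) = (\<Sum>i=1..n. R (snd \<alpha>) (- int i) (EM \<alpha> m (n - i) v))"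
proof -
  interpret c: full_H_vertex_algebra smul "\<lambda>h h'. Fg h' h" "\<lambda>a r s. Y a s r" vac ir il Br Bl
    by (rule conjugate_full_H_vertex_algebra)
  show ?thesis using c.EM_recursion_l[of n "prod.swap \<alpha>" m v] by (simp add: EM_swap lmode_def rmode_def)
qed

text \<open>Reduce the first index to 0, then the second one.\<close>

lemma EM_induct [consumes 0, case_names zero left right]:
  fixes P :: "nat \<Rightarrow> nat \<Rightarrow> bool"
  assumes "P 0 0"
    and "\<And>m n. m \<ge> 1 ==> (\<And>i. 1 \<le> i ==> i \<le> m ==> P (m - i) n) ==> P m n"
    and "\<And>n. n \<ge> 1 ==> (\<And>i. 1 \<le> i ==> i \<le> n ==> P 0 (n - i)) ==> P 0 n"
  shows "P m n"
proof (induction "m + n" arbitrary: m n rule: less_induct)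
  case less
  consider "m \<ge> 1" | "m = 0" "n \<ge> 1" | "m = 0" "n = 0" by linarith
  then show ?case
    by cases (use assms less in auto)
qed

lemma scale_of_nat_cancel: "m \<ge> 1 ==> smul (of_nat m) v = smul (of_nat m) w ==> v = w"
  by simp

lemma EM_lin: "EM \<alpha> m n (v + w) = EM \<alpha> m n v + EM \<alpha> m n w" (is ?A) "EM \<alpha> m n (smul c v) = smul c (EM \<alpha> m n v)" (is ?S)
proof -
  have "?A \<and> ?S"
  proof (induction m n rule: EM_induct)
    case (left m n)
    have a: "smul (of_nat m) (EM \<alpha> m n (v + w)) = smul (of_nat m) (EM \<alpha> m n v + EM \<alpha> m n w)"
      unfolding scale_right_distrib EM_recursion_l sum.distrib[symmetric]
      by (intro sum.cong refl) (use left(2) in \<open>simp add: L_lin\<close>)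
    have "smul (of_nat m) (smul c (EM \<alpha> m n v)) = smul c (smul (of_nat m) (EM \<alpha> m n v))" by (rule scale_left_commute)
    also have "\<dots> = smul (of_nat m) (EM \<alpha> m n (smul c v))"
      unfolding EM_recursion_l scale_sum_right by (intro sum.cong refl) (use left(2) in \<open>simp add: L_lin\<close>)
    finally have b: "smul (of_nat m) (EM \<alpha> m n (smul c v)) = smul (of_nat m) (smul c (EM \<alpha> m n v))" by simp
    from scale_of_nat_cancel[OF left(1) a] scale_of_nat_cancel[OF left(1) b] show ?case ..
  next
    case (right n)
    have a: "smul (of_nat n) (EM \<alpha> 0 n (v + w)) = smul (of_nat n) (EM \<alpha> 0 n v + EM \<alpha> 0 n w)"
      unfolding scale_right_distrib EM_recursion_r sum.distrib[symmetric]
      by (intro sum.cong refl) (use right(2) in \<open>simp add: R_lin\<close>)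
    have "smul (of_nat n) (smul c (EM \<alpha> 0 n v)) = smul c (smul (of_nat n) (EM \<alpha> 0 n v))" by (rule scale_left_commute)
    also have "\<dots> = smul (of_nat n) (EM \<alpha> 0 n (smul c v))"
      unfolding EM_recursion_r scale_sum_right by (intro sum.cong refl) (use right(2) in \<open>simp add: R_lin\<close>)
    finally have b: "smul (of_nat n) (EM \<alpha> 0 n (smul c v)) = smul (of_nat n) (smul c (EM \<alpha> 0 n v))" by simp
    from scale_of_nat_cancel[OF right(1) a] scale_of_nat_cancel[OF right(1) b] show ?case ..
  qed (simp add: EM_00)
  then show ?A ?S by simp_all
qed

lemma EM_0: "EM \<alpha> m n 0 = 0" using EM_lin(1)[of \<alpha> m n 0 0] by simp

lemma EM_preserves:
  assumes S: "\<And>m n. subspace (S m n)" and v: "v \<in> S 0 0"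
    and l: "\<And>m n i w. i \<ge> 1 ==> w \<in> S m n ==> L (fst \<alpha>) (- int i) w \<in> S (m + i) n"
    and r: "\<And>m n i w. i \<ge> 1 ==> w \<in> S m n ==> R (snd \<alpha>) (- int i) w \<in> S m (n + i)"
  shows "EM \<alpha> m n v \<in> S m n"
proof (induction m n rule: EM_induct)
  case (left m n)
  have "smul (of_nat m) (EM \<alpha> m n v) \<in> S m n"
    unfolding EM_recursion_l
  proof (rule subspace_sum[OF S])
    fix i assume i: "i \<in> {1..m}"
    then show "L (fst \<alpha>) (- int i) (EM \<alpha> (m - i) n v) \<in> S m n" using l[OF _ left(2)[of i], of i] by simp
  qed
  from subspace_scale[OF S this, of "1 / of_nat m"] left(1) show ?case by simp
next
  case (right n)
  have "smul (of_nat n) (EM \<alpha> 0 n v) \<in> S 0 n"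
    unfolding EM_recursion_r
  proof (rule subspace_sum[OF S])
    fix i assume i: "i \<in> {1..n}"
    then show "R (snd \<alpha>) (- int i) (EM \<alpha> 0 (n - i) v) \<in> S 0 n" using r[OF _ right(2)[of i], of i] by simp
  qed
  from subspace_scale[OF S this, of "1 / of_nat n"] right(1) show ?case by simp
qed (simp add: EM_00 v)

lemma WS_subspace: "subspace (WS \<alpha>)"
  unfolding weight_space_def by (rule subspaceI) (simp_all add: L_lin R_lin scale_right_distrib)

lemma VW_subspace: "subspace (VW \<alpha>)"
  by (rule subspaceI) (use WS_subspace[of \<alpha>] in \<open>auto simp: vac_weight_def L_lin R_lin subspace_0 subspace_add subspace_scale\<close>)

lemma EM_weight: "v \<in> WS \<beta> ==> EM \<alpha> m n v \<in> WS \<beta>"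
  by (rule EM_preserves[where S = "\<lambda>_ _. WS \<beta>"]) (auto simp: WS_subspace L_weight R_weight)

lemma EM_degree: "v \<in> Fg h h' ==> EM \<alpha> m n v \<in> Fg (h + real m) (h' + real n)"
proof (rule EM_preserves[where S = "\<lambda>m n. Fg (h + real m) (h' + real n)"])
  fix m n i w assume "w \<in> Fg (h + real m) (h' + real n)"
  from L_degree[OF this, of "fst \<alpha>" "- int i"] R_degree[OF this, of "snd \<alpha>" "- int i"]
  show "L (fst \<alpha>) (- int i) w \<in> Fg (h + real (m + i)) (h' + real n)"
    "R (snd \<alpha>) (- int i) w \<in> Fg (h + real m) (h' + real (n + i))" by (simp_all add: add.assoc)
qed (simp_all add: Fp_subspace)

lemma EM_zero_charge: "EM 0 m n v = (if m = 0 \<and> n = 0 then v else 0)"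
proof -
  have "L 0 k w = 0" "R 0 k w = 0" for k w using L_linx(2)[of 0 0 k w] R_linx(2)[of 0 0 k w] by simp_all
  then have "Xop 0 i j w = 0" for i j w by (simp add: Xop_def)
  then show ?thesis unfolding EM_Xop by (intro opser_exp_annihilated[OF vector_space_axioms])
qed

lemma EP_vac: "w \<in> VW \<beta> ==> E_plus smul Y il ir \<alpha> m n w = (if m = 0 \<and> n = 0 then w else 0)"
  unfolding E_plus_def
  by (rule opser_exp_annihilated[OF vector_space_axioms]) (simp_all add: vac_weightD L_lin R_lin)

text \<open>By the recursion, every coefficient of $E^-$ except the constant term is a sum of descendants.\<close>

lemma EM_killed:
  assumes u: "gdual u" and v: "v \<in> WS \<gamma>"
    and kl: "\<And>x m z. m \<ge> 1 ==> z \<in> WS \<gamma> ==> u (L x (- int m) z) = 0"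
    and kr: "\<And>y m z. m \<ge> 1 ==> z \<in> WS \<gamma> ==> u (R y (- int m) z) = 0"
  shows "u (EM \<alpha> m n v) = (if m = 0 \<and> n = 0 then u v else 0)"
proof -
  have us: "u (sum f A) = (\<Sum>i\<in>A. u (f i))" for f and A :: "nat set" by (rule additive_sum) (rule gdual_add[OF u])
  have "u (EM \<alpha> m n v) = 0" if "m \<noteq> 0"
  proof -
    have "of_nat m * u (EM \<alpha> m n v) = u (smul (of_nat m) (EM \<alpha> m n v))" by (simp add: gdual_scale[OF u])
    also have "\<dots> = 0" unfolding EM_recursion_l us by (intro sum.neutral ballI kl EM_weight v) simp
    finally show ?thesis using that by simp
  qed
  moreover have "u (EM \<alpha> m n v) = 0" if "n \<noteq> 0"
  proof -
    have "of_nat n * u (EM \<alpha> m n v) = u (smul (of_nat n) (EM \<alpha> m n v))" by (simp add: gdual_scale[OF u])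
    also have "\<dots> = 0" unfolding EM_recursion_r us by (intro sum.neutral ballI kr EM_weight v) simp
    finally show ?thesis using that by simp
  qed
  ultimately show ?thesis by (auto simp: EM_00)
qed

end

section \<open>The dressed vertex operators\<close>

lemma Sum_any_reindex_inj:
  assumes "inj \<phi>" "\<And>b. b \<notin> range \<phi> ==> g b = 0"
  shows "Sum_any g = Sum_any (\<lambda>a. g (\<phi> a))"
proof -
  have "{b. g b \<noteq> 0} = \<phi> ` {a. g (\<phi> a) \<noteq> 0}"
  proof (intro equalityI subsetI)
    fix b assume b: "b \<in> {b. g b \<noteq> 0}"
    then have "b \<in> range \<phi>" using assms(2)[of b] by blast
    with b show "b \<in> \<phi> ` {a. g (\<phi> a) \<noteq> 0}" by auto
  qed auto
  then have "Sum_any g = sum g (\<phi> ` {a. g (\<phi> a) \<noteq> 0})" by (simp add: Sum_any.expand_set)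
  also have "\<dots> = Sum_any (\<lambda>a. g (\<phi> a))"
    using assms(1) by (subst sum.reindex) (auto simp: Sum_any.expand_set inj_on_def)
  finally show ?thesis .
qed

lemma fin_dim_formD:
  fixes B :: "'h::real_vector \<Rightarrow> 'h \<Rightarrow> real"
  assumes "fin_dim_form B"
  shows "bilinear B" "B x y = B y x" "(\<And>y. B x y = 0) ==> x = 0" "\<exists>S::'h set. finite S \<and> span S = UNIV"
proof -
  note f = assms[unfolded fin_dim_form_def]
  show "bilinear B" using f[THEN conjunct2, THEN conjunct1] .
  show "\<exists>S::'h set. finite S \<and> span S = UNIV" using f[THEN conjunct1] .
  show "B x y = B y x" using f[THEN conjunct2, THEN conjunct2, THEN conjunct1] by (elim allE)
  show "(\<And>y. B x y = 0) ==> x = 0" using f[THEN conjunct2, THEN conjunct2, THEN conjunct2, rule_format, of x] .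
qed

lemma (in vector_space) subspace_Sum_any:
  assumes "subspace S" "\<And>i. f i \<in> S"
  shows "Sum_any f \<in> S"
  unfolding Sum_any.expand_set by (rule subspace_sum) (use assms in auto)

text \<open>The recursion of $(1-\epsilon x)^\kappa=\exp(-\kappa\sum_i\epsilon^ix^i/i)$ by its logarithmic derivative.\<close>

lemma binomial_series_recursion:
  fixes \<epsilon> :: complex and \<kappa> :: real
  shows "of_nat m * ((- \<epsilon>) ^ m * of_real (\<kappa> gchoose m)) =
    (\<Sum>i=1..m. - (\<epsilon> ^ i * of_real \<kappa>) * ((- \<epsilon>) ^ (m - i) * of_real (\<kappa> gchoose (m - i))))"
proof (induction m)
  case (Suc m)
  let ?c = "\<lambda>m. (- \<epsilon>) ^ m * complex_of_real (\<kappa> gchoose m)"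
  have "(\<Sum>i=1..Suc m. - (\<epsilon> ^ i * of_real \<kappa>) * ?c (Suc m - i)) =
      - (\<epsilon> * of_real \<kappa>) * ?c m + (\<Sum>i=1..m. - (\<epsilon> ^ Suc i * of_real \<kappa>) * ?c (m - i))"
    by (subst sum.atLeast_Suc_atMost) (simp, simp only: sum.shift_bounds_cl_Suc_ivl, simp)
  also have "(\<Sum>i=1..m. - (\<epsilon> ^ Suc i * of_real \<kappa>) * ?c (m - i)) = \<epsilon> * (of_nat m * ?c m)"
    unfolding Suc.IH sum_distrib_left by (intro sum.cong refl) (simp add: algebra_simps)
  finally have "(\<Sum>i=1..Suc m. - (\<epsilon> ^ i * of_real \<kappa>) * ?c (Suc m - i)) = - (\<epsilon> * of_real \<kappa>) * ?c m + \<epsilon> * (of_nat m * ?c m)" .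
  moreover have "of_nat (Suc m) * ?c (Suc m) = - (\<epsilon> * of_real \<kappa>) * ?c m + \<epsilon> * (of_nat m * ?c m)"
  proof -
    have "complex_of_real (\<kappa> * (\<kappa> gchoose m)) = of_real (of_nat m * (\<kappa> gchoose m) + of_nat (Suc m) * (\<kappa> gchoose Suc m))"
      by (simp only: gbinomial_mult_1)
    then have g: "of_nat (Suc m) * complex_of_real (\<kappa> gchoose Suc m) = of_real \<kappa> * of_real (\<kappa> gchoose m) - of_nat m * of_real (\<kappa> gchoose m)"
      by (simp add: algebra_simps)
    have "of_nat (Suc m) * ?c (Suc m) = (- \<epsilon>) ^ Suc m * (of_nat (Suc m) * complex_of_real (\<kappa> gchoose Suc m))" by (simp only: mult_ac)
    also have "\<dots> = - (\<epsilon> * of_real \<kappa>) * ?c m + \<epsilon> * (of_nat m * ?c m)" unfolding g by (simp add: algebra_simps)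
    finally show ?thesis .
  qed
  ultimately show ?case by simp
qed simp

context full_H_vertex_algebra
begin

text \<open>For $p\ge1$ the commutator of $h(p)$ with $\sum_i(p\alpha)(-i)x^i/i$ is the scalar $(h,p\alpha)x^p$, so
  $E^-$ is an eigenvector of the commutator with $h(p)$.\<close>

lemma comm_L_EM:
  assumes p: "p \<ge> 1"
  shows "L x (int p) (EM \<alpha> m n w) = EM \<alpha> m n (L x (int p) w) +
     (if p \<le> m then smul (of_real (Bl x (fst \<alpha>))) (EM \<alpha> (m - p) n w) else 0)"
proof (induction m n rule: EM_induct)
  case (left m n)
  let ?b = "of_real (Bl x (fst \<alpha>)) :: complex"
  let ?g = "\<lambda>i. if p \<le> m - i then smul ?b (EM \<alpha> (m - i - p) n w) else 0"
  let ?k = "\<lambda>i. if p = i then smul (of_nat p * ?b) (EM \<alpha> (m - i) n w) else 0"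
  have Ls: "L x k (sum f A) = (\<Sum>i\<in>A. L x k (f i))" for x k f and A :: "nat set"
    by (rule additive_sum) (rule L_lin)
  have "smul (of_nat m) (L x (int p) (EM \<alpha> m n w)) = (\<Sum>i=1..m. L x (int p) (L (fst \<alpha>) (- int i) (EM \<alpha> (m - i) n w)))"
    unfolding L_lin(2)[symmetric] EM_recursion_l Ls ..
  also have "\<dots> = (\<Sum>i=1..m. L (fst \<alpha>) (- int i) (EM \<alpha> (m - i) n (L x (int p) w)) + (L (fst \<alpha>) (- int i) (?g i) + ?k i))"
  proof (rule sum.cong[OF refl])
    fix i assume i: "i \<in> {1..m}"
    have "L x (int p) (L (fst \<alpha>) (- int i) (EM \<alpha> (m - i) n w)) = L (fst \<alpha>) (- int i) (L x (int p) (EM \<alpha> (m - i) n w)) + ?k i"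
      by (subst comm_LL) simp
    then show "L x (int p) (L (fst \<alpha>) (- int i) (EM \<alpha> (m - i) n w)) =
        L (fst \<alpha>) (- int i) (EM \<alpha> (m - i) n (L x (int p) w)) + (L (fst \<alpha>) (- int i) (?g i) + ?k i)"
      using left(2)[of i] i by (simp only: L_lin(1) atLeastAtMost_iff add.assoc simp_thms)
  qed
  also have "\<dots> = smul (of_nat m) (EM \<alpha> m n (L x (int p) w)) + ((\<Sum>i=1..m. L (fst \<alpha>) (- int i) (?g i)) + (\<Sum>i=1..m. ?k i))"
    unfolding EM_recursion_l by (simp only: sum.distrib)
  also have "(\<Sum>i=1..m. L (fst \<alpha>) (- int i) (?g i)) + (\<Sum>i=1..m. ?k i) =
      smul (of_nat m) (if p \<le> m then smul ?b (EM \<alpha> (m - p) n w) else 0)"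
  proof (cases "p \<le> m")
    case True
    have "(\<Sum>i=1..m. L (fst \<alpha>) (- int i) (?g i)) = (\<Sum>i=1..m - p. L (fst \<alpha>) (- int i) (smul ?b (EM \<alpha> (m - p - i) n w)))"
      by (rule sum.mono_neutral_cong_right) (use p in \<open>auto simp: L_lin diff_commute add.commute\<close>)
    also have "\<dots> = smul ?b (smul (of_nat (m - p)) (EM \<alpha> (m - p) n w))"
      unfolding EM_recursion_l by (simp only: L_lin(2) scale_sum_right)
    finally have "(\<Sum>i=1..m. L (fst \<alpha>) (- int i) (?g i)) = smul (of_nat (m - p) * ?b) (EM \<alpha> (m - p) n w)"
      by (simp add: mult.commute)
    moreover have "(\<Sum>i=1..m. ?k i) = smul (of_nat p * ?b) (EM \<alpha> (m - p) n w)"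
      using True p by (simp only: sum.delta' finite_atLeastAtMost) auto
    moreover have "of_nat (m - p) * ?b + of_nat p * ?b = of_nat m * ?b" using True by (simp add: of_nat_diff algebra_simps)
    ultimately show ?thesis using True by (simp flip: scale_left_distrib)
  next
    case False
    then have "(\<Sum>i=1..m. L (fst \<alpha>) (- int i) (?g i)) = 0" "(\<Sum>i=1..m. ?k i) = 0"
      by (auto intro!: sum.neutral simp: L_lin)
    with False show ?thesis by simp
  qed
  also have "smul (of_nat m) (EM \<alpha> m n (L x (int p) w)) + smul (of_nat m) (if p \<le> m then smul ?b (EM \<alpha> (m - p) n w) else 0) =
      smul (of_nat m) (EM \<alpha> m n (L x (int p) w) + (if p \<le> m then smul ?b (EM \<alpha> (m - p) n w) else 0))"
    by (rule scale_right_distrib[symmetric])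
  finally show ?case by (rule scale_of_nat_cancel[OF left(1)])
next
  case (right n)
  have Ls: "L x k (sum f A) = (\<Sum>i\<in>A. L x k (f i))" for x k f and A :: "nat set"
    by (rule additive_sum) (rule L_lin)
  have "smul (of_nat n) (L x (int p) (EM \<alpha> 0 n w)) = (\<Sum>i=1..n. L x (int p) (R (snd \<alpha>) (- int i) (EM \<alpha> 0 (n - i) w)))"
    unfolding L_lin(2)[symmetric] EM_recursion_r Ls ..
  also have "\<dots> = (\<Sum>i=1..n. R (snd \<alpha>) (- int i) (EM \<alpha> 0 (n - i) (L x (int p) w)))"
    by (rule sum.cong[OF refl]) (use right(2) p in \<open>simp add: comm_LR\<close>)
  also have "\<dots> = smul (of_nat n) (EM \<alpha> 0 n (L x (int p) w))" unfolding EM_recursion_r ..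
  finally have "L x (int p) (EM \<alpha> 0 n w) = EM \<alpha> 0 n (L x (int p) w)" by (rule scale_of_nat_cancel[OF right(1)])
  then show ?case using p by simp
qed (use p in \<open>simp add: EM_00\<close>)

text \<open>If a linear functional turns each creation operator into a shift of the exponents times a scalar, it turns the
  exponential of creation operators into the binomial series with the same recursion. The case
  $\epsilon=1$ occurs when $E^-$ is moved to the left, $\epsilon=-1$ when it stands inside an iterate.\<close>

lemma EM_eval:
  fixes G :: "'v \<Rightarrow> real \<Rightarrow> real \<Rightarrow> complex" and \<epsilon> :: complex
  assumes G: "\<And>c d s s'. G (c + d) s s' = G c s s' + G d s s'" "\<And>k c s s'. G (smul k c) s s' = k * G c s s'"
    and hl: "\<And>i c s s'. i \<ge> 1 ==> c \<in> WS \<gamma> ==> G (L (fst \<alpha>) (- int i) c) s s' = - (\<epsilon> ^ i * of_real \<kappa>) * G c (s + real i) s'"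
    and hr: "\<And>i c s s'. i \<ge> 1 ==> c \<in> WS \<gamma> ==> G (R (snd \<alpha>) (- int i) c) s s' = - (\<epsilon> ^ i * of_real \<kappa>') * G c s (s' + real i)"
    and c: "c \<in> WS \<gamma>"
  shows "G (EM \<alpha> m n c) s s' = ((- \<epsilon>) ^ m * of_real (\<kappa> gchoose m)) * ((- \<epsilon>) ^ n * of_real (\<kappa>' gchoose n)) * G c (s + real m) (s' + real n)"
proof (induction m n arbitrary: s s' rule: EM_induct)
  case (left m n)
  let ?l = "\<lambda>m. (- \<epsilon>) ^ m * complex_of_real (\<kappa> gchoose m)" and ?r = "(- \<epsilon>) ^ n * complex_of_real (\<kappa>' gchoose n)"
  have Gs: "G (sum f A) s s' = (\<Sum>i\<in>A. G (f i) s s')" for f and A :: "nat set" by (rule additive_sum) (rule G)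
  have "of_nat m * G (EM \<alpha> m n c) s s' = (\<Sum>i=1..m. G (L (fst \<alpha>) (- int i) (EM \<alpha> (m - i) n c)) s s')"
    unfolding G(2)[symmetric] EM_recursion_l Gs ..
  also have "\<dots> = (\<Sum>i=1..m. (- (\<epsilon> ^ i * of_real \<kappa>) * ?l (m - i)) * (?r * G c (s + real m) (s' + real n)))"
  proof (rule sum.cong[OF refl])
    fix i assume i: "i \<in> {1..m}"
    then have "s + real i + real (m - i) = s + real m" by (simp add: of_nat_diff)
    then show "G (L (fst \<alpha>) (- int i) (EM \<alpha> (m - i) n c)) s s' = (- (\<epsilon> ^ i * of_real \<kappa>) * ?l (m - i)) * (?r * G c (s + real m) (s' + real n))"
      using i hl[OF _ EM_weight[OF c], of i \<alpha> "m - i" n s s'] left(2)[of i "s + real i" s'] by (simp add: mult.assoc)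
  qed
  also have "\<dots> = of_nat m * (?l m * ?r * G c (s + real m) (s' + real n))"
    unfolding sum_distrib_right[symmetric] binomial_series_recursion[symmetric] by (simp only: mult.assoc)
  finally show ?case using left(1) by simp
next
  case (right n)
  let ?r = "\<lambda>n. (- \<epsilon>) ^ n * complex_of_real (\<kappa>' gchoose n)"
  have Gs: "G (sum f A) s s' = (\<Sum>i\<in>A. G (f i) s s')" for f and A :: "nat set" by (rule additive_sum) (rule G)
  have "of_nat n * G (EM \<alpha> 0 n c) s s' = (\<Sum>i=1..n. G (R (snd \<alpha>) (- int i) (EM \<alpha> 0 (n - i) c)) s s')"
    unfolding G(2)[symmetric] EM_recursion_r Gs ..
  also have "\<dots> = (\<Sum>i=1..n. (- (\<epsilon> ^ i * of_real \<kappa>') * ?r (n - i)) * G c s (s' + real n))"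
  proof (rule sum.cong[OF refl])
    fix i assume i: "i \<in> {1..n}"
    then have "s' + real i + real (n - i) = s' + real n" by (simp add: of_nat_diff)
    then show "G (R (snd \<alpha>) (- int i) (EM \<alpha> 0 (n - i) c)) s s' = (- (\<epsilon> ^ i * of_real \<kappa>') * ?r (n - i)) * G c s (s' + real n)"
      using i hr[OF _ EM_weight[OF c], of i \<alpha> 0 "n - i" s s'] right(2)[of i s "s' + real i"] by (simp add: mult.assoc)
  qed
  also have "\<dots> = of_nat n * (?r n * G c s (s' + real n))"
    unfolding sum_distrib_right[symmetric] binomial_series_recursion[symmetric] by (simp only: mult.assoc)
  finally show ?case using right(1) by simp
qed (simp add: EM_00)

lemma Bl_bilinear: "Bl (x + x') y = Bl x y + Bl x' y" "Bl x (y + y') = Bl x y + Bl x y'" "Bl (- x) y = - Bl x y"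
    "Bl x (- y) = - Bl x y" "Bl (c *\<^sub>R x) y = c * Bl x y" "Bl x 0 = 0" "Bl 0 x = 0"
  and Br_bilinear: "Br (z + z') w = Br z w + Br z' w" "Br z (w + w') = Br z w + Br z w'" "Br (- z) w = - Br z w"
    "Br z (- w) = - Br z w" "Br (c *\<^sub>R z) w = c * Br z w" "Br z 0 = 0" "Br 0 z = 0"
proof -
  have l: "bilinear Bl" and r: "bilinear Br" by (rule fin_dim_formD form_l form_r)+
  show "Bl (x + x') y = Bl x y + Bl x' y" "Bl x (y + y') = Bl x y + Bl x y'" "Bl (- x) y = - Bl x y"
    "Bl x (- y) = - Bl x y" "Bl (c *\<^sub>R x) y = c * Bl x y" "Bl x 0 = 0" "Bl 0 x = 0"
    by (simp_all add: bilinear_ladd[OF l] bilinear_radd[OF l] bilinear_lneg[OF l] bilinear_rneg[OF l] bilinear_lmul[OF l]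
        bilinear_lzero[OF l] bilinear_rzero[OF l])
  show "Br (z + z') w = Br z w + Br z' w" "Br z (w + w') = Br z w + Br z w'" "Br (- z) w = - Br z w"
    "Br z (- w) = - Br z w" "Br (c *\<^sub>R z) w = c * Br z w" "Br z 0 = 0" "Br 0 z = 0"
    by (simp_all add: bilinear_ladd[OF r] bilinear_radd[OF r] bilinear_lneg[OF r] bilinear_rneg[OF r] bilinear_lmul[OF r]
        bilinear_lzero[OF r] bilinear_rzero[OF r])
qed

lemma Bl_commute: "Bl x y = Bl y x" and Br_commute: "Br z w = Br w z"
  by (rule fin_dim_formD(2)[OF form_l] fin_dim_formD(2)[OF form_r])+

abbreviation "Bp \<alpha> \<beta> \<equiv> Bl (fst \<alpha>) (fst \<beta>)"
abbreviation "Bq \<alpha> \<beta> \<equiv> Br (snd \<alpha>) (snd \<beta>)"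

text \<open>$\hat Y(v,\underline z)w$ for vacuum vectors \<open>v\<close>, \<open>w\<close> of charges $\alpha$, $\beta$, where $E^+$ acts as the
  identity.\<close>

definition Yhat :: "'l \<times> 'r \<Rightarrow> 'l \<times> 'r \<Rightarrow> 'v \<Rightarrow> 'v \<Rightarrow> 'v ser" where
  "Yhat \<alpha> \<beta> v w = (\<lambda>s s'. Sum_any (\<lambda>(m, n). EM (- \<alpha>) m n
     (vser Y v w (s - real m + Bp \<alpha> \<beta>) (s' - real n + Bq \<alpha> \<beta>))))"

lemma Yhat_finite:
  fixes \<alpha> :: "'l \<times> 'r"
  shows "finite {(m, n). EM \<alpha> m n (vser Y v w (s - real m) (s' - real n)) \<noteq> 0}"
proof -
  obtain J where J: "\<And>j t'. j \<ge> J ==> vser Y v w (s - real j) t' = 0" "\<And>j t. j \<ge> J ==> vser Y v w t (s' - real j) = 0"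
  proof -
    obtain N where N: "\<And>t t'. t \<le> N \<or> t' \<le> N ==> vser Y v w t t' = 0" using vser_bounded by metis
    have "s - real j \<le> N" "s' - real j \<le> N" if "j \<ge> nat \<lceil>max s s' - N\<rceil>" for j using that by linarith+
    then show ?thesis using N by (intro that[of "nat \<lceil>max s s' - N\<rceil>"]) blast+
  qed
  have box: "m < J \<and> n < J" if nz: "EM \<alpha> m n (vser Y v w (s - real m) (s' - real n)) \<noteq> 0" for m n
  proof (rule ccontr)
    assume "\<not> (m < J \<and> n < J)"
    then have "m \<ge> J \<or> n \<ge> J" by linarith
    then have "vser Y v w (s - real m) (s' - real n) = 0" using J(1)[of m "s' - real n"] J(2)[of n "s - real m"] by fast
    then have "EM \<alpha> m n (vser Y v w (s - real m) (s' - real n)) = EM \<alpha> m n 0" by (rule arg_cong)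
    from notE[OF nz trans[OF this EM_0]] show False .
  qed
  have "{(m, n). EM \<alpha> m n (vser Y v w (s - real m) (s' - real n)) \<noteq> 0} \<subseteq> {..<J} \<times> {..<J}"
  proof
    fix i assume i: "i \<in> {(m, n). EM \<alpha> m n (vser Y v w (s - real m) (s' - real n)) \<noteq> 0}"
    obtain m n where mn: "i = (m, n)" by (cases i)
    show "i \<in> {..<J} \<times> {..<J}" using box[of m n] i unfolding mn by simp
  qed
  then show ?thesis by (rule finite_subset) simp
qed

lemma Yhat_finite': "finite {a. (case a of (m, n) \<Rightarrow> EM \<alpha> m n (vser Y v w (s - real m + k) (s' - real n + k'))) \<noteq> 0}"
  using Yhat_finite[of \<alpha> v w "s + k" "s' + k'"] by (simp add: split_def algebra_simps)

lemma Yhat_lin: "Yhat \<alpha> \<beta> (v + v') w s s' = Yhat \<alpha> \<beta> v w s s' + Yhat \<alpha> \<beta> v' w s s'"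
    "Yhat \<alpha> \<beta> v (w + w') s s' = Yhat \<alpha> \<beta> v w s s' + Yhat \<alpha> \<beta> v w' s s'"
    "Yhat \<alpha> \<beta> (smul c v) w s s' = smul c (Yhat \<alpha> \<beta> v w s s')"
    "Yhat \<alpha> \<beta> v (smul c w) s s' = smul c (Yhat \<alpha> \<beta> v w s s')"
proof -
  have V: "vser Y (v + v') w t t' = vser Y v w t t' + vser Y v' w t t'" "vser Y v (w + w') t t' = vser Y v w t t' + vser Y v w' t t'"
    "vser Y (smul c v) w t t' = smul c (vser Y v w t t')" "vser Y v (smul c w) t t' = smul c (vser Y v w t t')" for t t'
    by (simp_all add: vser_def Y_lin)
  have S: "smul c (Yhat \<alpha> \<beta> v w s s') = Sum_any (\<lambda>i. smul c (case i of (m, n) \<Rightarrow> EM (- \<alpha>) m n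
     (vser Y v w (s - real m + Bp \<alpha> \<beta>) (s' - real n + Bq \<alpha> \<beta>))))"
    unfolding Yhat_def by (rule Sum_any_additive) (use Yhat_finite' in \<open>auto simp: scale_right_distrib\<close>)
  show "Yhat \<alpha> \<beta> (v + v') w s s' = Yhat \<alpha> \<beta> v w s s' + Yhat \<alpha> \<beta> v' w s s'"
    "Yhat \<alpha> \<beta> v (w + w') s s' = Yhat \<alpha> \<beta> v w s s' + Yhat \<alpha> \<beta> v w' s s'"
    unfolding Yhat_def V EM_lin
    by (subst Sum_any.distrib[symmetric], (rule Yhat_finite')+, rule Sum_any.cong, simp split: prod.split)+
  show "Yhat \<alpha> \<beta> (smul c v) w s s' = smul c (Yhat \<alpha> \<beta> v w s s')" "Yhat \<alpha> \<beta> v (smul c w) s s' = smul c (Yhat \<alpha> \<beta> v w s s')"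
    unfolding S unfolding Yhat_def V EM_lin by (rule Sum_any.cong, simp split: prod.split)+
qed

lemma vser_vac_Y_hom:
  assumes "w \<in> VW \<beta>"
  shows "vser (vac_Y_hom smul Y il ir Bl Br \<alpha> \<beta>) v w = Yhat \<alpha> \<beta> v w"
proof (intro ext)
  fix s s'
  let ?g = "\<lambda>((m, n), (m', n')). EM (- \<alpha>) m n
         (Y v (- s - 1 + real m - real m' + Bl (fst (- \<alpha>)) (fst \<beta>))
              (- s' - 1 + real n - real n' + Br (snd (- \<alpha>)) (snd \<beta>))
           (E_plus smul Y il ir (- \<alpha>) m' n' w))"
  have "Sum_any ?g = Sum_any (\<lambda>p. ?g (p, (0, 0)))"
  proof (rule Sum_any_reindex_inj)
    show "inj (\<lambda>p :: nat \<times> nat. (p, (0 :: nat, 0 :: nat)))" by (auto simp: inj_def)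
    fix b :: "(nat \<times> nat) \<times> nat \<times> nat" assume b: "b \<notin> range (\<lambda>p. (p, (0, 0)))"
    obtain m n m' n' where e: "b = ((m, n), (m', n'))" by (metis prod.exhaust)
    have "\<not> (m' = 0 \<and> n' = 0)" using b e by auto
    then show "?g b = 0" unfolding e by (auto simp: EP_vac[OF assms] Y_lin EM_0)
  qed
  then show "vser (vac_Y_hom smul Y il ir Bl Br \<alpha> \<beta>) v w s s' = Yhat \<alpha> \<beta> v w s s'"
    unfolding vser_def vac_Y_hom_def Yhat_def
    by (simp add: EP_vac[OF assms] Bl_bilinear Br_bilinear split_def algebra_simps)
qed

lemma Yhat_degree:
  assumes "v \<in> Fg h h'" "w \<in> Fg k k'"
  shows "Yhat \<alpha> \<beta> v w s s' \<in> Fg (h + k + s + Bp \<alpha> \<beta>) (h' + k' + s' + Bq \<alpha> \<beta>)"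
  unfolding Yhat_def
proof (rule subspace_Sum_any[OF Fp_subspace])
  fix i :: "nat \<times> nat"
  obtain m n where i: "i = (m, n)" by (cases i)
  let ?s = "s - real m + Bp \<alpha> \<beta>" and ?s' = "s' - real n + Bq \<alpha> \<beta>"
  have "vser Y v w ?s ?s' \<in> Fg (h + k + ?s) (h' + k' + ?s')"
    using FV6[OF assms, of "- ?s - 1" "- ?s' - 1"] by (simp add: vser_def algebra_simps)
  from EM_degree[OF this, of "- \<alpha>" m n]
  show "(case i of (m, n) \<Rightarrow> EM (- \<alpha>) m n (vser Y v w (s - real m + Bp \<alpha> \<beta>) (s' - real n + Bq \<alpha> \<beta>)))
      \<in> Fg (h + k + s + Bp \<alpha> \<beta>) (h' + k' + s' + Bq \<alpha> \<beta>)"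
    unfolding i by (simp add: algebra_simps)
qed

lemma Yhat_weight: "v \<in> WS \<alpha> ==> w \<in> WS \<beta> ==> Yhat \<alpha> \<beta> v w s s' \<in> WS (\<alpha> + \<beta>)"
  unfolding Yhat_def by (rule subspace_Sum_any[OF WS_subspace]) (auto intro!: EM_weight vser_weight)

text \<open>The commutator of $h(p)$ with $Y(v,\underline z)$ is $(h,p\alpha)z^p$ and that with $E^-(-\alpha,\underline z)$ is $-(h,p\alpha)z^p$.
  In coefficients, the second contribution is the first one with the index \<open>m\<close> shifted by \<open>p\<close>.\<close>

lemma Yhat_annihilated_L:
  assumes v: "v \<in> VW \<alpha>" and w: "w \<in> VW \<beta>" and p: "p \<ge> 1"
  shows "L x (int p) (Yhat \<alpha> \<beta> v w s s') = 0"
proof -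
  let ?V = "\<lambda>m n. vser Y v w (s - real m + Bp \<alpha> \<beta>) (s' - real n + Bq \<alpha> \<beta>)"
  let ?b = "of_real (Bl x (fst \<alpha>)) :: complex"
  let ?T = "\<lambda>(m, n). smul ?b (EM (- \<alpha>) m n (?V (m + p) n))"
  let ?T' = "\<lambda>(m, n). if p \<le> m then ?T (m - p, n) else 0"
  have LV: "L x (int p) (?V m n) = smul ?b (?V (m + p) n)" for m n
  proof -
    have z: "vser Y v 0 t t' = 0" for t t' by (simp add: vser_def Y_lin)
    have L0: "L x (int p) w = 0" by (rule vac_weightD(2)[OF w]) (use p in simp)
    have e: "s - real (m + p) + Bp \<alpha> \<beta> = s - real m + Bp \<alpha> \<beta> - of_int (int p)" by simp
    show ?thesis unfolding e comm_L_vac[OF v] L0 z by simp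
  qed
  have E: "L x (int p) (EM (- \<alpha>) m n (?V m n)) = ?T (m, n) - ?T' (m, n)" for m n
    unfolding comm_L_EM[OF p] LV by (simp add: EM_lin Bl_bilinear)
  have f1: "finite {i. ?T i \<noteq> 0}"
    by (rule finite_subset[OF _ Yhat_finite'[of "- \<alpha>" v w s "Bp \<alpha> \<beta> - real p" s' "Bq \<alpha> \<beta>"]])
       (auto simp: algebra_simps)
  have r: "{i. ?T' i \<noteq> 0} \<subseteq> (\<lambda>(m, n). (m + p, n)) ` {i. ?T i \<noteq> 0}"
  proof
    fix i assume i: "i \<in> {i. ?T' i \<noteq> 0}"
    obtain m n where mn: "i = (m, n)" by (cases i)
    have "p \<le> m" "?T (m - p, n) \<noteq> 0" using i unfolding mn by (auto split: if_splits)
    then show "i \<in> (\<lambda>(m, n). (m + p, n)) ` {i. ?T i \<noteq> 0}" unfolding mn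
      by (intro image_eqI[of _ _ "(m - p, n)"]) auto
  qed
  have f2: "finite {i. ?T' i \<noteq> 0}" by (rule finite_subset[OF r]) (rule finite_imageI[OF f1])
  have "Sum_any ?T' = Sum_any (\<lambda>i. ?T' ((\<lambda>(m, n). (m + p, n)) i))"
  proof (rule Sum_any_reindex_inj)
    show "inj (\<lambda>(m, n). (m + p, n :: nat))" by (auto simp: inj_def)
    fix b assume b: "b \<notin> range (\<lambda>(m, n). (m + p, n :: nat))"
    obtain m n where mn: "b = (m, n)" by (cases b)
    have "\<not> p \<le> m"
    proof
      assume "p \<le> m" then have "b = (\<lambda>(m, n). (m + p, n)) (m - p, n)" using mn by simp
      with b show False by blast
    qed
    then show "?T' b = 0" unfolding mn by simp
  qed
  also have "\<dots> = Sum_any ?T" by (rule Sum_any.cong) (simp split: prod.split)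
  finally have TT: "Sum_any ?T' = Sum_any ?T" .
  have "L x (int p) (Yhat \<alpha> \<beta> v w s s') = Sum_any (\<lambda>i. L x (int p) (case i of (m, n) \<Rightarrow> EM (- \<alpha>) m n (?V m n)))"
    unfolding Yhat_def by (rule Sum_any_additive[OF Yhat_finite']) (rule L_lin)
  also have "\<dots> = Sum_any (\<lambda>i. ?T i + - ?T' i)"
  proof (rule Sum_any.cong)
    fix i show "L x (int p) (case i of (m, n) \<Rightarrow> EM (- \<alpha>) m n (?V m n)) = ?T i + - ?T' i"
      using E[of "fst i" "snd i"] by (cases i) simp
  qed
  also have "\<dots> = Sum_any ?T + Sum_any (\<lambda>i. - ?T' i)"
  proof (rule Sum_any.distrib[OF f1])
    have "{i. - ?T' i \<noteq> 0} = {i. ?T' i \<noteq> 0}" by simp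
    then show "finite {i. - ?T' i \<noteq> 0}" using f2 by simp
  qed
  also have "Sum_any (\<lambda>i. - ?T' i) = - Sum_any ?T'" by (rule Sum_any_additive[OF f2, symmetric]) simp
  finally show ?thesis using TT by simp
qed

lemma Yhat_swap:
  "full_H_vertex_algebra.Yhat smul (\<lambda>a r s. Y a s r) ir il Br Bl (prod.swap \<alpha>) (prod.swap \<beta>) v w s' s = Yhat \<alpha> \<beta> v w s s'"
proof -
  interpret c: full_H_vertex_algebra smul "\<lambda>h h'. Fg h' h" "\<lambda>a r s. Y a s r" vac ir il Br Bl
    by (rule conjugate_full_H_vertex_algebra)
  have "Yhat \<alpha> \<beta> v w s s' = Sum_any (\<lambda>i. case prod.swap i of (m, n) \<Rightarrow> EM (- \<alpha>) m n
     (vser Y v w (s - real m + Bp \<alpha> \<beta>) (s' - real n + Bq \<alpha> \<beta>)))"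
    unfolding Yhat_def by (rule Sum_any_reindex_inj) (auto simp: inj_def surj_def)
  also have "\<dots> = c.Yhat (prod.swap \<alpha>) (prod.swap \<beta>) v w s' s"
    unfolding c.Yhat_def
  proof (rule Sum_any.cong)
    have "prod.swap (- prod.swap \<alpha>) = - \<alpha>" by (simp add: prod_eq_iff)
    then show "(case prod.swap i of (m, n) \<Rightarrow> EM (- \<alpha>) m n
       (vser Y v w (s - real m + Bp \<alpha> \<beta>) (s' - real n + Bq \<alpha> \<beta>))) =
      (case i of (m, n) \<Rightarrow> c.EM (- prod.swap \<alpha>) m n (vser (\<lambda>a r s. Y a s r) v w (s' - real m + Br (fst (prod.swap \<alpha>)) (fst (prod.swap \<beta>)))
        (s - real n + Bl (snd (prod.swap \<alpha>)) (snd (prod.swap \<beta>)))))" for i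
      by (cases i) (simp add: EM_swap vser_def)
  qed
  finally show ?thesis ..
qed

lemma Yhat_VW:
  assumes v: "v \<in> VW \<alpha>" and w: "w \<in> VW \<beta>"
  shows "Yhat \<alpha> \<beta> v w s s' \<in> VW (\<alpha> + \<beta>)"
proof -
  interpret c: full_H_vertex_algebra smul "\<lambda>h h'. Fg h' h" "\<lambda>a r s. Y a s r" vac ir il Br Bl
    by (rule conjugate_full_H_vertex_algebra)
  have vw: "v \<in> c.VW (prod.swap \<alpha>)" "w \<in> c.VW (prod.swap \<beta>)" using v w by (simp_all add: vac_weight_swap)
  have "R y (int p) (Yhat \<alpha> \<beta> v w s s') = 0" if "p \<ge> 1" for y p
    using c.Yhat_annihilated_L[OF vw that, of y s' s] unfolding Yhat_swap by (simp add: lmode_def rmode_def)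
  then have "R y n (Yhat \<alpha> \<beta> v w s s') = 0" "L x n (Yhat \<alpha> \<beta> v w s s') = 0" if "n \<ge> 1" for x y n
    using Yhat_annihilated_L[OF v w, of "nat n" x s s'] that by (metis int_nat_eq nat_le_iff nat_one_as_int linorder_not_less nat_0_le le_nat_iff of_nat_1 zero_le_one order_trans)+
  with Yhat_weight[OF vac_weightD(1)[OF v] vac_weightD(1)[OF w]] show ?thesis by (simp add: vac_weight_def)
qed

text \<open>The exponent of $z$ is shifted by $(-,-)_l-(-,-)_{\mathrm{lat}}=(-,-)_r$, the same as the exponent of
  $\bar z$.\<close>

lemma Yhat_laurent: "laurent_ser (\<lambda>s s'. Yhat \<alpha> \<beta> v w (s - lat_form Bl Br \<alpha> \<beta>) s')"
proof (rule laurent_ser_mono[OF FV1[of v w]])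
  fix s s' assume "Yhat \<alpha> \<beta> v w (s - lat_form Bl Br \<alpha> \<beta>) s' \<noteq> 0"
  then obtain i where "(case i of (m, n) \<Rightarrow> EM (- \<alpha>) m n
     (vser Y v w (s - lat_form Bl Br \<alpha> \<beta> - real m + Bp \<alpha> \<beta>) (s' - real n + Bq \<alpha> \<beta>))) \<noteq> 0"
    unfolding Yhat_def using Sum_any.not_neutral_obtains_not_neutral by blast
  then obtain m n where mn: "EM (- \<alpha>) m n
     (vser Y v w (s - lat_form Bl Br \<alpha> \<beta> - real m + Bp \<alpha> \<beta>) (s' - real n + Bq \<alpha> \<beta>)) \<noteq> 0"
    by (cases i) auto
  have "vser Y v w (s - lat_form Bl Br \<alpha> \<beta> - real m + Bp \<alpha> \<beta>) (s' - real n + Bq \<alpha> \<beta>) \<noteq> 0"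
  proof
    assume z: "vser Y v w (s - lat_form Bl Br \<alpha> \<beta> - real m + Bp \<alpha> \<beta>) (s' - real n + Bq \<alpha> \<beta>) = 0"
    show False using mn unfolding z EM_0 by simp
  qed
  then have "vser Y v w (s - (- Bq \<alpha> \<beta>) - real m) (s' - (- Bq \<alpha> \<beta>) - real n) \<noteq> 0"
    by (simp add: lat_form_def algebra_simps)
  then show "\<exists>i j. vser Y v w (s - (- Bq \<alpha> \<beta>) - real i) (s' - (- Bq \<alpha> \<beta>) - real j) \<noteq> 0" by blast
qed

lemma vac_VW: "vac \<in> VW 0"
proof -
  have "L x n vac = 0" "R y n vac = 0" if "n \<ge> 0" for n x y
  proof -
    have "- real_of_int n - 1 \<notin> \<nat>" using that by (auto elim!: Nats_cases)
    then show "L x n vac = 0" "R y n vac = 0"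
      unfolding L_vser R_vser using FV3(1)[of "il x"] FV3(1)[of "ir y"] unfolding power_ser_def by blast+
  qed
  then show ?thesis by (simp add: vac_weight_def weight_space_def Bl_bilinear Br_bilinear)
qed

lemma Yhat_vac_right: "power_ser (Yhat \<alpha> 0 v vac)" "Yhat \<alpha> 0 v vac 0 0 = v"
proof -
  have nz: "vser Y v vac (s - real m) (s' - real n) = 0" if "\<not> (s \<in> \<nat> \<and> s' \<in> \<nat>)" for s s' m n
  proof -
    have "s \<in> \<nat>" if "s - real m \<in> \<nat>" for s m using Nats_add[OF that of_nat_in_Nats[of m]] by simp
    then have "\<not> (s - real m \<in> \<nat> \<and> s' - real n \<in> \<nat>)" using that by blast
    then show ?thesis using FV3(1)[of v] unfolding power_ser_def by blast
  qed
  show "power_ser (Yhat \<alpha> 0 v vac)" unfolding power_ser_def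
  proof (intro allI impI)
    fix s s' :: real assume "\<not> (s \<in> \<nat> \<and> s' \<in> \<nat>)"
    from nz[OF this] show "Yhat \<alpha> 0 v vac s s' = 0" unfolding Yhat_def by (simp add: Bl_bilinear Br_bilinear EM_0)
  qed
  have "vser Y v vac (0 - real m) (0 - real n) = (if m = 0 \<and> n = 0 then v else 0)" for m n
  proof (cases "m = 0 \<and> n = 0")
    case True then show ?thesis using FV3(2)[of v] by (simp add: vser_def)
  next
    case False
    then have "\<not> (- real m \<in> \<nat> \<and> - real n \<in> \<nat>)" by (auto elim!: Nats_cases)
    then show ?thesis using FV3(1)[of v] False unfolding power_ser_def by auto
  qed
  then have "Yhat \<alpha> 0 v vac 0 0 = Sum_any (\<lambda>(m, n). EM (- \<alpha>) m n (if m = 0 \<and> n = 0 then v else 0))"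
    unfolding Yhat_def by (simp only: zero_prod_def fst_conv snd_conv Bl_bilinear Br_bilinear add_0_right)
  also have "\<dots> = Sum_any (\<lambda>i :: nat \<times> nat. if i = (0, 0) then v else 0)"
    by (rule Sum_any.cong) (auto simp: EM_0 EM_00 split: prod.split)
  finally show "Yhat \<alpha> 0 v vac 0 0 = v" by simp
qed

lemma Yhat_vac_left: "Yhat 0 \<beta> vac w s s' = (if s = 0 \<and> s' = 0 then w else 0)"
proof -
  have "Yhat 0 \<beta> vac w s s' = Sum_any (\<lambda>i :: nat \<times> nat. if i = (0, 0) then vser Y vac w s s' else 0)"
    unfolding Yhat_def by (rule Sum_any.cong) (auto simp: EM_zero_charge Bl_bilinear Br_bilinear split: prod.split)
  then show ?thesis by (auto simp: vser_def FV4)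
qed

end

section \<open>Grading of the vacuum space\<close>

text \<open>Directness is independence of the summands: the difference of two decompositions of a vector
  decomposes 0.\<close>

lemma direct_sumI:
  fixes smul :: "complex \<Rightarrow> 'v::ab_group_add \<Rightarrow> 'v" and V :: "'i \<Rightarrow> 'v set"
  assumes vs: "vector_space smul" and V: "\<And>i. module.subspace smul (V i)"
    and indep: "\<And>f i. \<forall>i. f i \<in> V i ==> finite {i. f i \<noteq> 0} ==> Sum_any f = 0 ==> f i = 0"
  shows "direct_sum smul V (module.span smul (\<Union>i. V i))"
proof -
  interpret vector_space smul by fact
  have S: "subspace {v. \<exists>f. decomposition V v f}"
  proof (rule subspaceI)
    have "decomposition V 0 (\<lambda>_. 0)" by (simp add: decomposition_def subspace_0[OF V])
    then show "0 \<in> {v. \<exists>f. decomposition V v f}" by blast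
  next
    fix x y assume "x \<in> {v. \<exists>f. decomposition V v f}" "y \<in> {v. \<exists>f. decomposition V v f}"
    then obtain f g where "decomposition V x f" "decomposition V y g" by blast
    from decomposition_sum[where V = V, OF vs V this] show "x + y \<in> {v. \<exists>f. decomposition V v f}" by blast
  next
    fix c x assume "x \<in> {v. \<exists>f. decomposition V v f}"
    then obtain f where "decomposition V x f" by blast
    from decomposition_smul[where V = V, OF vs V this] show "smul c x \<in> {v. \<exists>f. decomposition V v f}" by blast
  qed
  have "(\<Union>i. V i) \<subseteq> {v. \<exists>f. decomposition V v f}"
    using decomposition_single[where V = V, OF vs V] by blast
  from span_minimal[OF this S] have ex: "\<exists>f. decomposition V v f" if "v \<in> span (\<Union>i. V i)" for v using that by blast
  have un: "f = g" if f: "decomposition V v f" and g: "decomposition V v g" for v f g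
  proof
    fix i
    have d: "decomposition V (v + smul (-1) v) (\<lambda>i. f i + smul (-1) (g i))"
      by (rule decomposition_sum[OF vs V f decomposition_smul[OF vs V g]])
    have "f i + smul (-1) (g i) = 0"
      by (rule indep) (use d in \<open>simp_all add: decomposition_def\<close>)
    then show "f i = g i" by simp
  qed
  show ?thesis unfolding direct_sum_def
  proof (intro conjI allI ballI subspace_span V)
    show "V i \<subseteq> span (\<Union>i. V i)" for i by (rule order_trans[OF _ span_superset]) blast
    fix v assume v: "v \<in> span (\<Union>i. V i)"
    then obtain f where f: "decomposition V v f" using ex by blast
    show "\<exists>!f. decomposition V v f" by (rule ex1I, rule f) (rule un[OF _ f])
  qed
qed

lemma lat_form_nondegenerate:
  fixes Bl :: "'l::real_vector \<Rightarrow> 'l \<Rightarrow> real" and Br :: "'r::real_vector \<Rightarrow> 'r \<Rightarrow> real"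
  assumes l: "fin_dim_form Bl" and r: "fin_dim_form Br"
  shows "fin_dim_form (lat_form Bl Br)"
proof -
  have bl: "bilinear Bl" and br: "bilinear Br" by (rule fin_dim_formD l r)+
  have "\<exists>S :: ('l \<times> 'r) set. finite S \<and> span S = UNIV"
  proof -
    obtain S :: "'l set" where S: "finite S" "span S = UNIV" using fin_dim_formD(4)[OF l] by blast
    obtain T :: "'r set" where T: "finite T" "span T = UNIV" using fin_dim_formD(4)[OF r] by blast
    let ?i = "\<lambda>x :: 'l. (x, 0 :: 'r)" and ?j = "\<lambda>y :: 'r. (0 :: 'l, y)"
    have li: "linear ?i" "linear ?j" by (simp_all add: linear_iff)
    have sp: "span (?i ` S) = range ?i" "span (?j ` T) = range ?j"
      using linear_span_image[OF li(1), of S] linear_span_image[OF li(2), of T] S T by simp_all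
    have "(x, y) \<in> span (?i ` S \<union> ?j ` T)" for x y
    proof -
      have "(x, 0) \<in> span (?i ` S \<union> ?j ` T)" "(0, y) \<in> span (?i ` S \<union> ?j ` T)"
        using sp span_mono[of "?i ` S" "?i ` S \<union> ?j ` T"] span_mono[of "?j ` T" "?i ` S \<union> ?j ` T"] by auto
      from span_add[OF this] show ?thesis by simp
    qed
    then have "p \<in> span (?i ` S \<union> ?j ` T)" for p by (cases p) simp
    then have "span (?i ` S \<union> ?j ` T) = UNIV" by (rule UNIV_eq_I[symmetric])
    then show ?thesis by (intro exI[of _ "?i ` S \<union> ?j ` T"] conjI finite_UnI finite_imageI S(1) T(1))
  qed
  moreover have "bilinear (lat_form Bl Br)"
    unfolding bilinear_def linear_iff lat_form_def
    by (simp add: bilinear_ladd[OF bl] bilinear_radd[OF bl] bilinear_lmul[OF bl] bilinear_rmul[OF bl]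
        bilinear_ladd[OF br] bilinear_radd[OF br] bilinear_lmul[OF br] bilinear_rmul[OF br] algebra_simps)
  moreover have "lat_form Bl Br x y = lat_form Bl Br y x" for x y
    unfolding lat_form_def using fin_dim_formD(2)[OF l, of "fst x" "fst y"] fin_dim_formD(2)[OF r, of "snd x" "snd y"] by simp
  moreover have "x = 0" if x: "\<forall>y. lat_form Bl Br x y = 0" for x
  proof -
    have l0: "Bl (fst x) y = 0" for y using spec[OF x, of "(y, 0)"] by (simp add: lat_form_def bilinear_rzero[OF br])
    have r0: "Br (snd x) y = 0" for y using spec[OF x, of "(0, y)"] by (simp add: lat_form_def bilinear_rzero[OF bl])
    show ?thesis using fin_dim_formD(3)[OF l l0] fin_dim_formD(3)[OF r r0] by (simp add: prod_eq_iff)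
  qed
  ultimately show ?thesis unfolding fin_dim_form_def by (intro conjI allI impI)
qed

context full_H_vertex_algebra
begin

text \<open>By nondegeneracy some $h_l(0)$ or $h_r(0)$ has different eigenvalues for the two charges.\<close>

lemma weights_separated:
  assumes "\<alpha> \<noteq> \<beta>"
  shows "\<exists>T l. (\<forall>v w. T (v + w) = T v + T w) \<and> (\<forall>\<gamma>. \<forall>v\<in>WS \<gamma>. T v = smul (l \<gamma>) v) \<and> l \<alpha> \<noteq> l \<beta>"
proof (cases "fst \<alpha> = fst \<beta>")
  case False
  have "\<exists>x. Bl (fst \<alpha> - fst \<beta>) x \<noteq> 0" using fin_dim_formD(3)[OF form_l, of "fst \<alpha> - fst \<beta>"] False by auto
  then obtain x where x: "Bl (fst \<alpha> - fst \<beta>) x \<noteq> 0" by blast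
  have "Bl (fst \<alpha> - fst \<beta>) x = Bl x (fst \<alpha>) - Bl x (fst \<beta>)"
    using Bl_bilinear(1)[of "fst \<alpha>" "- fst \<beta>" x] by (simp add: Bl_bilinear(3,4) Bl_commute[of _ x])
  with x have "complex_of_real (Bl x (fst \<alpha>)) \<noteq> of_real (Bl x (fst \<beta>))" by simp
  then show ?thesis
    by (intro exI[of _ "L x 0"] exI[of _ "\<lambda>\<gamma>. of_real (Bl x (fst \<gamma>))"]) (simp add: L_lin weight_spaceD)
next
  case True
  with assms have "snd \<alpha> \<noteq> snd \<beta>" by (simp add: prod_eq_iff)
  then have "\<exists>x. Br (snd \<alpha> - snd \<beta>) x \<noteq> 0" using fin_dim_formD(3)[OF form_r, of "snd \<alpha> - snd \<beta>"] by auto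
  then obtain x where x: "Br (snd \<alpha> - snd \<beta>) x \<noteq> 0" by blast
  have "Br (snd \<alpha> - snd \<beta>) x = Br x (snd \<alpha>) - Br x (snd \<beta>)"
    using Br_bilinear(1)[of "snd \<alpha>" "- snd \<beta>" x] by (simp add: Br_bilinear(3,4) Br_commute[of _ x])
  with x have "complex_of_real (Br x (snd \<alpha>)) \<noteq> of_real (Br x (snd \<beta>))" by simp
  then show ?thesis
    by (intro exI[of _ "R x 0"] exI[of _ "\<lambda>\<gamma>. of_real (Br x (snd \<gamma>))"]) (simp add: R_lin weight_spaceD)
qed

text \<open>Eigenvectors to different eigenvalues: applying $T-l(\beta)$ to a shortest relation removes the term of
  charge $\beta$ and keeps another one.\<close>

lemma WS_independent:
  assumes "\<forall>\<alpha>. f \<alpha> \<in> WS \<alpha>" "finite {\<alpha>. f \<alpha> \<noteq> 0}" "Sum_any f = 0"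
  shows "f \<alpha> = 0"
  using assms
proof (induction "card {\<alpha>. f \<alpha> \<noteq> 0}" arbitrary: f \<alpha> rule: less_induct)
  case less
  show ?case
  proof (rule ccontr)
    assume \<alpha>: "f \<alpha> \<noteq> 0"
    show False
    proof (cases "\<exists>\<beta>. \<beta> \<noteq> \<alpha> \<and> f \<beta> \<noteq> 0")
      case True
      then obtain \<beta> where \<beta>: "\<beta> \<noteq> \<alpha>" "f \<beta> \<noteq> 0" by blast
      obtain T l where T: "\<And>v w. T (v + w) = T v + T w" and Tl: "\<And>\<gamma> v. v \<in> WS \<gamma> ==> T v = smul (l \<gamma>) v" and l: "l \<alpha> \<noteq> l \<beta>"
        using weights_separated[of \<alpha> \<beta>] \<beta>(1) by blast
      define g where "g \<gamma> = smul (l \<gamma> - l \<beta>) (f \<gamma>)" for \<gamma>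
      have sub: "{\<gamma>. g \<gamma> \<noteq> 0} \<subseteq> {\<gamma>. f \<gamma> \<noteq> 0} - {\<beta>}" by (auto simp: g_def)
      then have "{\<gamma>. g \<gamma> \<noteq> 0} \<subset> {\<gamma>. f \<gamma> \<noteq> 0}" using \<beta>(2) by blast
      then have c: "card {\<gamma>. g \<gamma> \<noteq> 0} < card {\<gamma>. f \<gamma> \<noteq> 0}" by (rule psubset_card_mono[OF less.prems(2)])
      have gf: "finite {\<gamma>. g \<gamma> \<noteq> 0}" using sub less.prems(2) by (meson finite_Diff finite_subset)
      have gW: "\<forall>\<gamma>. g \<gamma> \<in> WS \<gamma>" using less.prems(1) subspace_scale[OF WS_subspace] by (simp add: g_def)
      have T0: "T 0 = 0" using T[of 0 0] by simp
      have "Sum_any g = Sum_any (\<lambda>\<gamma>. T (f \<gamma>) + smul (- l \<beta>) (f \<gamma>))"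
      proof (rule Sum_any.cong)
        fix \<gamma> show "g \<gamma> = T (f \<gamma>) + smul (- l \<beta>) (f \<gamma>)"
          unfolding Tl[OF spec[OF less.prems(1)]] by (simp add: g_def scale_left_diff_distrib)
      qed
      also have "\<dots> = Sum_any (\<lambda>\<gamma>. T (f \<gamma>)) + Sum_any (\<lambda>\<gamma>. smul (- l \<beta>) (f \<gamma>))"
        by (rule Sum_any.distrib; rule finite_subset[OF _ less.prems(2)]) (auto simp: T0)
      also have "Sum_any (\<lambda>\<gamma>. T (f \<gamma>)) = T (Sum_any f)" by (rule Sum_any_additive[OF less.prems(2) T, symmetric])
      also have "Sum_any (\<lambda>\<gamma>. smul (- l \<beta>) (f \<gamma>)) = smul (- l \<beta>) (Sum_any f)"
        by (rule Sum_any_additive[OF less.prems(2), symmetric]) (rule scale_right_distrib)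
      finally have "Sum_any g = 0" using less.prems(3) T0 by simp
      from less.hyps[OF c gW gf this, of \<alpha>] have "g \<alpha> = 0" .
      then show False using \<alpha> l by (simp add: g_def)
    next
      case False
      then have "Sum_any f = Sum_any (\<lambda>\<gamma>. if \<gamma> = \<alpha> then f \<alpha> else 0)" by (intro Sum_any.cong) auto
      then have "Sum_any f = f \<alpha>" by simp
      then show False using \<alpha> less.prems(3) by simp
    qed
  qed
qed

abbreviation "\<Omega> \<equiv> vac_space smul Y il ir Bl Br"
abbreviation "gr \<equiv> vac_grade smul Fg Y il ir Bl Br"
abbreviation "VY \<equiv> vac_Y smul Y il ir Bl Br"

lemma VW_subset_WS: "VW \<alpha> \<subseteq> WS \<alpha>" by (auto simp: vac_weight_def)

lemma VW_direct_sum: "direct_sum smul VW \<Omega>"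
  unfolding vac_space_def
proof (rule direct_sumI[OF vector_space_axioms VW_subspace])
  fix f \<alpha> assume f: "\<forall>\<alpha>. f \<alpha> \<in> VW \<alpha>" and s: "finite {\<alpha>. f \<alpha> \<noteq> 0}" "Sum_any f = 0"
  have "\<forall>\<alpha>. f \<alpha> \<in> WS \<alpha>" using f VW_subset_WS by blast
  from WS_independent[OF this s] show "f \<alpha> = 0" .
qed

text \<open>A homogeneous operator commutes with taking components up to its degree.\<close>

lemma comp_shift_operator:
  assumes T: "\<And>v w. T (v + w) = T v + T w" and deg: "\<And>h h' v. v \<in> Fg h h' ==> T v \<in> Fg (h + a) (h' + b)"
  shows "component Fp (h, h') (T v) = T (component Fp (h - a, h' - b) v)"
proof -
  have T0: "T 0 = 0" using T[of 0 0] by simp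
  define g where "g i = T (component Fp (fst i - a, snd i - b) v)" for i
  let ?\<phi> = "\<lambda>i :: real \<times> real. (fst i + a, snd i + b)"
  have "decomposition Fp (T v) g" unfolding decomposition_def
  proof (intro conjI allI)
    fix i show "g i \<in> Fp i" using deg[OF comp_mem[of "fst i - a" "snd i - b" v]] by (cases i) (simp add: g_def)
  next
    have "{i. g i \<noteq> 0} \<subseteq> ?\<phi> ` {i. component Fp i v \<noteq> 0}"
    proof
      fix i assume "i \<in> {i. g i \<noteq> 0}"
      then have "component Fp (fst i - a, snd i - b) v \<noteq> 0" using T0 by (auto simp: g_def)
      then show "i \<in> ?\<phi> ` {i. component Fp i v \<noteq> 0}" by (intro image_eqI[of _ _ "(fst i - a, snd i - b)"]) auto
    qed
    then show "finite {i. g i \<noteq> 0}" using finite_imageI[OF comp_finite] by (rule finite_subset)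
    have "Sum_any g = Sum_any (\<lambda>i. g (?\<phi> i))"
    proof (rule Sum_any_reindex_inj)
      show "inj ?\<phi>" by (auto simp: inj_def prod_eq_iff)
      fix i assume "i \<notin> range ?\<phi>"
      moreover have "i = ?\<phi> (fst i - a, snd i - b)" by simp
      ultimately show "g i = 0" by blast
    qed
    also have "\<dots> = Sum_any (\<lambda>i. T (component Fp i v))" by (simp add: g_def)
    also have "\<dots> = T (Sum_any (\<lambda>i. component Fp i v))" by (rule Sum_any_additive[OF comp_finite T, symmetric])
    finally show "T v = Sum_any g" using comp_sum[of v] by simp
  qed
  from direct_sum_component(2)[OF grading UNIV_I this] show ?thesis by (simp add: g_def)
qed

lemma comp_L: "component Fp (h, h') (L x n v) = L x n (component Fp (h + of_int n, h') v)"
  using comp_shift_operator[of "L x n" "- of_int n" 0 h h' v] L_degree[of _ _ _ x n] by (simp add: L_lin)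

lemma comp_R: "component Fp (h, h') (R y n v) = R y n (component Fp (h, h' + of_int n) v)"
  using comp_shift_operator[of "R y n" 0 "- of_int n" h h' v] R_degree[of _ _ _ y n] by (simp add: R_lin)

lemma comp_WS:
  assumes "v \<in> WS \<alpha>"
  shows "component Fp i v \<in> WS \<alpha>"
proof -
  obtain h h' where i: "i = (h, h')" by (cases i)
  have "L x 0 (component Fp i v) = component Fp i (L x 0 v)" "R y 0 (component Fp i v) = component Fp i (R y 0 v)" for x y
    unfolding i using comp_L[of h h' x 0 v] comp_R[of h h' y 0 v] by simp_all
  then show ?thesis using weight_spaceD[OF assms] by (simp add: weight_space_def comp_scale)
qed

lemma comp_0: "component Fp i 0 = 0" using comp_scale[of i 0 0] by simp

lemma comp_VW:
  assumes "v \<in> VW \<alpha>"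
  shows "component Fp i v \<in> VW \<alpha>"
proof -
  obtain h h' where i: "i = (h, h')" by (cases i)
  have "L x n (component Fp i v) = component Fp (h - of_int n, h') (L x n v)"
    "R y n (component Fp i v) = component Fp (h, h' - of_int n) (R y n v)" for x y n
    unfolding i using comp_L[of "h - of_int n" h' x n v] comp_R[of h "h' - of_int n" y n v] by simp_all
  then show ?thesis using comp_WS[OF vac_weightD(1)[OF assms]] vac_weightD(2,3)[OF assms]
    by (simp add: vac_weight_def comp_0)
qed

lemma gr_iff: "v \<in> gr \<alpha> t t' \<longleftrightarrow> v \<in> Fg (t + Bp \<alpha> \<alpha> / 2) (t' + Bq \<alpha> \<alpha> / 2) \<and> v \<in> VW \<alpha>"
  by (simp add: vac_grade_def)

lemma gr_subspace: "subspace (gr \<alpha> t t')"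
  unfolding vac_grade_def by (intro subspace_inter Fp_subspace VW_subspace)

lemma VW_in_span_gr:
  assumes "v \<in> VW \<alpha>"
  shows "v \<in> span (\<Union>t t'. gr \<alpha> t t')"
proof -
  have "component Fp i v \<in> span (\<Union>t t'. gr \<alpha> t t')" for i
  proof -
    obtain h h' where i: "i = (h, h')" by (cases i)
    have "component Fp i v \<in> gr \<alpha> (h - Bp \<alpha> \<alpha> / 2) (h' - Bq \<alpha> \<alpha> / 2)"
      using comp_VW[OF assms] comp_mem unfolding gr_iff i by simp
    then show ?thesis by (intro span_base) blast
  qed
  then have "Sum_any (\<lambda>i. component Fp i v) \<in> span (\<Union>t t'. gr \<alpha> t t')" by (rule subspace_Sum_any[OF subspace_span])
  then show ?thesis using comp_sum[of v] by simp
qed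

lemma charge_space_VW: "charge_space smul gr \<alpha> = VW \<alpha>"
proof
  show "charge_space smul gr \<alpha> \<subseteq> VW \<alpha>"
    unfolding charge_space_def by (rule span_minimal[OF _ VW_subspace]) (auto simp: gr_iff)
  show "VW \<alpha> \<subseteq> charge_space smul gr \<alpha>"
    unfolding charge_space_def using VW_in_span_gr by blast
qed

text \<open>Each degree of \<open>F\<close> meets each charge in exactly one summand, so independence follows from that of the
  charges.\<close>

lemma gr_direct_sum: "direct_sum smul (\<lambda>(\<alpha>, t, t'). gr \<alpha> t t') \<Omega>"
proof -
  have "\<Omega> = span (\<Union>i. (\<lambda>(\<alpha>, t, t'). gr \<alpha> t t') i)"
  proof
    have "VW \<alpha> \<subseteq> span (\<Union>i. (\<lambda>(\<alpha>, t, t'). gr \<alpha> t t') i)" for \<alpha>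
    proof
      fix v assume "v \<in> VW \<alpha>"
      from VW_in_span_gr[OF this] show "v \<in> span (\<Union>i. (\<lambda>(\<alpha>, t, t'). gr \<alpha> t t') i)"
        by (rule set_mp[OF span_mono, rotated]) auto
    qed
    then show "\<Omega> \<subseteq> span (\<Union>i. (\<lambda>(\<alpha>, t, t'). gr \<alpha> t t') i)"
      unfolding vac_space_def by (intro span_minimal[OF _ subspace_span]) blast
    show "span (\<Union>i. (\<lambda>(\<alpha>, t, t'). gr \<alpha> t t') i) \<subseteq> \<Omega>"
      unfolding vac_space_def by (rule span_mono) (auto simp: gr_iff)
  qed
  moreover have "direct_sum smul (\<lambda>(\<alpha>, t, t'). gr \<alpha> t t') (span (\<Union>i. (\<lambda>(\<alpha>, t, t'). gr \<alpha> t t') i))"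
  proof (rule direct_sumI[OF vector_space_axioms])
    show "subspace ((\<lambda>(\<alpha>, t, t'). gr \<alpha> t t') i)" for i using gr_subspace by (cases i) auto
    fix f :: "('l \<times> 'r) \<times> real \<times> real \<Rightarrow> 'v" and i :: "('l \<times> 'r) \<times> real \<times> real"
    assume f: "\<forall>i. f i \<in> (\<lambda>(\<alpha>, t, t'). gr \<alpha> t t') i" and s: "finite {i. f i \<noteq> 0}" "Sum_any f = 0"
    obtain \<alpha>0 t0 t0' where i: "i = (\<alpha>0, t0, t0')" by (cases i)
    let ?q = "\<lambda>\<alpha> :: 'l \<times> 'r. Bp \<alpha> \<alpha> / 2" and ?q' = "\<lambda>\<alpha> :: 'l \<times> 'r. Bq \<alpha> \<alpha> / 2"
    define h h' where "h = t0 + ?q \<alpha>0" and "h' = t0' + ?q' \<alpha>0"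
    let ?\<phi> = "\<lambda>\<alpha>. (\<alpha>, h - ?q \<alpha>, h' - ?q' \<alpha>)"
    have mem: "f (\<alpha>, t, t') \<in> Fg (t + ?q \<alpha>) (t' + ?q' \<alpha>)" "f (\<alpha>, t, t') \<in> VW \<alpha>" for \<alpha> t t'
      using spec[OF f, of "(\<alpha>, t, t')"] by (simp_all add: gr_iff)
    define g where "g j = component Fp (h, h') (f j)" for j
    have g: "g (\<alpha>, t, t') = (if (\<alpha>, t, t') = ?\<phi> \<alpha> then f (\<alpha>, t, t') else 0)" for \<alpha> t t'
      unfolding g_def comp_homogeneous[OF mem(1)] by auto
    have "Sum_any g = component Fp (h, h') (Sum_any f)"
      unfolding g_def by (rule Sum_any_additive[OF s(1), symmetric]) (rule comp_add)
    then have g0: "Sum_any g = 0" by (simp add: s(2) comp_0)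
    have "Sum_any g = Sum_any (\<lambda>\<alpha>. g (?\<phi> \<alpha>))"
    proof (rule Sum_any_reindex_inj)
      show "inj ?\<phi>" by (auto simp: inj_def)
      fix j assume j: "j \<notin> range ?\<phi>"
      obtain \<alpha> t t' where jj: "j = (\<alpha>, t, t')" by (cases j)
      have "(\<alpha>, t, t') \<noteq> ?\<phi> \<alpha>" using j unfolding jj by blast
      then show "g j = 0" unfolding jj g by (rule if_not_P)
    qed
    also have "\<dots> = Sum_any (\<lambda>\<alpha>. f (?\<phi> \<alpha>))" by (simp add: g)
    finally have s0: "Sum_any (\<lambda>\<alpha>. f (?\<phi> \<alpha>)) = 0" using g0 by simp
    have "{\<alpha>. f (?\<phi> \<alpha>) \<noteq> 0} \<subseteq> fst ` {i. f i \<noteq> 0}" by force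
    then have fin: "finite {\<alpha>. f (?\<phi> \<alpha>) \<noteq> 0}" using s(1) by (meson finite_imageI finite_subset)
    have W: "\<forall>\<alpha>. f (?\<phi> \<alpha>) \<in> WS \<alpha>" using mem(2) VW_subset_WS by blast
    have "f (?\<phi> \<alpha>0) = 0" by (rule WS_independent[OF W fin s0])
    then show "f i = 0" by (simp add: i h_def h'_def)
  qed
  ultimately show ?thesis by simp
qed

section \<open>The vertex operator on the vacuum space\<close>

abbreviation "C \<equiv> component VW"

lemma C_mem: "v \<in> \<Omega> ==> C \<alpha> v \<in> VW \<alpha>"
  and C_finite: "v \<in> \<Omega> ==> finite {\<alpha>. C \<alpha> v \<noteq> 0}"
  and C_sum: "v \<in> \<Omega> ==> v = Sum_any (\<lambda>\<alpha>. C \<alpha> v)"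
  using direct_sum_component(1)[OF VW_direct_sum] unfolding decomposition_def by blast+

lemma C_add:
  assumes "v \<in> \<Omega>" "w \<in> \<Omega>"
  shows "C \<alpha> (v + w) = C \<alpha> v + C \<alpha> w"
proof (rule direct_sum_component(2)[OF VW_direct_sum])
  show "v + w \<in> \<Omega>" using assms unfolding vac_space_def by (rule span_add)
  show "decomposition VW (v + w) (\<lambda>\<alpha>. C \<alpha> v + C \<alpha> w)"
    by (rule decomposition_sum[where V = VW and smul = smul])
      (rule vector_space_axioms VW_subspace direct_sum_component(1)[OF VW_direct_sum] assms)+
qed

lemma C_scale:
  assumes "v \<in> \<Omega>"
  shows "C \<alpha> (smul c v) = smul c (C \<alpha> v)"
proof (rule direct_sum_component(2)[OF VW_direct_sum])
  show "smul c v \<in> \<Omega>" using assms unfolding vac_space_def by (rule span_scale)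
  show "decomposition VW (smul c v) (\<lambda>\<alpha>. smul c (C \<alpha> v))"
    by (rule decomposition_smul[where V = VW and smul = smul])
      (rule vector_space_axioms VW_subspace direct_sum_component(1)[OF VW_direct_sum] assms)+
qed

lemma VW_subset: "VW \<alpha> \<subseteq> \<Omega>"
  unfolding vac_space_def by (rule order_trans[OF _ span_superset]) blast

lemma C_VW:
  assumes "v \<in> VW \<alpha>"
  shows "C \<beta> v = (if \<beta> = \<alpha> then v else 0)"
proof -
  have "v \<in> \<Omega>" using assms VW_subset by blast
  moreover have "decomposition VW v (\<lambda>\<beta>. if \<beta> = \<alpha> then v else 0)"
    by (rule decomposition_single[where V = VW and smul = smul]) (rule vector_space_axioms VW_subspace assms)+
  ultimately show ?thesis by (rule direct_sum_component(2)[OF VW_direct_sum])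
qed

lemma VY_Yhat:
  assumes "w \<in> \<Omega>"
  shows "VY v r s w = Sum_any (\<lambda>(\<alpha>, \<beta>). Yhat \<alpha> \<beta> (C \<alpha> v) (C \<beta> w) (- r - 1) (- s - 1))"
  unfolding vac_Y_def
proof (rule Sum_any.cong, clarify)
  fix a b c d
  show "vac_Y_hom smul Y il ir Bl Br (a, b) (c, d) (C (a, b) v) r s (C (c, d) w) =
      Yhat (a, b) (c, d) (C (a, b) v) (C (c, d) w) (- r - 1) (- s - 1)"
    unfolding vser_vac_Y_hom[OF C_mem[OF assms], symmetric] by (simp add: vser_def)
qed

lemma Yhat_0: "Yhat \<alpha> \<beta> 0 w s s' = 0" "Yhat \<alpha> \<beta> v 0 s s' = 0"
  using Yhat_lin(3)[of \<alpha> \<beta> 0 0 w s s'] Yhat_lin(4)[of \<alpha> \<beta> v 0 0 s s'] by simp_all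

lemma VY_finite:
  assumes "v \<in> \<Omega>" "w \<in> \<Omega>"
  shows "finite {i. (case i of (\<alpha>, \<beta>) \<Rightarrow> Yhat \<alpha> \<beta> (C \<alpha> v) (C \<beta> w) s s') \<noteq> 0}"
proof (rule finite_subset)
  show "finite ({\<alpha>. C \<alpha> v \<noteq> 0} \<times> {\<alpha>. C \<alpha> w \<noteq> 0})" using C_finite assms by simp
  show "{i. (case i of (\<alpha>, \<beta>) \<Rightarrow> Yhat \<alpha> \<beta> (C \<alpha> v) (C \<beta> w) s s') \<noteq> 0} \<subseteq> {\<alpha>. C \<alpha> v \<noteq> 0} \<times> {\<alpha>. C \<alpha> w \<noteq> 0}"
    by (auto simp: Yhat_0 split: prod.splits)
qed

lemma VY_closed: "v \<in> \<Omega> ==> w \<in> \<Omega> ==> VY v r s w \<in> \<Omega>"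
  unfolding VY_Yhat
proof (unfold vac_space_def, rule subspace_Sum_any[OF subspace_span], fold vac_space_def)
  fix i :: "('l \<times> 'r) \<times> 'l \<times> 'r" assume vw: "v \<in> \<Omega>" "w \<in> \<Omega>"
  obtain \<alpha> \<beta> where i: "i = (\<alpha>, \<beta>)" by (cases i)
  show "(case i of (\<alpha>, \<beta>) \<Rightarrow> Yhat \<alpha> \<beta> (C \<alpha> v) (C \<beta> w) (- r - 1) (- s - 1)) \<in> \<Omega>"
    unfolding i prod.case by (rule set_mp[OF VW_subset Yhat_VW[OF C_mem[OF vw(1)] C_mem[OF vw(2)]]])
qed

lemma VY_add_right:
  assumes "a \<in> \<Omega>" "b \<in> \<Omega>" "b' \<in> \<Omega>"
  shows "VY a r s (b + b') = VY a r s b + VY a r s b'"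
proof -
  have bb: "b + b' \<in> \<Omega>" using assms unfolding vac_space_def by (intro span_add)
  show ?thesis
    unfolding VY_Yhat[OF bb] VY_Yhat[OF assms(2)] VY_Yhat[OF assms(3)]
      Sum_any.distrib[OF VY_finite[OF assms(1,2)] VY_finite[OF assms(1,3)], symmetric]
    by (rule Sum_any.cong) (auto simp: C_add[OF assms(2,3)] Yhat_lin)
qed

lemma VY_add_left:
  assumes "a \<in> \<Omega>" "a' \<in> \<Omega>" "b \<in> \<Omega>"
  shows "VY (a + a') r s b = VY a r s b + VY a' r s b"
  unfolding VY_Yhat[OF assms(3)]
    Sum_any.distrib[OF VY_finite[OF assms(1,3)] VY_finite[OF assms(2,3)], symmetric]
  by (rule Sum_any.cong) (auto simp: C_add[OF assms(1,2)] Yhat_lin)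

lemma VY_scale_right:
  assumes "a \<in> \<Omega>" "b \<in> \<Omega>"
  shows "VY a r s (smul k b) = smul k (VY a r s b)"
proof -
  have bb: "smul k b \<in> \<Omega>" using assms unfolding vac_space_def by (intro span_scale)
  show ?thesis
    unfolding VY_Yhat[OF bb] VY_Yhat[OF assms(2)]
      Sum_any_additive[of _ "smul k", OF VY_finite[OF assms] scale_right_distrib]
    by (rule Sum_any.cong) (auto simp: C_scale[OF assms(2)] Yhat_lin)
qed

lemma VY_scale_left:
  assumes "a \<in> \<Omega>" "b \<in> \<Omega>"
  shows "VY (smul k a) r s b = smul k (VY a r s b)"
  unfolding VY_Yhat[OF assms(2)] Sum_any_additive[of _ "smul k", OF VY_finite[OF assms] scale_right_distrib]
  by (rule Sum_any.cong) (auto simp: C_scale[OF assms(1)] Yhat_lin)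

lemma VY_homogeneous:
  assumes v: "v \<in> VW \<alpha>" and w: "w \<in> VW \<beta>"
  shows "vser VY v w = Yhat \<alpha> \<beta> v w"
proof (intro ext)
  fix s s'
  have "w \<in> \<Omega>" using w VW_subset by blast
  then have "vser VY v w s s' = Sum_any (\<lambda>(\<alpha>', \<beta>'). Yhat \<alpha>' \<beta>' (C \<alpha>' v) (C \<beta>' w) s s')"
    unfolding vser_def by (subst VY_Yhat) simp_all
  also have "\<dots> = Sum_any (\<lambda>i. if i = (\<alpha>, \<beta>) then Yhat \<alpha> \<beta> v w s s' else 0)"
    by (rule Sum_any.cong) (auto simp: C_VW[OF v] C_VW[OF w] Yhat_0 split: prod.splits)
  finally show "vser VY v w s s' = Yhat \<alpha> \<beta> v w s s'" by simp
qed

end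

section \<open>Vacuum vectors and descendants\<close>

text \<open>For a finite basis \<open>S\<close> the operator $Tx=\sum_{s\in S}B(x,s)s$ is injective by nondegeneracy, so it is
  invertible. It is self-adjoint, whence $\sum_sB(T^{-1}s,x)s=\sum_sB(s,T^{-1}x)s=T(T^{-1}x)=x$.\<close>

lemma dual_basis_exists:
  fixes B :: "'h::real_vector \<Rightarrow> 'h \<Rightarrow> real"
  assumes B: "fin_dim_form B"
  shows "\<exists>(S::'h set) d. finite S \<and> (\<forall>x. x = (\<Sum>s\<in>S. B (d s) x *\<^sub>R s))"
proof -
  have b: "bilinear B" by (rule fin_dim_formD[OF B])
  note bl = bilinear_ladd[OF b] bilinear_radd[OF b] bilinear_lmul[OF b] bilinear_rmul[OF b]
  obtain S0 :: "'h set" where S0: "finite S0" "span S0 = UNIV" using fin_dim_formD(4)[OF B] by blast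
  obtain S :: "'h set" where S: "S \<subseteq> S0" "independent S" "S0 \<subseteq> span S"
    using maximal_independent_subset[of S0] by blast
  have fS: "finite S" using S(1) S0(1) by (rule finite_subset)
  have "span S0 \<subseteq> span S" by (rule span_minimal[OF S(3) subspace_span])
  then have sS: "span S = UNIV" using S0(2) by blast
  have fd1: "finite_dimensional_vector_space (scaleR :: real \<Rightarrow> 'h \<Rightarrow> 'h) S"
  proof (rule finite_dimensional_vector_space.intro[OF real_vector.vector_space_axioms], rule finite_dimensional_vector_space_axioms.intro)
    show "finite S" by (rule fS)
    show "\<not> module.dependent scaleR S" using S(2) by (simp add: dependent_raw_def)
    show "module.span scaleR S = UNIV" using sS by (simp add: span_raw_def)
  qed
  interpret fd: finite_dimensional_vector_space_pair scaleR S scaleR S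
    by (rule finite_dimensional_vector_space_pair.intro[OF fd1 fd1])
  define T where "T d = (\<Sum>s\<in>S. B d s *\<^sub>R s)" for d
  have Tadd: "T (x + y) = T x + T y" and Tscale: "T (c *\<^sub>R x) = c *\<^sub>R T x" for x y c
    by (simp_all add: T_def bl scaleR_left_distrib sum.distrib scaleR_sum_right)
  have lin: "linear T" by (simp add: linear_iff Tadd Tscale)
  have T0: "d = 0" if d: "T d = 0" for d
  proof (rule fin_dim_formD(3)[OF B])
    have z: "B d s = 0" if "s \<in> S" for s
      using independentD[OF S(2) fS order_refl, of "B d" s] d that by (simp add: T_def)
    fix y have "y \<in> span S" using sS by simp
    then show "B d y = 0"
      by (induction rule: span_induct_alt) (use z in \<open>simp_all add: bl bilinear_rzero[OF b]\<close>)
  qed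
  have "inj T"
  proof (rule injI)
    fix x y assume "T x = T y"
    then have "T (x + (-1) *\<^sub>R y) = 0" unfolding Tadd Tscale by simp
    from T0[OF this] show "x = y" by simp
  qed
  then have surj: "surj T"
    using fd.linear_injective_imp_surjective[OF lin[unfolded linear_def]] by simp
  have TT: "B (T x) y = B x (T y)" for x y
  proof -
    have "B (sum f A) y = (\<Sum>s\<in>A. B (f s) y)" for f and A :: "'h set" by (rule additive_sum[of "\<lambda>x. B x y"]) (rule bl)
    moreover have "B x (sum f A) = (\<Sum>s\<in>A. B x (f s))" for f and A :: "'h set" by (rule additive_sum[of "B x"]) (rule bl)
    ultimately show ?thesis unfolding T_def using fin_dim_formD(2)[OF B, of _ y] by (simp add: bl mult.commute)
  qed
  have "x = (\<Sum>s\<in>S. B (inv T s) x *\<^sub>R s)" for x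
  proof -
    obtain y where y: "x = T y" using surj by (rule surjE)
    have "(\<Sum>s\<in>S. B (inv T s) x *\<^sub>R s) = (\<Sum>s\<in>S. B y s *\<^sub>R s)"
      unfolding y TT[symmetric] surj_f_inv_f[OF surj] using fin_dim_formD(2)[OF B, of _ y] by simp
    then show ?thesis by (simp add: y T_def)
  qed
  then show ?thesis using fS by (intro exI[of _ S] exI[of _ "inv T"]) blast
qed

text \<open>$\prod_{k}(C-k)$.\<close>

definition shifted_product :: "(complex \<Rightarrow> 'v::ab_group_add \<Rightarrow> 'v) \<Rightarrow> ('v \<Rightarrow> 'v) \<Rightarrow> nat list \<Rightarrow> 'v \<Rightarrow> 'v" where
  "shifted_product smul C ks v = foldr (\<lambda>k w. C w - smul (of_nat k) w) ks v"

text \<open>The vectors killed by a product of factors $C-k$ with $k\ge n$. They would be sums of generalized eigenvectors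
  with integral eigenvalues at least \<open>n\<close>; this form avoids decomposing them.\<close>

definition annihilated :: "(complex \<Rightarrow> 'v::ab_group_add \<Rightarrow> 'v) \<Rightarrow> ('v \<Rightarrow> 'v) \<Rightarrow> nat \<Rightarrow> 'v set" where
  "annihilated smul C n = {v. \<exists>ks. (\<forall>k\<in>set ks. n \<le> k) \<and> shifted_product smul C ks v = 0}"

lemma shifted_product_simps:
  "shifted_product smul C [] v = v"
  "shifted_product smul C (k # ks) v = C (shifted_product smul C ks v) - smul (of_nat k) (shifted_product smul C ks v)"
  by (simp_all add: shifted_product_def)

lemma shifted_product_append:
  "shifted_product smul C (ks @ ls) v = shifted_product smul C ks (shifted_product smul C ls v)"
  by (simp add: shifted_product_def)

context
  fixes smul :: "complex \<Rightarrow> 'v::ab_group_add \<Rightarrow> 'v" and C :: "'v \<Rightarrow> 'v"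
  assumes vs: "vector_space smul"
    and C: "\<And>v w. C (v + w) = C v + C w" "\<And>c v. C (smul c v) = smul c (C v)"
begin

interpretation vector_space smul by (rule vs)

lemma shifted_product_lin:
  "shifted_product smul C ks (v + w) = shifted_product smul C ks v + shifted_product smul C ks w"
  "shifted_product smul C ks (smul c v) = smul c (shifted_product smul C ks v)"
  by (induction ks) (simp_all add: shifted_product_simps C scale_right_distrib scale_right_diff_distrib mult.commute)

lemma shifted_product_0: "shifted_product smul C ks 0 = 0"
  using shifted_product_lin(2)[of ks 0 0] by simp

lemma C_diff: "C (v - w) = C v - C w"
  using C(1)[of "v - w" w] by simp

lemma shifted_product_C: "shifted_product smul C ks (C v) = C (shifted_product smul C ks v)"
  by (induction ks) (simp_all add: shifted_product_simps C_diff C)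

lemma shifted_product_commute:
  "shifted_product smul C ks (shifted_product smul C ls v) = shifted_product smul C ls (shifted_product smul C ks v)"
proof (induction ls)
  case (Cons l ls)
  have d: "shifted_product smul C ks (x - y) = shifted_product smul C ks x - shifted_product smul C ks y" for x y
    using shifted_product_lin(1)[of ks "x - y" y] by simp
  show ?case by (simp add: shifted_product_simps d shifted_product_C shifted_product_lin Cons.IH)
qed (simp add: shifted_product_simps)

lemma annihilated_subspace: "subspace (annihilated smul C n)"
proof (rule subspaceI)
  have "shifted_product smul C [] 0 = 0" by (simp add: shifted_product_simps)
  then show "0 \<in> annihilated smul C n" unfolding annihilated_def by (intro CollectI exI[of _ "[]"]) simp
next
  fix v w assume "v \<in> annihilated smul C n" "w \<in> annihilated smul C n"
  then obtain ks ls where k: "\<forall>k\<in>set ks. n \<le> k" "shifted_product smul C ks v = 0"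
    and l: "\<forall>k\<in>set ls. n \<le> k" "shifted_product smul C ls w = 0" unfolding annihilated_def by blast
  have "shifted_product smul C (ks @ ls) (v + w) = 0"
    unfolding shifted_product_append shifted_product_lin using k(2) l(2)
    by (simp add: shifted_product_commute[of ks ls v] shifted_product_0)
  moreover have "\<forall>k\<in>set (ks @ ls). n \<le> k" using k(1) l(1) by auto
  ultimately show "v + w \<in> annihilated smul C n" unfolding annihilated_def by blast
next
  fix c v assume "v \<in> annihilated smul C n"
  then obtain ks where k: "\<forall>k\<in>set ks. n \<le> k" "shifted_product smul C ks v = 0" unfolding annihilated_def by blast
  have "shifted_product smul C ks (smul c v) = 0" using k(2) by (simp add: shifted_product_lin)
  with k(1) show "smul c v \<in> annihilated smul C n" unfolding annihilated_def by blast
qed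

text \<open>\<open>T\<close> intertwines $C-k$ with $C-(k+m)$.\<close>

lemma annihilated_raise:
  assumes T: "\<And>v w. T (v + w) = T v + T w" "\<And>c v. T (smul c v) = smul c (T v)"
    and CT: "\<And>v. C (T v) = T (C v) + smul (of_nat m) (T v)" and v: "v \<in> annihilated smul C 0" and m: "n \<le> m"
  shows "T v \<in> annihilated smul C n"
proof -
  obtain ks where k: "shifted_product smul C ks v = 0" using v unfolding annihilated_def by blast
  have Td: "T (x - y) = T x - T y" for x y using T(1)[of "x - y" y] by simp
  have "shifted_product smul C (map (\<lambda>k. k + m) ks) (T v) = T (shifted_product smul C ks v)"
    by (induction ks) (simp_all add: shifted_product_simps CT Td T scale_left_distrib)
  also have "\<dots> = 0" using T(1)[of 0 0] k by simp
  finally show ?thesis unfolding annihilated_def using m by (intro CollectI exI[of _ "map (\<lambda>k. k + m) ks"]) auto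
qed

text \<open>On the kernel of \<open>C\<close> the product $\prod(C-k)$ is the nonzero scalar $\prod(-k)$.\<close>

lemma annihilated_kernel:
  assumes "C v = 0" "v \<in> annihilated smul C 1"
  shows "v = 0"
proof -
  obtain ks where k: "\<forall>k\<in>set ks. 1 \<le> k" "shifted_product smul C ks v = 0" using assms(2) unfolding annihilated_def by blast
  from k show "v = 0"
  proof (induction ks)
    case (Cons k ks)
    have "C (shifted_product smul C ks v) = 0" using shifted_product_C[of ks v] assms(1) by (simp add: shifted_product_0)
    then have "shifted_product smul C ks v = 0" using Cons.prems by (simp add: shifted_product_simps)
    with Cons show ?case by simp
  qed (simp add: shifted_product_simps)
qed

lemma annihilated_C:
  assumes "C v \<in> annihilated smul C n"
  shows "v \<in> annihilated smul C 0"
proof -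
  obtain ks where k: "shifted_product smul C ks (C v) = 0" using assms unfolding annihilated_def by blast
  have "shifted_product smul C (ks @ [0]) v = 0"
    unfolding shifted_product_append by (simp add: shifted_product_simps k)
  then show ?thesis unfolding annihilated_def by blast
qed

end

context full_H_vertex_algebra
begin

definition left_casimir :: "('v \<Rightarrow> 'v) \<Rightarrow> bool" where
  "left_casimir K \<longleftrightarrow> (\<forall>v w. K (v + w) = K v + K w) \<and> (\<forall>c v. K (smul c v) = smul c (K v)) \<and>
     (\<forall>x m v. m \<ge> 1 --> K (L x (- int m) v) = L x (- int m) (K v) + smul (of_nat m) (L x (- int m) v)) \<and>
     (\<forall>y n v. K (R y n v) = R y n (K v)) \<and>
     (\<forall>v. (\<forall>x. \<forall>n\<ge>1. L x n v = 0) --> K v = 0) \<and>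
     (\<forall>v. K v \<in> span {L x (- int n) (L x' (int n) v) | x x' n. n \<ge> 1})"

text \<open>The operator $\sum_{n\ge1}\sum_ss(-n)d_s(n)$ for dual bases; its commutator with $h(-m)$ is
  $\sum_sm\,(d_s,h)s(-m)=m\,h(-m)$.\<close>

lemma half_casimir: "\<exists>K. left_casimir K"
proof -
  obtain S d where S: "finite S" and d: "\<And>x. x = (\<Sum>s\<in>S. Bl (d s) x *\<^sub>R s)" using dual_basis_exists[OF form_l] by metis
  define t where "t n v = (\<Sum>s\<in>S. L s (- int (Suc n)) (L (d s) (int (Suc n)) v))" for n v
  define K where "K v = Sum_any (\<lambda>n. t n v)" for v
  have t: "t n (v + w) = t n v + t n w" "t n (smul c v) = smul c (t n v)" "t n 0 = 0" for n v w c
    by (simp_all add: t_def L_lin sum.distrib scale_sum_right)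
  have fin: "finite {n. t n v \<noteq> 0}" for v
  proof -
    have "\<forall>s. \<exists>J. \<forall>j\<ge>J. L (d s) (int j) v = 0" using L_eventually_zero by blast
    then obtain J where J: "\<And>s j. j \<ge> J s ==> L (d s) (int j) v = 0" by metis
    show ?thesis
    proof (rule finite_nat_support[of "\<Sum>s\<in>S. J s"])
      fix n assume n: "n \<ge> (\<Sum>s\<in>S. J s)"
      show "t n v = 0" unfolding t_def
      proof (rule sum.neutral, rule ballI)
        fix s assume "s \<in> S"
        then have "J s \<le> Suc n" using member_le_sum[of s S J] S n by simp
        then show "L s (- int (Suc n)) (L (d s) (int (Suc n)) v) = 0" by (simp only: J L_lin)
      qed
    qed
  qed
  have Ladd: "K (v + w) = K v + K w" for v w
    unfolding K_def t by (rule Sum_any.distrib[OF fin fin])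
  have Lscale: "K (smul c v) = smul c (K v)" for c v
    unfolding K_def t by (rule Sum_any_additive[OF fin scale_right_distrib, symmetric])
  have comm: "K (L x (- int m) v) = L x (- int m) (K v) + smul (of_nat m) (L x (- int m) v)" if m: "m \<ge> 1" for x m v
  proof -
    have Lx: "L x (- int m) v = (\<Sum>s\<in>S. smul (of_real (Bl (d s) x)) (L s (- int m) v))" for x
    proof -
      have "L (sum f A) k v = (\<Sum>s\<in>A. L (f s) k v)" for f k and A :: "'l set"
        by (rule additive_sum[of "\<lambda>x. L x k v"]) (rule L_linx)
      then show ?thesis by (subst d[of x]) (simp add: L_linx)
    qed
    have tn: "t n (L x (- int m) v) = L x (- int m) (t n v) + (if n = m - 1 then smul (of_nat m) (L x (- int m) v) else 0)" for n
    proof -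
      have Ls: "L x k (sum f A) = (\<Sum>i\<in>A. L x k (f i))" for x k f and A :: "'l set"
        by (rule additive_sum) (rule L_lin)
      have "L s (- int (Suc n)) (L (d s) (int (Suc n)) (L x (- int m) v)) =
          L x (- int m) (L s (- int (Suc n)) (L (d s) (int (Suc n)) v)) +
          (if n = m - 1 then smul (of_nat m) (smul (of_real (Bl (d s) x)) (L s (- int m) v)) else 0)" for s
      proof -
        have "L (d s) (int (Suc n)) (L x (- int m) v) = L x (- int m) (L (d s) (int (Suc n)) v) +
            (if n = m - 1 then smul (of_nat m * of_real (Bl (d s) x)) v else 0)"
          using m by (subst comm_LL) auto
        moreover have b: "L s (- int (Suc n)) (L x (- int m) w) = L x (- int m) (L s (- int (Suc n)) w)" for w
          by (subst comm_LL) simp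
        moreover have "L s (- int (Suc n)) (if n = m - 1 then smul (of_nat m * of_real (Bl (d s) x)) v else 0) =
            (if n = m - 1 then smul (of_nat m) (smul (of_real (Bl (d s) x)) (L s (- int m) v)) else 0)"
        proof (cases "n = m - 1")
          case True
          then have e: "int (Suc n) = int m" using m by simp
          show ?thesis unfolding e using True by (simp add: L_lin)
        qed (simp add: L_lin)
        ultimately show ?thesis by (simp only: L_lin(1))
      qed
      then show ?thesis unfolding t_def Ls by (simp add: sum.distrib Lx[of x] scale_sum_right)
    qed
    have f2: "finite {n. (if n = m - 1 then smul (of_nat m) (L x (- int m) v) else 0) \<noteq> 0}"
      by (rule finite_subset[of _ "{m - 1}"]) auto
    have f1: "finite {n. L x (- int m) (t n v) \<noteq> 0}"
      by (rule finite_subset[OF _ fin[of v]]) (auto simp: L_lin)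
    show ?thesis
      unfolding K_def tn Sum_any.distrib[OF f1 f2] Sum_any_additive[OF fin, of "L x (- int m)", OF L_lin(1)] by simp
  qed
  have commR: "K (R y n v) = R y n (K v)" for y n v
  proof -
    have Rs: "R y k (sum f A) = (\<Sum>i\<in>A. R y k (f i))" for k f and A :: "'l set"
      by (rule additive_sum) (rule R_lin)
    have tR: "t j (R y n v) = R y n (t j v)" for j by (simp only: t_def comm_LR Rs)
    show ?thesis unfolding K_def tR by (rule Sum_any_additive[OF fin R_lin(1), symmetric])
  qed
  have zero: "K v = 0" if v: "\<forall>x. \<forall>n\<ge>1. L x n v = 0" for v
  proof -
    have "L (d s) (int (Suc n)) v = 0" for s n using v by simp
    then have "t n v = 0" for n by (simp only: t_def L_lin sum.neutral_const)
    then show ?thesis by (simp add: K_def)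
  qed
  have sp: "K v \<in> span {L x (- int n) (L x' (int n) v) | x x' n. n \<ge> 1}" for v
    unfolding K_def t_def
  proof (intro subspace_Sum_any[OF subspace_span] span_sum span_base)
    fix n s show "L s (- int (Suc n)) (L (d s) (int (Suc n)) v) \<in> {L x (- int n) (L x' (int n) v) | x x' n. n \<ge> 1}"
      by (intro CollectI exI[of _ s] exI[of _ "d s"] exI[of _ "Suc n"]) simp
  qed
  have "left_casimir K"
    unfolding left_casimir_def using Ladd Lscale comm commR zero sp by (intro conjI allI impI)
  then show ?thesis by blast
qed

definition casimir_operator :: "('v \<Rightarrow> 'v) \<Rightarrow> bool" where
  "casimir_operator K \<longleftrightarrow> (\<forall>v w. K (v + w) = K v + K w) \<and> (\<forall>c v. K (smul c v) = smul c (K v)) \<and>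
     (\<forall>x m v. m \<ge> 1 --> K (L x (- int m) v) = L x (- int m) (K v) + smul (of_nat m) (L x (- int m) v)) \<and>
     (\<forall>y m v. m \<ge> 1 --> K (R y (- int m) v) = R y (- int m) (K v) + smul (of_nat m) (R y (- int m) v)) \<and>
     (\<forall>\<alpha>. \<forall>v\<in>VW \<alpha>. K v = 0) \<and>
     (\<forall>v. K v \<in> span ({L x (- int n) (L x' (int n) v) | x x' n. n \<ge> 1} \<union> {R x (- int n) (R x' (int n) v) | x x' n. n \<ge> 1}))"

lemma casimir: "\<exists>K. casimir_operator K"
proof -
  interpret c: full_H_vertex_algebra smul "\<lambda>h h'. Fg h' h" "\<lambda>a r s. Y a s r" vac ir il Br Bl
    by (rule conjugate_full_H_vertex_algebra)
  have sw: "c.L = R" "c.R = L" by (simp_all add: lmode_def rmode_def fun_eq_iff)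
  obtain A where A0: "left_casimir A" using half_casimir by blast
  note A = A0[unfolded left_casimir_def]
  note A1 = A[THEN conjunct1, rule_format]
  note A2 = A[THEN conjunct2, THEN conjunct1, rule_format]
  note A3 = A[THEN conjunct2, THEN conjunct2, THEN conjunct1, rule_format]
  note A4 = A[THEN conjunct2, THEN conjunct2, THEN conjunct2, THEN conjunct1, rule_format]
  note A5 = A[THEN conjunct2, THEN conjunct2, THEN conjunct2, THEN conjunct2, THEN conjunct1, rule_format]
  note A6 = A[THEN conjunct2, THEN conjunct2, THEN conjunct2, THEN conjunct2, THEN conjunct2, rule_format]
  obtain B where B0: "c.left_casimir B" using c.half_casimir by blast
  note B = B0[unfolded c.left_casimir_def sw]
  note B1 = B[THEN conjunct1, rule_format]
  note B2 = B[THEN conjunct2, THEN conjunct1, rule_format]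
  note B3 = B[THEN conjunct2, THEN conjunct2, THEN conjunct1, rule_format]
  note B4 = B[THEN conjunct2, THEN conjunct2, THEN conjunct2, THEN conjunct1, rule_format]
  note B5 = B[THEN conjunct2, THEN conjunct2, THEN conjunct2, THEN conjunct2, THEN conjunct1, rule_format]
  note B6 = B[THEN conjunct2, THEN conjunct2, THEN conjunct2, THEN conjunct2, THEN conjunct2, rule_format]
  have "casimir_operator (\<lambda>v. A v + B v)"
    unfolding casimir_operator_def
  proof (intro conjI allI impI ballI)
    fix v
    have "A v \<in> span ({L x (- int n) (L x' (int n) v) | x x' n. n \<ge> 1} \<union> {R x (- int n) (R x' (int n) v) | x x' n. n \<ge> 1})"
      by (rule set_mp[OF span_mono A6]) (rule Un_upper1)
    moreover have "B v \<in> span ({L x (- int n) (L x' (int n) v) | x x' n. n \<ge> 1} \<union> {R x (- int n) (R x' (int n) v) | x x' n. n \<ge> 1})"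
      by (rule set_mp[OF span_mono B6]) (rule Un_upper2)
    ultimately show "A v + B v \<in> span ({L x (- int n) (L x' (int n) v) | x x' n. n \<ge> 1} \<union> {R x (- int n) (R x' (int n) v) | x x' n. n \<ge> 1})"
      by (rule span_add)
  next
    fix \<alpha> v assume "v \<in> VW \<alpha>"
    from vac_weightD(2,3)[OF this] show "A v + B v = 0" using A5[of v] B5[of v] by simp
  qed (simp_all add: A1 A2 A3 A4 B1 B2 B3 B4 L_lin R_lin scale_right_distrib algebra_simps)
  then show ?thesis by blast
qed

text \<open>Every \<open>z\<close> of charge $\gamma$ is killed by some $\prod(\mathrm{Cas}-k)$ with $k\ge0$: by induction on the degree, which is
  bounded below, $\mathrm{Cas}\,z$ is a sum of $h(-n)h'(n)z$ with $h'(n)z$ of lower degree. Applying $h(-m)$, $m\ge1$, raises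
  all \<open>k\<close> to positive numbers, while $\mathrm{Cas}$ kills vacuum vectors.\<close>

lemma VW_descendants_disjoint:
  assumes v: "v \<in> VW \<gamma>"
    and vN: "v \<in> span ({L x (- int m) z | x m z. m \<ge> 1 \<and> z \<in> WS \<gamma>} \<union> {R y (- int m) z | y m z. m \<ge> 1 \<and> z \<in> WS \<gamma>})"
  shows "v = 0"
proof -
  obtain K where K0: "casimir_operator K" using casimir by blast
  note K = K0[unfolded casimir_operator_def]
  note K1 = K[THEN conjunct1, rule_format]
  note K2 = K[THEN conjunct2, THEN conjunct1, rule_format]
  note K3 = K[THEN conjunct2, THEN conjunct2, THEN conjunct1, rule_format]
  note K4 = K[THEN conjunct2, THEN conjunct2, THEN conjunct2, THEN conjunct1, rule_format]
  note K5 = K[THEN conjunct2, THEN conjunct2, THEN conjunct2, THEN conjunct2, THEN conjunct1, rule_format]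
  note K6 = K[THEN conjunct2, THEN conjunct2, THEN conjunct2, THEN conjunct2, THEN conjunct2, rule_format]
  let ?A = "annihilated smul K"
  note sub = annihilated_subspace[where C = K, OF vector_space_axioms K1 K2]
  have raise: "L x (- int m) z \<in> ?A 1" "R y (- int m) z \<in> ?A 1" if "z \<in> ?A 0" "m \<ge> 1" for x y m z
    by (rule annihilated_raise[where C = K, OF vector_space_axioms K1 K2 L_lin(1,2) K3[OF that(2)] that])
       (rule annihilated_raise[where C = K, OF vector_space_axioms K1 K2 R_lin(1,2) K4[OF that(2)] that])
  obtain N where N: "\<And>t t'. t \<le> N \<or> t' \<le> N ==> Fg t t' \<inter> WS \<gamma> = {0}" using FH2[of \<gamma>] by blast
  have hom: "z \<in> ?A 0" if "(t - N) + (t' - N) \<le> real n" "z \<in> Fg t t'" "z \<in> WS \<gamma>" for n t t' z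
    using that
  proof (induction n arbitrary: t t' z rule: less_induct)
    case (less n)
    show ?case
    proof (cases "t \<le> N \<or> t' \<le> N")
      case True
      then have "z = 0" using N less.prems by blast
      then show ?thesis using subspace_0[OF sub] by simp
    next
      case False
      have low: "L x (int j) z \<in> ?A 0 \<and> R y (int j) z \<in> ?A 0" if j: "j \<ge> 1" for x y j
      proof (cases "j \<le> n")
        case True
        then have lt: "n - j < n" and re: "real (n - j) = real n - real j" using j by (simp_all add: of_nat_diff)
        have "L x (int j) z \<in> ?A 0"
          by (rule less.IH[OF lt _ L_degree[OF less.prems(2)] L_weight[OF less.prems(3)]]) (use less.prems(1) re in simp)
        moreover have "R y (int j) z \<in> ?A 0"
          by (rule less.IH[OF lt _ R_degree[OF less.prems(2)] R_weight[OF less.prems(3)]]) (use less.prems(1) re in simp)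
        ultimately show ?thesis ..
      next
        case j': False
        have "t - of_int (int j) \<le> N" "t' - of_int (int j) \<le> N" using False less.prems(1) j' by auto
        then have "L x (int j) z = 0" "R y (int j) z = 0"
          using N L_degree[OF less.prems(2), of x "int j"] L_weight[OF less.prems(3), of x "int j"]
            R_degree[OF less.prems(2), of y "int j"] R_weight[OF less.prems(3), of y "int j"] by blast+
        then show ?thesis using subspace_0[OF sub] by simp
      qed
      have "K z \<in> ?A 1"
        by (rule set_mp[OF span_minimal[OF _ sub] K6]) (use low raise in blast)
      then show ?thesis by (rule annihilated_C[where C = K, OF vector_space_axioms K1 K2])
    qed
  qed
  have all: "z \<in> ?A 0" if z: "z \<in> WS \<gamma>" for z
  proof -
    have "component Fp i z \<in> ?A 0" for i
    proof -
      obtain t t' where i: "i = (t, t')" by (cases i)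
      show ?thesis unfolding i
        by (rule hom[of t t' "nat \<lceil>(t - N) + (t' - N)\<rceil>"]) (use comp_mem comp_WS[OF z] real_nat_ceiling_ge in auto)
    qed
    then have "Sum_any (\<lambda>i. component Fp i z) \<in> ?A 0" by (rule subspace_Sum_any[OF sub])
    then show ?thesis using comp_sum[of z] by simp
  qed
  have "v \<in> ?A 1"
    by (rule set_mp[OF span_minimal[OF _ sub] vN]) (use all raise in blast)
  with K5[OF v] show ?thesis by (rule annihilated_kernel[where C = K, OF vector_space_axioms K1 K2])
qed

text \<open>Set the functional to 0 on the descendants of charge $\gamma$, extend it linearly, and cut it off to the finitely
  many degrees where it is nonzero on vacuum vectors. The cut-off changes neither property because components of
  vacuum vectors and of descendants are again such.\<close>

lemma vacuum_functional_extension: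
  assumes u: "linear_form_on smul (VW \<gamma>) u" and D: "finite D"
    and uD: "\<And>h h' v. (h, h') \<notin> D ==> v \<in> Fg h h' ==> v \<in> VW \<gamma> ==> u v = 0"
  shows "\<exists>u'. gdual u' \<and> (\<forall>v\<in>VW \<gamma>. u' v = u v) \<and>
     (\<forall>x m z. m \<ge> 1 --> z \<in> WS \<gamma> --> u' (L x (- int m) z) = 0) \<and>
     (\<forall>y m z. m \<ge> 1 --> z \<in> WS \<gamma> --> u' (R y (- int m) z) = 0)"
proof -
  define G where "G = {L x (- int m) z | x m z. m \<ge> 1 \<and> z \<in> WS \<gamma>} \<union> {R y (- int m) z | y m z. m \<ge> 1 \<and> z \<in> WS \<gamma>}"
  have uadd: "u (v + w) = u v + u w" and uscale: "u (smul c v) = c * u v" if "v \<in> VW \<gamma>" "w \<in> VW \<gamma>" for v w c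
    using u that unfolding linear_form_on_def by blast+
  define W where "W = {x + y | x y. x \<in> VW \<gamma> \<and> y \<in> span G}"
  \<comment> \<open>The projection to the vacuum vectors along the descendants, well defined on their sum.\<close>
  define p where "p w = (SOME x. x \<in> VW \<gamma> \<and> w - x \<in> span G)" for w
  have p: "p (x + y) = x" if xy: "x \<in> VW \<gamma>" "y \<in> span G" for x y
  proof -
    have "p (x + y) \<in> VW \<gamma> \<and> (x + y) - p (x + y) \<in> span G"
      unfolding p_def by (rule someI[of _ x]) (use xy in simp)
    then have 1: "p (x + y) \<in> VW \<gamma>" and 2: "(x + y) - p (x + y) \<in> span G" by blast+
    have "x - p (x + y) \<in> VW \<gamma>" by (rule subspace_diff[OF VW_subspace xy(1) 1])
    moreover have "((x + y) - p (x + y)) - y \<in> span G" by (rule span_diff[OF 2 xy(2)])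
    then have "x - p (x + y) \<in> span G" by (simp add: algebra_simps)
    ultimately have "x - p (x + y) = 0" unfolding G_def by (rule VW_descendants_disjoint)
    then show ?thesis by simp
  qed
  have Wsub: "subspace W" unfolding W_def by (rule subspace_sums[OF VW_subspace subspace_span])
  have "linear_form_on smul W (\<lambda>w. u (p w))"
    unfolding linear_form_on_def
  proof (intro conjI ballI allI)
    fix w w' assume "w \<in> W" "w' \<in> W"
    then obtain x y x' y' where w: "w = x + y" "x \<in> VW \<gamma>" "y \<in> span G" and w': "w' = x' + y'" "x' \<in> VW \<gamma>" "y' \<in> span G"
      unfolding W_def by blast
    have e: "w + w' = (x + x') + (y + y')" by (simp add: w w' algebra_simps)
    have "p (w + w') = x + x'" unfolding e by (intro p subspace_add[OF VW_subspace] span_add w w')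
    then show "u (p (w + w')) = u (p w) + u (p w')" using p[OF w(2,3)] p[OF w'(2,3)] uadd[OF w(2) w'(2)] w(1) w'(1) by simp
  next
    fix c w assume "w \<in> W"
    then obtain x y where w: "w = x + y" "x \<in> VW \<gamma>" "y \<in> span G" unfolding W_def by blast
    have e: "smul c w = smul c x + smul c y" by (simp add: w scale_right_distrib)
    have "p (smul c w) = smul c x" unfolding e by (intro p subspace_scale[OF VW_subspace] span_scale w)
    then show "u (p (smul c w)) = c * u (p w)" using p[OF w(2,3)] uscale[OF w(2) w(2)] w(1) by simp
  qed
  from functional_extension[OF vector_space_axioms Wsub this] obtain l where
    l: "\<And>x y. l (x + y) = l x + l y" "\<And>c x. l (smul c x) = c * l x" and lW': "\<forall>w\<in>W. l w = u (p w)"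
    by blast
  note lW = bspec[OF lW']
  have lV: "l x = u x" if x: "x \<in> VW \<gamma>" for x
  proof -
    have "x + 0 \<in> W" unfolding W_def using x span_zero by blast
    from lW[OF this] p[OF x span_zero] show ?thesis by simp
  qed
  have u0: "u 0 = 0" using uscale[OF subspace_0[OF VW_subspace] subspace_0[OF VW_subspace], of 0] by simp
  have lG: "l y = 0" if y: "y \<in> span G" for y
  proof -
    have z: "0 \<in> VW \<gamma>" by (rule subspace_0[OF VW_subspace])
    have "0 + y \<in> W" unfolding W_def using y z by blast
    from lW[OF this] p[OF z y] show ?thesis by (simp add: u0)
  qed
  \<comment> \<open>The cut-off to the degrees in \<open>D\<close>.\<close>
  define u' where "u' v = (\<Sum>i\<in>D. l (component Fp i v))" for v
  have "gdual u'" unfolding u'_def by (rule gdual_comp[OF l D])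
  moreover have "u' v = u v" if v: "v \<in> VW \<gamma>" for v
  proof -
    have "l v = l (Sum_any (\<lambda>i. component Fp i v))" using comp_sum[of v] by simp
    also have "\<dots> = Sum_any (\<lambda>i. l (component Fp i v))" by (rule Sum_any_additive[OF comp_finite l(1)])
    also have "\<dots> = (\<Sum>i\<in>D. l (component Fp i v))"
    proof (rule Sum_any.expand_superset[OF D], rule subsetI, rule ccontr)
      fix i assume i: "i \<in> {i. l (component Fp i v) \<noteq> 0}" "i \<notin> D"
      obtain h h' where hh: "i = (h, h')" by (cases i)
      have "u (component Fp i v) = 0" by (rule uD[of h h']) (use i(2) hh comp_mem comp_VW[OF v] in auto)
      then show False using i(1) lV[OF comp_VW[OF v]] by simp
    qed
    finally show ?thesis using lV[OF v] by (simp add: u'_def)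
  qed
  moreover have "u' (L x (- int m) z) = 0" if m: "m \<ge> 1" and z: "z \<in> WS \<gamma>" for x m z
    unfolding u'_def
  proof (rule sum.neutral, rule ballI)
    fix i :: "real \<times> real"
    obtain h h' where i: "i = (h, h')" by (cases i)
    have "component Fp i (L x (- int m) z) \<in> G"
      unfolding i comp_L G_def using m comp_WS[OF z] by blast
    then show "l (component Fp i (L x (- int m) z)) = 0" by (intro lG span_base)
  qed
  moreover have "u' (R y (- int m) z) = 0" if m: "m \<ge> 1" and z: "z \<in> WS \<gamma>" for y m z
    unfolding u'_def
  proof (rule sum.neutral, rule ballI)
    fix i :: "real \<times> real"
    obtain h h' where i: "i = (h, h')" by (cases i)
    have "component Fp i (R y (- int m) z) \<in> G"
      unfolding i comp_R G_def using m comp_WS[OF z] by blast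
    then show "l (component Fp i (R y (- int m) z)) = 0" by (intro lG span_base)
  qed
  ultimately show ?thesis by blast
qed

end

section \<open>Correlation functions of the dressed operators\<close>

context full_H_vertex_algebra
begin

text \<open>The outermost $E^-$ disappears against a functional that kills descendants.\<close>

lemma eval_Yhat:
  assumes u: "gdual u" and v: "v \<in> WS \<alpha>" and w: "w \<in> WS \<beta>"
    and kl: "\<And>x m z. m \<ge> 1 ==> z \<in> WS (\<alpha> + \<beta>) ==> u (L x (- int m) z) = 0"
    and kr: "\<And>y m z. m \<ge> 1 ==> z \<in> WS (\<alpha> + \<beta>) ==> u (R y (- int m) z) = 0"
  shows "u (Yhat \<alpha> \<beta> v w s s') = u (vser Y v w (s + Bp \<alpha> \<beta>) (s' + Bq \<alpha> \<beta>))"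
proof -
  have K: "u (EM (- \<alpha>) m n (vser Y v w t t')) = (if m = 0 \<and> n = 0 then u (vser Y v w t t') else 0)" for m n t t'
    by (rule EM_killed[OF u vser_weight[OF v w]]) (rule kl kr; assumption)+
  have "u (Yhat \<alpha> \<beta> v w s s') = Sum_any (\<lambda>i. u (case i of (m, n) \<Rightarrow> EM (- \<alpha>) m n
     (vser Y v w (s - real m + Bp \<alpha> \<beta>) (s' - real n + Bq \<alpha> \<beta>))))"
    unfolding Yhat_def by (rule gdual_Sum_any[OF u Yhat_finite'])
  also have "\<dots> = Sum_any (\<lambda>i :: nat \<times> nat. if i = (0, 0) then u (vser Y v w (s + Bp \<alpha> \<beta>) (s' + Bq \<alpha> \<beta>)) else 0)"
  proof (rule Sum_any.cong)
    fix i :: "nat \<times> nat"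
    obtain m n where i: "i = (m, n)" by (cases i)
    show "u (case i of (m, n) \<Rightarrow> EM (- \<alpha>) m n
       (vser Y v w (s - real m + Bp \<alpha> \<beta>) (s' - real n + Bq \<alpha> \<beta>))) =
       (if i = (0, 0) then u (vser Y v w (s + Bp \<alpha> \<beta>) (s' + Bq \<alpha> \<beta>)) else 0)"
      unfolding i prod.case K by simp
  qed
  finally show ?thesis by simp
qed

lemma eval_Sum_Yhat:
  fixes G :: "'v \<Rightarrow> real \<Rightarrow> real \<Rightarrow> complex" and \<epsilon> :: complex
  assumes G: "\<And>c d s s'. G (c + d) s s' = G c s s' + G d s s'" "\<And>k c s s'. G (smul k c) s s' = k * G c s s'"
    and hl: "\<And>i c s s'. i \<ge> 1 ==> c \<in> WS (\<alpha> + \<beta>) ==> G (L (- fst \<alpha>) (- int i) c) s s' = - (\<epsilon> ^ i * of_real \<kappa>) * G c (s + real i) s'"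
    and hr: "\<And>i c s s'. i \<ge> 1 ==> c \<in> WS (\<alpha> + \<beta>) ==> G (R (- snd \<alpha>) (- int i) c) s s' = - (\<epsilon> ^ i * of_real \<kappa>') * G c s (s' + real i)"
    and v: "v \<in> WS \<alpha>" and w: "w \<in> WS \<beta>"
    and P: "\<And>m. fps_nth P m = (- \<epsilon>) ^ m * of_real (\<kappa> gchoose m)" "\<And>m. fps_nth Q m = (- \<epsilon>) ^ m * of_real (\<kappa>' gchoose m)"
  shows "G (Yhat \<alpha> \<beta> v w t t') s s' = conv2 P Q (\<lambda>m n. G (vser Y v w (t - real m + Bp \<alpha> \<beta>) (t' - real n + Bq \<alpha> \<beta>)) (s + real m) (s' + real n))"
proof -
  have hl': "G (L (fst (- \<alpha>)) (- int i) c) s s' = - (\<epsilon> ^ i * of_real \<kappa>) * G c (s + real i) s'"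
    and hr': "G (R (snd (- \<alpha>)) (- int i) c) s s' = - (\<epsilon> ^ i * of_real \<kappa>') * G c s (s' + real i)"
    if "i \<ge> 1" "c \<in> WS (\<alpha> + \<beta>)" for i c s s' using hl[OF that] hr[OF that] by simp_all
  have "G (Yhat \<alpha> \<beta> v w t t') s s' = Sum_any (\<lambda>i. G (case i of (m, n) \<Rightarrow> EM (- \<alpha>) m n
     (vser Y v w (t - real m + Bp \<alpha> \<beta>) (t' - real n + Bq \<alpha> \<beta>))) s s')"
    unfolding Yhat_def by (rule Sum_any_additive[OF Yhat_finite', of "\<lambda>c. G c s s'"]) (rule G)
  also have "\<dots> = conv2 P Q (\<lambda>m n. G (vser Y v w (t - real m + Bp \<alpha> \<beta>) (t' - real n + Bq \<alpha> \<beta>)) (s + real m) (s' + real n))"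
    unfolding conv2_def
  proof (rule Sum_any.cong)
    fix i :: "nat \<times> nat"
    obtain m n where i: "i = (m, n)" by (cases i)
    show "G (case i of (m, n) \<Rightarrow> EM (- \<alpha>) m n
       (vser Y v w (t - real m + Bp \<alpha> \<beta>) (t' - real n + Bq \<alpha> \<beta>))) s s' =
       (case i of (m, n) \<Rightarrow> fps_nth P m * fps_nth Q n *
         G (vser Y v w (t - real m + Bp \<alpha> \<beta>) (t' - real n + Bq \<alpha> \<beta>)) (s + real m) (s' + real n))"
      unfolding i prod.case P by (rule EM_eval[OF G hl' hr' vser_weight[OF v w]])
  qed
  finally show ?thesis .
qed

context
  fixes u u' :: "'v \<Rightarrow> complex" and \<gamma> :: "'l \<times> 'r"
  assumes u': "gdual u'" and uu: "\<And>v. v \<in> VW \<gamma> ==> u v = u' v"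
    and kl: "\<And>x m z. m \<ge> 1 ==> z \<in> WS \<gamma> ==> u' (L x (- int m) z) = 0"
    and kr: "\<And>y m z. m \<ge> 1 ==> z \<in> WS \<gamma> ==> u' (R y (- int m) z) = 0"
begin

text \<open>The outer $E^-$ is killed, and $E^-(-\alpha_2,\underline z_2)$ becomes
  $(1-z_2/z_1)^{-(\alpha_1,\alpha_2)}$ on its way through $Y(a_1,\underline z_1)$ to the left.\<close>

lemma corr_12_VY:
  fixes \<alpha>1 \<alpha>2 \<alpha>3 :: "'l \<times> 'r"
  assumes a: "a1 \<in> VW \<alpha>1" "a2 \<in> VW \<alpha>2" "a3 \<in> VW \<alpha>3" and \<gamma>: "\<alpha>1 + (\<alpha>2 + \<alpha>3) = \<gamma>"
  defines "l12 \<equiv> Bp \<alpha>1 \<alpha>2" and "l13 \<equiv> Bp \<alpha>1 \<alpha>3" and "l23 \<equiv> Bp \<alpha>2 \<alpha>3"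
    and "r12 \<equiv> Bq \<alpha>1 \<alpha>2" and "r13 \<equiv> Bq \<alpha>1 \<alpha>3" and "r23 \<equiv> Bq \<alpha>2 \<alpha>3"
  shows "corr_12 VY u a1 a2 a3 = mul12 (bin_neg (- l12)) (bin_neg (- r12))
     (- (l12 + l13)) (- (r12 + r13)) (- l23) (- r23) (corr_12 Y u' a1 a2 a3)"
proof (intro ext)
  fix s1 s1' s2 s2'
  note W = vac_weightD(1)[OF a(1)] vac_weightD(1)[OF a(2)] vac_weightD(1)[OF a(3)]
  let ?w = "Yhat \<alpha>2 \<alpha>3 a2 a3 s2 s2'"
  have w: "?w \<in> VW (\<alpha>2 + \<alpha>3)" by (rule Yhat_VW[OF a(2,3)])
  define G where "G c s s' = u' (vser Y a1 c s s')" for c s s'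
  have "corr_12 VY u a1 a2 a3 s1 s1' s2 s2' = u (Yhat \<alpha>1 (\<alpha>2 + \<alpha>3) a1 ?w s1 s1')"
    unfolding corr_12_def VY_homogeneous[OF a(2,3)] VY_homogeneous[OF a(1) w] ..
  also have "\<dots> = u' (Yhat \<alpha>1 (\<alpha>2 + \<alpha>3) a1 ?w s1 s1')"
    by (rule uu) (use Yhat_VW[OF a(1) w] in \<open>simp only: \<gamma>\<close>)
  also have "\<dots> = G ?w (s1 + (l12 + l13)) (s1' + (r12 + r13))"
    unfolding G_def by (subst eval_Yhat[OF u' W(1) vac_weightD(1)[OF w]])
      (simp_all add: \<gamma> kl kr l12_def l13_def r12_def r13_def Bl_bilinear Br_bilinear)
  also have "\<dots> = conv2 (bin_neg (- l12)) (bin_neg (- r12)) (\<lambda>m n. G (vser Y a2 a3 (s2 - real m + l23) (s2' - real n + r23))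
      (s1 + (l12 + l13) + real m) (s1' + (r12 + r13) + real n))"
    unfolding l23_def r23_def
  proof (rule eval_Sum_Yhat[where \<epsilon> = 1 and G = G, OF _ _ _ _ W(2,3)])
    show "G (c + d) s s' = G c s s' + G d s s'" "G (smul k c) s s' = k * G c s s'" for c d k s s'
      by (simp_all add: G_def vser_def Y_lin gdual_add[OF u'] gdual_scale[OF u'])
    show "G (L (- fst \<alpha>2) (- int i) c) s s' = - (1 ^ i * of_real (- l12)) * G c (s + real i) s'"
      if i: "i \<ge> 1" and c: "c \<in> WS (\<alpha>2 + \<alpha>3)" for i c s s'
    proof -
      have V: "vser Y a1 c s s' \<in> WS \<gamma>" using vser_weight[OF W(1) c] by (simp only: \<gamma>)
      have "0 = u' (L (- fst \<alpha>2) (- int i) (vser Y a1 c s s'))" using kl[OF i V] by simp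
      also have "\<dots> = G (L (- fst \<alpha>2) (- int i) c) s s' + of_real (- l12) * G c (s + real i) s'"
        unfolding comm_L_vac[OF a(1)] gdual_add[OF u'] gdual_scale[OF u'] G_def l12_def
        by (simp add: Bl_bilinear Bl_commute[of "fst \<alpha>2"])
      finally show ?thesis by (simp add: eq_neg_iff_add_eq_0 add.commute)
    qed
    show "G (R (- snd \<alpha>2) (- int i) c) s s' = - (1 ^ i * of_real (- r12)) * G c s (s' + real i)"
      if i: "i \<ge> 1" and c: "c \<in> WS (\<alpha>2 + \<alpha>3)" for i c s s'
    proof -
      have V: "vser Y a1 c s s' \<in> WS \<gamma>" using vser_weight[OF W(1) c] by (simp only: \<gamma>)
      have "0 = u' (R (- snd \<alpha>2) (- int i) (vser Y a1 c s s'))" using kr[OF i V] by simp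
      also have "\<dots> = G (R (- snd \<alpha>2) (- int i) c) s s' + of_real (- r12) * G c s (s' + real i)"
        unfolding comm_R_vac[OF a(1)] gdual_add[OF u'] gdual_scale[OF u'] G_def r12_def
        by (simp add: Br_bilinear Br_commute[of "snd \<alpha>2"])
      finally show ?thesis by (simp add: eq_neg_iff_add_eq_0 add.commute)
    qed
  qed (simp_all add: bin_neg_nth)
  also have "\<dots> = mul12 (bin_neg (- l12)) (bin_neg (- r12))
     (- (l12 + l13)) (- (r12 + r13)) (- l23) (- r23) (corr_12 Y u' a1 a2 a3) s1 s1' s2 s2'"
    unfolding mul12_def act_def line12_def corr_12_def G_def by (simp add: algebra_simps)
  finally show "corr_12 VY u a1 a2 a3 s1 s1' s2 s2' = mul12 (bin_neg (- l12)) (bin_neg (- r12))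
     (- (l12 + l13)) (- (r12 + r13)) (- l23) (- r23) (corr_12 Y u' a1 a2 a3) s1 s1' s2 s2'" .
qed

lemma corr_21_VY:
  fixes \<alpha>1 \<alpha>2 \<alpha>3 :: "'l \<times> 'r"
  assumes a: "a1 \<in> VW \<alpha>1" "a2 \<in> VW \<alpha>2" "a3 \<in> VW \<alpha>3" and \<gamma>: "\<alpha>1 + (\<alpha>2 + \<alpha>3) = \<gamma>"
  defines "l12 \<equiv> Bp \<alpha>1 \<alpha>2" and "l13 \<equiv> Bp \<alpha>1 \<alpha>3" and "l23 \<equiv> Bp \<alpha>2 \<alpha>3"
    and "r12 \<equiv> Bq \<alpha>1 \<alpha>2" and "r13 \<equiv> Bq \<alpha>1 \<alpha>3" and "r23 \<equiv> Bq \<alpha>2 \<alpha>3"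
  shows "corr_21 VY u a1 a2 a3 = mul21 (bin_neg (- l12)) (bin_neg (- r12))
     (- l13) (- r13) (- (l12 + l23)) (- (r12 + r23)) (corr_21 Y u' a1 a2 a3)"
proof (intro ext)
  fix s1 s1' s2 s2'
  have \<gamma>': "\<alpha>2 + (\<alpha>1 + \<alpha>3) = \<gamma>" using \<gamma> by (simp add: add.left_commute)
  have "corr_21 VY u a1 a2 a3 s1 s1' s2 s2' = corr_12 VY u a2 a1 a3 s2 s2' s1 s1'"
    by (simp add: corr_12_def corr_21_def)
  also have "\<dots> = mul12 (bin_neg (- l12)) (bin_neg (- r12))
     (- (l12 + l23)) (- (r12 + r23)) (- l13) (- r13) (corr_12 Y u' a2 a1 a3) s2 s2' s1 s1'"
    unfolding corr_12_VY[OF a(2,1,3) \<gamma>'] l12_def l13_def l23_def r12_def r13_def r23_def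
    by (simp only: Bl_commute[of "fst \<alpha>2" "fst \<alpha>1"] Br_commute[of "snd \<alpha>2" "snd \<alpha>1"])
  also have "\<dots> = mul21 (bin_neg (- l12)) (bin_neg (- r12))
     (- l13) (- r13) (- (l12 + l23)) (- (r12 + r23)) (corr_21 Y u' a1 a2 a3) s1 s1' s2 s2'"
    unfolding mul12_def mul21_def act_def line12_def line21_def corr_12_def corr_21_def by (simp add: algebra_simps)
  finally show "corr_21 VY u a1 a2 a3 s1 s1' s2 s2' = mul21 (bin_neg (- l12)) (bin_neg (- r12))
     (- l13) (- r13) (- (l12 + l23)) (- (r12 + r23)) (corr_21 Y u' a1 a2 a3) s1 s1' s2 s2'" .
qed

text \<open>The outer $E^-$ is killed, and by the iterate formula $E^-(-\alpha_1,\underline z_0)$ inside the vertex operator becomes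
  $(1+z_0/z_2)^{-(\alpha_1,\alpha_3)}$.\<close>

lemma corr_20_VY:
  fixes \<alpha>1 \<alpha>2 \<alpha>3 :: "'l \<times> 'r"
  assumes a: "a1 \<in> VW \<alpha>1" "a2 \<in> VW \<alpha>2" "a3 \<in> VW \<alpha>3" and \<gamma>: "\<alpha>1 + (\<alpha>2 + \<alpha>3) = \<gamma>"
  defines "l12 \<equiv> Bp \<alpha>1 \<alpha>2" and "l13 \<equiv> Bp \<alpha>1 \<alpha>3" and "l23 \<equiv> Bp \<alpha>2 \<alpha>3"
    and "r12 \<equiv> Bq \<alpha>1 \<alpha>2" and "r13 \<equiv> Bq \<alpha>1 \<alpha>3" and "r23 \<equiv> Bq \<alpha>2 \<alpha>3"
  shows "corr_20 VY u a1 a2 a3 = mul21 (bin_pos (- l13)) (bin_pos (- r13))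
     (- l12) (- r12) (- (l13 + l23)) (- (r13 + r23)) (corr_20 Y u' a1 a2 a3)"
proof (intro ext)
  fix s0 s0' s2 s2'
  note W = vac_weightD(1)[OF a(1)] vac_weightD(1)[OF a(2)] vac_weightD(1)[OF a(3)]
  have \<gamma>': "(\<alpha>1 + \<alpha>2) + \<alpha>3 = \<gamma>" using \<gamma> by (simp add: add.assoc)
  let ?b = "Yhat \<alpha>1 \<alpha>2 a1 a2 s0 s0'"
  have b: "?b \<in> VW (\<alpha>1 + \<alpha>2)" by (rule Yhat_VW[OF a(1,2)])
  define G where "G c s s' = u' (vser Y c a3 s s')" for c s s'
  have "corr_20 VY u a1 a2 a3 s0 s0' s2 s2' = u (Yhat (\<alpha>1 + \<alpha>2) \<alpha>3 ?b a3 s2 s2')"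
    unfolding corr_20_def VY_homogeneous[OF a(1,2)] VY_homogeneous[OF b a(3)] ..
  also have "\<dots> = u' (Yhat (\<alpha>1 + \<alpha>2) \<alpha>3 ?b a3 s2 s2')"
    by (rule uu) (use Yhat_VW[OF b a(3)] in \<open>simp only: \<gamma>'\<close>)
  also have "\<dots> = G ?b (s2 + (l13 + l23)) (s2' + (r13 + r23))"
    unfolding G_def by (subst eval_Yhat[OF u' vac_weightD(1)[OF b] W(3)])
      (simp_all add: \<gamma>' kl kr l13_def l23_def r13_def r23_def Bl_bilinear Br_bilinear)
  also have "\<dots> = conv2 (bin_pos (- l13)) (bin_pos (- r13)) (\<lambda>m n. G (vser Y a1 a2 (s0 - real m + l12) (s0' - real n + r12))
      (s2 + (l13 + l23) + real m) (s2' + (r13 + r23) + real n))"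
    unfolding l12_def r12_def
  proof (rule eval_Sum_Yhat[where \<epsilon> = "-1" and G = G, OF _ _ _ _ W(1,2)])
    show "G (c + d) s s' = G c s s' + G d s s'" "G (smul k c) s s' = k * G c s s'" for c d k s s'
      by (simp_all add: G_def vser_def Y_lin gdual_add[OF u'] gdual_scale[OF u'])
    show "G (L (- fst \<alpha>1) (- int i) c) s s' = - ((-1) ^ i * of_real (- l13)) * G c (s + real i) s'"
      if i: "i \<ge> 1" and c: "c \<in> WS (\<alpha>1 + \<alpha>2)" for i c s s'
    proof -
      have "u' (L x (- int m) z) = 0" if "m \<ge> 1" "z \<in> WS ((\<alpha>1 + \<alpha>2) + \<alpha>3)" for x m z
        using kl[OF that(1)] that(2) unfolding \<gamma>' .
      from iterate_L_vac[OF u' a(3) i c this, of "- fst \<alpha>1" s s'] show ?thesis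
        unfolding G_def l13_def by (simp add: Bl_bilinear)
    qed
    show "G (R (- snd \<alpha>1) (- int i) c) s s' = - ((-1) ^ i * of_real (- r13)) * G c s (s' + real i)"
      if i: "i \<ge> 1" and c: "c \<in> WS (\<alpha>1 + \<alpha>2)" for i c s s'
    proof -
      have "u' (R x (- int m) z) = 0" if "m \<ge> 1" "z \<in> WS ((\<alpha>1 + \<alpha>2) + \<alpha>3)" for x m z
        using kr[OF that(1)] that(2) unfolding \<gamma>' .
      from iterate_R_vac[OF u' a(3) i c this, of "- snd \<alpha>1" s s'] show ?thesis
        unfolding G_def r13_def by (simp add: Br_bilinear)
    qed
  qed (simp_all add: bin_pos_nth)
  also have "\<dots> = mul21 (bin_pos (- l13)) (bin_pos (- r13))
     (- l12) (- r12) (- (l13 + l23)) (- (r13 + r23)) (corr_20 Y u' a1 a2 a3) s0 s0' s2 s2'"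
    unfolding mul21_def act_def line21_def corr_20_def G_def by (simp add: algebra_simps)
  finally show "corr_20 VY u a1 a2 a3 s0 s0' s2 s2' = mul21 (bin_pos (- l13)) (bin_pos (- r13))
     (- l12) (- r12) (- (l13 + l23)) (- (r13 + r23)) (corr_20 Y u' a1 a2 a3) s0 s0' s2 s2'" .
qed

end

text \<open>The branch factor, with exponents $(-,-)_l-(-,-)_r$, cancels the $(-,-)_l$ in the holomorphic exponents of the
  dressing, so that a single-valued factor remains.\<close>

lemma VY_correlation:
  fixes \<alpha>1 \<alpha>2 \<alpha>3 :: "'l \<times> 'r"
  defines "B \<equiv> lat_form Bl Br"
  assumes a: "a1 \<in> VW \<alpha>1" "a2 \<in> VW \<alpha>2" "a3 \<in> VW \<alpha>3"
    and u: "graded_dual smul (\<lambda>(\<alpha>, t, t'). gr \<alpha> t t') \<Omega> u"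
  shows "\<exists>\<mu>. gcor2 \<mu>
    (branch_12 (B \<alpha>1 \<alpha>3) (B \<alpha>2 \<alpha>3) (B \<alpha>1 \<alpha>2) (corr_12 VY u a1 a2 a3))
    (branch_20 (B \<alpha>1 \<alpha>3) (B \<alpha>2 \<alpha>3) (B \<alpha>1 \<alpha>2) (corr_20 VY u a1 a2 a3))
    (branch_21 (B \<alpha>1 \<alpha>3) (B \<alpha>2 \<alpha>3) (B \<alpha>1 \<alpha>2) (corr_21 VY u a1 a2 a3))"
proof -
  define \<gamma> where "\<gamma> = \<alpha>1 + (\<alpha>2 + \<alpha>3)"
  let ?q = "\<lambda>\<alpha> :: 'l \<times> 'r. Bp \<alpha> \<alpha> / 2" and ?q' = "\<lambda>\<alpha> :: 'l \<times> 'r. Bq \<alpha> \<alpha> / 2"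
  define I where "I = {i. \<exists>v\<in>(\<lambda>(\<alpha>, t, t'). gr \<alpha> t t') i. u v \<noteq> 0}"
  define D where "D = (\<lambda>(\<alpha>, t, t'). (t + ?q \<alpha>, t' + ?q' \<alpha>)) ` I"
  have "finite I" using u unfolding graded_dual_def I_def by (rule conjunct2)
  then have D: "finite D" unfolding D_def by (rule finite_imageI)
  have "linear_form_on smul \<Omega> u" using u unfolding graded_dual_def by (rule conjunct1)
  then have lf: "linear_form_on smul (VW \<gamma>) u" using VW_subset[of \<gamma>] unfolding linear_form_on_def by blast
  have uD: "u v = 0" if v: "(h, h') \<notin> D" "v \<in> Fg h h'" "v \<in> VW \<gamma>" for h h' v
  proof (rule ccontr)
    assume nz: "u v \<noteq> 0"
    have "v \<in> gr \<gamma> (h - ?q \<gamma>) (h' - ?q' \<gamma>)" using v(2,3) by (simp add: gr_iff)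
    then have "(\<gamma>, h - ?q \<gamma>, h' - ?q' \<gamma>) \<in> I" unfolding I_def using nz by (intro CollectI bexI[of _ v]) simp_all
    then have "(\<lambda>(\<alpha>, t, t'). (t + ?q \<alpha>, t' + ?q' \<alpha>)) (\<gamma>, h - ?q \<gamma>, h' - ?q' \<gamma>) \<in> D" unfolding D_def by (rule imageI)
    then show False using v(1) by simp
  qed
  have "\<exists>u'. gdual u' \<and> (\<forall>v\<in>VW \<gamma>. u' v = u v) \<and>
     (\<forall>x m z. m \<ge> 1 --> z \<in> WS \<gamma> --> u' (L x (- int m) z) = 0) \<and>
     (\<forall>y m z. m \<ge> 1 --> z \<in> WS \<gamma> --> u' (R y (- int m) z) = 0)"
    by (rule vacuum_functional_extension[OF lf D]) (rule uD)
  then obtain u' where u': "gdual u'" and uu': "\<forall>v\<in>VW \<gamma>. u' v = u v"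
    and kl': "\<forall>x m z. m \<ge> 1 --> z \<in> WS \<gamma> --> u' (L x (- int m) z) = 0"
    and kr': "\<forall>y m z. m \<ge> 1 --> z \<in> WS \<gamma> --> u' (R y (- int m) z) = 0"
    by blast
  have uu: "u v = u' v" if "v \<in> VW \<gamma>" for v using bspec[OF uu' that] by simp
  note kl = kl'[rule_format] and kr = kr'[rule_format]
  let ?l12 = "Bp \<alpha>1 \<alpha>2" and ?l13 = "Bp \<alpha>1 \<alpha>3" and ?l23 = "Bp \<alpha>2 \<alpha>3"
  let ?r12 = "Bq \<alpha>1 \<alpha>2" and ?r13 = "Bq \<alpha>1 \<alpha>3" and ?r23 = "Bq \<alpha>2 \<alpha>3"
  obtain \<mu> where g: "gcor2 \<mu> (corr_12 Y u' a1 a2 a3) (corr_20 Y u' a1 a2 a3) (corr_21 Y u' a1 a2 a3)"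
    using FV5[OF u'] by blast
  note lb = gcor2_lower_bounded[OF g]
  have lbm12: "lower_bounded (line12 \<alpha> \<beta> (mul12 P Q e1 e1' e2 e2' (corr_12 Y u' a1 a2 a3)))" for \<alpha> \<beta> P Q e1 e1' e2 e2'
    unfolding line12_mul12 by (intro lower_bounded_shift_ser lower_bounded_act lb)
  have lbm20: "lower_bounded (line21 \<alpha> \<beta> (mul21 P Q e1 e1' e2 e2' (corr_20 Y u' a1 a2 a3)))"
    and lbm21: "lower_bounded (line21 \<alpha> \<beta> (mul21 P Q e1 e1' e2 e2' (corr_21 Y u' a1 a2 a3)))" for \<alpha> \<beta> P Q e1 e1' e2 e2'
    unfolding line21_mul21 by (intro lower_bounded_shift_ser lower_bounded_act lb)+
  have e: "B \<alpha>1 \<alpha>2 = ?l12 - ?r12" "B \<alpha>1 \<alpha>3 = ?l13 - ?r13" "B \<alpha>2 \<alpha>3 = ?l23 - ?r23" by (simp_all add: B_def lat_form_def)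
  have c12: "corr_12 VY u a1 a2 a3 = mul12 (bin_neg (- ?l12)) (bin_neg (- ?r12))
     (- (?l12 + ?l13)) (- (?r12 + ?r13)) (- ?l23) (- ?r23) (corr_12 Y u' a1 a2 a3)"
    by (rule corr_12_VY[OF u' _ _ _ a \<gamma>_def[symmetric]]) (rule uu kl kr; assumption)+
  have c20: "corr_20 VY u a1 a2 a3 = mul21 (bin_pos (- ?l13)) (bin_pos (- ?r13))
     (- ?l12) (- ?r12) (- (?l13 + ?l23)) (- (?r13 + ?r23)) (corr_20 Y u' a1 a2 a3)"
    by (rule corr_20_VY[OF u' _ _ _ a \<gamma>_def[symmetric]]) (rule uu kl kr; assumption)+
  have c21: "corr_21 VY u a1 a2 a3 = mul21 (bin_neg (- ?l12)) (bin_neg (- ?r12))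
     (- ?l13) (- ?r13) (- (?l12 + ?l23)) (- (?r12 + ?r23)) (corr_21 Y u' a1 a2 a3)"
    by (rule corr_21_VY[OF u' _ _ _ a \<gamma>_def[symmetric]]) (rule uu kl kr; assumption)+
  have 12: "branch_12 (B \<alpha>1 \<alpha>3) (B \<alpha>2 \<alpha>3) (B \<alpha>1 \<alpha>2) (corr_12 VY u a1 a2 a3) =
      mul12 (bin_neg (- ?r12)) (bin_neg (- ?r12)) (- ?r13 + - ?r12) (- ?r13 + - ?r12) (- ?r23) (- ?r23) (corr_12 Y u' a1 a2 a3)"
    unfolding c12 branch_12_mul12[OF lbm12] mul12_mul12[OF lb(1)] bin_neg_mult e
    by (simp add: algebra_simps)
  have 20: "branch_20 (B \<alpha>1 \<alpha>3) (B \<alpha>2 \<alpha>3) (B \<alpha>1 \<alpha>2) (corr_20 VY u a1 a2 a3) =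
      mul21 (bin_pos (- ?r13)) (bin_pos (- ?r13)) (- ?r12) (- ?r12) (- ?r13 + - ?r23) (- ?r13 + - ?r23) (corr_20 Y u' a1 a2 a3)"
    unfolding c20 branch_20_mul21[OF lbm20] mul21_mul21[OF lb(2)] bin_pos_mult e
    by (simp add: algebra_simps)
  have 21: "branch_21 (B \<alpha>1 \<alpha>3) (B \<alpha>2 \<alpha>3) (B \<alpha>1 \<alpha>2) (corr_21 VY u a1 a2 a3) =
      mul21 (bin_neg (- ?r12)) (bin_neg (- ?r12)) (- ?r13) (- ?r13) (- ?r23 + - ?r12) (- ?r23 + - ?r12) (corr_21 Y u' a1 a2 a3)"
    unfolding c21 branch_21_mul21[OF lbm21] mul21_mul21[OF lb(3)] bin_neg_mult e
    by (simp add: algebra_simps)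
  show ?thesis unfolding 12 20 21 by (rule gcor2_mult[OF g])
qed

section \<open>The vacuum space is a generalized full vertex algebra\<close>

lemma VY_vac_right:
  assumes a: "a \<in> \<Omega>"
  shows "vser VY a vac s s' = Sum_any (\<lambda>\<alpha>. Yhat \<alpha> 0 (C \<alpha> a) vac s s')"
proof -
  have \<Omega>: "vac \<in> \<Omega>" using vac_VW VW_subset by blast
  have "vser VY a vac s s' = Sum_any (\<lambda>(\<alpha>, \<beta>). Yhat \<alpha> \<beta> (C \<alpha> a) (C \<beta> vac) s s')"
    unfolding vser_def VY_Yhat[OF \<Omega>] by simp
  also have "\<dots> = Sum_any (\<lambda>\<alpha>. Yhat \<alpha> 0 (C \<alpha> a) vac s s')"
  proof (rule trans[OF Sum_any_reindex_inj[of "\<lambda>\<alpha>. (\<alpha>, 0)"]])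
    show "inj (\<lambda>\<alpha> :: 'l \<times> 'r. (\<alpha>, 0 :: 'l \<times> 'r))" by (auto simp: inj_def)
    fix i :: "('l \<times> 'r) \<times> ('l \<times> 'r)" assume i: "i \<notin> range (\<lambda>\<alpha>. (\<alpha>, 0))"
    obtain \<alpha> \<beta> where ab: "i = (\<alpha>, \<beta>)" by (cases i)
    have "\<beta> \<noteq> 0" using i unfolding ab by blast
    then show "(case i of (\<alpha>, \<beta>) \<Rightarrow> Yhat \<alpha> \<beta> (C \<alpha> a) (C \<beta> vac) s s') = 0"
      unfolding ab prod.case C_VW[OF vac_VW] by (simp add: Yhat_0)
  qed (simp add: C_VW[OF vac_VW])
  finally show ?thesis .
qed

lemma vacuum_space_generalized: "generalized_full_vertex_algebra smul \<Omega> gr VY vac (lat_form Bl Br)"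
proof (unfold_locales, goal_cases)
  case 1 show ?case by (rule lat_form_nondegenerate[OF form_l form_r])
next
  case 2 show ?case by (rule gr_direct_sum)
next
  case (3 a b r s) then show ?case by (rule VY_closed)
next
  case (4 a b b' r s) then show ?case by (rule VY_add_right)
next
  case (5 a b r s k) then show ?case by (rule VY_scale_right)
next
  case (6 a a' b r s) then show ?case by (rule VY_add_left)
next
  case (7 a b k r s) then show ?case by (rule VY_scale_left)
next
  case 8 show ?case unfolding gr_iff using vac_degree vac_VW by (simp add: Bl_bilinear Br_bilinear)
next
  case (9 a \<alpha> b \<beta>) 
  then have "vser VY a b = Yhat \<alpha> \<beta> a b" unfolding charge_space_VW by (rule VY_homogeneous)
  then show ?case using Yhat_laurent[of \<alpha> \<beta> a b] by simp
next
  case (10 \<alpha> t t')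
  have e: "(t + Bp \<alpha> \<alpha> / 2) - (t' + Bq \<alpha> \<alpha> / 2) = lat_form Bl Br \<alpha> \<alpha> / 2 + t - t'"
    by (simp add: lat_form_def field_simps)
  have "Fg (t + Bp \<alpha> \<alpha> / 2) (t' + Bq \<alpha> \<alpha> / 2) = {0}"
    by (rule FV2) (unfold e, rule 10)
  then show ?case unfolding vac_grade_def using subspace_0[OF VW_subspace[of \<alpha>]] by auto
next
  case (11 a)
  have v: "vser VY a vac s s' = Sum_any (\<lambda>\<alpha>. Yhat \<alpha> 0 (C \<alpha> a) vac s s')" for s s'
    using 11 by (rule VY_vac_right)
  show ?case unfolding power_ser_def
  proof (intro allI impI)
    fix s s' :: real assume n: "\<not> (s \<in> \<nat> \<and> s' \<in> \<nat>)"
    have "Yhat \<alpha> 0 w vac s s' = 0" for \<alpha> w using Yhat_vac_right(1)[of \<alpha> w] n unfolding power_ser_def by blast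
    then show "vser VY a vac s s' = 0" unfolding v by simp
  qed
next
  case (12 a)
  have "VY a (-1) (-1) vac = vser VY a vac 0 0" by (simp add: vser_def)
  also have "\<dots> = Sum_any (\<lambda>\<alpha>. Yhat \<alpha> 0 (C \<alpha> a) vac 0 0)" using 12 by (rule VY_vac_right)
  also have "\<dots> = a" unfolding Yhat_vac_right(2) by (rule C_sum[OF 12, symmetric])
  finally show ?case .
next
  case (13 b r s)
  have "VY vac r s b = Sum_any (\<lambda>(\<alpha>, \<beta>). Yhat \<alpha> \<beta> (C \<alpha> vac) (C \<beta> b) (- r - 1) (- s - 1))" by (rule VY_Yhat[OF 13])
  also have "\<dots> = Sum_any (\<lambda>\<beta>. Yhat 0 \<beta> vac (C \<beta> b) (- r - 1) (- s - 1))"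
  proof (rule trans[OF Sum_any_reindex_inj[of "\<lambda>\<beta>. (0, \<beta>)"]])
    show "inj (\<lambda>\<beta> :: 'l \<times> 'r. (0 :: 'l \<times> 'r, \<beta>))" by (auto simp: inj_def)
    fix i :: "('l \<times> 'r) \<times> ('l \<times> 'r)" assume i: "i \<notin> range (\<lambda>\<beta>. (0, \<beta>))"
    obtain \<alpha> \<beta> where ab: "i = (\<alpha>, \<beta>)" by (cases i)
    have "\<alpha> \<noteq> 0" using i unfolding ab by blast
    then show "(case i of (\<alpha>, \<beta>) \<Rightarrow> Yhat \<alpha> \<beta> (C \<alpha> vac) (C \<beta> b) (- r - 1) (- s - 1)) = 0"
      unfolding ab prod.case C_VW[OF vac_VW] by (simp add: Yhat_0)
  qed (simp add: C_VW[OF vac_VW])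
  also have "\<dots> = (if r = -1 \<and> s = -1 then b else 0)"
    unfolding Yhat_vac_left using C_sum[OF 13] by auto
  finally show ?case .
next
  case (14 a1 \<alpha>1 a2 \<alpha>2 a3 \<alpha>3 u) then show ?case unfolding charge_space_VW by (rule VY_correlation)
next
  case (15 a \<alpha> t t' b \<beta> k k' r s)
  note a = 15(1)[unfolded gr_iff] and b = 15(2)[unfolded gr_iff]
  have "VY a r s b = Yhat \<alpha> \<beta> a b (- r - 1) (- s - 1)"
    using fun_cong[OF fun_cong[OF VY_homogeneous[OF conjunct2[OF a] conjunct2[OF b]], of "- r - 1"], of "- s - 1"]
    by (simp add: vser_def)
  moreover have "Yhat \<alpha> \<beta> a b (- r - 1) (- s - 1) \<in> VW (\<alpha> + \<beta>)"
    by (rule Yhat_VW[OF conjunct2[OF a] conjunct2[OF b]])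
  moreover have "Bl (fst \<alpha> + fst \<beta>) (fst \<alpha> + fst \<beta>) = Bp \<alpha> \<alpha> + 2 * Bp \<alpha> \<beta> + Bp \<beta> \<beta>"
    "Br (snd \<alpha> + snd \<beta>) (snd \<alpha> + snd \<beta>) = Bq \<alpha> \<alpha> + 2 * Bq \<alpha> \<beta> + Bq \<beta> \<beta>"
    using Bl_commute[of "fst \<beta>" "fst \<alpha>"] Br_commute[of "snd \<beta>" "snd \<alpha>"] by (simp_all add: Bl_bilinear Br_bilinear)
  ultimately show ?case
    using Yhat_degree[OF conjunct1[OF a] conjunct1[OF b], of \<alpha> \<beta> "- r - 1" "- s - 1"]
    unfolding gr_iff by (simp add: algebra_simps add_divide_distrib)
next
  case (16 \<alpha>)
  obtain N where N: "\<And>t t'. t \<le> N \<or> t' \<le> N ==> Fg t t' \<inter> WS \<alpha> = {0}" using FH2[of \<alpha>] by blast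
  \<comment> \<open>The degrees of the vacuum space differ from those of \<open>F\<close> by half the norms of the charge.\<close>
  define M where "M = N - \<bar>Bp \<alpha> \<alpha> / 2\<bar> - \<bar>Bq \<alpha> \<alpha> / 2\<bar>"
  show ?case
  proof (intro exI[of _ M] allI impI)
    fix t t' assume "t \<le> M \<or> t' \<le> M"
    then have "t + Bp \<alpha> \<alpha> / 2 \<le> N \<or> t' + Bq \<alpha> \<alpha> / 2 \<le> N" unfolding M_def by linarith
    from N[OF this] have "gr \<alpha> t t' \<subseteq> {0}" unfolding vac_grade_def using VW_subset_WS[of \<alpha>] by blast
    then show "gr \<alpha> t t' = {0}" using subspace_0[OF gr_subspace[of \<alpha> t t']] by blast
  qed
qed

end

theorem theorem5p3:
  fixes smul :: "complex \<Rightarrow> 'v::ab_group_add \<Rightarrow> 'v"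
    and Fg :: "real \<Rightarrow> real \<Rightarrow> 'v set"
    and Y :: "'v modes"
    and vac :: 'v
    and il :: "'l::real_vector \<Rightarrow> 'v"
    and ir :: "'r::real_vector \<Rightarrow> 'v"
    and Bl :: "'l \<Rightarrow> 'l \<Rightarrow> real"
    and Br :: "'r \<Rightarrow> 'r \<Rightarrow> real"
  assumes "full_H_vertex_algebra smul Fg Y vac il ir Bl Br"
  shows "generalized_full_vertex_algebra smul
    (vac_space smul Y il ir Bl Br)
    (vac_grade smul Fg Y il ir Bl Br)
    (vac_Y smul Y il ir Bl Br)
    vac
    (lat_form Bl Br)"
  by (rule full_H_vertex_algebra.vacuum_space_generalized[OF assms])

end
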